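(* Let $1<p<\infty$, $c>-1$ and $m\in\mathbb{R}$ with $0<\frac{m+1}p<c+1$. Then $$D(B^n_{m,p})=\Big\{u\in D(B_{m,p,max}):\ \frac{D_yu}y,\ D_{yy}u\in L^p_m\Big\}.$$ Moreover, $D(B^n_{m,p})=\{u\in W^{2,p}_m:D_yu(0)=0\}$ when $\frac{m+1}p<1$, and $D(B^n_{m,p})=W^{2,p}_m$ when $\frac{m+1}p>1$.
   Context: All spaces are on $\mathbb{R}_+=(0,\infty)$: $L^p_m=L^p((0,\infty);y^m\,dy)$, $W^{2,p}_m=\{u\in L^p_m:D_yu,D_{yy}u\in L^p_m\}$. When $\frac{m+1}p<1$ and $u\in W^{2,p}_m$, the limit $D_yu(0)=\lim_{y\to0}D_yu(y)$ exists and is finite. $B=D_{yy}+\frac cyD_y$ and $D(B_{m,p,max})=\{u\in L^p_m\cap W^{2,p}_{loc}(\mathbb{R}_+):Bu\in L^p_m\}$. $B^n_{m,p}$ is the generator of the bounded analytic semigroup $(e^{zB^n})_{\mathrm{Re}\,z>0}$ on $L^p_m$ given by $e^{zB^n}f(y)=\int_0^\infty p_{B^n}(z,y,\rho)f(\rho)\,d\rho$ with $$p_{B^n}(z,y,\rho)=\frac1{2z}\rho^c(y\rho)^{\frac{1-c}2}\exp\Big\{-\frac{y^2+\rho^2}{4z}\Big\}I_{\frac{c-1}2}\Big(\frac{y\rho}{2z}\Big),$$ $I_\nu$ being the modified Bessel function of the first kind. *)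

theory Defs
  imports "HOL-Analysis.Analysis"
begin

text \<open>
  Elements of the function spaces are represented by functions of type
  \<open>real \<Rightarrow> complex\<close>, of which only the values on \<open>{0<..}\<close> matter.  Functions that agree almost
  everywhere on \<open>{0<..}\<close> are not identified, but every space below is closed under changing
  a function on a Lebesgue null set, so an equality of two such sets of functions is an
  equality of the corresponding sets of equivalence classes.
\<close>

definition weighted_measure :: "real \<Rightarrow> real measure" where
  "weighted_measure m = density (lebesgue_on {0<..}) (\<lambda>y. ennreal (y powr m))"

definition Lp :: "real \<Rightarrow> real \<Rightarrow> (real \<Rightarrow> complex) set" where
  "Lp m p = {f \<in> borel_measurable (weighted_measure m).
               integrable (weighted_measure m) (\<lambda>y. norm (f y) powr p)}"

definition Lp_norm :: "real \<Rightarrow> real \<Rightarrow> (real \<Rightarrow> complex) \<Rightarrow> real" where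
  "Lp_norm m p f = (LINT y|weighted_measure m. norm (f y) powr p) powr (1 / p)"

definition Lp_loc :: "real \<Rightarrow> (real \<Rightarrow> complex) set" where
  "Lp_loc p = {f \<in> borel_measurable (lebesgue_on {0<..}).
                 \<forall>a b. 0 < a \<longrightarrow> set_integrable lebesgue {a..b} (\<lambda>y. norm (f y) powr p)}"


definition test_function :: "(real \<Rightarrow> real) \<Rightarrow> bool" where
  "test_function \<phi> \<longleftrightarrow>
     (\<forall>n x. (deriv ^^ n) \<phi> differentiable at x) \<and>
     (\<exists>a b. 0 < a \<and> (\<forall>x. x \<notin> {a..b} \<longrightarrow> \<phi> x = 0))"

definition has_weak_deriv :: "(real \<Rightarrow> complex) \<Rightarrow> (real \<Rightarrow> complex) \<Rightarrow> bool" where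
  "has_weak_deriv u v \<longleftrightarrow> u \<in> Lp_loc 1 \<and> v \<in> Lp_loc 1 \<and>
     (\<forall>\<phi>. test_function \<phi> \<longrightarrow>
        (LINT y|lebesgue_on {0<..}. deriv \<phi> y *\<^sub>R u y) =
        - (LINT y|lebesgue_on {0<..}. \<phi> y *\<^sub>R v y))"

definition weakly_differentiable :: "(real \<Rightarrow> complex) \<Rightarrow> bool" where
  "weakly_differentiable u \<longleftrightarrow> (\<exists>v. has_weak_deriv u v)"

text \<open>
  A representative of the weak derivative, which is unique up to null sets; arbitrary
  unless the function is weakly differentiable.
\<close>

definition Dy :: "(real \<Rightarrow> complex) \<Rightarrow> real \<Rightarrow> complex" where
  "Dy u = (SOME v. has_weak_deriv u v)"

abbreviation Dyy :: "(real \<Rightarrow> complex) \<Rightarrow> real \<Rightarrow> complex" where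
  "Dyy u \<equiv> Dy (Dy u)"

definition W2p :: "real \<Rightarrow> real \<Rightarrow> (real \<Rightarrow> complex) set" where
  "W2p m p = {u \<in> Lp m p. weakly_differentiable u \<and> Dy u \<in> Lp m p \<and>
                weakly_differentiable (Dy u) \<and> Dyy u \<in> Lp m p}"

definition W2p_loc :: "real \<Rightarrow> (real \<Rightarrow> complex) set" where
  "W2p_loc p = {u \<in> Lp_loc p. weakly_differentiable u \<and> Dy u \<in> Lp_loc p \<and>
                  weakly_differentiable (Dy u) \<and> Dyy u \<in> Lp_loc p}"

text \<open>
  \<open>D\<^sub>y u(0) = l\<close>.  The limit is that of the continuous representative of the weak derivative,
  which is unique and exists whenever the derivative is itself weakly differentiable.
\<close>

definition has_Dy_at_0 :: "(real \<Rightarrow> complex) \<Rightarrow> complex \<Rightarrow> bool" where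
  "has_Dy_at_0 u l \<longleftrightarrow>
     (\<exists>v. continuous_on {0<..} v \<and> has_weak_deriv u v \<and> (v \<longlongrightarrow> l) (at_right 0))"


definition B_op :: "real \<Rightarrow> (real \<Rightarrow> complex) \<Rightarrow> real \<Rightarrow> complex" where
  "B_op c u y = Dyy u y + of_real (c / y) * Dy u y"

definition dom_B_max :: "real \<Rightarrow> real \<Rightarrow> real \<Rightarrow> (real \<Rightarrow> complex) set" where
  "dom_B_max c m p = {u \<in> Lp m p \<inter> W2p_loc p. B_op c u \<in> Lp m p}"


text \<open>The modified Bessel function of the first kind, on the principal branch.\<close>

definition bessel_I :: "real \<Rightarrow> complex \<Rightarrow> complex" where
  "bessel_I \<nu> w = (w / 2) powr of_real \<nu> *
     (\<Sum>k. (w / 2) ^ (2 * k) / (fact k * Gamma (of_real \<nu> + of_nat k + 1)))"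

definition kernel_Bn :: "real \<Rightarrow> complex \<Rightarrow> real \<Rightarrow> real \<Rightarrow> complex" where
  "kernel_Bn c z y \<rho> =
     1 / (2 * z) * of_real (\<rho> powr c) * of_real ((y * \<rho>) powr ((1 - c) / 2)) *
     exp (- of_real (y\<^sup>2 + \<rho>\<^sup>2) / (4 * z)) *
     bessel_I ((c - 1) / 2) (of_real (y * \<rho>) / (2 * z))"

definition semigroup_Bn :: "real \<Rightarrow> complex \<Rightarrow> (real \<Rightarrow> complex) \<Rightarrow> real \<Rightarrow> complex" where
  "semigroup_Bn c z f y = (LINT \<rho>|lebesgue_on {0<..}. kernel_Bn c z y \<rho> * f \<rho>)"

text \<open>
  The graph of the infinitesimal generator on \<open>Lp m p\<close> of a semigroup \<open>T\<close> indexed by the open right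
  half-plane: \<open>(T(t)u - u)/t\<close> converges to \<open>g\<close> in norm as \<open>t\<close> tends to 0 along the positive reals.
  Membership in \<open>Lp m p\<close> is demanded explicitly because the integral in \<open>Lp_norm\<close> is 0
  for functions that are not integrable.
\<close>

definition is_generator_value ::
  "real \<Rightarrow> real \<Rightarrow> (complex \<Rightarrow> (real \<Rightarrow> complex) \<Rightarrow> real \<Rightarrow> complex) \<Rightarrow>
     (real \<Rightarrow> complex) \<Rightarrow> (real \<Rightarrow> complex) \<Rightarrow> bool" where
  "is_generator_value m p T u g \<longleftrightarrow>
     (let R = (\<lambda>t y. (T (of_real t) u y - u y) / of_real t - g y) in
        u \<in> Lp m p \<and> g \<in> Lp m p \<and>
        (\<forall>\<^sub>F t in at_right 0. R t \<in> Lp m p) \<and>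
        ((\<lambda>t. Lp_norm m p (R t)) \<longlongrightarrow> 0) (at_right 0))"

definition generator_domain ::
  "real \<Rightarrow> real \<Rightarrow> (complex \<Rightarrow> (real \<Rightarrow> complex) \<Rightarrow> real \<Rightarrow> complex) \<Rightarrow> (real \<Rightarrow> complex) set" where
  "generator_domain m p T = {u. \<exists>g. is_generator_value m p T u g}"

definition dom_Bn :: "real \<Rightarrow> real \<Rightarrow> real \<Rightarrow> (real \<Rightarrow> complex) set" where
  "dom_Bn c m p = generator_domain m p (semigroup_Bn c)"

end

theory Submission
  imports Defs
begin

text \<open>
  With \<open>\<tau> = 4t\<close>, the law of \<open>\<rho>\<^sup>2/\<tau>\<close> under the kernel is a Poisson mixture of Gamma laws.  This bounds
  the moments \<open>\<integral> p(t,y,\<rho>) \<rho>\<^sup>-\<^sup>b d\<rho>\<close> by a multiple of \<open>y\<^sup>-\<^sup>b\<close> for \<open>0 \<le> b < c + 1\<close>, and Schur's test with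
  power weights gives uniform boundedness and strong continuity on \<open>L\<^sup>p\<^sub>m\<close> when
  \<open>0 < (m+1)/p < c + 1\<close>.

  If \<open>y\<^sup>c u' = \<integral>\<^sub>0\<^sup>y s\<^sup>c g ds\<close> with \<open>u\<close>, \<open>g\<close> in \<open>L\<^sup>p\<^sub>m\<close>, then integrating the heat equation for the kernel by
  parts gives \<open>T(t)u - u = \<integral>\<^sub>0\<^sup>t T(s)g ds\<close>, so that \<open>u\<close> is in the domain and \<open>B\<^sup>nu = g\<close>.  Conversely,
  the kernel is symmetric with respect to \<open>y\<^sup>c dy\<close>, and pairing \<open>(T(t)u - u)/t\<close> with smooth elements
  of the domain of the dual semigroup shows that every \<open>u\<close> in the domain is of this form.

  Hardy's inequality, again by Schur's test, puts \<open>u'/y\<close> and hence \<open>u''\<close> into \<open>L\<^sup>p\<^sub>m\<close>; near infinity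
  \<open>u'\<close> is controlled by interpolating between \<open>u\<close> and \<open>u''\<close>.  For \<open>u \<in> W\<^sup>2\<^sup>,\<^sup>p\<^sub>m\<close> the condition
  \<open>u'/y \<in> L\<^sup>p\<^sub>m\<close> is equivalent to \<open>u'(0) = 0\<close> when \<open>(m+1)/p < 1\<close>, by Hardy's inequality at 0, and it is
  automatic when \<open>(m+1)/p > 1\<close>, by Hardy's inequality at infinity.
\<close>

text \<open>The condition 0 < (m+1)/p < c+1 does three jobs. It leaves room for the exponent of the
  power weights in Schur's test. It is invariant under duality: for the dual weight m' one has
  (m'+1)/q = c + 1 - (m+1)/p, so everything proved in the locale \<open>bessel_weight\<close> also
  holds on the dual space. And its upper bound keeps y^(-c-1) out of L^p_m near 0, which eliminates
  u' = y^(-c). \<open>Dy\<close> is an unspecified representative, so pointwise arguments use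
  continuous representatives, recorded by \<open>ac\<close>. Writing y^c u' = \<open>Gc c g\<close>
  encodes both Bu = g and the Neumann condition through a single integral of g, without boundary
  values. Membership in L^p_m yields no limits at 0 or infinity; boundary terms containing u are
  therefore made small only along sequences, using that 1/x is not integrable there. All
  descriptions of the domain are compared with \<open>E_space\<close>, the u in W^{2,p}_m with u'/y
  in L^p_m, in which c does not occur. The condition u'(0) = 0 is then the same Hardy argument with
  c = 0.\<close>

abbreviation leb_pos :: "real measure" where
  "leb_pos \<equiv> lebesgue_on {0<..}"

lemma sigma_finite_completion:
  assumes "sigma_finite_measure M"
  shows "sigma_finite_measure (completion M)"
proof -
  obtain A where A: "countable A" "A \<subseteq> sets M" "\<Union>A = space M" "\<forall>a\<in>A. emeasure M a \<noteq> \<infinity>"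
    using sigma_finite_measure.sigma_finite_countable[OF assms] by blast
  show ?thesis
  proof
    show "\<exists>B. countable B \<and> B \<subseteq> sets (completion M) \<and> \<Union>B = space (completion M) \<and> (\<forall>a\<in>B. emeasure (completion M) a \<noteq> \<infinity>)"
      using A by (intro exI[of _ A]) (auto simp: subset_iff)
  qed
qed

lemma sigma_finite_leb_pos: "sigma_finite_measure leb_pos"
  by (intro sigma_finite_measure_restrict_space sigma_finite_completion sigma_finite_lborel) simp

interpretation leb_pos: sigma_finite_measure leb_pos
  by (rule sigma_finite_leb_pos)

interpretation leb_pos2: pair_sigma_finite leb_pos leb_pos ..

lemma id_measurable_leb_pos [measurable]: "(\<lambda>x. x) \<in> borel_measurable leb_pos"
  by (intro measurable_restrict_space1 measurable_completion) simp

lemma AE_leb_pos_gt: "AE y in leb_pos. y > 0"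
  by (rule AE_I2) simp

section \<open>Schur's test and weighted \<open>L\<^sup>p\<close> spaces\<close>

text \<open>Young's inequality for the normalised f/a and g/b with a^p = A and b^q = B. Upper bounds
  A and B in place of the integrals keep all constants finite reals; a vanishing bound is treated
  first, since the normalisation divides by it.\<close>

lemma nn_integral_Holder:
  fixes f g :: "'a \<Rightarrow> real"
  assumes pq: "p > 1" "q > 1" "1/p + 1/q = 1"
    and [measurable]: "f \<in> borel_measurable M" "g \<in> borel_measurable M"
    and nn: "\<And>x. x \<in> space M \<Longrightarrow> f x \<ge> 0" "\<And>x. x \<in> space M \<Longrightarrow> g x \<ge> 0"
    and fA: "(\<integral>\<^sup>+x. ennreal (f x powr p) \<partial>M) \<le> ennreal A"
    and gB: "(\<integral>\<^sup>+x. ennreal (g x powr q) \<partial>M) \<le> ennreal B"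
    and AB: "A \<ge> 0" "B \<ge> 0"
  shows "(\<integral>\<^sup>+x. ennreal (f x * g x) \<partial>M) \<le> ennreal (A powr (1/p) * B powr (1/q))"
proof (cases "A = 0 \<or> B = 0")
  case True
  have "AE x in M. f x * g x = 0"
  proof -
    consider "A = 0" | "B = 0" using True by blast
    then show ?thesis
    proof cases
      case 1
      then have "(\<integral>\<^sup>+x. ennreal (f x powr p) \<partial>M) = 0" using fA by simp
      then have "AE x in M. ennreal (f x powr p) = 0" by (subst (asm) nn_integral_0_iff_AE) auto
      with AE_space show ?thesis by eventually_elim (use nn in \<open>auto simp: ennreal_eq_0_iff\<close>)
    next
      case 2
      then have "(\<integral>\<^sup>+x. ennreal (g x powr q) \<partial>M) = 0" using gB by simp
      then have "AE x in M. ennreal (g x powr q) = 0" by (subst (asm) nn_integral_0_iff_AE) auto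
      with AE_space show ?thesis by eventually_elim (use nn in \<open>auto simp: ennreal_eq_0_iff\<close>)
    qed
  qed
  then have "(\<integral>\<^sup>+x. ennreal (f x * g x) \<partial>M) = 0"
    by (subst nn_integral_0_iff_AE) auto
  then show ?thesis by simp
next
  case False
  then have A: "A > 0" and B: "B > 0" using AB by auto
  define a b where "a = A powr (1/p)" and "b = B powr (1/q)"
  have ab: "a > 0" "b > 0" "a powr p = A" "b powr q = B"
    using A B pq by (auto simp: a_def b_def powr_powr)
  have *: "ennreal (f x * g x) \<le> ennreal (a * b / (p * A)) * ennreal (f x powr p) + ennreal (a * b / (q * B)) * ennreal (g x powr q)"
    if "x \<in> space M" for x
  proof -
    have "(f x / a) * (g x / b) \<le> (f x / a) powr p / p + (g x / b) powr q / q"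
      using Youngs_inequality[OF pq, of "f x / a" "g x / b"] nn that ab by auto
    also have "\<dots> = f x powr p / (p * A) + g x powr q / (q * B)"
      using nn that ab by (simp add: powr_divide mult.commute)
    finally have "f x * g x / (a * b) \<le> f x powr p / (p * A) + g x powr q / (q * B)" by simp
    then have "f x * g x \<le> (a * b) * (f x powr p / (p * A) + g x powr q / (q * B))"
      using ab by (simp add: field_simps)
    also have "\<dots> = a * b / (p * A) * f x powr p + a * b / (q * B) * g x powr q"
      by (simp add: distrib_left)
    finally show ?thesis
      using ab pq A B by (simp add: ennreal_mult'[symmetric] ennreal_plus[symmetric] del: ennreal_plus)
  qed
  have "(\<integral>\<^sup>+x. ennreal (f x * g x) \<partial>M) \<le>
      (\<integral>\<^sup>+x. ennreal (a * b / (p * A)) * ennreal (f x powr p) + ennreal (a * b / (q * B)) * ennreal (g x powr q) \<partial>M)"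
    by (intro nn_integral_mono *)
  also have "\<dots> = ennreal (a * b / (p * A)) * (\<integral>\<^sup>+x. ennreal (f x powr p) \<partial>M) + ennreal (a * b / (q * B)) * (\<integral>\<^sup>+x. ennreal (g x powr q) \<partial>M)"
    by (simp add: nn_integral_add nn_integral_cmult)
  also have "\<dots> \<le> ennreal (a * b / (p * A)) * ennreal A + ennreal (a * b / (q * B)) * ennreal B"
    using fA gB by (intro add_mono mult_left_mono) auto
  also have "\<dots> = ennreal (a * b / (p * A) * A + a * b / (q * B) * B)"
    using ab pq A B by (simp add: ennreal_mult'[symmetric] ennreal_plus[symmetric] del: ennreal_plus)
  also have "a * b / (p * A) * A + a * b / (q * B) * B = a * b * (1/p + 1/q)"
    using A B by (simp add: field_simps)
  also have "\<dots> = a * b" using pq by simp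
  finally show ?thesis by (simp add: a_def b_def)
qed

text \<open>The classical argument with power weights: write k f as the product of k^(1/p) \<rho>^a
  f and k^(1/q) \<rho>^(-a), apply Hoelder in \<rho> together with \<open>k1\<close>, and exchange
  the integrals to use \<open>k2\<close>. Finiteness almost everywhere is a separate conclusion
  because \<open>enn2real\<close> would send an infinite inner integral to 0.\<close>

lemma schur_test:
  fixes k :: "real \<Rightarrow> real \<Rightarrow> real" and f :: "real \<Rightarrow> real"
  assumes pq: "p > 1" "q > 1" "1/p + 1/q = 1"
    and k [measurable]: "(\<lambda>(y, \<rho>). k y \<rho>) \<in> borel_measurable (leb_pos \<Otimes>\<^sub>M leb_pos)"
    and k0: "\<And>y \<rho>. y > 0 \<Longrightarrow> \<rho> > 0 \<Longrightarrow> k y \<rho> \<ge> 0"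
    and C: "C1 \<ge> 0" "C2 \<ge> 0"
    and k1: "\<And>y. y > 0 \<Longrightarrow> (\<integral>\<^sup>+\<rho>. ennreal (k y \<rho> * \<rho> powr (- a * q)) \<partial>leb_pos) \<le> ennreal (C1 * y powr (- a * q))"
    and k2: "\<And>\<rho>. \<rho> > 0 \<Longrightarrow> (\<integral>\<^sup>+y. ennreal (k y \<rho> * y powr (m - a * p)) \<partial>leb_pos) \<le> ennreal (C2 * \<rho> powr (m - a * p))"
    and f [measurable]: "f \<in> borel_measurable leb_pos" and f0: "\<And>y. y > 0 \<Longrightarrow> f y \<ge> 0"
    and fin: "(\<integral>\<^sup>+\<rho>. ennreal (f \<rho> powr p * \<rho> powr m) \<partial>leb_pos) < \<infinity>"
  shows "AE y in leb_pos. (\<integral>\<^sup>+\<rho>. ennreal (k y \<rho> * f \<rho>) \<partial>leb_pos) < \<infinity>"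
    and "(\<integral>\<^sup>+y. ennreal (enn2real (\<integral>\<^sup>+\<rho>. ennreal (k y \<rho> * f \<rho>) \<partial>leb_pos) powr p * y powr m) \<partial>leb_pos)
      \<le> ennreal (C1 powr (p - 1) * C2) * (\<integral>\<^sup>+\<rho>. ennreal (f \<rho> powr p * \<rho> powr m) \<partial>leb_pos)"
proof -
  \<comment> \<open>The p-th power of the first Hoelder factor; its integral against y^(m - a p) is
    estimated first, by exchanging the order of integration.\<close>
  define J where "J y = (\<integral>\<^sup>+\<rho>. ennreal (k y \<rho> * \<rho> powr (a * p) * f \<rho> powr p) \<partial>leb_pos)" for y
  have [measurable]: "J \<in> borel_measurable leb_pos" unfolding J_def by measurable
  have "(\<integral>\<^sup>+y. J y * ennreal (y powr (m - a * p)) \<partial>leb_pos)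
      = (\<integral>\<^sup>+y. (\<integral>\<^sup>+\<rho>. ennreal (k y \<rho> * \<rho> powr (a * p) * f \<rho> powr p * y powr (m - a * p)) \<partial>leb_pos) \<partial>leb_pos)"
    unfolding J_def
    by (intro nn_integral_cong) (auto simp: nn_integral_multc[symmetric] k0 ennreal_mult intro!: nn_integral_cong)
  also have "\<dots> = (\<integral>\<^sup>+\<rho>. (\<integral>\<^sup>+y. ennreal (k y \<rho> * \<rho> powr (a * p) * f \<rho> powr p * y powr (m - a * p)) \<partial>leb_pos) \<partial>leb_pos)"
    by (rule leb_pos2.Fubini') measurable
  also have "\<dots> \<le> (\<integral>\<^sup>+\<rho>. ennreal C2 * ennreal (f \<rho> powr p * \<rho> powr m) \<partial>leb_pos)"
  proof (intro nn_integral_mono)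
    fix \<rho> :: real assume "\<rho> \<in> space leb_pos"
    then have r: "\<rho> > 0" by simp
    have "(\<integral>\<^sup>+y. ennreal (k y \<rho> * \<rho> powr (a * p) * f \<rho> powr p * y powr (m - a * p)) \<partial>leb_pos)
      = (\<integral>\<^sup>+y. ennreal (\<rho> powr (a * p) * f \<rho> powr p) * ennreal (k y \<rho> * y powr (m - a * p)) \<partial>leb_pos)"
      using r k0 by (intro nn_integral_cong) (auto simp: ennreal_mult[symmetric] mult_ac)
    also have "\<dots> = ennreal (\<rho> powr (a * p) * f \<rho> powr p) * (\<integral>\<^sup>+y. ennreal (k y \<rho> * y powr (m - a * p)) \<partial>leb_pos)"
      using r by (intro nn_integral_cmult) measurable
    also have "\<dots> \<le> ennreal (\<rho> powr (a * p) * f \<rho> powr p) * ennreal (C2 * \<rho> powr (m - a * p))"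
      using k2[OF r] by (intro mult_left_mono) auto
    also have "\<dots> = ennreal (C2 * (f \<rho> powr p * (\<rho> powr (a * p) * \<rho> powr (m - a * p))))"
      using C by (simp add: ennreal_mult[symmetric] mult_ac)
    also have "\<rho> powr (a * p) * \<rho> powr (m - a * p) = \<rho> powr m"
      using r by (simp add: powr_add[symmetric])
    finally show "(\<integral>\<^sup>+y. ennreal (k y \<rho> * \<rho> powr (a * p) * f \<rho> powr p * y powr (m - a * p)) \<partial>leb_pos)
       \<le> ennreal C2 * ennreal (f \<rho> powr p * \<rho> powr m)"
      using C by (simp add: ennreal_mult)
  qed
  also have "\<dots> = ennreal C2 * (\<integral>\<^sup>+\<rho>. ennreal (f \<rho> powr p * \<rho> powr m) \<partial>leb_pos)"
    by (intro nn_integral_cmult) measurable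
  finally have JI: "(\<integral>\<^sup>+y. J y * ennreal (y powr (m - a * p)) \<partial>leb_pos) \<le> \<dots>" .
  also have "\<dots> < \<infinity>" using fin by (simp add: ennreal_mult_less_top)
  finally have "AE y in leb_pos. J y * ennreal (y powr (m - a * p)) \<noteq> \<infinity>"
    by (intro nn_integral_PInf_AE) auto
  then have Jfin: "AE y in leb_pos. J y < \<infinity>"
    using AE_leb_pos_gt by eventually_elim (auto simp: ennreal_mult_eq_top_iff less_top)
  have est: "(\<integral>\<^sup>+\<rho>. ennreal (k y \<rho> * f \<rho>) \<partial>leb_pos) \<le> ennreal (enn2real (J y) powr (1/p) * (C1 * y powr (- a * q)) powr (1/q))"
    if y: "y > 0" and fin: "J y < \<infinity>" for y
  proof -
    have [measurable]: "k y \<in> borel_measurable leb_pos"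
      using measurable_Pair2[OF k, of y] y by simp
    have "(\<integral>\<^sup>+\<rho>. ennreal (k y \<rho> * f \<rho>) \<partial>leb_pos)
       = (\<integral>\<^sup>+\<rho>. ennreal ((k y \<rho> powr (1/p) * \<rho> powr a * f \<rho>) * (k y \<rho> powr (1/q) * \<rho> powr (-a))) \<partial>leb_pos)"
    proof (intro nn_integral_cong)
      fix \<rho> :: real assume "\<rho> \<in> space leb_pos"
      then have r: "\<rho> > 0" by simp
      have "(k y \<rho> powr (1/p) * \<rho> powr a * f \<rho>) * (k y \<rho> powr (1/q) * \<rho> powr (-a))
        = (k y \<rho> powr (1/p) * k y \<rho> powr (1/q)) * (\<rho> powr a * \<rho> powr (-a)) * f \<rho>" by simp
      also have "\<dots> = k y \<rho> * f \<rho>"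
        using r k0[OF y r] pq by (simp add: powr_add[symmetric])
      finally show "ennreal (k y \<rho> * f \<rho>) = ennreal ((k y \<rho> powr (1/p) * \<rho> powr a * f \<rho>) * (k y \<rho> powr (1/q) * \<rho> powr (-a)))" by (simp only:)
    qed
    also have "\<dots> \<le> ennreal (enn2real (J y) powr (1/p) * (C1 * y powr (- a * q)) powr (1/q))"
    proof (rule nn_integral_Holder[OF pq])
      show "(\<lambda>\<rho>. k y \<rho> powr (1/p) * \<rho> powr a * f \<rho>) \<in> borel_measurable leb_pos"
        by measurable
      show "(\<lambda>\<rho>. k y \<rho> powr (1/q) * \<rho> powr (-a)) \<in> borel_measurable leb_pos"
        by measurable
      have "(\<integral>\<^sup>+\<rho>. ennreal ((k y \<rho> powr (1/p) * \<rho> powr a * f \<rho>) powr p) \<partial>leb_pos) = J y"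
        unfolding J_def using y k0 f0 pq by (intro nn_integral_cong) (auto simp: powr_mult powr_powr)
      then show "(\<integral>\<^sup>+\<rho>. ennreal ((k y \<rho> powr (1/p) * \<rho> powr a * f \<rho>) powr p) \<partial>leb_pos) \<le> ennreal (enn2real (J y))"
        using fin by simp
      have "(\<integral>\<^sup>+\<rho>. ennreal ((k y \<rho> powr (1/q) * \<rho> powr (-a)) powr q) \<partial>leb_pos) = (\<integral>\<^sup>+\<rho>. ennreal (k y \<rho> * \<rho> powr (- a * q)) \<partial>leb_pos)"
        using y k0 f0 pq by (intro nn_integral_cong) (auto simp: powr_mult powr_powr)
      then show "(\<integral>\<^sup>+\<rho>. ennreal ((k y \<rho> powr (1/q) * \<rho> powr (-a)) powr q) \<partial>leb_pos) \<le> ennreal (C1 * y powr (- a * q))"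
        using k1[OF y] by simp
    qed (use y k0 f0 C in auto)
    finally show ?thesis .
  qed
  show "AE y in leb_pos. (\<integral>\<^sup>+\<rho>. ennreal (k y \<rho> * f \<rho>) \<partial>leb_pos) < \<infinity>"
    using Jfin AE_leb_pos_gt
  proof eventually_elim
    case (elim y)
    show ?case using est[OF elim(2,1)] by (rule order.strict_trans1) simp
  qed
  have "(\<integral>\<^sup>+y. ennreal (enn2real (\<integral>\<^sup>+\<rho>. ennreal (k y \<rho> * f \<rho>) \<partial>leb_pos) powr p * y powr m) \<partial>leb_pos)
     \<le> (\<integral>\<^sup>+y. ennreal (C1 powr (p - 1)) * (J y * ennreal (y powr (m - a * p))) \<partial>leb_pos)"
  proof (rule nn_integral_mono_AE, use Jfin AE_leb_pos_gt in eventually_elim)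
    case (elim y)
    have q: "p / q = p - 1" using pq by (simp add: field_simps)
    define j where "j = enn2real (J y)"
    have j: "J y = ennreal j" "j \<ge> 0" using elim by (auto simp: j_def)
    have "enn2real (\<integral>\<^sup>+\<rho>. ennreal (k y \<rho> * f \<rho>) \<partial>leb_pos) \<le> j powr (1/p) * (C1 * y powr (- a * q)) powr (1/q)"
      using enn2real_mono[OF est[OF elim(2,1)]] by (simp add: j_def)
    then have "enn2real (\<integral>\<^sup>+\<rho>. ennreal (k y \<rho> * f \<rho>) \<partial>leb_pos) powr p \<le> (j powr (1/p) * (C1 * y powr (- a * q)) powr (1/q)) powr p"
      using pq by (intro powr_mono2) auto
    also have "\<dots> = j * (C1 powr (p - 1) * y powr (- a * p))"
      using j pq C elim by (simp add: powr_mult powr_powr q mult.assoc)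
    finally have "enn2real (\<integral>\<^sup>+\<rho>. ennreal (k y \<rho> * f \<rho>) \<partial>leb_pos) powr p * y powr m \<le> j * (C1 powr (p - 1) * y powr (- a * p)) * y powr m"
      by (intro mult_right_mono) auto
    also have "\<dots> = C1 powr (p - 1) * (j * (y powr m * y powr (- a * p)))" by simp
    also have "y powr m * y powr (- a * p) = y powr (m - a * p)"
      using elim by (simp add: powr_add[symmetric])
    finally show ?case
      using j by (simp add: ennreal_mult[symmetric] ennreal_leI)
  qed
  also have "\<dots> = ennreal (C1 powr (p - 1)) * (\<integral>\<^sup>+y. (J y * ennreal (y powr (m - a * p))) \<partial>leb_pos)"
    by (intro nn_integral_cmult) measurable
  also have "\<dots> \<le> ennreal (C1 powr (p - 1)) * (ennreal C2 * (\<integral>\<^sup>+\<rho>. ennreal (f \<rho> powr p * \<rho> powr m) \<partial>leb_pos))"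
    using JI by (intro mult_left_mono) auto
  finally show "(\<integral>\<^sup>+y. ennreal (enn2real (\<integral>\<^sup>+\<rho>. ennreal (k y \<rho> * f \<rho>) \<partial>leb_pos) powr p * y powr m) \<partial>leb_pos)
      \<le> ennreal (C1 powr (p - 1) * C2) * (\<integral>\<^sup>+\<rho>. ennreal (f \<rho> powr p * \<rho> powr m) \<partial>leb_pos)"
    using C by (simp add: ennreal_mult mult.assoc)
qed

text \<open>The p-th power of the norm as an extended nonnegative number. Membership becomes
  finiteness, and the triangle inequality is replaced by \<open>Np_add_le\<close> with the factor
  2^p, so roots appear only when passing to \<open>Lp_norm\<close>.\<close>

definition Np :: "real \<Rightarrow> real \<Rightarrow> (real \<Rightarrow> complex) \<Rightarrow> ennreal" where
  "Np m p f = (\<integral>\<^sup>+y. ennreal (norm (f y) powr p * y powr m) \<partial>leb_pos)"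

lemma sets_weighted_measure [measurable_cong]: "sets (weighted_measure m) = sets leb_pos"
  by (simp add: weighted_measure_def)

lemma measurable_weighted_measure: "borel_measurable (weighted_measure m) = borel_measurable leb_pos"
  by (rule measurable_cong_sets) (simp_all add: sets_weighted_measure)

lemma nn_integral_weighted_measure:
  assumes [measurable]: "f \<in> borel_measurable leb_pos" and "\<And>y. f y \<ge> 0"
  shows "(\<integral>\<^sup>+y. ennreal (f y) \<partial>weighted_measure m) = (\<integral>\<^sup>+y. ennreal (f y * y powr m) \<partial>leb_pos)"
proof -
  have "(\<integral>\<^sup>+y. ennreal (f y) \<partial>weighted_measure m) = (\<integral>\<^sup>+y. ennreal (y powr m) * ennreal (f y) \<partial>leb_pos)"
    unfolding weighted_measure_def by (intro nn_integral_density) measurable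
  then show ?thesis using assms(2) by (simp add: ennreal_mult mult.commute)
qed

lemma Lp_iff: "f \<in> Lp m p \<longleftrightarrow> f \<in> borel_measurable leb_pos \<and> Np m p f < \<infinity>"
proof (cases "f \<in> borel_measurable leb_pos")
  case True
  note [measurable] = True
  have "integrable (weighted_measure m) (\<lambda>y. norm (f y) powr p) \<longleftrightarrow>
      (\<integral>\<^sup>+y. ennreal (norm (f y) powr p) \<partial>weighted_measure m) < \<infinity>"
    by (subst integrable_iff_bounded) simp
  also have "(\<integral>\<^sup>+y. ennreal (norm (f y) powr p) \<partial>weighted_measure m) = Np m p f"
    unfolding Np_def by (intro nn_integral_weighted_measure) auto
  finally show ?thesis using True by (simp add: Lp_def measurable_weighted_measure)
qed (simp add: Lp_def measurable_weighted_measure)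

lemma Lp_norm_eq:
  assumes [measurable]: "f \<in> borel_measurable leb_pos"
  shows "Lp_norm m p f = enn2real (Np m p f) powr (1 / p)"
proof -
  have "(LINT y|weighted_measure m. norm (f y) powr p) = enn2real (\<integral>\<^sup>+y. ennreal (norm (f y) powr p) \<partial>weighted_measure m)"
    by (rule integral_eq_nn_integral) auto
  also have "(\<integral>\<^sup>+y. ennreal (norm (f y) powr p) \<partial>weighted_measure m) = Np m p f"
    unfolding Np_def by (intro nn_integral_weighted_measure) auto
  finally show ?thesis by (simp add: Lp_norm_def)
qed

lemma LpD: "f \<in> Lp m p \<Longrightarrow> f \<in> borel_measurable leb_pos" "f \<in> Lp m p \<Longrightarrow> Np m p f < \<infinity>"
  by (auto simp: Lp_iff)

lemma Np_cong_AE: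
  assumes "AE y in leb_pos. f y = g y"
  shows "Np m p f = Np m p g"
  unfolding Np_def by (rule nn_integral_cong_AE) (use assms in eventually_elim, auto)

lemma Np_mono:
  assumes "AE y in leb_pos. norm (f y) \<le> norm (g y)" "p \<ge> 0"
  shows "Np m p f \<le> Np m p g"
  unfolding Np_def using assms
  by (intro nn_integral_mono_AE) (auto elim!: eventually_mono intro!: ennreal_leI mult_right_mono powr_mono2)

lemma powr_add_le:
  fixes a b p :: real
  assumes "a \<ge> 0" "b \<ge> 0" "p \<ge> 0"
  shows "(a + b) powr p \<le> 2 powr p * (a powr p + b powr p)"
proof -
  have "(a + b) powr p \<le> (2 * max a b) powr p" using assms by (intro powr_mono2) auto
  also have "\<dots> = 2 powr p * max a b powr p" using assms by (simp add: powr_mult)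
  also have "max a b powr p \<le> a powr p + b powr p" by (auto simp: max_def)
  finally show ?thesis by (simp add: mult_left_mono)
qed

lemma Np_add_le:
  assumes [measurable]: "f \<in> borel_measurable leb_pos" "g \<in> borel_measurable leb_pos" and "p \<ge> 0"
  shows "Np m p (\<lambda>y. f y + g y) \<le> ennreal (2 powr p) * (Np m p f + Np m p g)"
proof -
  have "Np m p (\<lambda>y. f y + g y) \<le> (\<integral>\<^sup>+y. ennreal (2 powr p) * (ennreal (norm (f y) powr p * y powr m) + ennreal (norm (g y) powr p * y powr m)) \<partial>leb_pos)"
    unfolding Np_def
  proof (intro nn_integral_mono)
    fix y :: real
    have "norm (f y + g y) powr p * y powr m \<le> (norm (f y) + norm (g y)) powr p * y powr m"
      using assms by (intro mult_right_mono powr_mono2 norm_triangle_ineq) auto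
    also have "\<dots> \<le> 2 powr p * (norm (f y) powr p + norm (g y) powr p) * y powr m"
      using assms by (intro mult_right_mono powr_add_le) auto
    finally show "ennreal (norm (f y + g y) powr p * y powr m) \<le> ennreal (2 powr p) * (ennreal (norm (f y) powr p * y powr m) + ennreal (norm (g y) powr p * y powr m))"
      by (simp add: ennreal_mult[symmetric] ennreal_plus[symmetric] ennreal_leI distrib_left distrib_right mult.assoc del: ennreal_plus)
  qed
  also have "\<dots> = ennreal (2 powr p) * (Np m p f + Np m p g)"
    unfolding Np_def by (simp add: nn_integral_cmult nn_integral_add)
  finally show ?thesis .
qed

lemma Np_cmult:
  assumes [measurable]: "f \<in> borel_measurable leb_pos"
  shows "Np m p (\<lambda>y. c * f y) = ennreal (norm c powr p) * Np m p f"
  unfolding Np_def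
  by (subst nn_integral_cmult[symmetric], measurable)
     (auto intro!: nn_integral_cong simp: norm_mult powr_mult ennreal_mult mult.assoc)

lemma Np_uminus: "Np m p (\<lambda>y. - f y) = Np m p f"
  by (simp add: Np_def)

lemma Np_minus_commute: "Np m p (\<lambda>y. f y - g y) = Np m p (\<lambda>y. g y - f y)"
  by (simp add: Np_def norm_minus_commute)

lemma Np_diff_le:
  assumes [measurable]: "f \<in> borel_measurable leb_pos" "g \<in> borel_measurable leb_pos" and "p \<ge> 0"
  shows "Np m p (\<lambda>y. f y - g y) \<le> ennreal (2 powr p) * (Np m p f + Np m p g)"
  using Np_add_le[OF assms(1), of "\<lambda>y. - g y" p m] assms(3) by (simp add: Np_uminus)

lemma Lp_add:
  assumes "f \<in> Lp m p" "g \<in> Lp m p" "p \<ge> 0"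
  shows "(\<lambda>y. f y + g y) \<in> Lp m p"
proof -
  note [measurable] = LpD(1)[OF assms(1)] LpD(1)[OF assms(2)]
  have "Np m p (\<lambda>y. f y + g y) \<le> ennreal (2 powr p) * (Np m p f + Np m p g)"
    by (rule Np_add_le) (use assms in measurable)
  also have "\<dots> < \<infinity>" using LpD(2)[OF assms(1)] LpD(2)[OF assms(2)] by (simp add: ennreal_mult_less_top)
  finally show ?thesis by (simp add: Lp_iff)
qed

lemma Lp_cmult:
  assumes "f \<in> Lp m p"
  shows "(\<lambda>y. c * f y) \<in> Lp m p"
proof -
  note [measurable] = LpD(1)[OF assms(1)]
  show ?thesis using assms by (simp add: Lp_iff Np_cmult ennreal_mult_less_top)
qed

lemma Lp_diff:
  assumes "f \<in> Lp m p" "g \<in> Lp m p" "p \<ge> 0"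
  shows "(\<lambda>y. f y - g y) \<in> Lp m p"
  using Lp_add[OF assms(1) Lp_cmult[OF assms(2), of "-1"] assms(3)] by simp

lemma Lp_dom:
  assumes "g \<in> Lp m p" "f \<in> borel_measurable leb_pos" "AE y in leb_pos. norm (f y) \<le> norm (g y)" "p \<ge> 0"
  shows "f \<in> Lp m p"
  using Np_mono[OF assms(3,4), of m] assms by (auto simp: Lp_iff)

text \<open>Completeness of Lebesgue measure. Both functions are set to 0 off the half-line, so that
  the fact for the whole line applies.\<close>

lemma leb_pos_AE_measurable:
  fixes f g :: "real \<Rightarrow> 'a::euclidean_space"
  assumes "f \<in> borel_measurable leb_pos" "AE y in leb_pos. f y = g y"
  shows "g \<in> borel_measurable leb_pos"
proof -
  have "(\<lambda>x. if x \<in> {0<..} then g x else 0) \<in> borel_measurable lebesgue"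
  proof (rule borel_measurable_AE)
    show "(\<lambda>x. if x \<in> {0<..} then f x else 0) \<in> borel_measurable lebesgue"
      using assms(1) by (subst borel_measurable_if) simp_all
    show "AE x in lebesgue. (if x \<in> {0<..} then f x else 0) = (if x \<in> {0<..} then g x else 0)"
      using assms(2) by (subst (asm) AE_restrict_space_iff) (auto elim!: eventually_mono)
  qed
  then show ?thesis by (subst (asm) borel_measurable_if) simp_all
qed

lemma Lp_cong_AE:
  assumes "f \<in> Lp m p" "AE y in leb_pos. f y = g y"
  shows "g \<in> Lp m p"
  using assms leb_pos_AE_measurable[of f g] Np_cong_AE[of f g m p] by (auto simp: Lp_iff)

text \<open>The pairing \<open>\<integral>u v y\<^sup>c dy\<close> puts \<open>L\<^sup>p\<^sub>m\<close> in duality with \<open>L\<^sup>q\<^sub>m\<^sub>'\<close>, where \<open>m/p + m'/q = c\<close>.\<close>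

lemma Np_pairing:
  assumes pq: "p > 1" "q > 1" "1/p + 1/q = 1" and m: "m' / q = c - m / p"
    and [measurable]: "f \<in> borel_measurable leb_pos" "g \<in> borel_measurable leb_pos"
    and fin: "Np m p f < \<infinity>" "Np m' q g < \<infinity>"
  shows "(\<integral>\<^sup>+y. ennreal (norm (f y) * norm (g y) * y powr c) \<partial>leb_pos) \<le>
      ennreal (enn2real (Np m p f) powr (1/p) * enn2real (Np m' q g) powr (1/q))"
proof -
  have "(\<integral>\<^sup>+y. ennreal (norm (f y) * norm (g y) * y powr c) \<partial>leb_pos) =
    (\<integral>\<^sup>+y. ennreal ((norm (f y) * y powr (m/p)) * (norm (g y) * y powr (m'/q))) \<partial>leb_pos)"
    by (intro nn_integral_cong) (auto simp: m powr_diff)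
  also have "\<dots> \<le> ennreal (enn2real (Np m p f) powr (1/p) * enn2real (Np m' q g) powr (1/q))"
  proof (rule nn_integral_Holder[OF pq])
    have "(\<integral>\<^sup>+y. ennreal ((norm (f y) * y powr (m/p)) powr p) \<partial>leb_pos) = Np m p f"
      unfolding Np_def using pq by (intro nn_integral_cong) (auto simp: powr_mult powr_powr)
    then show "(\<integral>\<^sup>+y. ennreal ((norm (f y) * y powr (m/p)) powr p) \<partial>leb_pos) \<le> ennreal (enn2real (Np m p f))"
      using fin by simp
    have "(\<integral>\<^sup>+y. ennreal ((norm (g y) * y powr (m'/q)) powr q) \<partial>leb_pos) = Np m' q g"
      unfolding Np_def using pq by (intro nn_integral_cong) (auto simp: powr_mult powr_powr)
    then show "(\<integral>\<^sup>+y. ennreal ((norm (g y) * y powr (m'/q)) powr q) \<partial>leb_pos) \<le> ennreal (enn2real (Np m' q g))"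
      using fin by simp
  qed auto
  finally show ?thesis .
qed

section \<open>Weak derivatives on the half-line\<close>

definition flat_exp :: "real poly \<Rightarrow> real \<Rightarrow> real" where
  "flat_exp P x = (if x > 0 then poly P (1 / x) * exp (- 1 / x) else 0)"

lemma poly_div_exp_tendsto_0: "((\<lambda>x::real. poly P x / exp x) \<longlongrightarrow> 0) at_top"
proof -
  have "((\<lambda>x::real. \<Sum>i\<le>degree P. coeff P i * (x ^ i / exp x)) \<longlongrightarrow> (\<Sum>i\<le>degree P. coeff P i * 0)) at_top"
    by (intro tendsto_intros tendsto_power_div_exp_0)
  then show ?thesis by (simp add: poly_altdef sum_divide_distrib)
qed

lemma flat_exp_tendsto_0: "(flat_exp P \<longlongrightarrow> 0) (at 0)"
proof -
  have "((\<lambda>x. poly P (inverse x) / exp (inverse x)) \<longlongrightarrow> 0) (at_right 0)"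
    by (rule filterlim_compose[OF poly_div_exp_tendsto_0 filterlim_inverse_at_top_right])
  moreover have "\<forall>\<^sub>F x in at_right 0. poly P (inverse x) / exp (inverse x) = flat_exp P x"
    using eventually_at_right_less[of 0]
    by eventually_elim (simp add: flat_exp_def exp_minus divide_inverse)
  ultimately have "(flat_exp P \<longlongrightarrow> 0) (at_right 0)"
    by (rule Lim_transform_eventually)
  moreover have "(flat_exp P \<longlongrightarrow> 0) (at_left 0)"
  proof (rule Lim_transform_eventually[OF tendsto_const])
    show "\<forall>\<^sub>F x in at_left 0. 0 = flat_exp P x"
      by (auto simp: flat_exp_def eventually_at_filter)
  qed
  ultimately show ?thesis by (rule filterlim_split_at_real[rotated])
qed

text \<open>With t = 1/x, differentiation in x is -t^2 times differentiation in t, which turns P(t)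
  exp(-t) into t^2 (P - P')(t) exp(-t). The family is therefore closed under differentiation, also
  at the gluing point 0.\<close>

lemma flat_exp_deriv:
  "(flat_exp P has_field_derivative flat_exp ([:0, 0, 1:] * (P - pderiv P)) x) (at x)"
proof -
  consider "x > 0" | "x < 0" | "x = 0" by linarith
  then show ?thesis
  proof cases
    case 1
    have inv: "((\<lambda>x. 1 / x) has_field_derivative - (1 / x\<^sup>2)) (at x)"
      using 1 by (auto intro!: derivative_eq_intros simp: power2_eq_square)
    have "((\<lambda>x. poly P (1 / x)) has_field_derivative poly (pderiv P) (1 / x) * - (1 / x\<^sup>2)) (at x)"
      by (rule DERIV_chain2[OF poly_DERIV inv])
    moreover have "((\<lambda>x. exp (- (1 / x))) has_field_derivative exp (- (1 / x)) * - (- (1 / x\<^sup>2))) (at x)"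
      by (rule DERIV_chain2[OF DERIV_exp DERIV_minus[OF inv]])
    ultimately have "((\<lambda>x. poly P (1 / x) * exp (- (1 / x))) has_field_derivative
        poly (pderiv P) (1 / x) * - (1 / x\<^sup>2) * exp (- (1 / x)) + exp (- (1 / x)) * - (- (1 / x\<^sup>2)) * poly P (1 / x)) (at x)"
      by (rule DERIV_mult)
    also have "poly (pderiv P) (1 / x) * - (1 / x\<^sup>2) * exp (- (1 / x)) + exp (- (1 / x)) * - (- (1 / x\<^sup>2)) * poly P (1 / x)
       = flat_exp ([:0, 0, 1:] * (P - pderiv P)) x"
      using 1 by (simp add: flat_exp_def power2_eq_square algebra_simps)
    finally have "((\<lambda>x. poly P (1 / x) * exp (- 1 / x)) has_field_derivative
        flat_exp ([:0, 0, 1:] * (P - pderiv P)) x) (at x)" by simp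
    moreover have "\<forall>\<^sub>F y in nhds x. flat_exp P y = poly P (1 / y) * exp (- 1 / y)"
      using eventually_nhds_in_open[of "{0<..}" x] 1
      by (auto simp: flat_exp_def elim!: eventually_mono)
    ultimately show ?thesis by (subst DERIV_cong_ev[OF refl _ refl])
  next
    case 2
    have "((\<lambda>x. 0) has_field_derivative flat_exp ([:0, 0, 1:] * (P - pderiv P)) x) (at x)"
      using 2 by (simp add: flat_exp_def)
    moreover have "\<forall>\<^sub>F y in nhds x. flat_exp P y = 0"
      using eventually_nhds_in_open[of "{..<0}" x] 2
      by (auto simp: flat_exp_def elim!: eventually_mono)
    ultimately show ?thesis by (subst DERIV_cong_ev[OF refl _ refl])
  next
    case 3
    \<comment> \<open>Dividing by h multiplies P(1/h) by 1/h, so the difference quotient at 0 is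
      again of the form \<open>flat_exp\<close>, with polynomial \<open>pCons 0 P\<close>.\<close>
    have "(flat_exp (pCons 0 P) \<longlongrightarrow> 0) (at 0)" by (rule flat_exp_tendsto_0)
    then have "((\<lambda>h. (flat_exp P (0 + h) - flat_exp P 0) / h) \<longlongrightarrow> 0) (at 0)"
      by (rule Lim_transform_eventually) (auto simp: flat_exp_def eventually_at_filter)
    then show ?thesis using 3 by (simp add: DERIV_def flat_exp_def)
  qed
qed

text \<open>Closed under differentiation, so it consists of smooth functions.\<close>

inductive bump_alg :: "(real \<Rightarrow> real) \<Rightarrow> bool" where
  base: "bump_alg (\<lambda>x. flat_exp P (s * x + t))"
| const: "bump_alg (\<lambda>x. c)"
| add: "bump_alg f \<Longrightarrow> bump_alg g \<Longrightarrow> bump_alg (\<lambda>x. f x + g x)"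
| mult: "bump_alg f \<Longrightarrow> bump_alg g \<Longrightarrow> bump_alg (\<lambda>x. f x * g x)"

lemma bump_alg_deriv: "bump_alg f \<Longrightarrow> \<exists>f'. bump_alg f' \<and> (\<forall>x. (f has_field_derivative f' x) (at x))"
proof (induction rule: bump_alg.induct)
  case (base P s t)
  define Q where "Q = [:0, 0, 1:] * (P - pderiv P)"
  have "((\<lambda>x. flat_exp P (s * x + t)) has_field_derivative flat_exp Q (s * x + t) * s) (at x)" for x
    unfolding Q_def by (rule DERIV_chain2[OF flat_exp_deriv]) (auto intro!: derivative_eq_intros)
  moreover have "bump_alg (\<lambda>x. flat_exp Q (s * x + t) * s)"
    by (rule bump_alg.mult[OF bump_alg.base bump_alg.const])
  ultimately show ?case by (intro exI[of _ "\<lambda>x. flat_exp Q (s * x + t) * s"]) simp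
next
  case (const c)
  show ?case by (intro exI[of _ "\<lambda>x. 0"]) (auto intro: bump_alg.const)
next
  case (add f g)
  then obtain f' g' where "bump_alg f'" "\<forall>x. (f has_field_derivative f' x) (at x)"
    "bump_alg g'" "\<forall>x. (g has_field_derivative g' x) (at x)" by blast
  then show ?case
    by (intro exI[of _ "\<lambda>x. f' x + g' x"] conjI allI bump_alg.add DERIV_add) simp_all
next
  case (mult f g)
  then obtain f' g' where *: "bump_alg f'" "\<forall>x. (f has_field_derivative f' x) (at x)"
    "bump_alg g'" "\<forall>x. (g has_field_derivative g' x) (at x)" by blast
  with mult.hyps show ?case
    by (intro exI[of _ "\<lambda>x. f' x * g x + g' x * f x"] conjI allI bump_alg.add bump_alg.mult DERIV_mult) simp_all
qed

lemma bump_alg_funpow: "bump_alg f \<Longrightarrow> bump_alg ((deriv ^^ n) f)"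
proof (induction n)
  case (Suc n)
  then obtain f' where f': "bump_alg f'" "\<forall>x. ((deriv ^^ n) f has_field_derivative f' x) (at x)"
    using bump_alg_deriv by blast
  then have "deriv ((deriv ^^ n) f) = f'" by (auto intro!: ext DERIV_imp_deriv)
  then show ?case using f' by simp
qed simp

lemma bump_alg_smooth: "bump_alg f \<Longrightarrow> (deriv ^^ n) f differentiable at x"
  using bump_alg_deriv[OF bump_alg_funpow] by (meson real_differentiable_def)

text \<open>On (a, b) and for n > 0 this is exp(-1/(n(x - a)) - 1/(n(b - x))). It tends to 1 there
  as n grows, which makes the indicator of (a, b) a bounded limit of smooth functions.\<close>

definition bump :: "real \<Rightarrow> real \<Rightarrow> nat \<Rightarrow> real \<Rightarrow> real" where
  "bump a b n x = flat_exp 1 (real n * x + - (real n * a)) * flat_exp 1 (- real n * x + real n * b)"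

lemma bump_alg_bump: "bump_alg (bump a b n)"
  unfolding bump_def[abs_def] by (rule bump_alg.mult[OF bump_alg.base bump_alg.base])

lemma flat_exp_1_bounds: "0 \<le> flat_exp 1 x" "flat_exp 1 x \<le> 1"
  by (auto simp: flat_exp_def)

lemma bump_bounds: "0 \<le> bump a b n x" "bump a b n x \<le> 1"
  using flat_exp_1_bounds by (auto simp: bump_def intro: mult_le_one)

lemma bump_eq_0: "x \<notin> {a<..<b} \<Longrightarrow> bump a b n x = 0"
proof -
  assume "x \<notin> {a<..<b}"
  then have "real n * x \<le> real n * a \<or> real n * b \<le> real n * x"
    by (auto simp: not_less intro!: mult_left_mono)
  then show ?thesis by (auto simp: bump_def flat_exp_def)
qed

lemma bump_pos: "x \<in> {a<..<b} \<Longrightarrow> n > 0 \<Longrightarrow> bump a b n x > 0"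
  by (auto simp: bump_def flat_exp_def)

lemma bump_tendsto: "(\<lambda>n. bump a b n x) \<longlonglongrightarrow> indicator {a<..<b} x"
proof (cases "x \<in> {a<..<b}")
  case True
  have *: "(\<lambda>n. flat_exp 1 (real n * d)) \<longlonglongrightarrow> 1" if "d > 0" for d :: real
  proof -
    have "(\<lambda>n. exp (- (1 / d) * (1 / real n))) \<longlonglongrightarrow> exp (- (1 / d) * 0)"
      by (intro tendsto_intros lim_1_over_n)
    then have "(\<lambda>n. exp (- (1 / d) * (1 / real n))) \<longlonglongrightarrow> 1" by simp
    moreover have "\<forall>\<^sub>F n in sequentially. exp (- (1 / d) * (1 / real n)) = flat_exp 1 (real n * d)"
      using eventually_gt_at_top[of 0] by eventually_elim (use that in \<open>auto simp: flat_exp_def\<close>)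
    ultimately show ?thesis by (rule Lim_transform_eventually)
  qed
  have "(\<lambda>n. flat_exp 1 (real n * (x - a)) * flat_exp 1 (real n * (b - x))) \<longlonglongrightarrow> 1 * 1"
    using True by (intro tendsto_mult *) auto
  then show ?thesis using True by (simp add: bump_def algebra_simps)
qed (simp add: bump_eq_0)

lemma test_functionI:
  assumes "bump_alg f" "0 < a" "\<And>x. x \<notin> {a..b} \<Longrightarrow> f x = 0"
  shows "test_function f"
  using assms bump_alg_smooth unfolding test_function_def by blast

lemma test_functionD:
  assumes "test_function \<phi>"
  shows "(\<phi> has_field_derivative deriv \<phi> x) (at x)" "isCont \<phi> x" "isCont (deriv \<phi>) x"
    "\<exists>a b. 0 < a \<and> a < b \<and> (\<forall>x. x \<notin> {a..b} \<longrightarrow> \<phi> x = 0) \<and> (\<forall>x. x \<notin> {a..b} \<longrightarrow> deriv \<phi> x = 0)"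
proof -
  have d: "(deriv ^^ n) \<phi> differentiable at x" for n x
    using assms by (auto simp: test_function_def)
  have d0: "(\<phi> has_field_derivative deriv \<phi> x) (at x)" for x
    using d[of 0 x] by (simp add: DERIV_deriv_iff_real_differentiable)
  then show "(\<phi> has_field_derivative deriv \<phi> x) (at x)" .
  show "isCont \<phi> x" using d0 DERIV_isCont by blast
  show "isCont (deriv \<phi>) x"
    using d[of 1 x] differentiable_imp_continuous_within by fastforce
  obtain a b where ab: "0 < a" "\<And>x. x \<notin> {a..b} \<Longrightarrow> \<phi> x = 0"
    using assms by (auto simp: test_function_def)
  \<comment> \<open>The definition of a test function does not force a < b, so the right end is
    enlarged.\<close>
  define b' where "b' = max b (a + 1)"
  have "deriv \<phi> x = 0" if "x \<notin> {a..b'}" for x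
  proof -
    have "\<forall>\<^sub>F y in nhds x. \<phi> y = 0"
    proof (rule eventually_mono[OF eventually_nhds_in_open])
      show "open (- {a..b'})" by (simp add: open_Compl)
      show "x \<in> - {a..b'}" using that by simp
      show "\<phi> y = 0" if "y \<in> - {a..b'}" for y using that by (intro ab) (auto simp: b'_def)
    qed
    then have "(\<phi> has_field_derivative 0) (at x)"
      by (subst DERIV_cong_ev[OF refl _ refl, where g = "\<lambda>_. 0"]) auto
    then show ?thesis by (rule DERIV_imp_deriv)
  qed
  moreover have "\<phi> x = 0" if "x \<notin> {a..b'}" for x using that by (intro ab) (auto simp: b'_def)
  ultimately show "\<exists>a b. 0 < a \<and> a < b \<and> (\<forall>x. x \<notin> {a..b} \<longrightarrow> \<phi> x = 0) \<and> (\<forall>x. x \<notin> {a..b} \<longrightarrow> deriv \<phi> x = 0)"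
    using ab(1) by (intro exI[of _ a] exI[of _ b']) (auto simp: b'_def)
qed

text \<open>The primitive of \<theta> starting at a vanishes to the left of a; zero mean is what
  makes it vanish to the right of b.\<close>

lemma test_function_antideriv:
  assumes \<theta>: "test_function \<theta>" and ab: "0 < a" "a \<le> b" "\<And>x. x \<notin> {a..b} \<Longrightarrow> \<theta> x = 0"
    and int: "integral {a..b} \<theta> = 0"
  shows "\<exists>\<phi>. test_function \<phi> \<and> deriv \<phi> = \<theta>"
proof -
  define \<phi> where "\<phi> x = integral {a..x} \<theta>" for x
  have cont: "continuous_on S \<theta>" for S
    using test_functionD(2)[OF \<theta>] by (simp add: continuous_at_imp_continuous_on)
  have int: "\<theta> integrable_on {u..v}" for u v
    by (intro integrable_continuous_real cont)
  have D: "(\<phi> has_field_derivative \<theta> x) (at x)" for x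
  proof -
    \<comment> \<open>The fundamental theorem needs a base point to the left of x. Below a nothing
      changes, since \<theta> vanishes there and the integral over the empty interval is 0.\<close>
    define A B where "A = min a x - 1" and "B = x + 1"
    have *: "\<phi> y = integral {A..y} \<theta>" if "y \<in> {A<..<B}" for y
    proof (cases "a \<le> y")
      case True
      have "integral {A..y} \<theta> = integral {A..a} \<theta> + integral {a..y} \<theta>"
        using True int by (intro Henstock_Kurzweil_Integration.integral_combine[symmetric]) (auto simp: A_def)
      also have "integral {A..a} \<theta> = integral {A..a} (\<lambda>x. 0)"
        by (rule integral_spike[of "{a}"]) (auto simp: ab)
      finally show ?thesis by (simp add: \<phi>_def)
    next
      case False
      have "integral {A..y} \<theta> = integral {A..y} (\<lambda>x. 0)"
        by (rule Henstock_Kurzweil_Integration.integral_cong) (use False ab in auto)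
      then show ?thesis using False by (simp add: \<phi>_def)
    qed
    have "((\<lambda>y. integral {A..y} \<theta>) has_field_derivative \<theta> x) (at x within {A..B})"
      by (rule integral_has_real_derivative[OF cont]) (auto simp: A_def B_def)
    then have "((\<lambda>y. integral {A..y} \<theta>) has_field_derivative \<theta> x) (at x)"
      by (subst (asm) at_within_Icc_at) (auto simp: A_def B_def)
    moreover have "\<forall>\<^sub>F y in nhds x. \<phi> y = integral {A..y} \<theta>"
    proof (rule eventually_mono[OF eventually_nhds_in_open])
      show "open {A<..<B}" by simp
      show "x \<in> {A<..<B}" by (simp add: A_def B_def)
    qed (rule *)
    ultimately show ?thesis by (subst DERIV_cong_ev[OF refl _ refl])
  qed
  then have deriv: "deriv \<phi> = \<theta>" by (auto intro!: ext DERIV_imp_deriv)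
  have "(deriv ^^ n) \<phi> differentiable at x" for n x
  proof (cases n)
    case 0
    then show ?thesis using D by (auto simp: real_differentiable_def)
  next
    case (Suc k)
    then have "(deriv ^^ n) \<phi> = (deriv ^^ k) \<theta>" by (simp only: funpow_Suc_right o_def deriv)
    then show ?thesis using \<theta> by (simp add: test_function_def)
  qed
  moreover have "\<phi> x = 0" if x: "x \<notin> {a..b}" for x
  proof (cases "x < a")
    case False
    then have "x > b" using x by auto
    have "\<phi> x = integral {a..b} \<theta> + integral {b..x} \<theta>"
      unfolding \<phi>_def using \<open>x > b\<close> ab int by (intro Henstock_Kurzweil_Integration.integral_combine[symmetric]) auto
    also have "integral {b..x} \<theta> = integral {b..x} (\<lambda>x. 0)"
      by (rule integral_spike[of "{b}"]) (auto simp: ab)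
    finally show ?thesis using assms by simp
  qed (simp add: \<phi>_def)
  ultimately have "test_function \<phi>" using ab(1) unfolding test_function_def by blast
  then show ?thesis using deriv by blast
qed

section \<open>Local integrability on the half-line and absolutely continuous functions\<close>

definition loc_int :: "(real \<Rightarrow> 'a::euclidean_space) \<Rightarrow> bool" where
  "loc_int v \<longleftrightarrow> v \<in> borel_measurable leb_pos \<and>
     (\<forall>a b. 0 < a \<longrightarrow> integrable leb_pos (\<lambda>y. indicator {a..b} y *\<^sub>R v y))"

abbreviation iint :: "real \<Rightarrow> real \<Rightarrow> (real \<Rightarrow> 'a::euclidean_space) \<Rightarrow> 'a" where
  "iint a b v \<equiv> (LINT s|leb_pos. indicator {a..b} s *\<^sub>R v s)"

lemma integrable_leb_pos_iff:
  fixes f :: "real \<Rightarrow> 'a::euclidean_space"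
  shows "integrable leb_pos f \<longleftrightarrow> integrable lebesgue (\<lambda>x. indicator {0<..} x *\<^sub>R f x)"
  by (rule integrable_restrict_space) simp

lemma integral_leb_pos_eq:
  fixes f :: "real \<Rightarrow> 'a::euclidean_space"
  shows "integral\<^sup>L leb_pos f = (LINT x|lebesgue. indicator {0<..} x *\<^sub>R f x)"
  by (rule integral_restrict_space) simp

lemma indicator_pos_Icc: "0 < (a::real) \<Longrightarrow> indicator {0<..} x *\<^sub>R indicator {a..b} x *\<^sub>R (v::'a::real_vector) = indicator {a..b} x *\<^sub>R v"
  by (auto simp: indicator_def)

lemma integrable_leb_pos_Icc:
  fixes f :: "real \<Rightarrow> 'a::euclidean_space"
  assumes "0 < a"
  shows "integrable leb_pos (\<lambda>y. indicator {a..b} y *\<^sub>R f y) \<longleftrightarrow> set_integrable lebesgue {a..b} f"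
  using assms by (simp add: integrable_leb_pos_iff indicator_pos_Icc set_integrable_def del: scaleR_scaleR)

lemma iint_eq_lebesgue:
  fixes f :: "real \<Rightarrow> 'a::euclidean_space"
  assumes "0 < a"
  shows "iint a b f = (LINT y:{a..b}|lebesgue. f y)"
  using assms by (simp add: integral_leb_pos_eq indicator_pos_Icc set_lebesgue_integral_def del: scaleR_scaleR)

lemma iint_eq_integral:
  fixes f :: "real \<Rightarrow> 'a::euclidean_space"
  assumes "0 < a" "integrable leb_pos (\<lambda>y. indicator {a..b} y *\<^sub>R f y)"
  shows "f integrable_on {a..b}" "iint a b f = integral {a..b} f"
  using assms set_lebesgue_integral_eq_integral[of "{a..b}" f]
  by (simp_all add: integrable_leb_pos_Icc iint_eq_lebesgue)

lemma Lp_loc_iff: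
  "f \<in> Lp_loc p \<longleftrightarrow> f \<in> borel_measurable leb_pos \<and> loc_int (\<lambda>y. norm (f y) powr p)"
  unfolding Lp_loc_def loc_int_def by (auto simp: integrable_leb_pos_Icc simp del: real_scaleR_def)

lemma Lp_loc_1_iff: "f \<in> Lp_loc 1 \<longleftrightarrow> loc_int f"
proof (cases "f \<in> borel_measurable leb_pos")
  case True
  note [measurable] = True
  have "integrable leb_pos (\<lambda>y. indicator {a..b} y *\<^sub>R norm (f y)) \<longleftrightarrow> integrable leb_pos (\<lambda>y. indicator {a..b} y *\<^sub>R f y)" for a b
    by (subst integrable_norm_iff[symmetric, of "\<lambda>y. indicator {a..b} y *\<^sub>R f y"]) simp_all
  then show ?thesis using True by (simp add: Lp_loc_iff loc_int_def)
qed (simp add: Lp_loc_iff loc_int_def)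

lemma loc_intD: "loc_int v \<Longrightarrow> v \<in> borel_measurable leb_pos"
  "loc_int v \<Longrightarrow> 0 < a \<Longrightarrow> integrable leb_pos (\<lambda>y. indicator {a..b} y *\<^sub>R v y)"
  by (auto simp: loc_int_def)

lemma loc_int_AE:
  fixes u v :: "real \<Rightarrow> 'a::euclidean_space"
  assumes "loc_int u" "AE y in leb_pos. u y = v y"
  shows "loc_int v"
proof -
  note [measurable] = loc_intD(1)[OF assms(1)]
  have [measurable]: "v \<in> borel_measurable leb_pos"
    by (rule leb_pos_AE_measurable[OF loc_intD(1)[OF assms(1)] assms(2)])
  show ?thesis unfolding loc_int_def
  proof (intro conjI allI impI)
    fix a b :: real assume "0 < a"
    have "AE y in leb_pos. indicator {a..b} y *\<^sub>R u y = indicator {a..b} y *\<^sub>R v y"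
      using assms(2) by eventually_elim auto
    from integrable_cong_AE[OF _ _ this] show "integrable leb_pos (\<lambda>y. indicator {a..b} y *\<^sub>R v y)"
      using loc_intD(2)[OF assms(1) \<open>0 < a\<close>] by simp
  qed measurable
qed

lemma loc_int_add: "loc_int u \<Longrightarrow> loc_int v \<Longrightarrow> loc_int (\<lambda>y. u y + v y)"
  by (auto simp: loc_int_def scaleR_add_right)

lemma loc_int_diff: "loc_int u \<Longrightarrow> loc_int v \<Longrightarrow> loc_int (\<lambda>y. u y - v y)"
  by (auto simp: loc_int_def scaleR_diff_right)

lemma leb_pos_measurable_continuous:
  fixes f :: "real \<Rightarrow> 'a::euclidean_space"
  assumes "continuous_on {0<..} f"
  shows "f \<in> borel_measurable leb_pos"
  by (rule continuous_imp_measurable_on_sets_lebesgue[OF assms]) simp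

lemma cont_Icc_bounded:
  fixes f :: "real \<Rightarrow> 'a::euclidean_space"
  assumes "continuous_on {a..b} f"
  obtains B where "B \<ge> 0" "\<And>x. x \<in> {a..b} \<Longrightarrow> norm (f x) \<le> B"
proof -
  have "bounded (f ` {a..b})" by (intro compact_imp_bounded compact_continuous_image assms) simp
  then obtain B where "\<forall>x\<in>{a..b}. norm (f x) \<le> B" by (auto simp: bounded_iff)
  then show thesis by (intro that[of "max B 0"]) force+
qed

lemma integrable_cont_mult:
  fixes v :: "real \<Rightarrow> 'a::euclidean_space" and f :: "real \<Rightarrow> real"
  assumes a: "0 < a" and v: "integrable leb_pos (\<lambda>y. indicator {a..b} y *\<^sub>R v y)" and f: "continuous_on {a..b} f"
  shows "integrable leb_pos (\<lambda>y. indicator {a..b} y *\<^sub>R f y *\<^sub>R v y)"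
proof -
  obtain B where B: "B \<ge> 0" "\<And>x. x \<in> {a..b} \<Longrightarrow> norm (f x) \<le> B" using cont_Icc_bounded[OF f] by auto
  have [measurable]: "(\<lambda>y. indicator {a..b} y *\<^sub>R f y) \<in> borel_measurable leb_pos"
    by (rule measurable_restrict_space1[OF measurable_completion])
       (simp only: measurable_lborel2, rule borel_measurable_continuous_on_indicator[OF _ f], simp)
  have [measurable]: "(\<lambda>y. indicator {a..b} y *\<^sub>R v y) \<in> borel_measurable leb_pos" using v by auto
  have "integrable leb_pos (\<lambda>y. (indicator {a..b} y *\<^sub>R f y) *\<^sub>R (indicator {a..b} y *\<^sub>R v y))"
  proof (rule Bochner_Integration.integrable_bound[OF integrable_scaleR_right[OF v, of B]])
    show "AE y in leb_pos. norm ((indicator {a..b} y *\<^sub>R f y) *\<^sub>R (indicator {a..b} y *\<^sub>R v y)) \<le> norm (B *\<^sub>R (indicator {a..b} y *\<^sub>R v y))"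
      using B by (auto simp: indicator_def intro!: mult_right_mono)
  qed measurable
  then show ?thesis by (rule back_subst[of "integrable leb_pos"]) (auto simp: indicator_def)
qed

lemma loc_int_cont_mult:
  fixes v :: "real \<Rightarrow> 'a::euclidean_space" and f :: "real \<Rightarrow> real"
  assumes v: "loc_int v" and f: "continuous_on {0<..} f"
  shows "loc_int (\<lambda>y. f y *\<^sub>R v y)"
proof -
  note [measurable] = loc_intD(1)[OF v] leb_pos_measurable_continuous[OF f]
  show ?thesis unfolding loc_int_def
    by (intro conjI allI impI integrable_cont_mult loc_intD(2)[OF v] continuous_on_subset[OF f]) auto
qed

lemma integrable_leb_pos_cont:
  fixes f :: "real \<Rightarrow> 'a::euclidean_space"
  assumes "0 < a" "continuous_on {a..b} f"
  shows "integrable leb_pos (\<lambda>y. indicator {a..b} y *\<^sub>R f y)"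
  unfolding integrable_leb_pos_Icc[OF assms(1)]
  using borel_integrable_atLeastAtMost'[OF assms(2)] unfolding set_integrable_def
  by (subst integrable_completion) (auto intro: borel_measurable_integrable)

lemma loc_int_cont:
  fixes f :: "real \<Rightarrow> 'a::euclidean_space"
  assumes "continuous_on {0<..} f"
  shows "loc_int f"
  unfolding loc_int_def
  by (intro conjI allI impI integrable_leb_pos_cont leb_pos_measurable_continuous continuous_on_subset[OF assms] assms) auto

lemma iint_FTC:
  fixes f :: "real \<Rightarrow> real"
  assumes "0 < a" "a \<le> b" "\<And>x. x \<in> {a..b} \<Longrightarrow> (f has_field_derivative f' x) (at x)"
    and "continuous_on {a..b} f'"
  shows "iint a b f' = f b - f a"
proof -
  have "iint a b f' = integral {a..b} f'"
    by (intro iint_eq_integral integrable_leb_pos_cont assms)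
  also have "\<dots> = f b - f a"
    by (intro integral_unique fundamental_theorem_of_calculus assms)
       (use assms in \<open>auto simp: has_real_derivative_iff_has_vector_derivative[symmetric] intro: has_field_derivative_at_within\<close>)
  finally show ?thesis .
qed

lemma AE_leb_pos_neq: "AE s in leb_pos. s \<noteq> (x::real)"
proof -
  have "AE s in lebesgue. s \<noteq> x" by (simp add: AE_completion AE_lborel_singleton)
  then show ?thesis by (subst AE_restrict_space_iff) auto
qed

lemma iint_combine:
  fixes v :: "real \<Rightarrow> 'a::euclidean_space"
  assumes "0 < a" "a \<le> b" "b \<le> c" "integrable leb_pos (\<lambda>y. indicator {a..c} y *\<^sub>R v y)"
  shows "iint a c v = iint a b v + iint b c v"
proof -
  have s: "set_integrable lebesgue {a..c} v" using assms by (simp add: integrable_leb_pos_Icc)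
  have i: "integrable leb_pos (\<lambda>y. indicator {a..b} y *\<^sub>R v y)" "integrable leb_pos (\<lambda>y. indicator {b..c} y *\<^sub>R v y)"
    using assms set_integrable_subset[OF s, of "{a..b}"] set_integrable_subset[OF s, of "{b..c}"] by (auto simp: integrable_leb_pos_Icc)
  have "iint a c v = (LINT s|leb_pos. indicator {a..b} s *\<^sub>R v s + indicator {b..c} s *\<^sub>R v s)"
  proof (rule integral_cong_AE)
    show "(\<lambda>s. indicator {a..c} s *\<^sub>R v s) \<in> borel_measurable leb_pos" using assms(4) by auto
    show "(\<lambda>s. indicator {a..b} s *\<^sub>R v s + indicator {b..c} s *\<^sub>R v s) \<in> borel_measurable leb_pos"
      using i by (intro borel_measurable_add) auto
    show "AE s in leb_pos. indicator {a..c} s *\<^sub>R v s = indicator {a..b} s *\<^sub>R v s + indicator {b..c} s *\<^sub>R v s"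
      using AE_leb_pos_neq[of b] by eventually_elim (use assms in \<open>auto simp: indicator_def\<close>)
  qed
  then show ?thesis using i by simp
qed

text \<open>Open intervals form an intersection-stable generator of the Borel sets, and the sets
  over which w has integral zero are closed under complements (by \<open>tot\<close>) and countable
  disjoint unions. A Lebesgue set differs from a Borel set by a null set.\<close>

lemma AE_zero_if_interval_integrals_zero:
  fixes w :: "real \<Rightarrow> 'a::euclidean_space"
  assumes w: "integrable leb_pos w" and tot: "integral\<^sup>L leb_pos w = 0"
    and iv: "\<And>a b. (LINT y|leb_pos. indicator {a<..<b} y *\<^sub>R w y) = 0"
  shows "AE y in leb_pos. w y = 0"
proof (rule leb_pos.density_zero[OF w])
  note [measurable] = borel_measurable_integrable[OF w]
  have ind: "(LINT y|leb_pos. indicator A y *\<^sub>R w y) = set_lebesgue_integral leb_pos (A \<inter> {0<..}) w" for A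
    unfolding set_lebesgue_integral_def by (rule Bochner_Integration.integral_cong) (auto simp: indicator_def)
  have inS: "A \<inter> {0<..} \<in> sets leb_pos" if "A \<in> sets borel" for A
    using that by (auto simp: sets_restrict_space_iff)
  have *: "set_lebesgue_integral leb_pos (A \<inter> {0<..}) w = 0" if "A \<in> sets borel" for A
  proof -
    have subset_Pow_UNIV: "range (\<lambda>(a::real, b). box a b) \<subseteq> Pow UNIV" by simp
    have st: "Int_stable (range (\<lambda>(a::real, b). box a b))"
    proof (rule Int_stableI_image)
      fix i j :: "real \<times> real"
      show "\<exists>k\<in>UNIV. (case i of (a, b) \<Rightarrow> box a b) \<inter> (case j of (a, b) \<Rightarrow> box a b) = (case k of (a, b) \<Rightarrow> box a b)"
        by (intro bexI[of _ "(max (fst i) (fst j), min (snd i) (snd j))"]) (auto simp: box_real split: prod.splits)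
    qed
    have bs: "sets borel = sigma_sets UNIV (range (\<lambda>(a::real, b). box a b))"
      by (subst borel_eq_box) simp
    have "A \<in> sigma_sets UNIV (range (\<lambda>(a::real, b). box a b))" using that bs by simp
    from st subset_Pow_UNIV this show ?thesis
    proof (induction rule: sigma_sets_induct_disjoint)
      case (basic A)
      then show ?case using iv by (auto simp: ind[symmetric] box_real)
    next
      case empty
      show ?case by (simp add: set_lebesgue_integral_def)
    next
      case (compl A)
      then have A: "A \<in> sets borel" using bs by simp
      have "(UNIV - A) \<inter> {0<..} = {0<..} - A \<inter> {0<..}" by auto
      moreover have "set_lebesgue_integral leb_pos ({0<..} - A \<inter> {0<..}) w = integral\<^sup>L leb_pos w - set_lebesgue_integral leb_pos (A \<inter> {0<..}) w"
      proof -
        have i: "integrable leb_pos (\<lambda>y. indicator (A \<inter> {0<..}) y *\<^sub>R w y)"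
          by (rule integrable_mult_indicator[OF inS[OF A] w])
        have "set_lebesgue_integral leb_pos ({0<..} - A \<inter> {0<..}) w = (LINT y|leb_pos. w y - indicator (A \<inter> {0<..}) y *\<^sub>R w y)"
          unfolding set_lebesgue_integral_def by (rule Bochner_Integration.integral_cong) (auto simp: indicator_def)
        also have "\<dots> = integral\<^sup>L leb_pos w - set_lebesgue_integral leb_pos (A \<inter> {0<..}) w"
          unfolding set_lebesgue_integral_def by (rule Bochner_Integration.integral_diff[OF w i])
        finally show ?thesis .
      qed
      ultimately show ?case using compl tot by simp
    next
      case (union A)
      then have A: "A i \<in> sets borel" for i using bs by auto
      have "(\<Union>i. A i) \<inter> {0<..} = (\<Union>i. A i \<inter> {0<..})" by auto
      moreover have "set_lebesgue_integral leb_pos (\<Union>i. A i \<inter> {0<..}) w = (\<Sum>i. set_lebesgue_integral leb_pos (A i \<inter> {0<..}) w)"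
      proof (rule lebesgue_integral_countable_add)
        show "A i \<inter> {0<..} \<in> sets leb_pos" for i by (rule inS[OF A])
        show "(A i \<inter> {0<..}) \<inter> (A j \<inter> {0<..}) = {}" if "i \<noteq> j" for i j
          using that union(1) by (auto simp: disjoint_family_on_def)
        show "set_integrable leb_pos (\<Union>i. A i \<inter> {0<..}) w" unfolding set_integrable_def
          by (rule integrable_mult_indicator[OF _ w]) (rule sets.countable_UN[OF image_subsetI], rule inS[OF A])
      qed
      ultimately show ?case using union by simp
    qed
  qed
  fix A assume A: "A \<in> sets leb_pos"
  then have "A \<in> sets lebesgue" "A \<subseteq> {0<..}" by (auto simp: sets_restrict_space_iff)
  then obtain S N N' where S: "A = S \<union> N" "N \<subseteq> N'" "N' \<in> null_sets lborel" "S \<in> sets lborel"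
    by (auto elim: sets_completionE)
  have SA: "S \<inter> {0<..} = S" using S \<open>A \<subseteq> {0<..}\<close> by auto
  have "AE y in lborel. y \<notin> N'" by (rule AE_not_in[OF S(3)])
  then have "AE y in lebesgue. y \<notin> N'" by (rule AE_completion)
  then have "AE y in leb_pos. y \<notin> N'" by (subst AE_restrict_space_iff) auto
  then have ae: "AE y in leb_pos. indicator A y *\<^sub>R w y = indicator (S \<inter> {0<..}) y *\<^sub>R w y"
    by eventually_elim (use S SA in \<open>auto simp: indicator_def\<close>)
  have "set_lebesgue_integral leb_pos A w = set_lebesgue_integral leb_pos (S \<inter> {0<..}) w"
    unfolding set_lebesgue_integral_def
  proof (rule integral_cong_AE[OF _ _ ae])
    show "(\<lambda>x. indicator A x *\<^sub>R w x) \<in> borel_measurable leb_pos" using A by measurable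
    have "S \<inter> {0<..} \<in> sets leb_pos" using S by (intro inS) simp
    then show "(\<lambda>x. indicator (S \<inter> {0<..}) x *\<^sub>R w x) \<in> borel_measurable leb_pos" by measurable
  qed
  then show "set_lebesgue_integral leb_pos A w = 0" using *[of S] S by simp
qed

text \<open>The previous lemma asks for global integrability, so v is cut off to (1/(n+1), n+1); the
  countably many exceptional null sets are united.\<close>

lemma loc_int_AE_zero:
  fixes v :: "real \<Rightarrow> 'a::euclidean_space"
  assumes v: "loc_int v" and iv: "\<And>a b. 0 < a \<Longrightarrow> a < b \<Longrightarrow> (LINT y|leb_pos. indicator {a<..<b} y *\<^sub>R v y) = 0"
  shows "AE y in leb_pos. v y = 0"
proof -
  note [measurable] = loc_intD(1)[OF v]
  have "AE y in leb_pos. indicator {1 / real (Suc n)<..<real (Suc n)} y *\<^sub>R v y = 0" for n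
  proof (rule AE_zero_if_interval_integrals_zero)
    define c d where "c = 1 / real (Suc n)" and "d = real (Suc n)"
    have c: "c > 0" by (simp add: c_def)
    have iv': "(LINT y|leb_pos. indicator {a<..<b} y *\<^sub>R v y) = 0" if "0 < a" for a b
      using iv[of a b] that by (cases "a < b") auto
    have "integrable leb_pos (\<lambda>y. indicator {c<..<d} y *\<^sub>R v y)"
      by (rule Bochner_Integration.integrable_bound[OF loc_intD(2)[OF v c, of d]])
         (auto simp: indicator_def)
    then show "integrable leb_pos (\<lambda>y. indicator {1 / real (Suc n)<..<real (Suc n)} y *\<^sub>R v y)"
      by (simp only: c_def d_def)
    show "(LINT y|leb_pos. indicator {1 / real (Suc n)<..<real (Suc n)} y *\<^sub>R v y) = 0"
      by (rule iv') simp
    fix a b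
    have "(LINT y|leb_pos. indicator {a<..<b} y *\<^sub>R indicator {c<..<d} y *\<^sub>R v y) =
       (LINT y|leb_pos. indicator {max a c<..<min b d} y *\<^sub>R v y)"
      by (rule Bochner_Integration.integral_cong) (auto simp: indicator_def)
    also have "\<dots> = 0" using c by (intro iv') auto
    finally show "(LINT y|leb_pos. indicator {a<..<b} y *\<^sub>R indicator {1 / real (Suc n)<..<real (Suc n)} y *\<^sub>R v y) = 0"
      by (simp only: c_def d_def)
  qed
  then have "AE y in leb_pos. \<forall>n. indicator {1 / real (Suc n)<..<real (Suc n)} y *\<^sub>R v y = 0"
    by (subst AE_all_countable) (rule allI)
  then show ?thesis using AE_leb_pos_gt
  proof eventually_elim
    case (elim y)
    obtain n1 where n1: "1 / y < real n1" using reals_Archimedean2 by blast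
    obtain n2 where n2: "y < real n2" using reals_Archimedean2 by blast
    define n where "n = max n1 n2"
    have "1 / y < real (Suc n)" "y < real (Suc n)" using n1 n2 by (auto simp: n_def)
    then have "y \<in> {1 / real (Suc n)<..<real (Suc n)}" using elim(2) by (auto simp: field_simps)
    then show ?case using elim(1)[rule_format, of n] by simp
  qed
qed

text \<open>Local absolute continuity on the open half-line, expressed by the fundamental theorem of
  calculus rather than by pointwise derivatives: v matters only up to null sets, whereas u is a
  genuine continuous function.\<close>

definition ac :: "(real \<Rightarrow> complex) \<Rightarrow> (real \<Rightarrow> complex) \<Rightarrow> bool" where
  "ac u v \<longleftrightarrow> loc_int v \<and> (\<forall>a b. 0 < a \<longrightarrow> a \<le> b \<longrightarrow> u b - u a = iint a b v)"

lemma acD: "ac u v \<Longrightarrow> loc_int v" "ac u v \<Longrightarrow> 0 < a \<Longrightarrow> a \<le> b \<Longrightarrow> u b - u a = iint a b v"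
  by (auto simp: ac_def)

lemma ac_continuous_on:
  assumes "ac u v"
  shows "continuous_on {0<..} u"
proof -
  have "isCont u x" if x: "x > 0" for x
  proof -
    define a b where "a = x / 2" and "b = 2 * x"
    have ab: "0 < a" "a < x" "x < b" using x by (auto simp: a_def b_def)
    have i: "integrable leb_pos (\<lambda>y. indicator {a..z} y *\<^sub>R v y)" for z
      using acD(1)[OF assms] ab by (auto simp: loc_int_def)
    have "continuous_on {a..b} (\<lambda>z. u a + integral {a..z} v)"
      by (intro continuous_intros indefinite_integral_continuous_1 iint_eq_integral(1) ab i)
    moreover have "u a + integral {a..z} v = u z" if "z \<in> {a..b}" for z
      using acD(2)[OF assms, of a z] that ab iint_eq_integral(2)[OF _ i, of z] by (auto simp: algebra_simps)
    ultimately have "continuous_on {a..b} u" by (rule continuous_on_eq)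
    then show ?thesis using ab by (auto intro: continuous_on_interior)
  qed
  then show ?thesis by (auto intro: continuous_at_imp_continuous_on)
qed

lemma ac_loc_int: "ac u v \<Longrightarrow> loc_int u"
  by (intro loc_int_cont ac_continuous_on)

lemma ac_cong_AE:
  assumes "ac u v" "AE y in leb_pos. v y = w y"
  shows "ac u w"
proof -
  have w: "loc_int w" by (rule loc_int_AE[OF acD(1)[OF assms(1)] assms(2)])
  have "iint a b v = iint a b w" for a b
  proof (rule integral_cong_AE)
    note [measurable] = loc_intD(1)[OF acD(1)[OF assms(1)]] loc_intD(1)[OF w]
    show "(\<lambda>s. indicator {a..b} s *\<^sub>R v s) \<in> borel_measurable leb_pos"
      "(\<lambda>s. indicator {a..b} s *\<^sub>R w s) \<in> borel_measurable leb_pos" by measurable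
    show "AE s in leb_pos. indicator {a..b} s *\<^sub>R v s = indicator {a..b} s *\<^sub>R w s"
      using assms(2) by eventually_elim simp
  qed
  then show ?thesis using assms(1) w by (auto simp: ac_def)
qed

lemma integrable_pair_prod:
  fixes f :: "real \<Rightarrow> real" and g :: "real \<Rightarrow> complex"
  assumes f: "integrable leb_pos f" and g: "integrable leb_pos g"
  shows "integrable (leb_pos \<Otimes>\<^sub>M leb_pos) (\<lambda>(x, y). f x *\<^sub>R g y)"
proof (rule leb_pos2.Fubini_integrable)
  note [measurable] = borel_measurable_integrable[OF f] borel_measurable_integrable[OF g]
  show "(\<lambda>(x, y). f x *\<^sub>R g y) \<in> borel_measurable (leb_pos \<Otimes>\<^sub>M leb_pos)" by measurable
  show "integrable leb_pos (\<lambda>x. LINT y|leb_pos. norm (case (x, y) of (x, y) \<Rightarrow> f x *\<^sub>R g y))"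
    using f by simp
  show "AE x in leb_pos. integrable leb_pos (\<lambda>y. case (x, y) of (x, y) \<Rightarrow> f x *\<^sub>R g y)"
    using g by simp
qed

text \<open>Fubini for f'(x) v(s) on the triangle a \<le> s \<le> x \<le> b. Integrating first in s
  produces f'(x) (u(x) - u(a)), integrating first in x produces (f(b) - f(s)) v(s). The function u
  enters only through its increments.\<close>

lemma ac_by_parts:
  assumes u: "ac u v" and ab: "0 < a" "a \<le> b"
    and f: "\<And>x. x \<in> {a..b} \<Longrightarrow> (f has_field_derivative f' x) (at x)" "continuous_on {a..b} f'"
  shows "iint a b (\<lambda>x. f' x *\<^sub>R u x) = f b *\<^sub>R u b - f a *\<^sub>R u a - iint a b (\<lambda>x. f x *\<^sub>R v x)"
proof -
  have iv: "integrable leb_pos (\<lambda>y. indicator {a..b} y *\<^sub>R v y)"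
    by (rule loc_intD(2)[OF acD(1)[OF u] ab(1)])
  have if': "integrable leb_pos (\<lambda>y. indicator {a..b} y *\<^sub>R f' y)"
    by (rule integrable_leb_pos_cont[OF ab(1) f(2)])
  have cf: "continuous_on {a..b} f"
    using f(1) by (intro continuous_at_imp_continuous_on ballI) (blast intro: DERIV_isCont)
  have ifv: "integrable leb_pos (\<lambda>y. indicator {a..b} y *\<^sub>R f y *\<^sub>R v y)"
    by (rule integrable_cont_mult[OF ab(1) iv cf])
  note [measurable] = borel_measurable_integrable[OF iv] borel_measurable_integrable[OF if']
  define k where "k x s = (if s \<le> x then (indicator {a..b} x *\<^sub>R f' x) *\<^sub>R (indicator {a..b} s *\<^sub>R v s) else 0)" for x s
  have k: "integrable (leb_pos \<Otimes>\<^sub>M leb_pos) (case_prod k)"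
  proof (rule Bochner_Integration.integrable_bound[OF integrable_pair_prod[OF if' iv]])
    show "case_prod k \<in> borel_measurable (leb_pos \<Otimes>\<^sub>M leb_pos)" unfolding k_def by measurable
  qed (auto simp: k_def)
  have k1: "(LINT s|leb_pos. k x s) = indicator {a..b} x *\<^sub>R f' x *\<^sub>R (u x - u a)" for x
  proof (cases "x \<in> {a..b}")
    case True
    have "(LINT s|leb_pos. k x s) = (LINT s|leb_pos. f' x *\<^sub>R (indicator {a..x} s *\<^sub>R v s))"
      by (rule Bochner_Integration.integral_cong) (use True in \<open>auto simp: k_def indicator_def\<close>)
    also have "\<dots> = f' x *\<^sub>R iint a x v" by (rule integral_scaleR_right)
    finally show ?thesis using True acD(2)[OF u, of a x] ab by simp
  next
    case False
    then have "k x = (\<lambda>s. 0)" by (auto simp: k_def)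
    then show ?thesis using False by simp
  qed
  have k2: "(LINT x|leb_pos. k x s) = indicator {a..b} s *\<^sub>R (f b - f s) *\<^sub>R v s" for s
  proof (cases "s \<in> {a..b}")
    case True
    have "(LINT x|leb_pos. k x s) = (LINT x|leb_pos. (indicator {s..b} x *\<^sub>R f' x) *\<^sub>R v s)"
      by (rule Bochner_Integration.integral_cong) (use True in \<open>auto simp: k_def indicator_def\<close>)
    also have "\<dots> = iint s b f' *\<^sub>R v s"
    proof (rule integral_scaleR_left)
      show "integrable leb_pos (\<lambda>x. indicator {s..b} x *\<^sub>R f' x)"
        using True ab by (intro integrable_leb_pos_cont continuous_on_subset[OF f(2)]) auto
    qed
    also have "iint s b f' = f b - f s"
      using True ab by (intro iint_FTC continuous_on_subset[OF f(2)] f(1)) auto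
    finally show ?thesis using True by simp
  next
    case False
    then have "(\<lambda>x. k x s) = (\<lambda>x. 0)" by (auto simp: k_def)
    then show ?thesis using False by simp
  qed
  have "(LINT x|leb_pos. indicator {a..b} x *\<^sub>R f' x *\<^sub>R (u x - u a)) = (LINT s|leb_pos. indicator {a..b} s *\<^sub>R (f b - f s) *\<^sub>R v s)"
    using leb_pos2.Fubini_integral[OF k] by (simp only: k1 k2)
  also have "\<dots> = (LINT s|leb_pos. f b *\<^sub>R (indicator {a..b} s *\<^sub>R v s) - indicator {a..b} s *\<^sub>R f s *\<^sub>R v s)"
    by (rule Bochner_Integration.integral_cong) (auto simp: indicator_def scaleR_diff_left)
  also have "\<dots> = f b *\<^sub>R iint a b v - iint a b (\<lambda>x. f x *\<^sub>R v x)"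
    by (subst Bochner_Integration.integral_diff[OF integrable_scaleR_right[OF iv] ifv]) (simp only: integral_scaleR_right)
  finally have 1: "(LINT x|leb_pos. indicator {a..b} x *\<^sub>R f' x *\<^sub>R (u x - u a)) = f b *\<^sub>R iint a b v - iint a b (\<lambda>x. f x *\<^sub>R v x)" .
  have if'u: "integrable leb_pos (\<lambda>y. indicator {a..b} y *\<^sub>R f' y *\<^sub>R u y)"
    by (rule integrable_cont_mult[OF ab(1) loc_intD(2)[OF ac_loc_int[OF u] ab(1)] f(2)])
  have "(LINT x|leb_pos. indicator {a..b} x *\<^sub>R f' x *\<^sub>R (u x - u a)) = (LINT x|leb_pos. indicator {a..b} x *\<^sub>R f' x *\<^sub>R u x - (indicator {a..b} x *\<^sub>R f' x) *\<^sub>R u a)"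
    by (rule Bochner_Integration.integral_cong) (auto simp: indicator_def scaleR_diff_right)
  also have "\<dots> = iint a b (\<lambda>x. f' x *\<^sub>R u x) - (LINT x|leb_pos. (indicator {a..b} x *\<^sub>R f' x) *\<^sub>R u a)"
    by (rule Bochner_Integration.integral_diff[OF if'u integrable_scaleR_left[OF if']])
  also have "(LINT x|leb_pos. (indicator {a..b} x *\<^sub>R f' x) *\<^sub>R u a) = iint a b f' *\<^sub>R u a"
    by (rule integral_scaleR_left[OF if'])
  also have "iint a b f' = f b - f a" by (rule iint_FTC[OF ab f])
  finally have 2: "iint a b (\<lambda>x. f' x *\<^sub>R u x) = (LINT x|leb_pos. indicator {a..b} x *\<^sub>R f' x *\<^sub>R (u x - u a)) + (f b - f a) *\<^sub>R u a"
    by (simp only: diff_add_cancel)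
  have 3: "f b *\<^sub>R (p - q) - R + (f b - f a) *\<^sub>R q = f b *\<^sub>R p - f a *\<^sub>R q - R" for p q R :: complex
    by (simp add: algebra_simps)
  show ?thesis unfolding 2 1 acD(2)[OF u ab, symmetric] 3 ..
qed

text \<open>The product rule is integration by parts read as a formula for the increments of f
  u.\<close>

lemma ac_mult:
  assumes u: "ac u v" and f: "\<And>x. x > 0 \<Longrightarrow> (f has_field_derivative f' x) (at x)" "continuous_on {0<..} f'"
  shows "ac (\<lambda>x. f x *\<^sub>R u x) (\<lambda>x. f' x *\<^sub>R u x + f x *\<^sub>R v x)"
proof -
  have cf: "continuous_on {0<..} f"
    using f(1) by (intro continuous_at_imp_continuous_on ballI) (auto intro: DERIV_isCont)
  have l: "loc_int (\<lambda>x. f' x *\<^sub>R u x)" "loc_int (\<lambda>x. f x *\<^sub>R v x)"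
    by (intro loc_int_cont_mult f cf ac_loc_int[OF u] acD(1)[OF u])+
  have "f b *\<^sub>R u b - f a *\<^sub>R u a = iint a b (\<lambda>x. f' x *\<^sub>R u x + f x *\<^sub>R v x)" if ab: "0 < a" "a \<le> b" for a b
  proof -
    have "iint a b (\<lambda>x. f' x *\<^sub>R u x + f x *\<^sub>R v x) = iint a b (\<lambda>x. f' x *\<^sub>R u x) + iint a b (\<lambda>x. f x *\<^sub>R v x)"
      unfolding scaleR_add_right
      by (rule Bochner_Integration.integral_add[OF loc_intD(2)[OF l(1) ab(1)] loc_intD(2)[OF l(2) ab(1)]])
    moreover have "continuous_on {a..b} f'"
      by (rule continuous_on_subset[OF f(2)]) (use ab in auto)
    then have "iint a b (\<lambda>x. f' x *\<^sub>R u x) = f b *\<^sub>R u b - f a *\<^sub>R u a - iint a b (\<lambda>x. f x *\<^sub>R v x)"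
      by (intro ac_by_parts[OF u ab]) (use f ab in auto)
    ultimately show ?thesis by (simp only: diff_add_cancel)
  qed
  then show ?thesis using loc_int_add[OF l] by (auto simp: ac_def)
qed

section \<open>Weak derivatives and absolutely continuous representatives\<close>

lemma LINT_supp:
  fixes f :: "real \<Rightarrow> real" and g :: "real \<Rightarrow> complex"
  assumes "\<And>x. x \<notin> {a..b} \<Longrightarrow> f x = 0"
  shows "(LINT x|leb_pos. f x *\<^sub>R g x) = iint a b (\<lambda>x. f x *\<^sub>R g x)"
  by (rule Bochner_Integration.integral_cong) (use assms in \<open>auto simp: indicator_def\<close>)

lemma ac_weak:
  assumes u: "ac u v" and ab: "0 < a" "a < b"
    and f: "\<And>x. x > 0 \<Longrightarrow> (f has_field_derivative f' x) (at x)" "continuous_on {0<..} f'"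
    and supp: "\<And>x. x \<notin> {a..b} \<Longrightarrow> f x = 0" "\<And>x. x \<notin> {a..b} \<Longrightarrow> f' x = 0"
  shows "(LINT x|leb_pos. f' x *\<^sub>R u x) = - (LINT x|leb_pos. f x *\<^sub>R v x)"
proof -
  \<comment> \<open>The support may reach a and b, so the interval is enlarged until f vanishes at
    both of its ends.\<close>
  have s: "f x = 0" "f' x = 0" if "x \<notin> {a/2..b+1}" for x using supp[of x] that ab by auto
  have "(LINT x|leb_pos. f' x *\<^sub>R u x) = iint (a/2) (b+1) (\<lambda>x. f' x *\<^sub>R u x)" by (rule LINT_supp[OF s(2)])
  also have "\<dots> = f (b+1) *\<^sub>R u (b+1) - f (a/2) *\<^sub>R u (a/2) - iint (a/2) (b+1) (\<lambda>x. f x *\<^sub>R v x)"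
    using ab f by (intro ac_by_parts[OF u]) (auto intro: continuous_on_subset)
  also have "f (b+1) *\<^sub>R u (b+1) - f (a/2) *\<^sub>R u (a/2) = 0" using ab by (simp add: supp)
  also have "iint (a/2) (b+1) (\<lambda>x. f x *\<^sub>R v x) = (LINT x|leb_pos. f x *\<^sub>R v x)" by (rule LINT_supp[OF s(1), symmetric])
  finally show ?thesis by simp
qed

lemma ac_has_weak_deriv:
  assumes u: "ac u v"
  shows "has_weak_deriv u v"
  unfolding has_weak_deriv_def Lp_loc_1_iff
proof (intro conjI allI impI ac_loc_int[OF u] acD(1)[OF u])
  fix \<phi> assume \<phi>: "test_function \<phi>"
  then obtain a b where "0 < a" "a < b" "\<forall>x. x \<notin> {a..b} \<longrightarrow> \<phi> x = 0" "\<forall>x. x \<notin> {a..b} \<longrightarrow> deriv \<phi> x = 0"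
    using test_functionD(4) by blast
  then show "(LINT y|leb_pos. deriv \<phi> y *\<^sub>R u y) = - (LINT y|leb_pos. \<phi> y *\<^sub>R v y)"
    using test_functionD[OF \<phi>] by (intro ac_weak[OF u, of a b]) (auto intro: continuous_at_imp_continuous_on)
qed

text \<open>The bump functions on (a, b) converge boundedly to the indicator, so all interval
  integrals of v vanish. Restricting the hypothesis to test functions in \<open>bump_alg\<close>
  matters for \<open>du_bois_reymond\<close>, where smoothness of a modified test function is
  inferred from \<open>bump_alg\<close>.\<close>

lemma weak_zero:
  assumes v: "loc_int v" and z: "\<And>\<phi>. test_function \<phi> \<Longrightarrow> bump_alg \<phi> \<Longrightarrow> (LINT y|leb_pos. \<phi> y *\<^sub>R v y) = (0::complex)"
  shows "AE y in leb_pos. v y = 0"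
proof (rule loc_int_AE_zero[OF v])
  fix a b :: real assume ab: "0 < a" "a < b"
  note [measurable] = loc_intD(1)[OF v]
  have bm [measurable]: "bump a b n \<in> borel_measurable leb_pos" for n
  proof (rule leb_pos_measurable_continuous, intro continuous_at_imp_continuous_on ballI)
    show "isCont (bump a b n) x" for x
      using bump_alg_deriv[OF bump_alg_bump, of a b n] DERIV_isCont by blast
  qed
  have "(\<lambda>n. LINT y|leb_pos. bump a b n y *\<^sub>R v y) \<longlonglongrightarrow> (LINT y|leb_pos. indicator {a<..<b} y *\<^sub>R v y)"
  proof (rule integral_dominated_convergence[where w = "\<lambda>y. norm (indicator {a..b} y *\<^sub>R v y)"])
    show "integrable leb_pos (\<lambda>y. norm (indicator {a..b} y *\<^sub>R v y))"
      by (intro integrable_norm loc_intD(2)[OF v] ab)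
    show "AE y in leb_pos. (\<lambda>n. bump a b n y *\<^sub>R v y) \<longlonglongrightarrow> indicator {a<..<b} y *\<^sub>R v y"
      by (intro AE_I2 tendsto_intros bump_tendsto)
    show "AE y in leb_pos. norm (bump a b n y *\<^sub>R v y) \<le> norm (indicator {a..b} y *\<^sub>R v y)" for n
    proof (intro AE_I2)
      fix y
      show "norm (bump a b n y *\<^sub>R v y) \<le> norm (indicator {a..b} y *\<^sub>R v y)"
      proof (cases "y \<in> {a<..<b}")
        case True
        then show ?thesis using bump_bounds[of a b n y] by (auto simp: indicator_def intro!: mult_left_le_one_le)
      qed (simp add: bump_eq_0)
    qed
  qed measurable
  moreover have "(LINT y|leb_pos. bump a b n y *\<^sub>R v y) = 0" for n
  proof (rule z[OF _ bump_alg_bump], rule test_functionI[OF bump_alg_bump ab(1)])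
    show "bump a b n x = 0" if "x \<notin> {a..b}" for x using that by (intro bump_eq_0) auto
  qed
  ultimately show "(LINT y|leb_pos. indicator {a<..<b} y *\<^sub>R v y) = 0"
    by (simp add: LIMSEQ_const_iff)
qed

lemma test_integrable:
  assumes "test_function \<phi>" "loc_int v"
  shows "integrable leb_pos (\<lambda>y. \<phi> y *\<^sub>R (v y::complex))" "integrable leb_pos (\<lambda>y. deriv \<phi> y *\<^sub>R v y)"
proof -
  obtain a b where ab: "0 < a" "\<forall>x. x \<notin> {a..b} \<longrightarrow> \<phi> x = 0" "\<forall>x. x \<notin> {a..b} \<longrightarrow> deriv \<phi> x = 0"
    using test_functionD(4)[OF assms(1)] by blast
  have c: "continuous_on {a..b} \<phi>" "continuous_on {a..b} (deriv \<phi>)"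
    using test_functionD(2,3)[OF assms(1)] by (auto intro: continuous_at_imp_continuous_on)
  have "(\<lambda>y. \<phi> y *\<^sub>R v y) = (\<lambda>y. indicator {a..b} y *\<^sub>R \<phi> y *\<^sub>R v y)"
    "(\<lambda>y. deriv \<phi> y *\<^sub>R v y) = (\<lambda>y. indicator {a..b} y *\<^sub>R deriv \<phi> y *\<^sub>R v y)"
    using ab by (auto simp: indicator_def fun_eq_iff)
  then show "integrable leb_pos (\<lambda>y. \<phi> y *\<^sub>R v y)" "integrable leb_pos (\<lambda>y. deriv \<phi> y *\<^sub>R v y)"
    using integrable_cont_mult[OF ab(1) loc_intD(2)[OF assms(2) ab(1)]] c by simp_all
qed

lemma has_weak_deriv_unique:
  assumes "has_weak_deriv u v" "has_weak_deriv u w"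
  shows "AE y in leb_pos. v y = w y"
proof -
  have l: "loc_int v" "loc_int w" using assms by (auto simp: has_weak_deriv_def Lp_loc_1_iff)
  have "AE y in leb_pos. v y - w y = 0"
  proof (rule weak_zero[OF loc_int_diff[OF l]])
    fix \<phi> assume "test_function \<phi>"
    then have "(LINT y|leb_pos. \<phi> y *\<^sub>R v y) = (LINT y|leb_pos. \<phi> y *\<^sub>R w y)"
      using assms by (simp add: has_weak_deriv_def)
    then show "(LINT y|leb_pos. \<phi> y *\<^sub>R (v y - w y)) = 0"
      using test_integrable(1)[OF \<open>test_function \<phi>\<close>] l by (simp add: scaleR_diff_right)
  qed
  then show ?thesis by simp
qed

lemma has_weak_deriv_cong_AE:
  assumes "has_weak_deriv u v" "AE y in leb_pos. u y = u' y" "AE y in leb_pos. v y = v' y"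
  shows "has_weak_deriv u' v'"
proof -
  have l: "loc_int u" "loc_int v" using assms by (auto simp: has_weak_deriv_def Lp_loc_1_iff)
  have l': "loc_int u'" "loc_int v'" using l assms loc_int_AE by blast+
  show ?thesis unfolding has_weak_deriv_def Lp_loc_1_iff
  proof (intro conjI allI impI l')
    fix \<phi> assume \<phi>: "test_function \<phi>"
    have "(LINT y|leb_pos. deriv \<phi> y *\<^sub>R u' y) = (LINT y|leb_pos. deriv \<phi> y *\<^sub>R u y)"
      using assms(2) borel_measurable_integrable[OF test_integrable(2)[OF \<phi> l(1)]] borel_measurable_integrable[OF test_integrable(2)[OF \<phi> l'(1)]]
      by (intro integral_cong_AE) auto
    moreover have "(LINT y|leb_pos. \<phi> y *\<^sub>R v' y) = (LINT y|leb_pos. \<phi> y *\<^sub>R v y)"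
      using assms(3) borel_measurable_integrable[OF test_integrable(1)[OF \<phi> l(2)]] borel_measurable_integrable[OF test_integrable(1)[OF \<phi> l'(2)]]
      by (intro integral_cong_AE) auto
    ultimately show "(LINT y|leb_pos. deriv \<phi> y *\<^sub>R u' y) = - (LINT y|leb_pos. \<phi> y *\<^sub>R v' y)"
      using assms(1) \<phi> by (simp add: has_weak_deriv_def)
  qed
qed

lemma Dy_eq:
  assumes "has_weak_deriv u v"
  shows "has_weak_deriv u (Dy u)" "AE y in leb_pos. Dy u y = v y"
proof -
  show *: "has_weak_deriv u (Dy u)" unfolding Dy_def by (rule someI[of "has_weak_deriv u", OF assms])
  show "AE y in leb_pos. Dy u y = v y" by (rule has_weak_deriv_unique[OF * assms])
qed

lemma integral_spike_set_supp:
  fixes f :: "real \<Rightarrow> real"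
  assumes "A \<le> a" "b \<le> B" "\<And>x. x \<notin> {a..b} \<Longrightarrow> f x = 0"
  shows "integral {A..B} f = integral {a..b} f"
proof -
  have "integral {A..B} f = integral {A..B} (\<lambda>x. if x \<in> {a..b} then f x else 0)"
    by (rule Henstock_Kurzweil_Integration.integral_cong) (use assms(3) in auto)
  also have "\<dots> = integral ({a..b} \<inter> {A..B}) f" by (rule Henstock_Kurzweil_Integration.integral_restrict_Int)
  also have "{a..b} \<inter> {A..B} = {a..b}" using assms by auto
  finally show ?thesis .
qed

text \<open>Subtracting from a test function \<theta> the right multiple of a fixed bump \<theta>0
  leaves a function of mean zero, hence the derivative of a test function. So the integral of
  \<theta> v is that of \<theta> times a constant C depending only on \<theta>0 and v.\<close>

lemma du_bois_reymond:
  fixes v :: "real \<Rightarrow> complex"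
  assumes v: "loc_int v" and z: "\<And>\<phi>. test_function \<phi> \<Longrightarrow> (LINT y|leb_pos. deriv \<phi> y *\<^sub>R v y) = 0"
  shows "\<exists>C. AE y in leb_pos. v y = C"
proof -
  define \<theta>0 where "\<theta>0 = bump 1 2 1"
  have b0: "bump_alg \<theta>0" unfolding \<theta>0_def by (rule bump_alg_bump)
  have s0: "\<theta>0 x = 0" if "x \<notin> {1..2}" for x unfolding \<theta>0_def using that by (intro bump_eq_0) auto
  have t0: "test_function \<theta>0" by (rule test_functionI[OF b0, of 1 2]) (auto intro: s0)
  define I0 where "I0 = integral {1..2} \<theta>0"
  \<comment> \<open>With mean zero, the nonnegative \<theta>0 would have a compactly supported
    primitive that is nondecreasing, hence zero.\<close>
  have "I0 \<noteq> 0"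
  proof
    assume "I0 = 0"
    then obtain \<phi> where \<phi>: "test_function \<phi>" "deriv \<phi> = \<theta>0"
      using test_function_antideriv[OF t0, of 1 2] s0 by (auto simp: I0_def)
    have "\<theta>0 x = 0" if x: "x \<in> {1<..<2}" for x
    proof (rule ccontr)
      assume "\<theta>0 x \<noteq> 0"
      obtain a b where ab: "0 < a" "a < b" "\<forall>x. x \<notin> {a..b} \<longrightarrow> \<phi> x = 0" using test_functionD(4)[OF \<phi>(1)] by blast
      have D: "(\<phi> has_field_derivative \<theta>0 y) (at y)" for y using test_functionD(1)[OF \<phi>(1)] \<phi>(2) by simp
      have nn: "\<theta>0 y \<ge> 0" for y unfolding \<theta>0_def by (rule bump_bounds)
      have mono: "\<phi> u \<le> \<phi> w" if "u \<le> w" for u w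
        by (rule DERIV_nonneg_imp_nondecreasing[OF that]) (use D nn in blast)
      have "\<phi> x = 0" for x
        using mono[of "min x (a - 1)" x] mono[of x "max x (b + 1)"] ab(3)[rule_format, of "min x (a - 1)"] ab(3)[rule_format, of "max x (b + 1)"] by auto
      then have "\<phi> = (\<lambda>x. 0)" by auto
      then have "\<theta>0 x = 0" using \<phi>(2) by auto
      then show False using \<open>\<theta>0 x \<noteq> 0\<close> by simp
    qed
    then show False using bump_pos[of "3/2" 1 2 1] by (auto simp: \<theta>0_def)
  qed
  define C where "C = (LINT y|leb_pos. \<theta>0 y *\<^sub>R v y) / of_real I0"
  have iv: "AE y in leb_pos. v y - C = 0"
  proof (rule weak_zero)
    have lC: "loc_int (\<lambda>y. C)" by (rule loc_int_cont) auto
    show "loc_int (\<lambda>y. v y - C)" by (rule loc_int_diff[OF v lC])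
    fix \<theta> assume \<theta>: "test_function \<theta>" "bump_alg \<theta>"
    obtain a b where ab: "0 < a" "a < b" "\<forall>x. x \<notin> {a..b} \<longrightarrow> \<theta> x = 0" using test_functionD(4)[OF \<theta>(1)] by blast
    define A B where "A = min a 1" and "B = max b 2"
    have AB: "0 < A" "A < B" "A \<le> 1" "2 \<le> B" "A \<le> a" "b \<le> B" using ab by (auto simp: A_def B_def)
    have sA: "\<theta> x = 0" "\<theta>0 x = 0" if "x \<notin> {A..B}" for x
    proof -
      have "x \<notin> {a..b}" "x \<notin> {1..2}" using that AB by auto
      then show "\<theta> x = 0" "\<theta>0 x = 0" using ab(3) s0 by blast+
    qed
    have c: "continuous_on S \<theta>" "continuous_on S \<theta>0" for S
      using test_functionD(2)[OF \<theta>(1)] test_functionD(2)[OF t0] by (auto intro: continuous_at_imp_continuous_on)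
    define J where "J = integral {A..B} \<theta>"
    have I0: "integral {A..B} \<theta>0 = I0"
      unfolding I0_def by (rule integral_spike_set_supp[OF AB(3,4) s0])
    define \<eta> where "\<eta> x = \<theta> x + (- J / I0) * \<theta>0 x" for x
    have b\<eta>: "bump_alg \<eta>" unfolding \<eta>_def[abs_def] by (intro bump_alg.add[OF \<theta>(2)] bump_alg.mult[OF bump_alg.const b0])
    have s\<eta>: "\<eta> x = 0" if "x \<notin> {A..B}" for x using sA[OF that] by (simp add: \<eta>_def)
    have t\<eta>: "test_function \<eta>" by (rule test_functionI[OF b\<eta> AB(1) s\<eta>])
    have c0: "(\<lambda>x. (- J / I0) * \<theta>0 x) integrable_on {A..B}" "\<theta> integrable_on {A..B}"
      by (intro integrable_continuous_real continuous_on_mult continuous_on_const c)+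
    have "integral {A..B} \<eta> = J + (- J / I0) * I0" unfolding \<eta>_def[abs_def]
      by (subst Henstock_Kurzweil_Integration.integral_add[OF c0(2,1)]) (simp only: integral_mult_right I0 J_def)
    then have "integral {A..B} \<eta> = 0" using \<open>I0 \<noteq> 0\<close> by simp
    then obtain \<phi> where \<phi>: "test_function \<phi>" "deriv \<phi> = \<eta>"
      using test_function_antideriv[OF t\<eta> AB(1) less_imp_le[OF AB(2)] s\<eta>] by blast
    have i: "integrable leb_pos (\<lambda>y. \<theta> y *\<^sub>R v y)" "integrable leb_pos (\<lambda>y. \<theta>0 y *\<^sub>R v y)" "integrable leb_pos (\<lambda>y. \<theta> y *\<^sub>R C)"
      by (rule test_integrable(1)[OF \<theta>(1) v] test_integrable(1)[OF t0 v] test_integrable(1)[OF \<theta>(1) lC])+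
    have "0 = (LINT y|leb_pos. \<theta> y *\<^sub>R v y + (- J / I0) *\<^sub>R (\<theta>0 y *\<^sub>R v y))"
    proof -
      have "\<eta> y *\<^sub>R v y = \<theta> y *\<^sub>R v y + (- J / I0) *\<^sub>R (\<theta>0 y *\<^sub>R v y)" for y
        unfolding \<eta>_def by (simp only: scaleR_add_left scaleR_scaleR)
      then show ?thesis using z[OF \<phi>(1)] unfolding \<phi>(2) by simp
    qed
    also have "\<dots> = (LINT y|leb_pos. \<theta> y *\<^sub>R v y) + (- J / I0) *\<^sub>R (LINT y|leb_pos. \<theta>0 y *\<^sub>R v y)"
      by (subst Bochner_Integration.integral_add[OF i(1) integrable_scaleR_right[OF i(2)]]) (simp only: integral_scaleR_right)
    also have "(- J / I0) *\<^sub>R (LINT y|leb_pos. \<theta>0 y *\<^sub>R v y) = - (J *\<^sub>R C)"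
      by (simp add: C_def scaleR_conv_of_real)
    finally have 1: "(LINT y|leb_pos. \<theta> y *\<^sub>R v y) = J *\<^sub>R C" by simp
    have "(LINT y|leb_pos. \<theta> y *\<^sub>R C) = iint A B (\<lambda>y. \<theta> y *\<^sub>R C)" by (rule LINT_supp[OF sA(1)])
    also have "\<dots> = (LINT y|leb_pos. (indicator {A..B} y *\<^sub>R \<theta> y) *\<^sub>R C)" by simp
    also have "\<dots> = iint A B \<theta> *\<^sub>R C"
      by (rule integral_scaleR_left[OF integrable_leb_pos_cont[OF AB(1) c(1)]])
    also have "iint A B \<theta> = J" unfolding J_def
      by (rule iint_eq_integral(2)[OF AB(1) integrable_leb_pos_cont[OF AB(1) c(1)]])
    finally show "(LINT y|leb_pos. \<theta> y *\<^sub>R (v y - C)) = 0"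
      using 1 by (simp only: scaleR_diff_right Bochner_Integration.integral_diff[OF i(1) i(3)]) simp
  qed
  then show ?thesis by (intro exI[of _ C]) simp
qed

lemma iint_degenerate:
  fixes v :: "real \<Rightarrow> 'a::euclidean_space"
  assumes "b \<le> a"
  shows "iint a b v = 0"
proof (cases "a = b")
  case True
  have "AE s in leb_pos. indicator {a..b} s *\<^sub>R v s = 0"
    using AE_leb_pos_neq[of a] by eventually_elim (use True in simp)
  then show ?thesis by (rule integral_eq_zero_AE)
qed (use assms in simp)

lemma ac_exists:
  assumes v: "loc_int v"
  shows "\<exists>w. ac w v"
proof -
  \<comment> \<open>Primitive with base point 1. Since \<open>iint\<close> vanishes on reversed
    intervals, one of the two terms is 0 and the formula covers both sides of 1.\<close>
  define w where "w y = iint 1 y v - iint y 1 v" for y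
  have i: "integrable leb_pos (\<lambda>y. indicator {a..b} y *\<^sub>R v y)" if "0 < a" for a b
    using v that by (rule loc_intD)
  have "w b - w a = iint a b v" if ab: "0 < a" "a \<le> b" for a b
  proof -
    consider "1 \<le> a" | "b \<le> 1" | "a < 1" "1 < b" by linarith
    then show ?thesis
    proof cases
      case 1
      then show ?thesis using iint_combine[of 1 a b v] ab i by (simp add: w_def iint_degenerate)
    next
      case 2
      then show ?thesis using iint_combine[of a b 1 v] ab i by (simp add: w_def iint_degenerate)
    next
      case 3
      then show ?thesis using iint_combine[of a 1 b v] ab i by (simp add: w_def iint_degenerate)
    qed
  qed
  then show ?thesis using v by (auto simp: ac_def)
qed

lemma ac_add_const: "ac u v \<Longrightarrow> ac (\<lambda>y. u y + C) v"
  by (simp add: ac_def)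

lemma ac_unique:
  assumes "ac u v" "ac w v" "x > 0" "y > 0"
  shows "u x - w x = u y - w y"
proof -
  have "u x - w x = u y - w y" if "0 < x" "x \<le> y" for x y
    using acD(2)[OF assms(1) that] acD(2)[OF assms(2) that] by (simp add: algebra_simps)
  from this[of x y] this[of y x, symmetric] show ?thesis using assms(3,4) linear[of x y] by blast
qed

text \<open>Any primitive w of v has the same weak derivative as u, so u - w is almost everywhere
  constant by \<open>du_bois_reymond\<close>; the constant is absorbed into w.\<close>

lemma weak_deriv_imp_ac:
  assumes "has_weak_deriv u v"
  shows "\<exists>w. ac w v \<and> (AE y in leb_pos. u y = w y)"
proof -
  have l: "loc_int u" "loc_int v" using assms by (auto simp: has_weak_deriv_def Lp_loc_1_iff)
  obtain w where w: "ac w v" using ac_exists[OF l(2)] by blast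
  have lw: "loc_int w" by (rule ac_loc_int[OF w])
  have "\<exists>C. AE y in leb_pos. u y - w y = C"
  proof (rule du_bois_reymond[OF loc_int_diff[OF l(1) lw]])
    fix \<phi> assume \<phi>: "test_function \<phi>"
    have "(LINT y|leb_pos. deriv \<phi> y *\<^sub>R u y) = (LINT y|leb_pos. deriv \<phi> y *\<^sub>R w y)"
      using assms ac_has_weak_deriv[OF w] \<phi> by (simp add: has_weak_deriv_def)
    then show "(LINT y|leb_pos. deriv \<phi> y *\<^sub>R (u y - w y)) = 0"
      using test_integrable(2)[OF \<phi> l(1)] test_integrable(2)[OF \<phi> lw] by (simp add: scaleR_diff_right)
  qed
  then obtain C where "AE y in leb_pos. u y - w y = C" by blast
  then have "AE y in leb_pos. u y = w y + C" by eventually_elim (simp add: algebra_simps)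
  then show ?thesis using ac_add_const[OF w, of C] by blast
qed

section \<open>The Bessel heat kernel\<close>

text \<open>\<open>I\<^sub>\<nu>(x) = (x/2)\<^sup>\<nu> F\<^sub>\<nu>\<^sub>+\<^sub>1(x\<^sup>2/4)\<close>.\<close>

definition FF :: "real \<Rightarrow> real \<Rightarrow> real" where
  "FF a z = (\<Sum>k. z ^ k / (fact k * Gamma (a + real k)))"

lemma Gamma_shift_pos: "a > 0 \<Longrightarrow> Gamma (a + real k) > 0"
  by (rule Gamma_real_pos) simp

lemma Gamma_shift_Suc: "a > 0 \<Longrightarrow> Gamma (a + real (Suc k)) = (a + real k) * Gamma (a + real k)"
  using Gamma_plus1[of "a + real k"] nonpos_Ints_nonpos[of "a + real k"] by (auto simp: add_ac)

lemma summable_power_div_Gamma: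
  fixes X a :: real
  assumes a: "a > 0"
  shows "summable (\<lambda>k. X ^ k / Gamma (a + real k))"
proof -
  obtain N where N: "2 * \<bar>X\<bar> \<le> real N" using real_arch_simple by blast
  show ?thesis
  proof (rule summable_ratio_test[of "1/2" N])
    fix n assume "N \<le> n"
    then have "2 * \<bar>X\<bar> \<le> a + real n" using N a by linarith
    then have "\<bar>X\<bar> / (a + real n) \<le> 1 / 2" using a by (simp add: field_simps)
    then have "\<bar>X\<bar> / (a + real n) * norm (X ^ n / Gamma (a + real n)) \<le> 1 / 2 * norm (X ^ n / Gamma (a + real n))"
      by (rule mult_right_mono) simp
    moreover have "norm (X ^ Suc n / Gamma (a + real (Suc n))) = \<bar>X\<bar> / (a + real n) * norm (X ^ n / Gamma (a + real n))"
      unfolding Gamma_shift_Suc[OF a] using a by (simp add: norm_divide abs_mult)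
    ultimately show "norm (X ^ Suc n / Gamma (a + real (Suc n))) \<le> 1 / 2 * norm (X ^ n / Gamma (a + real n))"
      by simp
  qed simp
qed

lemma power_div_Gamma_bounded:
  assumes "a > (0::real)"
  shows "\<exists>C>0. \<forall>k. X ^ k / Gamma (a + real k) \<le> C"
proof -
  have "Bseq (\<lambda>k. X ^ k / Gamma (a + real k))"
    using summable_LIMSEQ_zero[OF summable_power_div_Gamma[OF assms]] by (intro convergent_imp_Bseq convergentI)
  then obtain K where "K > 0" "\<forall>k. norm (X ^ k / Gamma (a + real k)) \<le> K" by (auto elim: BseqE)
  then show ?thesis by (metis abs_ge_self order_trans real_norm_def)
qed

lemma summable_FF:
  assumes a: "a > 0"
  shows "summable (\<lambda>k. z ^ k / (fact k * Gamma (a + real k)))"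
proof (rule summable_comparison_test[OF _ summable_power_div_Gamma[OF a, of "\<bar>z\<bar>"]])
  have "norm (z ^ k / (fact k * Gamma (a + real k))) \<le> \<bar>z\<bar> ^ k / Gamma (a + real k)" for k
  proof -
    have "Gamma (a + real k) \<le> fact k * Gamma (a + real k)"
      using Gamma_shift_pos[OF a, of k] fact_ge_1[of k] by simp
    then show ?thesis
      using Gamma_shift_pos[OF a, of k] by (auto simp: norm_divide power_abs abs_mult intro!: divide_left_mono)
  qed
  then show "\<exists>N. \<forall>n\<ge>N. norm (z ^ n / (fact n * Gamma (a + real n))) \<le> \<bar>z\<bar> ^ n / Gamma (a + real n)" by blast
qed

lemma FF_nonneg: "a > 0 \<Longrightarrow> z \<ge> 0 \<Longrightarrow> FF a z \<ge> 0"
  unfolding FF_def by (rule suminf_nonneg[OF summable_FF]) (auto intro!: divide_nonneg_pos mult_pos_pos Gamma_shift_pos)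

text \<open>Termwise comparison with the exponential series, as X^k / Gamma(a+k) is bounded in k.
  Later z = y^2 \<rho>^2 / s^2 and w = \<rho>^2 / (2 s), so the growth of the Bessel factor costs
  half of the Gaussian exponent.\<close>

lemma FF_bound:
  assumes a: "a > 0"
  shows "\<exists>C>0. \<forall>w z. 0 \<le> z \<longrightarrow> z \<le> w * X \<longrightarrow> 0 \<le> w \<longrightarrow> FF a z \<le> C * exp w"
proof -
  obtain C where C: "C > 0" "\<And>k. X ^ k / Gamma (a + real k) \<le> C" using power_div_Gamma_bounded[OF a] by blast
  show ?thesis
  proof (intro exI[of _ C] conjI allI impI C(1))
    fix w z :: real assume z: "0 \<le> z" "z \<le> w * X" "0 \<le> w"
    have s: "(\<lambda>k. C * (w ^ k /\<^sub>R fact k)) sums (C * exp w)" by (intro sums_mult exp_converges)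
    have "FF a z \<le> (\<Sum>k. C * (w ^ k /\<^sub>R fact k))"
      unfolding FF_def
    proof (rule suminf_le[OF _ summable_FF[OF a] sums_summable[OF s]])
      fix k
      have "z ^ k / (fact k * Gamma (a + real k)) \<le> (w * X) ^ k / (fact k * Gamma (a + real k))"
        using z Gamma_shift_pos[OF a, of k] by (intro divide_right_mono power_mono) auto
      also have "\<dots> = w ^ k / fact k * (X ^ k / Gamma (a + real k))" by (simp add: power_mult_distrib)
      also have "\<dots> \<le> w ^ k / fact k * C" using z by (intro mult_left_mono C) auto
      finally show "z ^ k / (fact k * Gamma (a + real k)) \<le> C * (w ^ k /\<^sub>R fact k)"
        by (simp add: divide_inverse mult_ac)
    qed
    then show "FF a z \<le> C * exp w" using sums_unique[OF s] by simp
  qed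
qed

text \<open>Differentiating the series termwise shifts the index, which raises the parameter by
  1.\<close>

lemma FF_deriv:
  assumes a: "a > 0"
  shows "(FF a has_field_derivative FF (a + 1) z) (at z)"
proof -
  define c where "c k = 1 / (fact k * Gamma (a + real k))" for k
  have FFc: "FF a = (\<lambda>z. \<Sum>k. c k * z ^ k)" by (simp add: FF_def c_def fun_eq_iff)
  have "((\<lambda>z. \<Sum>k. c k * z ^ k) has_field_derivative (\<Sum>k. diffs c k * z ^ k)) (at z)"
    by (rule termdiffs_strong_converges_everywhere) (use summable_FF[OF a] in \<open>simp add: c_def\<close>)
  moreover have "diffs c k * z ^ k = z ^ k / (fact k * Gamma (a + 1 + real k))" for k
    by (simp add: diffs_def c_def add_ac)
  ultimately show ?thesis unfolding FFc by (simp add: FF_def)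
qed

text \<open>Bessel's equation in the variable z: since FF(a+1) and FF(a+2) are the first two
  derivatives of F = FF(a), this is z F'' + a F' = F. On coefficients it reads (k + a) /
  Gamma(a+1+k) = 1 / Gamma(a+k).\<close>

lemma FF_ode:
  assumes a: "a > 0"
  shows "z * FF (a + 2) z + a * FF (a + 1) z = FF a z"
proof -
  have s1: "(\<lambda>k. z * (z ^ k / (fact k * Gamma (a + 2 + real k)))) sums (z * FF (a + 2) z)"
    unfolding FF_def by (intro sums_mult summable_sums summable_FF) (use a in simp)
  \<comment> \<open>The terms of FF(a+1) weighted by k. The term with k = 0 vanishes, so shifting
    the index loses nothing and gives z FF(a+2).\<close>
  define f where "f k = real k * (z ^ k / (fact k * Gamma (a + 1 + real k)))" for k
  have "f (Suc k) = z * (z ^ k / (fact k * Gamma (a + 2 + real k)))" for k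
  proof -
    have "a + 1 + real (Suc k) = a + 2 + real k" by simp
    then have "f (Suc k) = real (Suc k) * (z ^ Suc k / (fact (Suc k) * Gamma (a + 2 + real k)))"
      by (simp only: f_def)
    then show ?thesis by (simp del: of_nat_Suc)
  qed
  then have "(\<lambda>k. f (Suc k)) sums (z * FF (a + 2) z)" using s1 by simp
  then have "f sums (z * FF (a + 2) z)" by (subst (asm) sums_Suc_iff) (simp add: f_def)
  then have "(\<lambda>k. real k * (z ^ k / (fact k * Gamma (a + 1 + real k)))) sums (z * FF (a + 2) z)"
    by (simp add: f_def[abs_def])
  moreover have "(\<lambda>k. a * (z ^ k / (fact k * Gamma (a + 1 + real k)))) sums (a * FF (a + 1) z)"
    unfolding FF_def by (intro sums_mult summable_sums summable_FF) (use a in simp)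
  ultimately have "(\<lambda>k. real k * (z ^ k / (fact k * Gamma (a + 1 + real k))) + a * (z ^ k / (fact k * Gamma (a + 1 + real k)))) sums (z * FF (a + 2) z + a * FF (a + 1) z)"
    by (rule sums_add)
  moreover have "real k * (z ^ k / (fact k * Gamma (a + 1 + real k))) + a * (z ^ k / (fact k * Gamma (a + 1 + real k))) = z ^ k / (fact k * Gamma (a + real k))" for k
  proof -
    have "Gamma (a + 1 + real k) = (a + real k) * Gamma (a + real k)"
      using Gamma_shift_Suc[OF a, of k] by (simp add: add_ac)
    moreover have "a + real k \<noteq> 0" using a by linarith
    moreover have X: "real k * X + a * X = (a + real k) * X" for X by (simp add: algebra_simps)
    ultimately show ?thesis unfolding X by simp
  qed
  ultimately have "(\<lambda>k. z ^ k / (fact k * Gamma (a + real k))) sums (z * FF (a + 2) z + a * FF (a + 1) z)" by simp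
  then show ?thesis unfolding FF_def by (simp add: sums_iff)
qed

lemma FF_measurable [measurable]: "a > 0 \<Longrightarrow> FF a \<in> borel_measurable borel"
  by (intro borel_measurable_continuous_onI continuous_at_imp_continuous_on ballI DERIV_isCont[OF FF_deriv])

text \<open>Throughout, \<open>\<tau> = 4t\<close> is the time variable.\<close>

definition heat :: "real \<Rightarrow> real \<Rightarrow> real \<Rightarrow> real \<Rightarrow> real" where
  "heat a \<tau> y \<rho> = \<tau> powr - a * exp (- (y\<^sup>2 + \<rho>\<^sup>2) / \<tau>) * FF a (y\<^sup>2 * \<rho>\<^sup>2 / \<tau>\<^sup>2)"

text \<open>\<open>heat\<close> is the symmetric kernel for integration against \<rho>^c d\<rho>;
  the weight is put into \<open>kern\<close>, as in the definition of the semigroup. The factor 2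
  appears when 1/(2t) is rewritten in \<tau> = 4t.\<close>

definition kern :: "real \<Rightarrow> real \<Rightarrow> real \<Rightarrow> real \<Rightarrow> real" where
  "kern c \<tau> y \<rho> = 2 * \<rho> powr c * heat ((c + 1) / 2) \<tau> y \<rho>"

lemma kernel_Bn_eq:
  assumes c: "c > -1" and t: "t > 0" and y: "y > 0" "\<rho> > 0"
  shows "kernel_Bn c (of_real t) y \<rho> = of_real (kern c (4 * t) y \<rho>)"
proof -
  define \<nu> where "\<nu> = (c - 1) / 2"
  define a where "a = (c + 1) / 2"
  define w where "w = y * \<rho> / (2 * t)"
  have a: "a > 0" "a = \<nu> + 1" using c by (auto simp: a_def \<nu>_def field_simps)
  have w: "w > 0" using t y by (simp add: w_def)
  have p: "(complex_of_real w / 2) powr of_real \<nu> = of_real ((w / 2) powr \<nu>)"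
    using w by (subst powr_of_real[symmetric]) auto
  have "(\<Sum>k. (complex_of_real w / 2) ^ (2 * k) / (fact k * Gamma (of_real \<nu> + of_nat k + 1)))
      = (\<Sum>k. of_real ((y\<^sup>2 * \<rho>\<^sup>2 / (4 * t)\<^sup>2) ^ k / (fact k * Gamma (a + real k))))"
  proof (rule suminf_cong)
    fix k
    have "complex_of_real \<nu> + of_nat k + 1 = of_real (a + real k)" by (simp add: a(2))
    then have G: "Gamma (complex_of_real \<nu> + of_nat k + 1) = of_real (Gamma (a + real k))"
      by (simp only: Gamma_complex_of_real)
    have "(complex_of_real w / 2) ^ (2 * k) = of_real (((w / 2)\<^sup>2) ^ k)"
      by (simp add: power_mult)
    also have "(w / 2)\<^sup>2 = y\<^sup>2 * \<rho>\<^sup>2 / (4 * t)\<^sup>2" by (simp add: w_def power_divide power_mult_distrib)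
    finally show "(complex_of_real w / 2) ^ (2 * k) / (fact k * Gamma (of_real \<nu> + of_nat k + 1))
      = of_real ((y\<^sup>2 * \<rho>\<^sup>2 / (4 * t)\<^sup>2) ^ k / (fact k * Gamma (a + real k)))"
      unfolding G by simp
  qed
  also have "\<dots> = of_real (FF a (y\<^sup>2 * \<rho>\<^sup>2 / (4 * t)\<^sup>2))"
    unfolding FF_def by (rule suminf_of_real[OF summable_FF[OF a(1)], symmetric])
  finally have b: "bessel_I \<nu> (of_real w) = of_real ((w / 2) powr \<nu> * FF a (y\<^sup>2 * \<rho>\<^sup>2 / (4 * t)\<^sup>2))"
    unfolding bessel_I_def p by simp
  have w': "complex_of_real (y * \<rho>) / (2 * complex_of_real t) = of_real w" by (simp add: w_def)
  have e: "exp (- complex_of_real (y\<^sup>2 + \<rho>\<^sup>2) / (4 * complex_of_real t)) = of_real (exp (- (y\<^sup>2 + \<rho>\<^sup>2) / (4 * t)))"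
  proof -
    have "- complex_of_real (y\<^sup>2 + \<rho>\<^sup>2) / (4 * complex_of_real t) = of_real (- (y\<^sup>2 + \<rho>\<^sup>2) / (4 * t))" by simp
    then show ?thesis by (simp only: exp_of_real)
  qed
  \<comment> \<open>The exponents (1 - c)/2 and \<nu> cancel, so y \<rho> drops out and only a power
    of 4t remains.\<close>
  have "1 / (2 * t) * (y * \<rho>) powr ((1 - c) / 2) * (w / 2) powr \<nu> = 2 * (4 * t) powr - a"
  proof -
    have "(w / 2) powr \<nu> = (y * \<rho>) powr \<nu> / (4 * t) powr \<nu>"
      using y t by (simp add: w_def powr_divide[symmetric])
    moreover have "(y * \<rho>) powr ((1 - c) / 2) * (y * \<rho>) powr \<nu> = 1"
      using y by (simp add: powr_add[symmetric] \<nu>_def field_simps)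
    moreover have "(4 * t) powr - a = 1 / (4 * t) * (1 / (4 * t) powr \<nu>)"
      using t by (simp add: a(2) powr_diff powr_minus_divide field_simps)
    moreover have "1 / (2 * t) * (y * \<rho>) powr ((1 - c) / 2) * ((y * \<rho>) powr \<nu> / (4 * t) powr \<nu>)
       = 1 / (2 * t) * ((y * \<rho>) powr ((1 - c) / 2) * (y * \<rho>) powr \<nu>) / (4 * t) powr \<nu>" by simp
    ultimately show ?thesis by simp
  qed
  note E = this
  have "kern c (4 * t) y \<rho> = (2 * (4 * t) powr - a) * (\<rho> powr c * exp (- (y\<^sup>2 + \<rho>\<^sup>2) / (4 * t)) * FF a (y\<^sup>2 * \<rho>\<^sup>2 / (4 * t)\<^sup>2))"
    by (simp add: kern_def heat_def a_def[symmetric])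
  then have "kern c (4 * t) y \<rho> = 1 / (2 * t) * \<rho> powr c * (y * \<rho>) powr ((1 - c) / 2) * exp (- (y\<^sup>2 + \<rho>\<^sup>2) / (4 * t)) * ((w / 2) powr \<nu> * FF a (y\<^sup>2 * \<rho>\<^sup>2 / (4 * t)\<^sup>2))"
    unfolding E[symmetric] by (simp only: mult_ac)
  then show ?thesis
    unfolding kernel_Bn_def \<nu>_def[symmetric] w' b e by simp
qed

lemma heat_commute: "heat a \<tau> y \<rho> = heat a \<tau> \<rho> y"
  by (simp add: heat_def add.commute mult.commute)

lemma heat_nonneg: "a > 0 \<Longrightarrow> heat a \<tau> y \<rho> \<ge> 0"
  by (simp add: heat_def FF_nonneg)

lemma kern_nonneg: "c > -1 \<Longrightarrow> kern c \<tau> y \<rho> \<ge> 0"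
  by (simp add: kern_def heat_nonneg)

lemma kern_symm: "kern c \<tau> y \<rho> * y powr c = kern c \<tau> \<rho> y * \<rho> powr c"
  by (simp add: kern_def heat_commute[of _ _ y])

lemma kern_measurable [measurable (raw)]:
  assumes "c > -1" and [measurable]: "f \<in> borel_measurable M" "g \<in> borel_measurable M" "h \<in> borel_measurable M"
  shows "(\<lambda>x. kern c (f x) (g x) (h x)) \<in> borel_measurable M"
proof -
  have [measurable]: "FF ((c + 1) / 2) \<in> borel_measurable borel" using assms by (intro FF_measurable) simp
  show ?thesis unfolding kern_def heat_def by measurable
qed

section \<open>Moments of the kernel\<close>

lemma nn_integral_leb_pos_has_integral:
  fixes f :: "real \<Rightarrow> real"
  assumes "\<And>x. x > 0 \<Longrightarrow> f x \<ge> 0" "(f has_integral I) {0<..}"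
  shows "(\<integral>\<^sup>+x. ennreal (f x) \<partial>leb_pos) = ennreal I"
proof -
  have "(\<integral>\<^sup>+x. ennreal (f x) \<partial>leb_pos) = (\<integral>\<^sup>+x. ennreal (f x) * indicator {0<..} x \<partial>lborel)"
    by (subst nn_integral_restrict_space) (simp_all add: nn_integral_completion)
  also have "\<dots> = ennreal I"
    by (rule nn_integral_has_integral_lebesgue') (use assms in auto)
  finally show ?thesis .
qed

lemma nn_integral_leb_pos_has_integral_subset:
  fixes f :: "real \<Rightarrow> real"
  assumes "S \<subseteq> {0<..}" "\<And>x. x \<in> S \<Longrightarrow> f x \<ge> 0" "(f has_integral I) S"
  shows "(\<integral>\<^sup>+x. ennreal (indicator S x * f x) \<partial>leb_pos) = ennreal I"
proof (rule nn_integral_leb_pos_has_integral)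
  have "((\<lambda>x. if x \<in> S then f x else 0) has_integral I) {0<..}"
    using assms by (subst has_integral_restrict) auto
  then show "((\<lambda>x. indicator S x * f x) has_integral I) {0<..}"
    by (rule has_integral_eq[rotated]) (auto simp: indicator_def)
qed (use assms in \<open>auto simp: indicator_def\<close>)

lemma nn_integral_powr_below:
  assumes "s > -1" "y > 0"
  shows "(\<integral>\<^sup>+x. ennreal (indicator {0<..y} x * x powr s) \<partial>leb_pos) = ennreal (y powr (s + 1) / (s + 1))"
proof (rule nn_integral_leb_pos_has_integral_subset)
  show "((\<lambda>x. x powr s) has_integral y powr (s + 1) / (s + 1)) {0<..y}"
  proof (rule iffD1[OF has_integral_spike_set_eq has_integral_powr_from_0])
    show "negligible {x \<in> {0..y} - {0<..y}. x powr s \<noteq> 0}" "negligible {x \<in> {0<..y} - {0..y}. x powr s \<noteq> 0}"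
      by (rule negligible_subset[of "{0}"]; force)+
  qed (use assms in auto)
qed auto

lemma nn_integral_powr_above:
  assumes "s < -1" "y > 0"
  shows "(\<integral>\<^sup>+x. ennreal (indicator {y..} x * x powr s) \<partial>leb_pos) = ennreal (- (y powr (s + 1)) / (s + 1))"
  by (rule nn_integral_leb_pos_has_integral_subset[OF _ _ has_integral_powr_to_inf]) (use assms in auto)

lemma power2_powr: "x > 0 \<Longrightarrow> (x\<^sup>2) powr s = x powr (2 * s)" for x s :: real
  using powr_powr[of x 2 s] powr_numeral[of x "num.Bit0 num.One"] by simp

text \<open>The substitution r = \<rho>^2 / \<tau> in Euler's integral for Gamma(\<alpha>).\<close>

lemma nn_integral_gauss:
  assumes "\<alpha> > 0" "\<tau> > 0"
  shows "(\<integral>\<^sup>+\<rho>. ennreal (2 * \<rho> powr (2 * \<alpha> - 1) * exp (- \<rho>\<^sup>2 / \<tau>)) \<partial>leb_pos) = ennreal (\<tau> powr \<alpha> * Gamma \<alpha>)"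
proof -
  define f where "f r = r powr (\<alpha> - 1) / exp r" for r :: real
  define g where "g \<rho> = \<rho>\<^sup>2 / \<tau>" for \<rho>
  have "(f has_integral Gamma \<alpha>) {0<..}"
    unfolding f_def
  proof (rule iffD1[OF has_integral_spike_set_eq Gamma_integral_real[OF assms(1)]])
    show "negligible {x \<in> {0..} - {0<..}. x powr (\<alpha> - 1) / exp x \<noteq> 0}" "negligible {x \<in> {0<..} - {0..}. x powr (\<alpha> - 1) / exp x \<noteq> 0}"
      by (rule negligible_subset[of "{0}"]; force)+
  qed
  then have f: "f absolutely_integrable_on {0<..}" "integral {0<..} f = Gamma \<alpha>"
    by (auto intro!: nonnegative_absolutely_integrable_1 simp: f_def integral_unique)
  have img: "g ` {0<..} = {0<..}"
  proof (intro equalityI subsetI)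
    fix r :: real assume "r \<in> {0<..}"
    then have "r = g (sqrt (\<tau> * r))" "sqrt (\<tau> * r) \<in> {0<..}" using assms by (auto simp: g_def)
    then show "r \<in> g ` {0<..}" by blast
  qed (use assms in \<open>auto simp: g_def\<close>)
  have "(\<lambda>x. \<bar>2 * x / \<tau>\<bar> * f (g x)) absolutely_integrable_on {0<..} \<and> integral {0<..} (\<lambda>x. \<bar>2 * x / \<tau>\<bar> * f (g x)) = Gamma \<alpha>"
  proof (rule iffD2[OF has_absolute_integral_change_of_variables_1'[of "{0<..}" g "\<lambda>x. 2 * x / \<tau>" f "Gamma \<alpha>"]])
    show "inj_on g {0<..}" using assms by (auto simp: inj_on_def g_def)
    show "(g has_real_derivative 2 * x / \<tau>) (at x within {0<..})" for x
      unfolding g_def using assms by (auto intro!: derivative_eq_intros)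
  qed (use f img in auto)
  then have "((\<lambda>x. \<bar>2 * x / \<tau>\<bar> * f (g x)) has_integral Gamma \<alpha>) {0<..}"
    using absolutely_integrable_on_def integrable_integral by (metis (no_types, lifting))
  from has_integral_mult_right[OF this, of "\<tau> powr \<alpha>"]
  have "((\<lambda>\<rho>. 2 * \<rho> powr (2 * \<alpha> - 1) * exp (- \<rho>\<^sup>2 / \<tau>)) has_integral \<tau> powr \<alpha> * Gamma \<alpha>) {0<..}"
  proof (rule has_integral_eq[rotated])
    fix x :: real assume "x \<in> {0<..}"
    then have x: "x > 0" by simp
    have "(x\<^sup>2 / \<tau>) powr (\<alpha> - 1) = x powr (2 * \<alpha> - 2) / (\<tau> powr (\<alpha> - 1))"
      using x assms by (simp add: powr_divide power2_powr right_diff_distrib)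
    moreover have "x * x powr (2 * \<alpha> - 2) = x powr (2 * \<alpha> - 1)"
      using x powr_add[of x 1 "2 * \<alpha> - 2"] by simp
    moreover have "\<tau> powr \<alpha> = \<tau> * \<tau> powr (\<alpha> - 1)"
      using assms powr_add[of \<tau> 1 "\<alpha> - 1"] by simp
    moreover have "\<tau> powr (\<alpha> - 1) > 0" using assms by simp
    ultimately show "\<tau> powr \<alpha> * (\<bar>2 * x / \<tau>\<bar> * f (g x)) = 2 * x powr (2 * \<alpha> - 1) * exp (- x\<^sup>2 / \<tau>)"
      using x assms by (simp add: f_def g_def exp_minus field_simps)
  qed
  then show ?thesis by (intro nn_integral_leb_pos_has_integral) auto
qed

definition pois :: "real \<Rightarrow> nat \<Rightarrow> real" where
  "pois x k = exp (- x) * (x ^ k / fact k)"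

lemma pois_nonneg: "x \<ge> 0 \<Longrightarrow> pois x k \<ge> 0"
  by (simp add: pois_def)

lemma pois_sums: "pois x sums 1"
proof -
  have "(\<lambda>k. exp (- x) * (x ^ k /\<^sub>R fact k)) sums (exp (- x) * exp x)"
    by (intro sums_mult exp_converges)
  then show ?thesis by (simp add: pois_def[abs_def] exp_minus divide_inverse mult_ac)
qed

text \<open>Trades one factor k for a factor x. An index shift then gives the factorial moments of
  the Poisson law.\<close>

lemma pois_Suc: "real (Suc k) * pois x (Suc k) = x * pois x k"
  by (simp add: pois_def field_simps del: of_nat_Suc)

lemma pois_sums_1: "(\<lambda>k. real k * pois x k) sums x"
proof -
  have "(\<lambda>k. real (Suc k) * pois x (Suc k)) sums (x * 1)"
    unfolding pois_Suc by (intro sums_mult pois_sums)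
  then show ?thesis by (subst (asm) sums_Suc_iff) simp
qed

lemma pois_sums_2: "(\<lambda>k. real k * (real k - 1) * pois x k) sums x\<^sup>2"
proof -
  have "real (Suc k) * (real (Suc k) - 1) * pois x (Suc k) = x * (real k * pois x k)" for k
  proof -
    have "real (Suc k) * (real (Suc k) - 1) * pois x (Suc k) = (real (Suc k) * pois x (Suc k)) * real k" by simp
    then show ?thesis unfolding pois_Suc by simp
  qed
  then have "(\<lambda>k. real (Suc k) * (real (Suc k) - 1) * pois x (Suc k)) sums (x * x)"
    by (simp only:) (intro sums_mult pois_sums_1)
  then show ?thesis by (subst (asm) sums_Suc_iff) (simp add: power2_eq_square)
qed

text \<open>The kernel is a Poisson mixture of (square roots of) Gamma distributions.\<close>

lemma kern_moment:
  assumes c: "c > -1" and \<tau>: "\<tau> > 0" and y: "y > 0" and \<beta>: "(c + 1) / 2 + \<beta> > 0"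
  shows "(\<integral>\<^sup>+\<rho>. ennreal (kern c \<tau> y \<rho> * \<rho> powr (2 * \<beta>)) \<partial>leb_pos) =
     (\<Sum>k. ennreal (\<tau> powr \<beta> * (pois (y\<^sup>2 / \<tau>) k * (Gamma ((c + 1) / 2 + real k + \<beta>) / Gamma ((c + 1) / 2 + real k)))))"
proof -
  define a where "a = (c + 1) / 2"
  have a: "a > 0" "a + \<beta> > 0" using c \<beta> by (auto simp: a_def)
  define x where "x = y\<^sup>2 / \<tau>"
  have x: "x > 0" using \<tau> y by (simp add: x_def)
  \<comment> \<open>Chosen so that the k-th term of the series for the kernel moment is
    \<open>M k\<close> times the integrand of \<open>nn_integral_gauss\<close> with \<alpha> = a + k
    + \<beta>.\<close>
  define M where "M k = \<tau> powr - a * \<tau> powr - real k * pois x k / Gamma (a + real k)" for k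
  have M0: "M k \<ge> 0" for k
    unfolding M_def using \<tau> x pois_nonneg[of x k] Gamma_shift_pos[OF a(1), of k] by auto
  define T where "T k \<rho> = M k * (2 * \<rho> powr (2 * (a + real k + \<beta>) - 1) * exp (- \<rho>\<^sup>2 / \<tau>))" for k \<rho>
  have "ennreal (kern c \<tau> y \<rho> * \<rho> powr (2 * \<beta>)) = (\<Sum>k. ennreal (T k \<rho>))" if \<rho>: "\<rho> > 0" for \<rho>
  proof (rule suminf_ennreal_eq[symmetric])
    show "0 \<le> T k \<rho>" for k using M0 by (simp add: T_def)
    have "(\<lambda>k. 2 * \<rho> powr c * (\<tau> powr - a * exp (- (y\<^sup>2 + \<rho>\<^sup>2) / \<tau>)) * \<rho> powr (2 * \<beta>) * ((y\<^sup>2 * \<rho>\<^sup>2 / \<tau>\<^sup>2) ^ k / (fact k * Gamma (a + real k))))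
       sums (2 * \<rho> powr c * (\<tau> powr - a * exp (- (y\<^sup>2 + \<rho>\<^sup>2) / \<tau>)) * \<rho> powr (2 * \<beta>) * FF a (y\<^sup>2 * \<rho>\<^sup>2 / \<tau>\<^sup>2))"
      unfolding FF_def by (intro sums_mult summable_sums summable_FF a)
    also have "(\<lambda>k. 2 * \<rho> powr c * (\<tau> powr - a * exp (- (y\<^sup>2 + \<rho>\<^sup>2) / \<tau>)) * \<rho> powr (2 * \<beta>) * ((y\<^sup>2 * \<rho>\<^sup>2 / \<tau>\<^sup>2) ^ k / (fact k * Gamma (a + real k)))) = (\<lambda>k. T k \<rho>)"
    proof
      fix k
      have e: "exp (- (y\<^sup>2 + \<rho>\<^sup>2) / \<tau>) = exp (- x) * exp (- \<rho>\<^sup>2 / \<tau>)"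
        unfolding x_def by (simp add: exp_add[symmetric] add_divide_distrib diff_divide_distrib)
      have p: "(y\<^sup>2 * \<rho>\<^sup>2 / \<tau>\<^sup>2) ^ k = x ^ k * (\<rho> powr (2 * real k) * \<tau> powr - real k)"
      proof -
        have "\<rho> powr (2 * real k) = (\<rho>\<^sup>2) ^ k"
          using \<rho> powr_realpow[of \<rho> "2 * k"] by (simp add: power_mult)
        moreover have "\<tau> powr - real k = 1 / \<tau> ^ k" using \<tau> by (simp add: powr_minus_divide powr_realpow)
        ultimately show ?thesis by (simp add: x_def power_mult_distrib power_divide power2_eq_square)
      qed
      have q: "\<rho> powr (2 * (a + real k + \<beta>) - 1) = \<rho> powr c * \<rho> powr (2 * \<beta>) * \<rho> powr (2 * real k)"
        by (simp add: powr_add[symmetric] a_def algebra_simps add_divide_distrib)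
      show "2 * \<rho> powr c * (\<tau> powr - a * exp (- (y\<^sup>2 + \<rho>\<^sup>2) / \<tau>)) * \<rho> powr (2 * \<beta>) * ((y\<^sup>2 * \<rho>\<^sup>2 / \<tau>\<^sup>2) ^ k / (fact k * Gamma (a + real k))) = T k \<rho>"
        unfolding T_def M_def e p q pois_def by (simp add: mult_ac)
    qed
    finally show "(\<lambda>k. T k \<rho>) sums (kern c \<tau> y \<rho> * \<rho> powr (2 * \<beta>))"
      by (simp add: kern_def heat_def a_def[symmetric] mult_ac)
  qed
  then have "(\<integral>\<^sup>+\<rho>. ennreal (kern c \<tau> y \<rho> * \<rho> powr (2 * \<beta>)) \<partial>leb_pos) = (\<integral>\<^sup>+\<rho>. (\<Sum>k. ennreal (T k \<rho>)) \<partial>leb_pos)"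
    by (intro nn_integral_cong) auto
  also have "\<dots> = (\<Sum>k. (\<integral>\<^sup>+\<rho>. ennreal (T k \<rho>) \<partial>leb_pos))"
    by (rule nn_integral_suminf) (unfold T_def, measurable)
  also have "(\<lambda>k. (\<integral>\<^sup>+\<rho>. ennreal (T k \<rho>) \<partial>leb_pos)) = (\<lambda>k. ennreal (\<tau> powr \<beta> * (pois x k * (Gamma (a + real k + \<beta>) / Gamma (a + real k)))))"
  proof
    fix k
    have g: "a + real k + \<beta> > 0" using a by linarith
    have "(\<integral>\<^sup>+\<rho>. ennreal (T k \<rho>) \<partial>leb_pos) = ennreal (M k) * (\<integral>\<^sup>+\<rho>. ennreal (2 * \<rho> powr (2 * (a + real k + \<beta>) - 1) * exp (- \<rho>\<^sup>2 / \<tau>)) \<partial>leb_pos)"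
      unfolding T_def ennreal_mult'[OF M0] by (rule nn_integral_cmult) measurable
    also have "\<dots> = ennreal (M k * (\<tau> powr (a + real k + \<beta>) * Gamma (a + real k + \<beta>)))"
      unfolding nn_integral_gauss[OF g \<tau>] by (rule ennreal_mult'[OF M0, symmetric])
    also have "M k * (\<tau> powr (a + real k + \<beta>) * Gamma (a + real k + \<beta>)) = (\<tau> powr - a * \<tau> powr - real k * \<tau> powr (a + real k + \<beta>)) * (pois x k * (Gamma (a + real k + \<beta>) / Gamma (a + real k)))"
      by (simp add: M_def)
    also have "\<tau> powr - a * \<tau> powr - real k * \<tau> powr (a + real k + \<beta>) = \<tau> powr \<beta>"
      unfolding powr_add[symmetric] by simp
    finally show "(\<integral>\<^sup>+\<rho>. ennreal (T k \<rho>) \<partial>leb_pos) = ennreal (\<tau> powr \<beta> * (pois x k * (Gamma (a + real k + \<beta>) / Gamma (a + real k))))" .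
  qed
  finally show ?thesis by (simp only: a_def x_def)
qed

text \<open>Induction on k: with s = a + k, both sides change by explicit factors, and the step
  amounts to (1 - b/s) (s+1)^b \<le> s^b. This follows from 1 + x \<le> exp x at x = 1/s and at x =
  -b/s. The constant is chosen to give equality at k = 0.\<close>

lemma Gamma_ratio_bound:
  assumes a: "a > 0" and b: "0 \<le> b" "b < a"
  shows "Gamma (a + real k - b) / Gamma (a + real k) \<le> (Gamma (a - b) / Gamma a * a powr b) * (a + real k) powr - b"
proof (induction k)
  case 0
  show ?case using a by (simp add: powr_minus field_simps)
next
  case (Suc k)
  define s where "s = a + real k"
  have s: "s > 0" "s - b > 0" using a b by (auto simp: s_def)
  have 1: "Gamma (a + real (Suc k) - b) = (s - b) * Gamma (s - b)"
    using Gamma_shift_Suc[of "a - b" k] b by (simp add: s_def algebra_simps)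
  have 2: "Gamma (a + real (Suc k)) = s * Gamma s"
    using Gamma_shift_Suc[OF a, of k] by (simp add: s_def)
  have K: "Gamma (a - b) / Gamma a * a powr b \<ge> 0" using a b by (auto intro!: divide_nonneg_pos mult_nonneg_nonneg less_imp_le[OF Gamma_real_pos] Gamma_real_pos)
  have "(s + 1) powr b = s powr b * (1 + 1 / s) powr b"
    using s by (simp add: powr_mult[symmetric] distrib_left)
  also have "\<dots> \<le> s powr b * exp (1 / s) powr b"
    using s b by (intro mult_left_mono powr_mono2 exp_ge_add_one_self) auto
  also have "exp (1 / s) powr b = exp (b / s)" by (simp add: powr_def)
  finally have "exp (- (b / s)) * (s + 1) powr b \<le> s powr b"
    by (simp add: exp_minus field_simps)
  moreover have "(1 - b / s) * (s + 1) powr b \<le> exp (- (b / s)) * (s + 1) powr b"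
    using exp_ge_add_one_self[of "- (b / s)"] by (intro mult_right_mono) auto
  ultimately have "(1 - b / s) * (s + 1) powr b \<le> s powr b" by linarith
  then have 3: "(1 - b / s) * s powr - b \<le> (s + 1) powr - b"
    using s by (simp add: powr_minus field_simps)
  have "Gamma (a + real (Suc k) - b) / Gamma (a + real (Suc k)) = (1 - b / s) * (Gamma (s - b) / Gamma s)"
    unfolding 1 2 using s by (simp add: field_simps)
  also have "\<dots> \<le> (1 - b / s) * ((Gamma (a - b) / Gamma a * a powr b) * s powr - b)"
    using Suc s by (intro mult_left_mono) (auto simp: s_def)
  also have "\<dots> = (Gamma (a - b) / Gamma a * a powr b) * ((1 - b / s) * s powr - b)" by simp
  also have "\<dots> \<le> (Gamma (a - b) / Gamma a * a powr b) * (s + 1) powr - b"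
    by (intro mult_left_mono 3 K)
  finally show ?case by (simp add: s_def add_ac)
qed

text \<open>In terms of x = y^2/\<tau> and \<beta> = b/2 it suffices that the Poisson mean of
  (1+k)^(-\<beta>) is at most a constant times x^(-\<beta>), whatever x is; this makes the bound
  independent of \<tau>. With t = x/(1+k), t^\<beta> is replaced by 1 + t^n for an integer n, and
  t^n times the k-th Poisson weight is at most n! times the (k+n)-th one.\<close>

lemma kern_powr_bound:
  assumes c: "c > -1" and b: "0 \<le> b" "b < c + 1"
  shows "\<exists>C>0. \<forall>\<tau> y. \<tau> > 0 \<longrightarrow> y > 0 \<longrightarrow>
     (\<integral>\<^sup>+\<rho>. ennreal (kern c \<tau> y \<rho> * \<rho> powr - b) \<partial>leb_pos) \<le> ennreal (C * y powr - b)"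
proof -
  define a where "a = (c + 1) / 2"
  define \<beta> where "\<beta> = b / 2"
  have a: "a > 0" "0 \<le> \<beta>" "\<beta> < a" using c b by (auto simp: a_def \<beta>_def)
  obtain n where n: "\<beta> \<le> real n" using real_arch_simple by blast
  \<comment> \<open>Makes d (1 + k) \<le> a + k for all k.\<close>
  define d where "d = min a 1"
  have d: "d > 0" "d \<le> a" "d \<le> 1" using a by (auto simp: d_def)
  define K where "K = Gamma (a - \<beta>) / Gamma a * a powr \<beta> * d powr - \<beta>"
  have K: "K > 0" unfolding K_def using a d by (auto intro!: mult_pos_pos divide_pos_pos Gamma_real_pos)
  have R: "Gamma (a + real k - \<beta>) / Gamma (a + real k) \<le> K * (1 + real k) powr - \<beta>" for k
  proof -
    have "d * (1 + real k) \<le> a + real k"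
      using d by (simp add: distrib_left add_mono mult_left_le_one_le)
    then have "(a + real k) powr - \<beta> \<le> (d * (1 + real k)) powr - \<beta>"
      using d a by (intro powr_mono2') auto
    then have "(a + real k) powr - \<beta> \<le> d powr - \<beta> * (1 + real k) powr - \<beta>"
      using d by (simp add: powr_mult)
    moreover have "Gamma (a - \<beta>) / Gamma a * a powr \<beta> \<ge> 0"
      using a by (auto intro!: mult_nonneg_nonneg divide_nonneg_pos less_imp_le[OF Gamma_real_pos] Gamma_real_pos)
    ultimately have "(Gamma (a - \<beta>) / Gamma a * a powr \<beta>) * (a + real k) powr - \<beta> \<le> (Gamma (a - \<beta>) / Gamma a * a powr \<beta>) * (d powr - \<beta> * (1 + real k) powr - \<beta>)"
      by (rule mult_left_mono)
    then show ?thesis using Gamma_ratio_bound[OF a, of k] by (simp add: K_def mult_ac)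
  qed
  show ?thesis
  proof (intro exI[of _ "K * (1 + fact n)"] conjI allI impI)
    show "K * (1 + fact n) > 0" using K by (intro mult_pos_pos) (auto intro: add_pos_pos)
    fix \<tau> y :: real assume \<tau>: "\<tau> > 0" and y: "y > 0"
    define x where "x = y\<^sup>2 / \<tau>"
    have x: "x > 0" using \<tau> y by (simp add: x_def)
    define B where "B k = \<tau> powr - \<beta> * (K * x powr - \<beta> * (pois x k + fact n * pois x (k + n)))" for k
    have "summable (\<lambda>k. pois x (k + n))" "(\<Sum>k. pois x (k + n)) \<le> 1"
    proof -
      show s: "summable (\<lambda>k. pois x (k + n))" using pois_sums by (intro summable_ignore_initial_segment) (auto simp: sums_iff)
      have "(\<Sum>k. pois x (k + n)) + (\<Sum>k<n. pois x k) = 1"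
        using suminf_split_initial_segment[of "pois x" n] pois_sums[of x] by (auto simp: sums_iff)
      moreover have "(\<Sum>k<n. pois x k) \<ge> 0" using x by (intro sum_nonneg pois_nonneg) auto
      ultimately show "(\<Sum>k. pois x (k + n)) \<le> 1" by linarith
    qed
    then have Bs: "B sums (\<tau> powr - \<beta> * (K * x powr - \<beta> * (1 + fact n * (\<Sum>k. pois x (k + n)))))"
      unfolding B_def[abs_def] by (intro sums_mult sums_add pois_sums summable_sums)
    have "(\<integral>\<^sup>+\<rho>. ennreal (kern c \<tau> y \<rho> * \<rho> powr (2 * - \<beta>)) \<partial>leb_pos) =
       (\<Sum>k. ennreal (\<tau> powr - \<beta> * (pois x k * (Gamma (a + real k + - \<beta>) / Gamma (a + real k)))))"
      unfolding a_def x_def by (rule kern_moment[OF c \<tau> y]) (use a in \<open>simp add: a_def\<close>)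
    also have "\<dots> \<le> (\<Sum>k. ennreal (B k))"
    proof (intro suminf_le ennreal_leI)
      fix k
      define t where "t = x / (1 + real k)"
      have t: "t > 0" using x by (simp add: t_def)
      have "pois x k * (Gamma (a + real k + - \<beta>) / Gamma (a + real k)) \<le> pois x k * (K * (1 + real k) powr - \<beta>)"
        using R[of k] x by (intro mult_left_mono pois_nonneg) auto
      also have "(1 + real k) powr - \<beta> = x powr - \<beta> * t powr \<beta>"
        using x by (simp add: t_def powr_divide powr_minus field_simps)
      also have "pois x k * (K * (x powr - \<beta> * t powr \<beta>)) \<le> pois x k * (K * (x powr - \<beta> * (1 + t ^ n)))"
      proof (intro mult_left_mono)
        \<comment> \<open>The real exponent is traded for the integer n \<ge> \<beta>; the summand 1
          covers t \<le> 1.\<close>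
        show "t powr \<beta> \<le> 1 + t ^ n"
        proof (cases "t \<le> 1")
          case True
          then have "t powr \<beta> \<le> 1" using t a by (intro powr_le1) auto
          then show ?thesis using t by (smt (verit) zero_le_power)
        next
          case False
          then have "t powr \<beta> \<le> t powr real n" using n by (intro powr_mono) auto
          then show ?thesis using t by (simp add: powr_realpow)
        qed
      qed (use K x pois_nonneg in auto)
      also have "pois x k * (K * (x powr - \<beta> * (1 + t ^ n))) = K * x powr - \<beta> * (pois x k + pois x k * t ^ n)"
        by (simp add: algebra_simps)
      also have "\<dots> \<le> K * x powr - \<beta> * (pois x k + fact n * pois x (k + n))"
      proof (intro mult_left_mono add_left_mono)
        \<comment> \<open>Each factor k + j of (k+n)!/k! is at most j (1 + k).\<close>
        have fk: "fact (k + n) \<le> fact k * (fact n * (1 + real k) ^ n)"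
        proof (induction n)
          case (Suc n)
          have "fact (k + Suc n) = (real k + real n + 1) * fact (k + n)" by (simp add: algebra_simps)
          also have "\<dots> \<le> ((real n + 1) * (1 + real k)) * (fact k * (fact n * (1 + real k) ^ n))"
            using Suc by (intro mult_mono) (auto simp: algebra_simps)
          also have "\<dots> = fact k * (fact (Suc n) * (1 + real k) ^ Suc n)" by (simp add: algebra_simps)
          finally show ?case .
        qed simp
        have "pois x k * t ^ n = exp (- x) * (x ^ (k + n) / (fact k * (1 + real k) ^ n))"
          by (simp add: pois_def t_def power_divide power_add)
        also have "\<dots> \<le> exp (- x) * (x ^ (k + n) * (fact n / fact (k + n)))"
        proof (intro mult_left_mono)
          have "1 / (fact k * (1 + real k) ^ n) \<le> fact n / fact (k + n)"
            using fk by (simp add: field_simps)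
          then have "x ^ (k + n) * (1 / (fact k * (1 + real k) ^ n)) \<le> x ^ (k + n) * (fact n / fact (k + n))"
            using x by (intro mult_left_mono) auto
          then show "x ^ (k + n) / (fact k * (1 + real k) ^ n) \<le> x ^ (k + n) * (fact n / fact (k + n))" by simp
        qed simp
        also have "\<dots> = fact n * pois x (k + n)" by (simp add: pois_def)
        finally show "pois x k * t ^ n \<le> fact n * pois x (k + n)" .
      qed (use K in auto)
      finally show "\<tau> powr - \<beta> * (pois x k * (Gamma (a + real k + - \<beta>) / Gamma (a + real k))) \<le> B k"
        unfolding B_def by (intro mult_left_mono) auto
    qed auto
    also have "\<dots> = ennreal (\<tau> powr - \<beta> * (K * x powr - \<beta> * (1 + fact n * (\<Sum>k. pois x (k + n)))))"
      by (rule suminf_ennreal_eq[OF _ Bs]) (use K x in \<open>auto simp: B_def intro!: mult_nonneg_nonneg add_nonneg_nonneg pois_nonneg\<close>)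
    also have "\<dots> \<le> ennreal (\<tau> powr - \<beta> * (K * x powr - \<beta> * (1 + fact n * 1)))"
      using K \<open>(\<Sum>k. pois x (k + n)) \<le> 1\<close> by (intro ennreal_leI mult_left_mono add_left_mono) auto
    also have "\<tau> powr - \<beta> * (K * x powr - \<beta> * (1 + fact n * 1)) = K * (1 + fact n) * (\<tau> powr - \<beta> * x powr - \<beta>)" by simp
    also have "\<tau> powr - \<beta> * x powr - \<beta> = (y\<^sup>2) powr - \<beta>"
      unfolding x_def using \<tau> y by (simp add: powr_mult[symmetric])
    also have "(y\<^sup>2) powr - \<beta> = y powr - b"
      using y by (simp add: power2_powr \<beta>_def)
    finally show "(\<integral>\<^sup>+\<rho>. ennreal (kern c \<tau> y \<rho> * \<rho> powr - b) \<partial>leb_pos) \<le> ennreal (K * (1 + fact n) * y powr - b)"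
      by (simp add: \<beta>_def)
  qed
qed

text \<open>The zeroth moment: the Gamma factors cancel and the Poisson weights sum to 1.\<close>

lemma kern_total:
  assumes c: "c > -1" and \<tau>: "\<tau> > 0" and y: "y > 0"
  shows "(\<integral>\<^sup>+\<rho>. ennreal (kern c \<tau> y \<rho>) \<partial>leb_pos) = 1"
proof -
  have G: "Gamma ((c + 1) / 2 + real k) \<noteq> 0" for k using Gamma_shift_pos[of "(c + 1) / 2" k] c by simp
  have "(\<integral>\<^sup>+\<rho>. ennreal (kern c \<tau> y \<rho>) \<partial>leb_pos) = (\<integral>\<^sup>+\<rho>. ennreal (kern c \<tau> y \<rho> * \<rho> powr (2 * 0)) \<partial>leb_pos)"
    by (intro nn_integral_cong) auto
  also have "\<dots> = (\<Sum>k. ennreal (pois (y\<^sup>2 / \<tau>) k))"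
    by (subst kern_moment[OF c \<tau> y]) (use c \<tau> G in auto)
  also have "\<dots> = ennreal 1"
    by (rule suminf_ennreal_eq[OF _ pois_sums]) (use \<tau> in \<open>auto intro: pois_nonneg\<close>)
  finally show ?thesis by simp
qed

text \<open>The computation with \<open>\<rho>\<^sup>2\<close> in place of \<open>\<rho>\<close> keeps all moments polynomial.\<close>

lemma kern_second_moment:
  assumes c: "c > -1" and \<tau>: "\<tau> > 0" and y: "y > 0"
  shows "(\<integral>\<^sup>+\<rho>. ennreal (kern c \<tau> y \<rho> * (\<rho>\<^sup>2 - y\<^sup>2)\<^sup>2) \<partial>leb_pos) = ennreal (\<tau>\<^sup>2 * ((c + 1) / 2 * ((c + 1) / 2 + 1)) + 2 * y\<^sup>2 * \<tau>)"
proof -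
  define a where "a = (c + 1) / 2"
  define x where "x = y\<^sup>2 / \<tau>"
  have a: "a > 0" using c by (simp add: a_def)
  have x: "x > 0" "\<tau> * x = y\<^sup>2" using \<tau> y by (auto simp: x_def)
  have G: "Gamma (a + real k) > 0" for k by (rule Gamma_shift_pos[OF a])
  have [measurable]: "(\<lambda>\<rho>. kern c \<tau> y \<rho>) \<in> borel_measurable leb_pos"
    using c by (intro kern_measurable) auto
  have k0: "kern c \<tau> y \<rho> \<ge> 0" for \<rho> by (rule kern_nonneg[OF c])
  have m1: "(\<integral>\<^sup>+\<rho>. ennreal (kern c \<tau> y \<rho> * \<rho>\<^sup>2) \<partial>leb_pos) = ennreal (\<tau> * (a + x))"
  proof -
    have "(\<integral>\<^sup>+\<rho>. ennreal (kern c \<tau> y \<rho> * \<rho>\<^sup>2) \<partial>leb_pos) = (\<integral>\<^sup>+\<rho>. ennreal (kern c \<tau> y \<rho> * \<rho> powr (2 * 1)) \<partial>leb_pos)"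
      by (intro nn_integral_cong) (auto simp: powr_numeral)
    also have "\<dots> = (\<Sum>k. ennreal (\<tau> powr 1 * (pois x k * (Gamma (a + real k + 1) / Gamma (a + real k)))))"
      unfolding a_def x_def by (rule kern_moment[OF c \<tau> y]) (use c in \<open>simp add: field_simps\<close>)
    also have "\<dots> = (\<Sum>k. ennreal (\<tau> * (a * pois x k + real k * pois x k)))"
    proof (intro suminf_cong arg_cong[where f = ennreal])
      fix k
      have "Gamma (a + real k + 1) / Gamma (a + real k) = a + real k"
        using Gamma_shift_Suc[OF a, of k] G[of k] by (simp add: add_ac)
      then show "\<tau> powr 1 * (pois x k * (Gamma (a + real k + 1) / Gamma (a + real k))) = \<tau> * (a * pois x k + real k * pois x k)"
        using \<tau> by (simp add: algebra_simps)
    qed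
    also have "\<dots> = ennreal (\<tau> * (a * 1 + x))"
      by (rule suminf_ennreal_eq[OF _ sums_mult[OF sums_add[OF sums_mult[OF pois_sums] pois_sums_1]]])
         (use \<tau> x a in \<open>auto intro!: mult_nonneg_nonneg add_nonneg_nonneg pois_nonneg\<close>)
    finally show ?thesis by simp
  qed
  have m2: "(\<integral>\<^sup>+\<rho>. ennreal (kern c \<tau> y \<rho> * (\<rho>\<^sup>2)\<^sup>2) \<partial>leb_pos) = ennreal (\<tau>\<^sup>2 * (a * (a + 1) + (2 * (a + 1)) * x + x\<^sup>2))"
  proof -
    have "(\<integral>\<^sup>+\<rho>. ennreal (kern c \<tau> y \<rho> * (\<rho>\<^sup>2)\<^sup>2) \<partial>leb_pos) = (\<integral>\<^sup>+\<rho>. ennreal (kern c \<tau> y \<rho> * \<rho> powr (2 * 2)) \<partial>leb_pos)"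
      by (intro nn_integral_cong) (auto simp: powr_numeral)
    also have "\<dots> = (\<Sum>k. ennreal (\<tau> powr 2 * (pois x k * (Gamma (a + real k + 2) / Gamma (a + real k)))))"
      unfolding a_def x_def by (rule kern_moment[OF c \<tau> y]) (use c in \<open>simp add: field_simps\<close>)
    also have "\<dots> = (\<Sum>k. ennreal (\<tau>\<^sup>2 * ((a * (a + 1) * pois x k + (2 * (a + 1)) * (real k * pois x k)) + real k * (real k - 1) * pois x k)))"
    proof (intro suminf_cong arg_cong[where f = ennreal])
      fix k
      have "Gamma (a + real k + 2) / Gamma (a + real k) = (a + real k + 1) * (a + real k)"
        using Gamma_shift_Suc[OF a, of k] Gamma_shift_Suc[OF a, of "Suc k"] G[of k] by (simp add: add_ac)
      then show "\<tau> powr 2 * (pois x k * (Gamma (a + real k + 2) / Gamma (a + real k))) = \<tau>\<^sup>2 * ((a * (a + 1) * pois x k + (2 * (a + 1)) * (real k * pois x k)) + real k * (real k - 1) * pois x k)"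
        using \<tau> by (simp add: powr_numeral) (simp add: algebra_simps)
    qed
    also have "\<dots> = ennreal (\<tau>\<^sup>2 * ((a * (a + 1) * 1 + (2 * (a + 1)) * x) + x\<^sup>2))"
    proof (rule suminf_ennreal_eq[OF _ sums_mult[OF sums_add[OF sums_add[OF sums_mult[OF pois_sums] sums_mult[OF pois_sums_1]] pois_sums_2]]])
      fix k
      have "real k * (real k - 1) \<ge> 0" by (cases k) auto
      then show "0 \<le> \<tau>\<^sup>2 * ((a * (a + 1) * pois x k + (2 * (a + 1)) * (real k * pois x k)) + real k * (real k - 1) * pois x k)"
        using \<tau> x a pois_nonneg[of x k] by (intro mult_nonneg_nonneg[of "\<tau>\<^sup>2"] add_nonneg_nonneg mult_nonneg_nonneg[of "real k * (real k - 1)"]) auto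
    qed
    finally show ?thesis by simp
  qed
  \<comment> \<open>The square is expanded with its negative term moved to the left, because
    subtraction of extended nonnegative reals is truncated. The finite extra summand is cancelled at
    the end.\<close>
  have S: "(\<integral>\<^sup>+\<rho>. ennreal (kern c \<tau> y \<rho> * (\<rho>\<^sup>2 - y\<^sup>2)\<^sup>2) \<partial>leb_pos) + ennreal (2 * y\<^sup>2) * (\<integral>\<^sup>+\<rho>. ennreal (kern c \<tau> y \<rho> * \<rho>\<^sup>2) \<partial>leb_pos)
     = (\<integral>\<^sup>+\<rho>. ennreal (kern c \<tau> y \<rho> * (\<rho>\<^sup>2)\<^sup>2) \<partial>leb_pos) + ennreal ((y\<^sup>2)\<^sup>2) * (\<integral>\<^sup>+\<rho>. ennreal (kern c \<tau> y \<rho>) \<partial>leb_pos)"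
  proof -
    have "(\<integral>\<^sup>+\<rho>. ennreal (kern c \<tau> y \<rho> * (\<rho>\<^sup>2 - y\<^sup>2)\<^sup>2) + ennreal (2 * y\<^sup>2) * ennreal (kern c \<tau> y \<rho> * \<rho>\<^sup>2) \<partial>leb_pos)
      = (\<integral>\<^sup>+\<rho>. ennreal (kern c \<tau> y \<rho> * (\<rho>\<^sup>2)\<^sup>2) + ennreal ((y\<^sup>2)\<^sup>2) * ennreal (kern c \<tau> y \<rho>) \<partial>leb_pos)"
    proof (intro nn_integral_cong)
      fix \<rho> :: real
      define K where "K = kern c \<tau> y \<rho>"
      have K: "K \<ge> 0" unfolding K_def by (rule k0)
      have "ennreal (K * (\<rho>\<^sup>2 - y\<^sup>2)\<^sup>2) + ennreal (2 * y\<^sup>2) * ennreal (K * \<rho>\<^sup>2) = ennreal (K * (\<rho>\<^sup>2 - y\<^sup>2)\<^sup>2 + 2 * y\<^sup>2 * (K * \<rho>\<^sup>2))"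
        using K by (simp add: ennreal_mult)
      also have "K * (\<rho>\<^sup>2 - y\<^sup>2)\<^sup>2 + 2 * y\<^sup>2 * (K * \<rho>\<^sup>2) = K * (\<rho>\<^sup>2)\<^sup>2 + (y\<^sup>2)\<^sup>2 * K"
        by (simp add: power2_eq_square algebra_simps)
      also have "ennreal \<dots> = ennreal (K * (\<rho>\<^sup>2)\<^sup>2) + ennreal ((y\<^sup>2)\<^sup>2) * ennreal K"
        using K by (simp add: ennreal_mult)
      finally show "ennreal (kern c \<tau> y \<rho> * (\<rho>\<^sup>2 - y\<^sup>2)\<^sup>2) + ennreal (2 * y\<^sup>2) * ennreal (kern c \<tau> y \<rho> * \<rho>\<^sup>2)
        = ennreal (kern c \<tau> y \<rho> * (\<rho>\<^sup>2)\<^sup>2) + ennreal ((y\<^sup>2)\<^sup>2) * ennreal (kern c \<tau> y \<rho>)"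
        unfolding K_def .
    qed
    then show ?thesis by (simp add: nn_integral_add nn_integral_cmult)
  qed
  have "\<tau>\<^sup>2 * (a * (a + 1) + (2 * (a + 1)) * x + x\<^sup>2) + (y\<^sup>2)\<^sup>2 = (\<tau>\<^sup>2 * (a * (a + 1)) + 2 * y\<^sup>2 * \<tau>) + 2 * y\<^sup>2 * (\<tau> * (a + x))"
    unfolding x(2)[symmetric] by (simp add: power2_eq_square algebra_simps)
  then have "(\<integral>\<^sup>+\<rho>. ennreal (kern c \<tau> y \<rho> * (\<rho>\<^sup>2 - y\<^sup>2)\<^sup>2) \<partial>leb_pos) + ennreal (2 * y\<^sup>2 * (\<tau> * (a + x)))
     = ennreal (\<tau>\<^sup>2 * (a * (a + 1)) + 2 * y\<^sup>2 * \<tau>) + ennreal (2 * y\<^sup>2 * (\<tau> * (a + x)))"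
    using S \<tau> a x unfolding m1 m2 kern_total[OF c \<tau> y] by (simp add: ennreal_mult'[symmetric] ennreal_plus[symmetric] del: ennreal_plus)
  then have "ennreal (2 * y\<^sup>2 * (\<tau> * (a + x))) + (\<integral>\<^sup>+\<rho>. ennreal (kern c \<tau> y \<rho> * (\<rho>\<^sup>2 - y\<^sup>2)\<^sup>2) \<partial>leb_pos)
     = ennreal (2 * y\<^sup>2 * (\<tau> * (a + x))) + ennreal (\<tau>\<^sup>2 * (a * (a + 1)) + 2 * y\<^sup>2 * \<tau>)"
    by (simp only: add.commute)
  then show ?thesis unfolding a_def[symmetric] ennreal_add_left_cancel by simp
qed

section \<open>The heat equation and Gaussian bounds for the kernel\<close>

definition heat_r :: "real \<Rightarrow> real \<Rightarrow> real \<Rightarrow> real \<Rightarrow> real" where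
  "heat_r a \<tau> y \<rho> = \<tau> powr - a * exp (- (y\<^sup>2 + \<rho>\<^sup>2) / \<tau>) *
     (2 * y\<^sup>2 * \<rho> / \<tau>\<^sup>2 * FF (a + 1) (y\<^sup>2 * \<rho>\<^sup>2 / \<tau>\<^sup>2) - 2 * \<rho> / \<tau> * FF a (y\<^sup>2 * \<rho>\<^sup>2 / \<tau>\<^sup>2))"

definition heat_t :: "real \<Rightarrow> real \<Rightarrow> real \<Rightarrow> real \<Rightarrow> real" where
  "heat_t a \<tau> y \<rho> = \<tau> powr - a * exp (- (y\<^sup>2 + \<rho>\<^sup>2) / \<tau>) *
     (((y\<^sup>2 + \<rho>\<^sup>2) / \<tau>\<^sup>2 - a / \<tau>) * FF a (y\<^sup>2 * \<rho>\<^sup>2 / \<tau>\<^sup>2) - 2 * (y\<^sup>2 * \<rho>\<^sup>2 / \<tau>\<^sup>2) / \<tau> * FF (a + 1) (y\<^sup>2 * \<rho>\<^sup>2 / \<tau>\<^sup>2))"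

lemma FF_arg_deriv_r:
  assumes "\<tau> > 0" "b > 0"
  shows "((\<lambda>\<rho>. FF b (y\<^sup>2 * \<rho>\<^sup>2 / \<tau>\<^sup>2)) has_field_derivative FF (b + 1) (y\<^sup>2 * \<rho>\<^sup>2 / \<tau>\<^sup>2) * (2 * y\<^sup>2 * \<rho> / \<tau>\<^sup>2)) (at \<rho>)"
  by (rule DERIV_chain2[OF FF_deriv[OF assms(2)]]) (use assms in \<open>auto intro!: derivative_eq_intros simp: field_simps power2_eq_square power4_eq_xxxx\<close>)

lemma exp_arg_deriv_r:
  assumes "\<tau> > (0::real)"
  shows "((\<lambda>\<rho>. K * exp (- (y\<^sup>2 + \<rho>\<^sup>2) / \<tau>)) has_field_derivative K * exp (- (y\<^sup>2 + \<rho>\<^sup>2) / \<tau>) * (- 2 * \<rho> / \<tau>)) (at \<rho>)"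
proof -
  have "\<tau> \<noteq> 0" using assms by simp
  then have "((\<lambda>\<rho>. - (y\<^sup>2 + \<rho>\<^sup>2) / \<tau>) has_field_derivative - 2 * \<rho> / \<tau>) (at \<rho>)"
    by (auto intro!: derivative_eq_intros)
  then have "((\<lambda>\<rho>. K * exp (- (y\<^sup>2 + \<rho>\<^sup>2) / \<tau>)) has_field_derivative K * (exp (- (y\<^sup>2 + \<rho>\<^sup>2) / \<tau>) * (- 2 * \<rho> / \<tau>))) (at \<rho>)"
    by (intro DERIV_cmult DERIV_chain2[OF DERIV_exp])
  then show ?thesis by (simp only: mult.assoc)
qed

lemma heat_deriv_r:
  assumes \<tau>: "\<tau> > 0" and a: "a > 0"
  shows "((\<lambda>\<rho>. heat a \<tau> y \<rho>) has_field_derivative heat_r a \<tau> y \<rho>) (at \<rho>)"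
proof -
  have "((\<lambda>\<rho>. heat a \<tau> y \<rho>) has_field_derivative
     \<tau> powr - a * exp (- (y\<^sup>2 + \<rho>\<^sup>2) / \<tau>) * (- 2 * \<rho> / \<tau>) * FF a (y\<^sup>2 * \<rho>\<^sup>2 / \<tau>\<^sup>2) +
     FF (a + 1) (y\<^sup>2 * \<rho>\<^sup>2 / \<tau>\<^sup>2) * (2 * y\<^sup>2 * \<rho> / \<tau>\<^sup>2) * (\<tau> powr - a * exp (- (y\<^sup>2 + \<rho>\<^sup>2) / \<tau>))) (at \<rho>)"
    unfolding heat_def by (intro DERIV_mult exp_arg_deriv_r FF_arg_deriv_r assms)
  then show ?thesis
    by (rule back_subst[of "\<lambda>D. ((\<lambda>\<rho>. heat a \<tau> y \<rho>) has_field_derivative D) (at \<rho>)"]) (simp add: heat_r_def algebra_simps)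
qed

lemma heat_deriv_t:
  assumes \<tau>: "\<tau> > 0" and a: "a > 0"
  shows "((\<lambda>\<tau>. heat a \<tau> y \<rho>) has_field_derivative heat_t a \<tau> y \<rho>) (at \<tau>)"
proof -
  have 1: "((\<lambda>\<tau>. \<tau> powr - a) has_field_derivative - a * \<tau> powr - a / \<tau>) (at \<tau>)"
    using \<tau> by (auto intro!: derivative_eq_intros simp: powr_diff)
  have 2: "((\<lambda>\<tau>. exp (- (y\<^sup>2 + \<rho>\<^sup>2) / \<tau>)) has_field_derivative exp (- (y\<^sup>2 + \<rho>\<^sup>2) / \<tau>) * ((y\<^sup>2 + \<rho>\<^sup>2) / \<tau>\<^sup>2)) (at \<tau>)"
    using \<tau> by (intro DERIV_chain2[OF DERIV_exp]) (auto intro!: derivative_eq_intros simp: power2_eq_square field_simps)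
  have 3: "((\<lambda>\<tau>. FF a (y\<^sup>2 * \<rho>\<^sup>2 / \<tau>\<^sup>2)) has_field_derivative FF (a + 1) (y\<^sup>2 * \<rho>\<^sup>2 / \<tau>\<^sup>2) * (- 2 * (y\<^sup>2 * \<rho>\<^sup>2 / \<tau>\<^sup>2) / \<tau>)) (at \<tau>)"
    using \<tau> by (intro DERIV_chain2[OF FF_deriv[OF a]]) (auto intro!: derivative_eq_intros simp: power2_eq_square field_simps)
  have "((\<lambda>\<tau>. heat a \<tau> y \<rho>) has_field_derivative
     ((- a * \<tau> powr - a / \<tau>) * exp (- (y\<^sup>2 + \<rho>\<^sup>2) / \<tau>) + exp (- (y\<^sup>2 + \<rho>\<^sup>2) / \<tau>) * ((y\<^sup>2 + \<rho>\<^sup>2) / \<tau>\<^sup>2) * \<tau> powr - a) * FF a (y\<^sup>2 * \<rho>\<^sup>2 / \<tau>\<^sup>2)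
     + FF (a + 1) (y\<^sup>2 * \<rho>\<^sup>2 / \<tau>\<^sup>2) * (- 2 * (y\<^sup>2 * \<rho>\<^sup>2 / \<tau>\<^sup>2) / \<tau>) * (\<tau> powr - a * exp (- (y\<^sup>2 + \<rho>\<^sup>2) / \<tau>))) (at \<tau>)"
    unfolding heat_def by (intro DERIV_mult 1 2 3)
  then show ?thesis
    by (rule back_subst[of "\<lambda>D. ((\<lambda>\<tau>. heat a \<tau> y \<rho>) has_field_derivative D) (at \<tau>)"]) (simp add: heat_t_def algebra_simps)
qed

text \<open>The operator B in the variable \<rho> is used in its self-adjoint form, (\<rho>^c h')' =
  \<rho>^c B h. The factor 4 is the change of time \<tau> = 4t. After the common factor is split
  off, the second derivative of \<open>FF\<close> is eliminated with \<open>FF_ode\<close>.\<close>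

lemma heat_equation:
  assumes \<tau>: "\<tau> > 0" and a: "a > 0" and c: "c = 2 * a - 1" and \<rho>: "\<rho> > 0"
  shows "((\<lambda>\<rho>. \<rho> powr c * heat_r a \<tau> y \<rho>) has_field_derivative 4 * \<rho> powr c * heat_t a \<tau> y \<rho>) (at \<rho>)"
proof -
  define E where "E = \<tau> powr - a * exp (- (y\<^sup>2 + \<rho>\<^sup>2) / \<tau>)"
  define z where "z = y\<^sup>2 * \<rho>\<^sup>2 / \<tau>\<^sup>2"
  define F0 F1 F2 where "F0 = FF a z" and "F1 = FF (a + 1) z" and "F2 = FF (a + 2) z"
  have ode: "F0 = z * F2 + a * F1" unfolding F0_def F1_def F2_def using FF_ode[OF a] by simp
  define q where "q = y\<^sup>2 / \<tau>\<^sup>2"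
  have z: "z = q * \<rho>\<^sup>2" by (simp add: z_def q_def)
  have F1': "((\<lambda>\<rho>. 2 * y\<^sup>2 * \<rho> / \<tau>\<^sup>2 * FF (a + 1) (y\<^sup>2 * \<rho>\<^sup>2 / \<tau>\<^sup>2)) has_field_derivative 2 * q * F1 + F2 * (2 * q * \<rho>) * (2 * q * \<rho>)) (at \<rho>)"
  proof -
    have "((\<lambda>\<rho>. 2 * y\<^sup>2 * \<rho> / \<tau>\<^sup>2) has_field_derivative 2 * q) (at \<rho>)"
      using \<tau> by (auto intro!: derivative_eq_intros simp: q_def field_simps power2_eq_square power4_eq_xxxx)
    moreover have "((\<lambda>\<rho>. FF (a + 1) (y\<^sup>2 * \<rho>\<^sup>2 / \<tau>\<^sup>2)) has_field_derivative F2 * (2 * q * \<rho>)) (at \<rho>)"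
      using FF_arg_deriv_r[OF \<tau>, of "a + 1" y \<rho>] a by (simp add: F2_def z_def q_def add_ac)
    ultimately show ?thesis
      by (rule DERIV_mult[THEN DERIV_cong]) (simp add: F1_def z_def q_def)
  qed
  have F0': "((\<lambda>\<rho>. 2 * \<rho> / \<tau> * FF a (y\<^sup>2 * \<rho>\<^sup>2 / \<tau>\<^sup>2)) has_field_derivative 2 / \<tau> * F0 + F1 * (2 * q * \<rho>) * (2 * \<rho> / \<tau>)) (at \<rho>)"
  proof -
    have "((\<lambda>\<rho>. 2 * \<rho> / \<tau>) has_field_derivative 2 / \<tau>) (at \<rho>)"
      using \<tau> by (auto intro!: derivative_eq_intros)
    moreover have "((\<lambda>\<rho>. FF a (y\<^sup>2 * \<rho>\<^sup>2 / \<tau>\<^sup>2)) has_field_derivative F1 * (2 * q * \<rho>)) (at \<rho>)"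
      using FF_arg_deriv_r[OF \<tau> a, of y \<rho>] by (simp add: F1_def z_def q_def)
    ultimately show ?thesis
      by (rule DERIV_mult[THEN DERIV_cong]) (simp add: F0_def z_def)
  qed
  define S where "S = 2 * q * \<rho> * F1 - 2 * \<rho> / \<tau> * F0"
  have r: "((\<lambda>\<rho>. heat_r a \<tau> y \<rho>) has_field_derivative E * (- 2 * \<rho> / \<tau>) * S +
     (2 * q * F1 + F2 * (2 * q * \<rho>) * (2 * q * \<rho>) - (2 / \<tau> * F0 + F1 * (2 * q * \<rho>) * (2 * \<rho> / \<tau>))) * E) (at \<rho>)"
    unfolding heat_r_def
    by (rule DERIV_mult[OF exp_arg_deriv_r[OF \<tau>] DERIV_diff[OF F1' F0'], THEN DERIV_cong])
       (simp add: E_def S_def F0_def F1_def z_def q_def)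
  have p: "((\<lambda>\<rho>. \<rho> powr c) has_field_derivative c * \<rho> powr c / \<rho>) (at \<rho>)"
    using \<rho> by (auto intro!: derivative_eq_intros simp: powr_diff)
  have hr: "heat_r a \<tau> y \<rho> = E * S" by (simp add: heat_r_def E_def S_def F0_def F1_def z_def q_def)
  have ht: "heat_t a \<tau> y \<rho> = E * ((q + \<rho>\<^sup>2 / \<tau>\<^sup>2 - a / \<tau>) * F0 - 2 * z / \<tau> * F1)"
    by (simp add: heat_t_def E_def F0_def F1_def z_def q_def add_divide_distrib)
  define R where "R = c / \<rho> * S + (- 2 * \<rho> / \<tau>) * S + (2 * q * F1 + F2 * (2 * q * \<rho>) * (2 * q * \<rho>) - (2 / \<tau> * F0 + F1 * (2 * q * \<rho>) * (2 * \<rho> / \<tau>)))"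
  \<comment> \<open>The terms containing F2 and the multiples of F1 that carry a combine to 4 q (z
    F2 + a F1), which is 4 q F0.\<close>
  have R: "R = 4 * ((q + \<rho>\<^sup>2 / \<tau>\<^sup>2 - a / \<tau>) * F0 - 2 * z / \<tau> * F1)"
  proof -
    have "R = 4 * q * (z * F2 + a * F1) + 4 * \<rho>\<^sup>2 / \<tau>\<^sup>2 * F0 - 4 * a / \<tau> * F0 - 8 * z / \<tau> * F1"
      using \<tau> \<rho> by (simp add: R_def S_def c z field_simps power2_eq_square)
    then show ?thesis unfolding ode[symmetric] by (simp add: algebra_simps)
  qed
  have "((\<lambda>\<rho>. \<rho> powr c * heat_r a \<tau> y \<rho>) has_field_derivative \<rho> powr c * E * R) (at \<rho>)"
    by (rule DERIV_mult[OF p r, THEN DERIV_cong]) (simp add: hr R_def algebra_simps)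
  then show ?thesis unfolding R ht by (simp add: mult_ac)
qed

text \<open>The bounds are uniform for times in [\<tau>1, \<tau>2]; the constant may depend on y.
  \<open>FF_bound\<close> with w = \<rho>^2/(2s) and X = 2 y^2/\<tau>1 spends half of the decay
  exp(-\<rho>^2/s) on the Bessel series; the other half is at most exp(-\<rho>^2/(2
  \<tau>2)).\<close>

lemma heat_bounds:
  assumes a: "a > 0" and \<tau>: "0 < \<tau>1" "\<tau>1 \<le> \<tau>2"
  shows "\<exists>C>0. \<forall>s \<rho>. \<tau>1 \<le> s \<longrightarrow> s \<le> \<tau>2 \<longrightarrow> \<rho> \<ge> 0 \<longrightarrow>
    heat a s y \<rho> \<le> C * exp (- \<rho>\<^sup>2 / (2 * \<tau>2)) \<and>
    \<bar>heat_r a s y \<rho>\<bar> \<le> C * \<rho> * exp (- \<rho>\<^sup>2 / (2 * \<tau>2)) \<and>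
    \<bar>heat_t a s y \<rho>\<bar> \<le> C * (1 + \<rho>\<^sup>2) * exp (- \<rho>\<^sup>2 / (2 * \<tau>2))"
proof -
  define X where "X = 2 * y\<^sup>2 / \<tau>1"
  obtain C0 where C0: "C0 > 0" "\<And>w z. 0 \<le> z \<Longrightarrow> z \<le> w * X \<Longrightarrow> 0 \<le> w \<Longrightarrow> FF a z \<le> C0 * exp w"
    using FF_bound[OF a] by blast
  obtain C1 where C1: "C1 > 0" "\<And>w z. 0 \<le> z \<Longrightarrow> z \<le> w * X \<Longrightarrow> 0 \<le> w \<Longrightarrow> FF (a + 1) z \<le> C1 * exp w"
    using FF_bound[of "a + 1"] a by (metis add_pos_pos zero_less_one)
  define D where "D = \<tau>1 powr - a"
  define Y where "Y = y\<^sup>2"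
  have D: "D > 0" using \<tau> by (simp add: D_def)
  have Y: "Y \<ge> 0" by (simp add: Y_def)
  define B1 where "B1 = 2 * Y / \<tau>1\<^sup>2 * C1 + 2 / \<tau>1 * C0"
  define B2 where "B2 = (Y / \<tau>1\<^sup>2 + 1 / \<tau>1\<^sup>2 + a / \<tau>1) * C0 + 2 * (Y / \<tau>1\<^sup>2) / \<tau>1 * C1"
  have B: "B1 \<ge> 0" "B2 \<ge> 0" using Y \<tau> C0(1) C1(1) a by (auto simp: B1_def B2_def intro!: add_nonneg_nonneg mult_nonneg_nonneg divide_nonneg_nonneg)
  show ?thesis
  proof (intro exI[of _ "D * (C0 + B1 + B2)"] conjI allI impI)
    show "D * (C0 + B1 + B2) > 0" using D C0 B by (intro mult_pos_pos) auto
    fix s \<rho> :: real assume s: "\<tau>1 \<le> s" "s \<le> \<tau>2" and \<rho>: "\<rho> \<ge> 0"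
    have s0: "s > 0" using s \<tau> by linarith
    define w where "w = \<rho>\<^sup>2 / (2 * s)"
    define z where "z = y\<^sup>2 * \<rho>\<^sup>2 / s\<^sup>2"
    define F0 F1 where "F0 = FF a z" and "F1 = FF (a + 1) z"
    have z: "0 \<le> z" by (simp add: z_def)
    have w: "0 \<le> w" using s0 by (simp add: w_def)
    have zX: "z \<le> w * X"
    proof -
      have "z = w * (2 * y\<^sup>2 / s)" using s0 by (simp add: z_def w_def power2_eq_square)
      also have "\<dots> \<le> w * X" unfolding X_def using s \<tau> w by (intro mult_left_mono divide_left_mono) auto
      finally show ?thesis .
    qed
    have F0: "0 \<le> F0" "F0 \<le> C0 * exp w" unfolding F0_def using C0(2)[OF z zX w] FF_nonneg[OF a z] by auto
    have F1: "0 \<le> F1" "F1 \<le> C1 * exp w" unfolding F1_def using C1(2)[OF z zX w] FF_nonneg[of "a + 1" z] a z by auto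
    have e: "s powr - a * exp (- (y\<^sup>2 + \<rho>\<^sup>2) / s) * exp w \<le> D * exp (- \<rho>\<^sup>2 / (2 * \<tau>2))"
    proof -
      have "s powr - a \<le> D" unfolding D_def using s \<tau> a by (intro powr_mono2') auto
      moreover have "exp (- (y\<^sup>2 + \<rho>\<^sup>2) / s) * exp w \<le> exp (- \<rho>\<^sup>2 / (2 * \<tau>2))"
      proof -
        have "- (y\<^sup>2 + \<rho>\<^sup>2) / s + w = - y\<^sup>2 / s - \<rho>\<^sup>2 / (2 * s)" using s0 by (simp add: w_def field_simps)
        moreover have "\<rho>\<^sup>2 / (2 * \<tau>2) \<le> \<rho>\<^sup>2 / (2 * s)" using s s0 by (intro divide_left_mono) auto
        moreover have "0 \<le> y\<^sup>2 / s" using s0 by simp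
        ultimately have "- (y\<^sup>2 + \<rho>\<^sup>2) / s + w \<le> - \<rho>\<^sup>2 / (2 * \<tau>2)" by simp
        then show ?thesis unfolding exp_add[symmetric] by simp
      qed
      ultimately have "s powr - a * (exp (- (y\<^sup>2 + \<rho>\<^sup>2) / s) * exp w) \<le> D * exp (- \<rho>\<^sup>2 / (2 * \<tau>2))"
        using D by (intro mult_mono) auto
      then show ?thesis by (simp add: mult_ac)
    qed
    define P where "P = s powr - a * exp (- (y\<^sup>2 + \<rho>\<^sup>2) / s)"
    define G where "G = exp (- \<rho>\<^sup>2 / (2 * \<tau>2))"
    have P: "P \<ge> 0" "P * exp w \<le> D * G" using e by (auto simp: P_def G_def)
    have G: "G > 0" by (simp add: G_def)
    have main: "P * (K * exp w) \<le> D * K * G" if "K \<ge> 0" for K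
      using mult_left_mono[OF P(2) that] by (simp add: mult_ac)
    have inv: "1 / s \<le> 1 / \<tau>1" "1 / s\<^sup>2 \<le> 1 / \<tau>1\<^sup>2" "0 < 1 / s"
      using s \<tau> by (auto intro!: divide_left_mono power_mono mult_pos_pos)
    have abs2: "\<bar>p - q\<bar> \<le> p + q" if "p \<ge> 0" "q \<ge> 0" for p q :: real using that by linarith
    have abs3: "\<bar>p - q - r\<bar> \<le> p + q + r" if "p \<ge> 0" "q \<ge> 0" "r \<ge> 0" for p q r :: real using that by linarith
    have "heat a s y \<rho> = P * F0" by (simp add: heat_def P_def F0_def z_def)
    also have "\<dots> \<le> P * (C0 * exp w)" using F0 P by (intro mult_left_mono) auto
    also have "\<dots> \<le> D * C0 * G" by (rule main) (use C0 in simp)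
    also have "\<dots> \<le> D * (C0 + B1 + B2) * G" using D G B by (intro mult_right_mono mult_left_mono) auto
    finally show "heat a s y \<rho> \<le> D * (C0 + B1 + B2) * exp (- \<rho>\<^sup>2 / (2 * \<tau>2))" by (simp add: G_def)
    have "heat_r a s y \<rho> = P * (2 * Y * (1 / s\<^sup>2) * \<rho> * F1 - 2 * (1 / s) * \<rho> * F0)"
      by (simp add: heat_r_def P_def F0_def F1_def z_def Y_def)
    then have "\<bar>heat_r a s y \<rho>\<bar> = P * \<bar>2 * Y * (1 / s\<^sup>2) * \<rho> * F1 - 2 * (1 / s) * \<rho> * F0\<bar>"
      using P by (simp add: abs_mult)
    also have "\<dots> \<le> P * (2 * Y * (1 / s\<^sup>2) * \<rho> * F1 + 2 * (1 / s) * \<rho> * F0)"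
    proof (intro mult_left_mono P(1))
      have "2 * Y * (1 / s\<^sup>2) * \<rho> * F1 \<ge> 0" "2 * (1 / s) * \<rho> * F0 \<ge> 0"
        using Y s0 \<rho> F0 F1 by (auto intro!: mult_nonneg_nonneg divide_nonneg_nonneg)
      then show "\<bar>2 * Y * (1 / s\<^sup>2) * \<rho> * F1 - 2 * (1 / s) * \<rho> * F0\<bar> \<le> 2 * Y * (1 / s\<^sup>2) * \<rho> * F1 + 2 * (1 / s) * \<rho> * F0" by (rule abs2)
    qed
    also have "\<dots> \<le> P * (2 * Y * (1 / \<tau>1\<^sup>2) * \<rho> * (C1 * exp w) + 2 * (1 / \<tau>1) * \<rho> * (C0 * exp w))"
      using P F0 F1 Y \<rho> inv C0(1) C1(1) \<tau> by (intro mult_left_mono add_mono mult_mono) (auto intro!: mult_nonneg_nonneg)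
    also have "\<dots> = P * ((\<rho> * B1) * exp w)" by (simp add: B1_def algebra_simps)
    also have "\<dots> \<le> D * (\<rho> * B1) * G" by (rule main) (use \<rho> B in simp)
    also have "\<dots> \<le> D * ((C0 + B1 + B2) * \<rho>) * G"
      using D G B \<rho> C0(1) by (intro mult_right_mono mult_left_mono) (auto simp: mult.commute[of \<rho>] intro!: mult_right_mono)
    finally show "\<bar>heat_r a s y \<rho>\<bar> \<le> D * (C0 + B1 + B2) * \<rho> * exp (- \<rho>\<^sup>2 / (2 * \<tau>2))" by (simp add: G_def mult_ac)
    have "heat_t a s y \<rho> = P * (((Y + \<rho>\<^sup>2) * (1 / s\<^sup>2) - a * (1 / s)) * F0 - 2 * (Y * \<rho>\<^sup>2 * (1 / s\<^sup>2)) * (1 / s) * F1)"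
      by (simp add: heat_t_def P_def F0_def F1_def z_def Y_def)
    then have "\<bar>heat_t a s y \<rho>\<bar> = P * \<bar>((Y + \<rho>\<^sup>2) * (1 / s\<^sup>2) - a * (1 / s)) * F0 - 2 * (Y * \<rho>\<^sup>2 * (1 / s\<^sup>2)) * (1 / s) * F1\<bar>"
      using P by (simp add: abs_mult)
    also have "\<dots> \<le> P * (((Y + \<rho>\<^sup>2) * (1 / s\<^sup>2) + a * (1 / s)) * F0 + 2 * (Y * \<rho>\<^sup>2 * (1 / s\<^sup>2)) * (1 / s) * F1)"
    proof (intro mult_left_mono P(1))
      have "(Y + \<rho>\<^sup>2) * (1 / s\<^sup>2) * F0 \<ge> 0" "a * (1 / s) * F0 \<ge> 0" "2 * (Y * \<rho>\<^sup>2 * (1 / s\<^sup>2)) * (1 / s) * F1 \<ge> 0"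
        using Y s0 \<rho> F0 F1 a by (auto intro!: mult_nonneg_nonneg divide_nonneg_nonneg)
      then show "\<bar>((Y + \<rho>\<^sup>2) * (1 / s\<^sup>2) - a * (1 / s)) * F0 - 2 * (Y * \<rho>\<^sup>2 * (1 / s\<^sup>2)) * (1 / s) * F1\<bar> \<le> ((Y + \<rho>\<^sup>2) * (1 / s\<^sup>2) + a * (1 / s)) * F0 + 2 * (Y * \<rho>\<^sup>2 * (1 / s\<^sup>2)) * (1 / s) * F1"
        unfolding distrib_right[of _ _ F0] left_diff_distrib[of _ _ F0] by (rule abs3)
    qed
    also have "\<dots> \<le> P * (((Y + \<rho>\<^sup>2) * (1 / \<tau>1\<^sup>2) + a * (1 / \<tau>1)) * (C0 * exp w) + 2 * (Y * \<rho>\<^sup>2 * (1 / \<tau>1\<^sup>2)) * (1 / \<tau>1) * (C1 * exp w))"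
      using P F0 F1 Y \<rho> inv C0(1) C1(1) \<tau> a by (intro mult_left_mono add_mono mult_mono) (auto intro!: mult_nonneg_nonneg add_nonneg_nonneg)
    also have "\<dots> \<le> P * (((1 + \<rho>\<^sup>2) * B2) * exp w)"
    proof (intro mult_left_mono P(1))
      define A1 A2 A3 A4 where "A1 = Y * (1 / \<tau>1\<^sup>2) * C0" and "A2 = (1 / \<tau>1\<^sup>2) * C0" and "A3 = a * (1 / \<tau>1) * C0" and "A4 = 2 * (Y * (1 / \<tau>1\<^sup>2)) * (1 / \<tau>1) * C1"
      have A: "A1 \<ge> 0" "A2 \<ge> 0" "A3 \<ge> 0" "A4 \<ge> 0"
        using Y \<tau> a C0(1) C1(1) by (auto simp: A1_def A2_def A3_def A4_def intro!: mult_nonneg_nonneg divide_nonneg_nonneg)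
      have "A1 + \<rho>\<^sup>2 * A2 + A3 + \<rho>\<^sup>2 * A4 \<le> (1 + \<rho>\<^sup>2) * (A1 + A2 + A3 + A4)"
        using A by (simp add: distrib_left distrib_right)
      then have "(A1 + \<rho>\<^sup>2 * A2 + A3 + \<rho>\<^sup>2 * A4) * exp w \<le> (1 + \<rho>\<^sup>2) * (A1 + A2 + A3 + A4) * exp w" by (rule mult_right_mono) simp
      moreover have "B2 = A1 + A2 + A3 + A4" by (simp add: B2_def A1_def A2_def A3_def A4_def algebra_simps)
      moreover have "((Y + \<rho>\<^sup>2) * (1 / \<tau>1\<^sup>2) + a * (1 / \<tau>1)) * (C0 * exp w) + 2 * (Y * \<rho>\<^sup>2 * (1 / \<tau>1\<^sup>2)) * (1 / \<tau>1) * (C1 * exp w) = (A1 + \<rho>\<^sup>2 * A2 + A3 + \<rho>\<^sup>2 * A4) * exp w"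
        by (simp add: A1_def A2_def A3_def A4_def algebra_simps add_divide_distrib)
      ultimately show "((Y + \<rho>\<^sup>2) * (1 / \<tau>1\<^sup>2) + a * (1 / \<tau>1)) * (C0 * exp w) + 2 * (Y * \<rho>\<^sup>2 * (1 / \<tau>1\<^sup>2)) * (1 / \<tau>1) * (C1 * exp w) \<le> (1 + \<rho>\<^sup>2) * B2 * exp w"
        by simp
    qed
    also have "\<dots> \<le> D * ((1 + \<rho>\<^sup>2) * B2) * G" by (rule main) (use B in simp)
    also have "\<dots> \<le> D * ((C0 + B1 + B2) * (1 + \<rho>\<^sup>2)) * G"
      using D G B C0(1) by (intro mult_right_mono mult_left_mono) (auto simp: mult.commute[of "1 + \<rho>\<^sup>2"] intro!: mult_right_mono)
    finally show "\<bar>heat_t a s y \<rho>\<bar> \<le> D * (C0 + B1 + B2) * (1 + \<rho>\<^sup>2) * exp (- \<rho>\<^sup>2 / (2 * \<tau>2))" by (simp add: G_def mult_ac)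
  qed
qed

section \<open>The semigroup\<close>

text \<open>For \<tau> > 0 this is the semigroup at the real time \<tau>/4.\<close>

definition TT :: "real \<Rightarrow> real \<Rightarrow> (real \<Rightarrow> complex) \<Rightarrow> real \<Rightarrow> complex" where
  "TT c \<tau> f y = (LINT \<rho>|leb_pos. kern c \<tau> y \<rho> *\<^sub>R f \<rho>)"

lemma semigroup_Bn_eq:
  assumes "c > -1" "t > 0" "y > 0"
  shows "semigroup_Bn c (of_real t) f y = TT c (4 * t) f y"
  unfolding semigroup_Bn_def TT_def
  by (rule Bochner_Integration.integral_cong) (use assms kernel_Bn_eq[OF assms(1,2)] in \<open>auto simp: scaleR_conv_of_real\<close>)

lemma TT_measurable:
  assumes c: "c > -1" and [measurable]: "f \<in> borel_measurable leb_pos" "g \<in> borel_measurable M" "h \<in> borel_measurable M"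
  shows "(\<lambda>x. TT c (g x) f (h x)) \<in> borel_measurable M"
proof -
  have "(\<lambda>(x, \<rho>). kern c (g x) (h x) \<rho> *\<^sub>R f \<rho>) \<in> borel_measurable (M \<Otimes>\<^sub>M leb_pos)"
    unfolding case_prod_beta by (intro borel_measurable_scaleR kern_measurable c) measurable
  then show ?thesis unfolding TT_def by (rule leb_pos.borel_measurable_lebesgue_integral)
qed

lemma TT_cong_AE:
  assumes c: "c > -1" and f: "f \<in> borel_measurable leb_pos" and ae: "AE \<rho> in leb_pos. f \<rho> = g \<rho>"
  shows "TT c \<tau> f y = TT c \<tau> g y"
proof -
  note [measurable] = f leb_pos_AE_measurable[OF f ae]
  have [measurable]: "(\<lambda>\<rho>. kern c \<tau> y \<rho>) \<in> borel_measurable leb_pos" by (intro kern_measurable c) measurable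
  show ?thesis unfolding TT_def
  proof (rule integral_cong_AE)
    show "AE \<rho> in leb_pos. kern c \<tau> y \<rho> *\<^sub>R f \<rho> = kern c \<tau> y \<rho> *\<^sub>R g \<rho>"
      using ae by eventually_elim simp
  qed measurable
qed

text \<open>The first bound also covers non-integrable f, whose Bochner integral is 0 by convention.
  The second excludes the value infinity, which \<open>enn2real\<close> would turn into 0.\<close>

lemma norm_integral_le_enn2real:
  fixes f :: "'a \<Rightarrow> 'b::{banach, second_countable_topology}"
  shows "ennreal (norm (integral\<^sup>L M f)) \<le> (\<integral>\<^sup>+x. ennreal (norm (f x)) \<partial>M)"
    and "(\<integral>\<^sup>+x. ennreal (norm (f x)) \<partial>M) < \<infinity> \<Longrightarrow> norm (integral\<^sup>L M f) \<le> enn2real (\<integral>\<^sup>+x. ennreal (norm (f x)) \<partial>M)"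
proof -
  show 1: "ennreal (norm (integral\<^sup>L M f)) \<le> (\<integral>\<^sup>+x. ennreal (norm (f x)) \<partial>M)"
    by (cases "integrable M f") (auto simp: integral_norm_bound_ennreal not_integrable_integral_eq)
  show "norm (integral\<^sup>L M f) \<le> enn2real (\<integral>\<^sup>+x. ennreal (norm (f x)) \<partial>M)" if "(\<integral>\<^sup>+x. ennreal (norm (f x)) \<partial>M) < \<infinity>"
    using enn2real_mono[OF 1] that by simp
qed

text \<open>A locale, because the results are used for three sets of parameters: the given ones, the
  dual ones, and c = 0 for the condition at the origin.\<close>

locale bessel_weight =
  fixes p c m :: real
  assumes p: "1 < p" and c: "c > -1" and m0: "0 < (m + 1) / p" and m1: "(m + 1) / p < c + 1"
begin

definition q :: real where "q = p / (p - 1)"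
definition md :: real where "md = (c - m / p) * q"

lemma m_gt: "m > -1" using m0 p by (simp add: zero_less_divide_iff)

lemma q: "q > 1" "1 / p + 1 / q = 1" "q * (p - 1) = p"
  using p by (auto simp: q_def field_simps)

lemma md: "md / q = c - m / p" using q by (simp add: md_def)

text \<open>With m/p + md/q = c one gets (md+1)/q = c + 1 - (m+1)/p, so passing to the dual space
  reflects (m+1)/p in the interval (0, c+1).\<close>

lemma dual: "bessel_weight q c md"
proof -
  have "1 / q = 1 - 1 / p" using q by simp
  then have "(md + 1) / q = c + 1 - (m + 1) / p" unfolding add_divide_distrib md by (simp add: field_simps)
  then show ?thesis using m0 m1 c q by unfold_locales auto
qed

lemma pairing_integrable:
  assumes f: "f \<in> Lp m p" and g: "g \<in> Lp md q"
  shows "integrable leb_pos (\<lambda>y. (y powr c) *\<^sub>R (f y * g y))"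
proof (rule integrableI_bounded)
  note [measurable] = LpD(1)[OF f] LpD(1)[OF g]
  show "(\<lambda>y. (y powr c) *\<^sub>R (f y * g y)) \<in> borel_measurable leb_pos" by measurable
  have "(\<integral>\<^sup>+y. ennreal (norm ((y powr c) *\<^sub>R (f y * g y))) \<partial>leb_pos) = (\<integral>\<^sup>+y. ennreal (norm (f y) * norm (g y) * y powr c) \<partial>leb_pos)"
    by (intro nn_integral_cong) (simp add: norm_mult mult_ac)
  also have "\<dots> \<le> ennreal (enn2real (Np m p f) powr (1/p) * enn2real (Np md q g) powr (1/q))"
    by (rule Np_pairing[OF p q(1,2) md]) (use f g in \<open>auto dest: LpD\<close>)
  also have "\<dots> < \<infinity>" by simp
  finally show "(\<integral>\<^sup>+y. ennreal (norm ((y powr c) *\<^sub>R (f y * g y))) \<partial>leb_pos) < \<infinity>" .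
qed

lemma pairing_bound:
  assumes f: "f \<in> Lp m p" and g: "g \<in> Lp md q"
  shows "norm (LINT y|leb_pos. (y powr c) *\<^sub>R (f y * g y)) \<le> enn2real (Np m p f) powr (1/p) * enn2real (Np md q g) powr (1/q)"
proof -
  have "ennreal (norm (LINT y|leb_pos. (y powr c) *\<^sub>R (f y * g y))) \<le> (\<integral>\<^sup>+y. ennreal (norm ((y powr c) *\<^sub>R (f y * g y))) \<partial>leb_pos)"
    by (rule norm_integral_le_enn2real)
  also have "\<dots> = (\<integral>\<^sup>+y. ennreal (norm (f y) * norm (g y) * y powr c) \<partial>leb_pos)"
    by (intro nn_integral_cong) (simp add: norm_mult mult_ac)
  also have "\<dots> \<le> ennreal (enn2real (Np m p f) powr (1/p) * enn2real (Np md q g) powr (1/q))"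
    by (rule Np_pairing[OF p q(1,2) md]) (use f g in \<open>auto dest: LpD\<close>)
  finally show ?thesis by simp
qed

text \<open>The integral is that of \<open>nn_integral_gauss\<close> with \<alpha> = (m+1)/2, which
  is positive because m > -1.\<close>

lemma gauss_Lp:
  assumes "d > 0"
  shows "(\<lambda>\<rho>. complex_of_real (exp (- d * \<rho>\<^sup>2))) \<in> Lp m p"
  unfolding Lp_iff
proof
  have "Np m p (\<lambda>\<rho>. complex_of_real (exp (- d * \<rho>\<^sup>2))) = (\<integral>\<^sup>+\<rho>. ennreal (1 / 2) * ennreal (2 * \<rho> powr (2 * ((m + 1) / 2) - 1) * exp (- \<rho>\<^sup>2 / (1 / (d * p)))) \<partial>leb_pos)"
    unfolding Np_def
  proof (intro nn_integral_cong)
    fix x :: real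
    have e: "2 * ((m + 1) / 2) - 1 = m" by (simp add: field_simps)
    have "exp (- d * x\<^sup>2) powr p = exp (- (d * x\<^sup>2 * p))" by (simp add: powr_def mult_ac)
    then show "ennreal (norm (complex_of_real (exp (- d * x\<^sup>2))) powr p * x powr m) = ennreal (1 / 2) * ennreal (2 * x powr (2 * ((m + 1) / 2) - 1) * exp (- x\<^sup>2 / (1 / (d * p))))"
      unfolding e by (subst ennreal_mult'[symmetric]) (simp_all add: mult_ac)
  qed
  also have "\<dots> = ennreal (1 / 2) * (\<integral>\<^sup>+\<rho>. ennreal (2 * \<rho> powr (2 * ((m + 1) / 2) - 1) * exp (- \<rho>\<^sup>2 / (1 / (d * p)))) \<partial>leb_pos)"
    by (rule nn_integral_cmult) measurable
  also have "(\<integral>\<^sup>+\<rho>. ennreal (2 * \<rho> powr (2 * ((m + 1) / 2) - 1) * exp (- \<rho>\<^sup>2 / (1 / (d * p)))) \<partial>leb_pos) = ennreal ((1 / (d * p)) powr ((m + 1) / 2) * Gamma ((m + 1) / 2))"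
    by (rule nn_integral_gauss) (use m_gt p assms in auto)
  also have "ennreal (1 / 2) * \<dots> = ennreal (1 / 2 * ((1 / (d * p)) powr ((m + 1) / 2) * Gamma ((m + 1) / 2)))"
    by (rule ennreal_mult'[symmetric]) simp
  also have "\<dots> < \<infinity>" by simp
  finally show "Np m p (\<lambda>\<rho>. complex_of_real (exp (- d * \<rho>\<^sup>2))) < \<infinity>" .
  show "(\<lambda>\<rho>. complex_of_real (exp (- d * \<rho>\<^sup>2))) \<in> borel_measurable leb_pos" by measurable
qed

text \<open>Gaussians lie in the dual space L^q_md, so this is an instance of the pairing. It serves
  as the integrability criterion for the kernels below, which are dominated by \<rho>^c times a
  Gaussian.\<close>

lemma gauss_integrable:
  assumes f: "f \<in> Lp m p" and "d > 0"
  shows "integrable leb_pos (\<lambda>\<rho>. (\<rho> powr c * exp (- d * \<rho>\<^sup>2)) *\<^sub>R f \<rho>)"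
proof -
  have "integrable leb_pos (\<lambda>y. (y powr c) *\<^sub>R (f y * complex_of_real (exp (- d * y\<^sup>2))))"
    by (rule pairing_integrable[OF f bessel_weight.gauss_Lp[OF dual \<open>d > 0\<close>]])
  then show ?thesis by (simp add: scaleR_conv_of_real mult_ac)
qed

lemma kern_integrable:
  assumes f: "f \<in> Lp m p" and \<tau>: "\<tau> > 0"
  shows "integrable leb_pos (\<lambda>\<rho>. kern c \<tau> y \<rho> *\<^sub>R f \<rho>)"
proof -
  note [measurable] = LpD(1)[OF f]
  have [measurable]: "(\<lambda>\<rho>. kern c \<tau> y \<rho>) \<in> borel_measurable leb_pos" by (intro kern_measurable c) measurable
  obtain C where C: "C > 0" "\<And>\<rho>. \<rho> \<ge> 0 \<Longrightarrow> heat ((c + 1) / 2) \<tau> y \<rho> \<le> C * exp (- \<rho>\<^sup>2 / (2 * \<tau>))"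
    using heat_bounds[of "(c + 1) / 2" \<tau> \<tau> y] c \<tau> by auto
  show ?thesis
  proof (rule Bochner_Integration.integrable_bound)
    show "integrable leb_pos (\<lambda>\<rho>. (2 * C) *\<^sub>R ((\<rho> powr c * exp (- (1 / (2 * \<tau>)) * \<rho>\<^sup>2)) *\<^sub>R f \<rho>))"
      by (intro integrable_scaleR_right gauss_integrable[OF f]) (use \<tau> in simp)
    show "AE \<rho> in leb_pos. norm (kern c \<tau> y \<rho> *\<^sub>R f \<rho>) \<le> norm ((2 * C) *\<^sub>R ((\<rho> powr c * exp (- (1 / (2 * \<tau>)) * \<rho>\<^sup>2)) *\<^sub>R f \<rho>))"
      using AE_leb_pos_gt
    proof eventually_elim
      case (elim \<rho>)
      have "kern c \<tau> y \<rho> \<le> 2 * \<rho> powr c * (C * exp (- \<rho>\<^sup>2 / (2 * \<tau>)))"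
        unfolding kern_def using C(2)[of \<rho>] elim by (intro mult_left_mono) auto
      then have "\<bar>kern c \<tau> y \<rho>\<bar> * norm (f \<rho>) \<le> (2 * \<rho> powr c * (C * exp (- \<rho>\<^sup>2 / (2 * \<tau>)))) * norm (f \<rho>)"
        using kern_nonneg[OF c, of \<tau> y \<rho>] by (intro mult_right_mono) auto
      then show ?case using C(1) by (simp add: mult_ac)
    qed
  qed measurable
qed

lemma TT_add: "f \<in> Lp m p \<Longrightarrow> g \<in> Lp m p \<Longrightarrow> \<tau> > 0 \<Longrightarrow> TT c \<tau> (\<lambda>y. f y + g y) y = TT c \<tau> f y + TT c \<tau> g y"
  unfolding TT_def scaleR_add_right by (intro Bochner_Integration.integral_add kern_integrable)

lemma TT_cmult: "TT c \<tau> (\<lambda>y. z * f y) y = z * TT c \<tau> f y"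
  unfolding TT_def by (simp add: mult_scaleR_right[symmetric] del: mult_scaleR_right)

lemma TT_diff: "f \<in> Lp m p \<Longrightarrow> g \<in> Lp m p \<Longrightarrow> \<tau> > 0 \<Longrightarrow> TT c \<tau> (\<lambda>y. f y - g y) y = TT c \<tau> f y - TT c \<tau> g y"
  unfolding TT_def scaleR_diff_right by (intro Bochner_Integration.integral_diff kern_integrable)

text \<open>The inequalities provide the conditions 0 \<le> b < c+1 of
  \<open>kern_powr_bound\<close> for b = a q and b = c + a p - m, the two moments in Schur's test.
  The constraints on a are compatible because 0 < (m+1)/p < c+1.\<close>

lemma schur_exponent: "\<exists>a. a \<ge> 0 \<and> a * q < c + 1 \<and> a * p < m + 1 \<and> m - c < a * p"
proof -
  define lo hi where "lo = max 0 ((m - c) / p)" and "hi = min ((c + 1) / q) ((m + 1) / p)"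
  have q1: "1 / q = 1 - 1 / p" using q(2) by simp
  have "(c + 1) / q = (c + 1) * (1 / q)" by simp
  also have "\<dots> = (c + 1) - (c + 1) / p" unfolding q1 by (simp add: algebra_simps)
  finally have cq: "(c + 1) / q = (c + 1) - (c + 1) / p" .
  have "(m - c) / p < (c + 1) / q"
    unfolding cq using m1 by (simp add: diff_divide_distrib add_divide_distrib)
  moreover have "(m - c) / p < (m + 1) / p" using p c by (intro divide_strict_right_mono) auto
  moreover have "0 < (c + 1) / q" using c q(1) by simp
  ultimately have "lo < hi" using m0 by (auto simp: lo_def hi_def)
  define a where "a = (lo + hi) / 2"
  have "lo < a" "a < hi" using \<open>lo < hi\<close> by (auto simp: a_def)
  then have "0 < a" "(m - c) / p < a" "a < (c + 1) / q" "a < (m + 1) / p" by (auto simp: lo_def hi_def)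
  then show ?thesis using p q(1) by (intro exI[of _ a]) (auto simp: field_simps)
qed

lemma kern_pair_measurable: "(\<lambda>(y, \<rho>). kern c \<tau> y \<rho>) \<in> borel_measurable (leb_pos \<Otimes>\<^sub>M leb_pos)"
  unfolding case_prod_beta by (intro kern_measurable c) measurable

text \<open>Schur's test. The moments in y reduce to moments in \<rho> by \<open>kern_symm\<close>.
  The constant does not depend on \<tau>, which the density argument for strong continuity relies
  on.\<close>

lemma TT_bound:
  "\<exists>C>0. \<forall>\<tau> f. \<tau> > 0 \<longrightarrow> f \<in> Lp m p \<longrightarrow>  Np m p (\<lambda>y. TT c \<tau> f y) \<le> ennreal C * Np m p f"
proof -
  obtain a where a: "a \<ge> 0" "a * q < c + 1" "a * p < m + 1" "m - c < a * p" using schur_exponent by blast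
  obtain C1 where C1: "C1 > 0" "\<And>\<tau> y. \<tau> > 0 \<Longrightarrow> y > 0 \<Longrightarrow>
     (\<integral>\<^sup>+\<rho>. ennreal (kern c \<tau> y \<rho> * \<rho> powr - (a * q)) \<partial>leb_pos) \<le> ennreal (C1 * y powr - (a * q))"
    using kern_powr_bound[OF c, of "a * q"] a q by auto
  obtain C2 where C2: "C2 > 0" "\<And>\<tau> y. \<tau> > 0 \<Longrightarrow> y > 0 \<Longrightarrow>
     (\<integral>\<^sup>+\<rho>. ennreal (kern c \<tau> y \<rho> * \<rho> powr - (c + a * p - m)) \<partial>leb_pos) \<le> ennreal (C2 * y powr - (c + a * p - m))"
    using kern_powr_bound[OF c, of "c + a * p - m"] a by auto
  show ?thesis
  proof (intro exI[of _ "C1 powr (p - 1) * C2"] conjI allI impI)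
    show "C1 powr (p - 1) * C2 > 0" using C1 C2 by simp
    fix \<tau> :: real and f assume \<tau>: "\<tau> > 0" and f: "f \<in> Lp m p"
    note [measurable] = LpD(1)[OF f]
    have sch: "(\<integral>\<^sup>+y. ennreal (enn2real (\<integral>\<^sup>+\<rho>. ennreal (kern c \<tau> y \<rho> * norm (f \<rho>)) \<partial>leb_pos) powr p * y powr m) \<partial>leb_pos)
      \<le> ennreal (C1 powr (p - 1) * C2) * (\<integral>\<^sup>+\<rho>. ennreal (norm (f \<rho>) powr p * \<rho> powr m) \<partial>leb_pos)"
    proof (rule schur_test(2)[OF p q(1,2) kern_pair_measurable, of \<tau> C1 C2 a])
      show "(\<integral>\<^sup>+\<rho>. ennreal (kern c \<tau> y \<rho> * \<rho> powr (- a * q)) \<partial>leb_pos) \<le> ennreal (C1 * y powr (- a * q))" if "y > 0" for y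
        using C1(2)[OF \<tau> that] by simp
      fix \<rho> :: real assume \<rho>: "\<rho> > 0"
      have "(\<integral>\<^sup>+y. ennreal (kern c \<tau> y \<rho> * y powr (m - a * p)) \<partial>leb_pos) = (\<integral>\<^sup>+y. ennreal (\<rho> powr c) * ennreal (kern c \<tau> \<rho> y * y powr - (c + a * p - m)) \<partial>leb_pos)"
      proof (intro nn_integral_cong)
        fix y assume "y \<in> space leb_pos"
        then have y: "y > 0" by simp
        have "kern c \<tau> y \<rho> * y powr (m - a * p) = kern c \<tau> y \<rho> * (y powr c * y powr - (c + a * p - m))"
          using y by (simp add: powr_add[symmetric])
        also have "\<dots> = \<rho> powr c * (kern c \<tau> \<rho> y * y powr - (c + a * p - m))"
          using kern_symm[of c \<tau> y \<rho>] by (simp add: mult.assoc[symmetric])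
        finally show "ennreal (kern c \<tau> y \<rho> * y powr (m - a * p)) = ennreal (\<rho> powr c) * ennreal (kern c \<tau> \<rho> y * y powr - (c + a * p - m))"
          by (simp add: ennreal_mult'[symmetric])
      qed
      also have "\<dots> = ennreal (\<rho> powr c) * (\<integral>\<^sup>+y. ennreal (kern c \<tau> \<rho> y * y powr - (c + a * p - m)) \<partial>leb_pos)"
      proof (rule nn_integral_cmult)
        have [measurable]: "(\<lambda>y. kern c \<tau> \<rho> y) \<in> borel_measurable leb_pos" by (intro kern_measurable c) measurable
        show "(\<lambda>y. ennreal (kern c \<tau> \<rho> y * y powr - (c + a * p - m))) \<in> borel_measurable leb_pos" by measurable
      qed
      also have "\<dots> \<le> ennreal (\<rho> powr c) * ennreal (C2 * \<rho> powr - (c + a * p - m))"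
        by (intro mult_left_mono C2 \<tau> \<rho>) simp
      also have "\<dots> = ennreal (C2 * (\<rho> powr c * \<rho> powr - (c + a * p - m)))"
        by (simp add: ennreal_mult'[symmetric] mult_ac)
      also have "\<rho> powr c * \<rho> powr - (c + a * p - m) = \<rho> powr (m - a * p)"
        using \<rho> by (simp add: powr_add[symmetric])
      finally show "(\<integral>\<^sup>+y. ennreal (kern c \<tau> y \<rho> * y powr (m - a * p)) \<partial>leb_pos) \<le> ennreal (C2 * \<rho> powr (m - a * p))" .
    qed (use C1 C2 kern_nonneg[OF c] LpD(2)[OF f] in \<open>auto simp: Np_def\<close>)
    have "Np m p (\<lambda>y. TT c \<tau> f y) \<le> (\<integral>\<^sup>+y. ennreal (enn2real (\<integral>\<^sup>+\<rho>. ennreal (kern c \<tau> y \<rho> * norm (f \<rho>)) \<partial>leb_pos) powr p * y powr m) \<partial>leb_pos)"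
      unfolding Np_def
    proof (intro nn_integral_mono ennreal_leI mult_right_mono powr_mono2)
      fix y
      have "(\<integral>\<^sup>+\<rho>. ennreal (norm (kern c \<tau> y \<rho> *\<^sub>R f \<rho>)) \<partial>leb_pos) < \<infinity>"
        using kern_integrable[OF f \<tau>, of y] by (simp add: integrable_iff_bounded)
      from norm_integral_le_enn2real(2)[OF this]
      show "norm (TT c \<tau> f y) \<le> enn2real (\<integral>\<^sup>+\<rho>. ennreal (kern c \<tau> y \<rho> * norm (f \<rho>)) \<partial>leb_pos)"
        using kern_nonneg[OF c] by (simp add: TT_def)
    qed (use p in auto)
    also note sch
    finally show "Np m p (\<lambda>y. TT c \<tau> f y) \<le> ennreal (C1 powr (p - 1) * C2) * Np m p f"
      by (simp add: Np_def)
  qed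
qed

lemma TT_Lp: "f \<in> Lp m p \<Longrightarrow> \<tau> > 0 \<Longrightarrow> (\<lambda>y. TT c \<tau> f y) \<in> Lp m p"
proof -
  assume f: "f \<in> Lp m p" and \<tau>: "\<tau> > 0"
  obtain C where "Np m p (\<lambda>y. TT c \<tau> f y) \<le> ennreal C * Np m p f" using TT_bound f \<tau> by blast
  also have "\<dots> < \<infinity>" using LpD(2)[OF f] by (simp add: ennreal_mult_less_top)
  finally show ?thesis unfolding Lp_iff using TT_measurable[OF c LpD(1)[OF f], of "\<lambda>_. \<tau>" leb_pos "\<lambda>y. y"] by simp
qed

end

section \<open>Strong continuity at time zero\<close>

lemma ennreal_tendsto_0_iff:
  fixes F :: "'a \<Rightarrow> ennreal"
  shows "(F \<longlongrightarrow> 0) G \<longleftrightarrow> (\<forall>e>0. \<forall>\<^sub>F x in G. F x < ennreal e)"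
proof
  assume "(F \<longlongrightarrow> 0) G"
  then show "\<forall>e>0. \<forall>\<^sub>F x in G. F x < ennreal e" by (auto intro: order_tendstoD)
next
  assume *: "\<forall>e>0. \<forall>\<^sub>F x in G. F x < ennreal e"
  show "(F \<longlongrightarrow> 0) G"
  proof (rule order_tendstoI)
    fix a :: ennreal assume "0 < a"
    have "\<exists>e>0. ennreal e \<le> a"
    proof (cases a)
      case (real r)
      then show ?thesis using \<open>0 < a\<close> by (intro exI[of _ r]) auto
    qed (auto intro: exI[of _ 1])
    then obtain e where "e > 0" "ennreal e \<le> a" by blast
    then show "\<forall>\<^sub>F x in G. F x < a" using *[rule_format, of e] by (auto elim!: eventually_mono intro: less_le_trans)
  qed simp
qed

text \<open>Dominated convergence; the limit f is also bounded by g, so (2 |g|)^p is a majorant for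
  the p-th power of the difference.\<close>

lemma Np_dominated:
  assumes [measurable]: "\<And>n. F n \<in> borel_measurable leb_pos" "f \<in> borel_measurable leb_pos"
    and g: "g \<in> Lp m p" and p: "p > 0"
    and dom: "\<And>n. AE y in leb_pos. norm (F n y) \<le> norm (g y)"
    and lim: "AE y in leb_pos. (\<lambda>n. F n y) \<longlonglongrightarrow> f y"
  shows "(\<lambda>n. Np m p (\<lambda>y. F n y - f y)) \<longlonglongrightarrow> 0"
proof -
  note [measurable] = LpD(1)[OF g]
  have "(\<lambda>n. \<integral>\<^sup>+y. ennreal (norm (F n y - f y) powr p * y powr m) \<partial>leb_pos) \<longlonglongrightarrow> (\<integral>\<^sup>+y. 0 \<partial>leb_pos)"
  proof (rule nn_integral_dominated_convergence[where w = "\<lambda>y. ennreal (norm (2 * g y) powr p * y powr m)"])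
    have dom': "AE y in leb_pos. \<forall>n. norm (F n y) \<le> norm (g y)" using dom by (subst AE_all_countable) auto
    show "AE y in leb_pos. ennreal (norm (F n y - f y) powr p * y powr m) \<le> ennreal (norm (2 * g y) powr p * y powr m)" for n
      using dom' lim
    proof eventually_elim
      case (elim y)
      have "norm (f y) \<le> norm (g y)"
        by (rule LIMSEQ_le_const2[OF tendsto_norm[OF elim(2)]]) (use elim in auto)
      then have "norm (F n y - f y) \<le> norm (2 * g y)"
        using elim(1)[rule_format, of n] norm_triangle_ineq4[of "F n y" "f y"] by simp
      then show ?case using p by (intro ennreal_leI mult_right_mono powr_mono2) auto
    qed
    show "(\<integral>\<^sup>+y. ennreal (norm (2 * g y) powr p * y powr m) \<partial>leb_pos) < \<infinity>"
      using LpD(2)[OF Lp_cmult[OF g, of 2]] by (simp add: Np_def)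
    show "AE y in leb_pos. (\<lambda>n. ennreal (norm (F n y - f y) powr p * y powr m)) \<longlonglongrightarrow> 0"
      using lim
    proof eventually_elim
      case (elim y)
      have "(\<lambda>n. norm (F n y - f y)) \<longlonglongrightarrow> 0" using elim by (intro tendsto_norm_zero) (simp add: LIM_zero)
      then have "(\<lambda>n. norm (F n y - f y) powr p) \<longlonglongrightarrow> 0 powr p"
        using p by (intro tendsto_powr') auto
      then have "(\<lambda>n. norm (F n y - f y) powr p * y powr m) \<longlonglongrightarrow> 0 powr p * y powr m" by (rule tendsto_mult[OF _ tendsto_const])
      then have "(\<lambda>n. ennreal (norm (F n y - f y) powr p * y powr m)) \<longlonglongrightarrow> ennreal 0" using p by (intro tendsto_ennrealI) simp
      then show ?case by simp
    qed
  qed measurable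
  then show ?thesis by (simp add: Np_def)
qed

lemma Lp_bounded_supp:
  assumes [measurable]: "f \<in> borel_measurable leb_pos" and l: "0 < l" and B: "B \<ge> 0" and p: "p > 0"
    and f: "AE y in leb_pos. norm (f y) \<le> B * indicator {l..u} y"
  shows "f \<in> Lp m p"
proof -
  have "integrable leb_pos (\<lambda>y. indicator {l..u} y *\<^sub>R (B powr p * y powr m))"
    by (intro integrable_leb_pos_cont l continuous_intros) (use l in auto)
  then have "(\<integral>\<^sup>+y. ennreal (norm (indicator {l..u} y *\<^sub>R (B powr p * y powr m))) \<partial>leb_pos) < \<infinity>"
    by (simp add: integrable_iff_bounded)
  moreover have "Np m p f \<le> (\<integral>\<^sup>+y. ennreal (norm (indicator {l..u} y *\<^sub>R (B powr p * y powr m))) \<partial>leb_pos)"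
    unfolding Np_def
  proof (rule nn_integral_mono_AE, use f in eventually_elim)
    case (elim y)
    have "norm (f y) powr p \<le> (B * indicator {l..u} y) powr p" using elim p by (intro powr_mono2) auto
    also have "\<dots> = indicator {l..u} y * B powr p" using p by (auto simp: indicator_def)
    finally have "norm (f y) powr p * y powr m \<le> indicator {l..u} y * B powr p * y powr m" by (intro mult_right_mono) auto
    then show ?case by (intro ennreal_leI) (simp add: mult_ac abs_mult)
  qed
  ultimately show ?thesis by (simp add: Lp_iff)
qed

context bessel_weight
begin

lemma kern_LINT:
  assumes "\<tau> > 0" "y > 0"
  shows "integrable leb_pos (\<lambda>\<rho>. kern c \<tau> y \<rho>)" "(LINT \<rho>|leb_pos. kern c \<tau> y \<rho>) = 1"
proof -
  have [measurable]: "(\<lambda>\<rho>. kern c \<tau> y \<rho>) \<in> borel_measurable leb_pos" by (intro kern_measurable c) measurable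
  show "integrable leb_pos (\<lambda>\<rho>. kern c \<tau> y \<rho>)"
    by (rule integrableI_nonneg) (use kern_nonneg[OF c] kern_total[OF c assms] in auto)
  show "(LINT \<rho>|leb_pos. kern c \<tau> y \<rho>) = 1"
    by (subst integral_eq_nn_integral) (use kern_nonneg[OF c] kern_total[OF c assms] in auto)
qed

text \<open>Chebyshev's inequality in disguise: the hypothesis \<open>bd\<close> holds for bounded f
  that are constant near y, and the second moment of \<rho>^2 - y^2 tends to 0 with \<tau>.\<close>

lemma TT_pointwise:
  assumes [measurable]: "f \<in> borel_measurable leb_pos" and f: "f \<in> Lp m p" and y: "y > 0" and K: "K \<ge> 0"
    and bd: "\<And>\<rho>. \<rho> > 0 \<Longrightarrow> norm (f \<rho> - f y) \<le> K * (\<rho>\<^sup>2 - y\<^sup>2)\<^sup>2"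
  shows "((\<lambda>\<tau>. TT c \<tau> f y) \<longlongrightarrow> f y) (at_right 0)"
proof -
  define A where "A = (c + 1) / 2 * ((c + 1) / 2 + 1)"
  have est: "norm (TT c \<tau> f y - f y) \<le> K * (\<tau>\<^sup>2 * A + 2 * y\<^sup>2 * \<tau>)" if \<tau>: "\<tau> > 0" for \<tau>
  proof -
    have A0: "A \<ge> 0" using c by (simp add: A_def)
    have [measurable]: "(\<lambda>\<rho>. kern c \<tau> y \<rho>) \<in> borel_measurable leb_pos" by (intro kern_measurable c) measurable
    have "f y = (LINT \<rho>|leb_pos. kern c \<tau> y \<rho> *\<^sub>R f y)"
      using kern_LINT[OF \<tau> y] by simp
    then have "TT c \<tau> f y - f y = (LINT \<rho>|leb_pos. kern c \<tau> y \<rho> *\<^sub>R f \<rho>) - (LINT \<rho>|leb_pos. kern c \<tau> y \<rho> *\<^sub>R f y)"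
      by (simp add: TT_def)
    also have "\<dots> = (LINT \<rho>|leb_pos. kern c \<tau> y \<rho> *\<^sub>R (f \<rho> - f y))"
      unfolding scaleR_diff_right
      by (intro Bochner_Integration.integral_diff[symmetric] kern_integrable[OF f \<tau>] integrable_scaleR_left) (rule kern_LINT[OF \<tau> y])
    finally have "ennreal (norm (TT c \<tau> f y - f y)) \<le> (\<integral>\<^sup>+\<rho>. ennreal (norm (kern c \<tau> y \<rho> *\<^sub>R (f \<rho> - f y))) \<partial>leb_pos)"
      using norm_integral_le_enn2real(1) by metis
    also have "\<dots> \<le> (\<integral>\<^sup>+\<rho>. ennreal K * ennreal (kern c \<tau> y \<rho> * (\<rho>\<^sup>2 - y\<^sup>2)\<^sup>2) \<partial>leb_pos)"
    proof (intro nn_integral_mono)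
      fix \<rho> assume "\<rho> \<in> space leb_pos"
      then have "kern c \<tau> y \<rho> * norm (f \<rho> - f y) \<le> kern c \<tau> y \<rho> * (K * (\<rho>\<^sup>2 - y\<^sup>2)\<^sup>2)"
        using kern_nonneg[OF c] by (intro mult_left_mono bd) auto
      then show "ennreal (norm (kern c \<tau> y \<rho> *\<^sub>R (f \<rho> - f y))) \<le> ennreal K * ennreal (kern c \<tau> y \<rho> * (\<rho>\<^sup>2 - y\<^sup>2)\<^sup>2)"
        using K kern_nonneg[OF c, of \<tau> y \<rho>] by (simp add: ennreal_mult'[symmetric] ennreal_leI mult_ac)
    qed
    also have "\<dots> = ennreal K * ennreal (\<tau>\<^sup>2 * A + 2 * y\<^sup>2 * \<tau>)"
      unfolding A_def kern_second_moment[OF c \<tau> y, symmetric] by (rule nn_integral_cmult) measurable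
    also have "\<dots> = ennreal (K * (\<tau>\<^sup>2 * A + 2 * y\<^sup>2 * \<tau>))" using K by (simp add: ennreal_mult')
    finally show ?thesis using K A0 \<tau> by (subst (asm) ennreal_le_iff) auto
  qed
  have "((\<lambda>\<tau>. K * (\<tau>\<^sup>2 * A + 2 * y\<^sup>2 * \<tau>)) \<longlongrightarrow> K * (0\<^sup>2 * A + 2 * y\<^sup>2 * 0)) (at_right 0)"
    by (intro tendsto_intros)
  then have 0: "((\<lambda>\<tau>. K * (\<tau>\<^sup>2 * A + 2 * y\<^sup>2 * \<tau>)) \<longlongrightarrow> 0) (at_right 0)" by simp
  have "((\<lambda>\<tau>. TT c \<tau> f y - f y) \<longlongrightarrow> 0) (at_right 0)"
    by (rule Lim_null_comparison[OF _ 0]) (use est in \<open>auto intro: eventually_at_rightI[of 0 1]\<close>)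
  then show ?thesis by (rule LIM_zero_cancel)
qed

text \<open>A name for the claim, so that it can be propagated from intervals to Borel sets, simple
  functions and dominated limits.\<close>

definition strongly_cont :: "(real \<Rightarrow> complex) \<Rightarrow> bool" where
  "strongly_cont f \<longleftrightarrow> f \<in> Lp m p \<and> ((\<lambda>\<tau>. Np m p (\<lambda>y. TT c \<tau> f y - f y)) \<longlongrightarrow> 0) (at_right 0)"

lemma TT_meas: "f \<in> borel_measurable leb_pos \<Longrightarrow> (\<lambda>y. TT c \<tau> f y) \<in> borel_measurable leb_pos"
  by (rule TT_measurable[OF c]) auto

text \<open>T(\<tau>)f tends to f pointwise off the two end points; what has to be found is a
  majorant in L^p_m that is independent of \<tau>. Near 0 the bound 1 suffices, near infinity a
  moment bound gives a power of y.\<close>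

lemma strongly_cont_interval:
  assumes a: "0 < a" "a < b"
  shows "strongly_cont (\<lambda>y. of_real (indicator {a<..<b} y))"
proof -
  define f where "f y = complex_of_real (indicator {a<..<b} y)" for y
  have [measurable]: "f \<in> borel_measurable leb_pos" unfolding f_def by measurable
  have f: "f \<in> Lp m p"
    by (rule Lp_bounded_supp[of _ a 1 p b]) (use a p in \<open>auto simp: f_def indicator_def\<close>)
  \<comment> \<open>The upper bound on b2 makes the moment finite, the lower one puts y^(-b2) into
    L^p_m near infinity.\<close>
  obtain b2 where b2: "(m + 1) / p < b2" "b2 < c + 1" using dense[OF m1] by blast
  have b20: "b2 > 0" using b2 m0 by linarith
  obtain C where C: "C > 0" "\<And>\<tau> y. \<tau> > 0 \<Longrightarrow> y > 0 \<Longrightarrow> (\<integral>\<^sup>+\<rho>. ennreal (kern c \<tau> y \<rho> * \<rho> powr - b2) \<partial>leb_pos) \<le> ennreal (C * y powr - b2)"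
    using kern_powr_bound[OF c _ b2(2)] b20 by auto
  define K where "K = b powr b2 * C"
  have K: "K > 0" using a C by (simp add: K_def)
  define g where "g y = complex_of_real (if y \<le> 1 then 1 else K * y powr - b2)" for y
  have [measurable]: "g \<in> borel_measurable leb_pos" unfolding g_def by measurable
  have g: "g \<in> Lp m p"
  proof -
    have "Np m p g \<le> (\<integral>\<^sup>+y. ennreal (indicator {0<..1} y * y powr m) + ennreal (K powr p) * ennreal (indicator {1..} y * y powr (m - b2 * p)) \<partial>leb_pos)"
      unfolding Np_def
    proof (intro nn_integral_mono)
      fix y assume "y \<in> space leb_pos"
      then have y: "y > 0" by simp
      show "ennreal (norm (g y) powr p * y powr m) \<le> ennreal (indicator {0<..1} y * y powr m) + ennreal (K powr p) * ennreal (indicator {1..} y * y powr (m - b2 * p))"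
      proof (cases "y \<le> 1")
        case False
        have "norm (g y) powr p * y powr m = K powr p * (y powr (- b2 * p) * y powr m)"
        proof -
          have "norm (g y) = K * y powr - b2" unfolding g_def norm_of_real using False K by simp
          then show ?thesis using K by (simp add: powr_mult powr_powr)
        qed
        also have "y powr (- b2 * p) * y powr m = y powr (m - b2 * p)" by (simp add: powr_add[symmetric])
        finally show ?thesis using False by (simp add: ennreal_mult)
      qed (use y in \<open>simp add: g_def\<close>)
    qed
    also have "\<dots> = (\<integral>\<^sup>+y. ennreal (indicator {0<..1} y * y powr m) \<partial>leb_pos) + ennreal (K powr p) * (\<integral>\<^sup>+y. ennreal (indicator {1..} y * y powr (m - b2 * p)) \<partial>leb_pos)"
      by (simp add: nn_integral_add nn_integral_cmult)
    also have "\<dots> < \<infinity>"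
    proof -
      have "m - b2 * p < -1" using b2 p by (simp add: field_simps)
      then show ?thesis
        by (simp add: nn_integral_powr_below[OF m_gt] nn_integral_powr_above ennreal_mult_less_top)
    qed
    finally show ?thesis by (simp add: Lp_iff)
  qed
  have dom: "norm (TT c \<tau> f y) \<le> norm (g y)" if \<tau>: "\<tau> > 0" and y: "y > 0" for \<tau> y
  proof -
    have [measurable]: "(\<lambda>\<rho>. kern c \<tau> y \<rho>) \<in> borel_measurable leb_pos" by (intro kern_measurable c) measurable
    have n: "ennreal (norm (TT c \<tau> f y)) \<le> (\<integral>\<^sup>+\<rho>. ennreal (norm (kern c \<tau> y \<rho> *\<^sub>R f \<rho>)) \<partial>leb_pos)"
      unfolding TT_def by (rule norm_integral_le_enn2real(1))
    have "(\<integral>\<^sup>+\<rho>. ennreal (norm (kern c \<tau> y \<rho> *\<^sub>R f \<rho>)) \<partial>leb_pos) \<le> (\<integral>\<^sup>+\<rho>. ennreal (kern c \<tau> y \<rho>) \<partial>leb_pos)"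
      by (intro nn_integral_mono ennreal_leI) (use kern_nonneg[OF c] in \<open>auto simp: f_def indicator_def\<close>)
    with n have 1: "ennreal (norm (TT c \<tau> f y)) \<le> 1" unfolding kern_total[OF c \<tau> y] by (rule order_trans)
    have "(\<integral>\<^sup>+\<rho>. ennreal (norm (kern c \<tau> y \<rho> *\<^sub>R f \<rho>)) \<partial>leb_pos) \<le> (\<integral>\<^sup>+\<rho>. ennreal (b powr b2) * ennreal (kern c \<tau> y \<rho> * \<rho> powr - b2) \<partial>leb_pos)"
    proof (intro nn_integral_mono)
      fix \<rho> assume "\<rho> \<in> space leb_pos"
      then have \<rho>: "\<rho> > 0" by simp
      have "norm (f \<rho>) \<le> b powr b2 * \<rho> powr - b2"
      proof (cases "\<rho> \<in> {a<..<b}")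
        case True
        then have "\<rho> powr b2 \<le> b powr b2" using \<rho> b20 by (intro powr_mono2) auto
        then show ?thesis using True \<rho> by (simp add: f_def powr_minus field_simps)
      qed (use \<rho> in \<open>simp add: f_def\<close>)
      then have "kern c \<tau> y \<rho> * norm (f \<rho>) \<le> kern c \<tau> y \<rho> * (b powr b2 * \<rho> powr - b2)"
        by (intro mult_left_mono kern_nonneg c)
      then show "ennreal (norm (kern c \<tau> y \<rho> *\<^sub>R f \<rho>)) \<le> ennreal (b powr b2) * ennreal (kern c \<tau> y \<rho> * \<rho> powr - b2)"
        using kern_nonneg[OF c, of \<tau> y \<rho>] by (simp add: ennreal_mult'[symmetric] ennreal_leI mult_ac)
    qed
    also have "\<dots> = ennreal (b powr b2) * (\<integral>\<^sup>+\<rho>. ennreal (kern c \<tau> y \<rho> * \<rho> powr - b2) \<partial>leb_pos)"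
      by (rule nn_integral_cmult) measurable
    also have "\<dots> \<le> ennreal (b powr b2) * ennreal (C * y powr - b2)" by (intro mult_left_mono C \<tau> y) simp
    also have "\<dots> = ennreal (K * y powr - b2)" by (simp add: K_def ennreal_mult'[symmetric] mult_ac)
    finally have 2: "ennreal (norm (TT c \<tau> f y)) \<le> ennreal (K * y powr - b2)" using n by (rule order_trans[rotated])
    show ?thesis using 1 2 K by (auto simp: g_def abs_mult)
  qed
  have "((\<lambda>\<tau>. Np m p (\<lambda>y. TT c \<tau> f y - f y)) \<longlongrightarrow> 0) (at_right 0)"
  proof (rule tendsto_at_right_sequentially[of 0 1])
    fix S :: "nat \<Rightarrow> real" assume S: "\<And>n. 0 < S n" "S \<longlonglongrightarrow> 0"
    have Sf: "filterlim S (at_right 0) sequentially"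
    proof -
      have "S n \<noteq> 0" for n using S(1)[of n] by simp
      then show ?thesis unfolding filterlim_at using S by (auto intro!: always_eventually)
    qed
    show "(\<lambda>n. Np m p (\<lambda>y. TT c (S n) f y - f y)) \<longlonglongrightarrow> 0"
    proof (rule Np_dominated[OF _ _ g])
      show "(\<lambda>y. TT c (S n) f y) \<in> borel_measurable leb_pos" for n by (rule TT_meas) measurable
      show "AE y in leb_pos. norm (TT c (S n) f y) \<le> norm (g y)" for n
        using AE_leb_pos_gt by eventually_elim (rule dom[OF S(1)])
      show "AE y in leb_pos. (\<lambda>n. TT c (S n) f y) \<longlonglongrightarrow> f y"
        using AE_leb_pos_gt AE_leb_pos_neq[of a] AE_leb_pos_neq[of b]
      proof eventually_elim
        case (elim y)
        \<comment> \<open>f does not change as long as \<rho>^2 differs from y^2 by less than d, so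
          the jump of f is dominated by (\<rho>^2 - y^2)^2 / d^2.\<close>
        define d where "d = min \<bar>a\<^sup>2 - y\<^sup>2\<bar> \<bar>b\<^sup>2 - y\<^sup>2\<bar>"
        have "a\<^sup>2 \<noteq> y\<^sup>2" "b\<^sup>2 \<noteq> y\<^sup>2" using elim a by (auto simp: power2_eq_iff)
        then have d: "d > 0" by (auto simp: d_def)
        have "((\<lambda>\<tau>. TT c \<tau> f y) \<longlongrightarrow> f y) (at_right 0)"
        proof (rule TT_pointwise[OF _ f elim(1), of "1 / d\<^sup>2"])
          fix \<rho> :: real assume \<rho>: "\<rho> > 0"
          show "norm (f \<rho> - f y) \<le> 1 / d\<^sup>2 * (\<rho>\<^sup>2 - y\<^sup>2)\<^sup>2"
          proof (cases "indicator {a<..<b} \<rho> = (indicator {a<..<b} y :: real)")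
            case True
            then show ?thesis by (simp add: f_def)
          next
            case False
            have sq: "u\<^sup>2 \<le> v\<^sup>2" if "0 < u" "u \<le> v" for u v :: real using that by (intro power_mono) auto
            have dd: "d \<le> \<bar>a\<^sup>2 - y\<^sup>2\<bar>" "d \<le> \<bar>b\<^sup>2 - y\<^sup>2\<bar>" by (auto simp: d_def)
            have "d \<le> \<bar>\<rho>\<^sup>2 - y\<^sup>2\<bar>"
            proof (cases "y \<in> {a<..<b}")
              case True
              then have "\<rho> \<le> a \<or> b \<le> \<rho>" using False by (auto simp: indicator_def split: if_splits)
              then show ?thesis
              proof
                assume "\<rho> \<le> a"
                then have "\<rho>\<^sup>2 \<le> a\<^sup>2" "a\<^sup>2 \<le> y\<^sup>2" using True \<rho> a by (auto intro!: sq)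
                then show ?thesis using dd(1) by linarith
              next
                assume "b \<le> \<rho>"
                then have "b\<^sup>2 \<le> \<rho>\<^sup>2" "y\<^sup>2 \<le> b\<^sup>2" using True elim(1) a by (auto intro!: sq)
                then show ?thesis using dd(2) by linarith
              qed
            next
              case F: False
              then have "a < \<rho>" "\<rho> < b" "y \<le> a \<or> b \<le> y" using False by (auto simp: indicator_def split: if_splits)
              then have ab: "a\<^sup>2 \<le> \<rho>\<^sup>2" "\<rho>\<^sup>2 \<le> b\<^sup>2" using \<rho> a by (auto intro!: sq)
              from \<open>y \<le> a \<or> b \<le> y\<close> show ?thesis
              proof
                assume "y \<le> a"
                then have "y\<^sup>2 \<le> a\<^sup>2" using elim(1) by (intro sq) auto
                then show ?thesis using dd(1) ab by linarith
              next
                assume "b \<le> y"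
                then have "b\<^sup>2 \<le> y\<^sup>2" using a by (intro sq) auto
                then show ?thesis using dd(2) ab by linarith
              qed
            qed
            then have "d\<^sup>2 \<le> \<bar>\<rho>\<^sup>2 - y\<^sup>2\<bar>\<^sup>2" using d by (intro power_mono) auto
            then have "1 \<le> 1 / d\<^sup>2 * (\<rho>\<^sup>2 - y\<^sup>2)\<^sup>2" using d by (simp add: field_simps)
            moreover have "norm (f \<rho> - f y) \<le> 1" unfolding f_def of_real_diff[symmetric] norm_of_real by (auto simp: indicator_def)
            ultimately show ?thesis by linarith
          qed
        qed auto
        then show ?case using Sf by (rule filterlim_compose)
      qed
    qed (use p in auto)
  qed simp
  then show ?thesis using f unfolding strongly_cont_def f_def by simp
qed

text \<open>Split T f - f into T(f - h), T h - h and h - f; the first term is controlled uniformly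
  in \<tau> by \<open>TT_bound\<close>.\<close>

lemma strongly_cont_closed:
  assumes f: "f \<in> Lp m p" and appr: "\<And>e. e > 0 \<Longrightarrow> \<exists>h. strongly_cont h \<and> Np m p (\<lambda>y. h y - f y) < ennreal e"
  shows "strongly_cont f"
  unfolding strongly_cont_def
proof (intro conjI f, unfold ennreal_tendsto_0_iff, intro allI impI)
  obtain C where C: "C > 0" "\<And>\<tau> f. \<tau> > 0 \<Longrightarrow> f \<in> Lp m p \<Longrightarrow> Np m p (\<lambda>y. TT c \<tau> f y) \<le> ennreal C * Np m p f"
    using TT_bound by blast
  fix e :: real assume e: "e > 0"
  define P where "P = 2 powr p"
  have P: "P > 0" by (simp add: P_def)
  \<comment> \<open>The three parts add up to at most P (C + 2 P) d, where each addition costs a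
    factor P; the + 1 makes the final inequality strict.\<close>
  define d where "d = e / (P * (C + 2 * P) + 1)"
  have den: "P * (C + 2 * P) > 0" using P C(1) by (intro mult_pos_pos) auto
  have d: "d > 0" "P * (C + 2 * P) * d < e" using e den by (auto simp: d_def field_simps)
  obtain h where h: "strongly_cont h" "Np m p (\<lambda>y. h y - f y) < ennreal d" using appr[OF d(1)] by blast
  have hL: "h \<in> Lp m p" using h by (simp add: strongly_cont_def)
  have "\<forall>\<^sub>F \<tau> in at_right 0. Np m p (\<lambda>y. TT c \<tau> h y - h y) < ennreal d"
    using h(1) d(1) unfolding strongly_cont_def ennreal_tendsto_0_iff by blast
  then show "\<forall>\<^sub>F \<tau> in at_right 0. Np m p (\<lambda>y. TT c \<tau> f y - f y) < ennreal e"
    using eventually_at_right_less[of 0]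
  proof eventually_elim
    case (elim \<tau>)
    note [measurable] = LpD(1)[OF f] LpD(1)[OF hL] TT_meas[OF LpD(1)[OF f], of \<tau>] TT_meas[OF LpD(1)[OF hL], of \<tau>]
    have fh: "(\<lambda>y. f y - h y) \<in> Lp m p" using p by (intro Lp_diff f hL) auto
    note [measurable] = TT_meas[OF LpD(1)[OF fh], of \<tau>]
    have "Np m p (\<lambda>y. TT c \<tau> f y - f y) = Np m p (\<lambda>y. TT c \<tau> (\<lambda>y. f y - h y) y + ((TT c \<tau> h y - h y) + (h y - f y)))"
      by (intro arg_cong[where f = "Np m p"] ext) (simp add: TT_diff[OF f hL elim(2)])
    also have "\<dots> \<le> ennreal P * (Np m p (\<lambda>y. TT c \<tau> (\<lambda>y. f y - h y) y) + Np m p (\<lambda>y. (TT c \<tau> h y - h y) + (h y - f y)))"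
      unfolding P_def by (rule Np_add_le) (use p in auto)
    also have "\<dots> \<le> ennreal P * (ennreal C * ennreal d + ennreal P * (ennreal d + ennreal d))"
    proof (intro mult_left_mono add_mono)
      have "Np m p (\<lambda>y. TT c \<tau> (\<lambda>y. f y - h y) y) \<le> ennreal C * Np m p (\<lambda>y. f y - h y)" by (rule C(2)[OF elim(2) fh])
      also have "\<dots> \<le> ennreal C * ennreal d" using h(2) Np_minus_commute[of m p h f] by (intro mult_left_mono) auto
      finally show "Np m p (\<lambda>y. TT c \<tau> (\<lambda>y. f y - h y) y) \<le> ennreal C * ennreal d" .
      have "Np m p (\<lambda>y. (TT c \<tau> h y - h y) + (h y - f y)) \<le> ennreal P * (Np m p (\<lambda>y. TT c \<tau> h y - h y) + Np m p (\<lambda>y. h y - f y))"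
        unfolding P_def by (rule Np_add_le) (use p in auto)
      also have "\<dots> \<le> ennreal P * (ennreal d + ennreal d)" using h(2) elim(1) by (intro mult_left_mono add_mono) auto
      finally show "Np m p (\<lambda>y. (TT c \<tau> h y - h y) + (h y - f y)) \<le> ennreal P * (ennreal d + ennreal d)" .
    qed auto
    also have "\<dots> = ennreal (P * (C + 2 * P) * d)"
      using P C(1) d(1) by (simp add: ennreal_mult'[symmetric] ennreal_plus[symmetric] distrib_left mult_ac del: ennreal_plus)
    also have "\<dots> < ennreal e" using d(2) e by (simp add: ennreal_lessI)
    finally show ?case .
  qed
qed

lemma strongly_cont_add:
  assumes "strongly_cont f" "strongly_cont g"
  shows "strongly_cont (\<lambda>y. f y + g y)"
proof -
  have f: "f \<in> Lp m p" and g: "g \<in> Lp m p" using assms by (auto simp: strongly_cont_def)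
  note [measurable] = LpD(1)[OF f] LpD(1)[OF g]
  have "((\<lambda>\<tau>. ennreal (2 powr p) * (Np m p (\<lambda>y. TT c \<tau> f y - f y) + Np m p (\<lambda>y. TT c \<tau> g y - g y))) \<longlongrightarrow> ennreal (2 powr p) * (0 + 0)) (at_right 0)"
    using assms unfolding strongly_cont_def by (intro ennreal_tendsto_cmult tendsto_add) auto
  then have 0: "((\<lambda>\<tau>. ennreal (2 powr p) * (Np m p (\<lambda>y. TT c \<tau> f y - f y) + Np m p (\<lambda>y. TT c \<tau> g y - g y))) \<longlongrightarrow> 0) (at_right 0)" by simp
  have "((\<lambda>\<tau>. Np m p (\<lambda>y. TT c \<tau> (\<lambda>y. f y + g y) y - (f y + g y))) \<longlongrightarrow> 0) (at_right 0)"
  proof (rule tendsto_sandwich[OF _ _ tendsto_const 0])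
    show "\<forall>\<^sub>F \<tau> in at_right 0. Np m p (\<lambda>y. TT c \<tau> (\<lambda>y. f y + g y) y - (f y + g y)) \<le> ennreal (2 powr p) * (Np m p (\<lambda>y. TT c \<tau> f y - f y) + Np m p (\<lambda>y. TT c \<tau> g y - g y))"
      using eventually_at_right_less[of 0]
    proof eventually_elim
      case (elim \<tau>)
      note [measurable] = TT_meas[OF LpD(1)[OF f], of \<tau>] TT_meas[OF LpD(1)[OF g], of \<tau>]
      have "Np m p (\<lambda>y. TT c \<tau> (\<lambda>y. f y + g y) y - (f y + g y)) = Np m p (\<lambda>y. (TT c \<tau> f y - f y) + (TT c \<tau> g y - g y))"
        by (intro arg_cong[where f = "Np m p"] ext) (simp add: TT_add[OF f g elim])
      also have "\<dots> \<le> ennreal (2 powr p) * (Np m p (\<lambda>y. TT c \<tau> f y - f y) + Np m p (\<lambda>y. TT c \<tau> g y - g y))"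
        by (rule Np_add_le) (use p in auto)
      finally show ?case .
    qed
  qed simp
  then show ?thesis using Lp_add[OF f g] p by (simp add: strongly_cont_def)
qed

lemma strongly_cont_cmult:
  assumes "strongly_cont f"
  shows "strongly_cont (\<lambda>y. z * f y)"
proof -
  have f: "f \<in> Lp m p" using assms by (auto simp: strongly_cont_def)
  have "Np m p (\<lambda>y. TT c \<tau> (\<lambda>y. z * f y) y - z * f y) = ennreal (norm z powr p) * Np m p (\<lambda>y. TT c \<tau> f y - f y)" for \<tau>
  proof -
    note [measurable] = LpD(1)[OF f] TT_meas[OF LpD(1)[OF f], of \<tau>]
    show ?thesis unfolding TT_cmult right_diff_distrib[symmetric] by (rule Np_cmult) measurable
  qed
  moreover have "((\<lambda>\<tau>. ennreal (norm z powr p) * Np m p (\<lambda>y. TT c \<tau> f y - f y)) \<longlongrightarrow> ennreal (norm z powr p) * 0) (at_right 0)"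
    using assms unfolding strongly_cont_def by (intro ennreal_tendsto_cmult) auto
  ultimately show ?thesis using Lp_cmult[OF f] by (simp add: strongly_cont_def)
qed

lemma strongly_cont_sum: "(\<And>i. i \<in> I \<Longrightarrow> strongly_cont (f i)) \<Longrightarrow> strongly_cont (\<lambda>y. \<Sum>i\<in>I. f i y)"
proof (induction I rule: infinite_finite_induct)
  case (insert i I)
  then show ?case by (simp add: strongly_cont_add)
next
  have "strongly_cont (\<lambda>y. 0)" using strongly_cont_cmult[OF strongly_cont_interval[of 1 2], of 0] by simp
  then show "strongly_cont (\<lambda>y. \<Sum>i\<in>A. f i y)" if "infinite A" for A using that by simp
  show "strongly_cont (\<lambda>y. \<Sum>i\<in>{}. f i y)" using \<open>strongly_cont (\<lambda>y. 0)\<close> by simp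
qed

lemma strongly_cont_dominated:
  assumes F: "\<And>n. strongly_cont (F n)" and f: "f \<in> borel_measurable leb_pos" and g: "g \<in> Lp m p"
    and dom: "\<And>n. AE y in leb_pos. norm (F n y) \<le> norm (g y)" "AE y in leb_pos. norm (f y) \<le> norm (g y)"
    and lim: "AE y in leb_pos. (\<lambda>n. F n y) \<longlonglongrightarrow> f y"
  shows "strongly_cont f"
proof (rule strongly_cont_closed)
  show "f \<in> Lp m p" by (rule Lp_dom[OF g f dom(2)]) (use p in simp)
  have "(\<lambda>n. Np m p (\<lambda>y. F n y - f y)) \<longlonglongrightarrow> 0"
    by (rule Np_dominated[OF _ f g _ dom(1) lim]) (use F p in \<open>auto simp: strongly_cont_def dest: LpD\<close>)
  then show "\<exists>h. strongly_cont h \<and> Np m p (\<lambda>y. h y - f y) < ennreal e" if "e > 0" for e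
    using F that unfolding ennreal_tendsto_0_iff eventually_sequentially by blast
qed

lemma strongly_cont_cong_AE:
  assumes "strongly_cont f" "AE y in leb_pos. f y = g y"
  shows "strongly_cont g"
proof -
  have f: "f \<in> Lp m p" using assms by (simp add: strongly_cont_def)
  have g: "g \<in> Lp m p" by (rule Lp_cong_AE[OF f assms(2)])
  show ?thesis
    by (rule strongly_cont_dominated[OF assms(1) LpD(1)[OF g] g]) (use assms(2) in \<open>auto elim!: eventually_mono\<close>)
qed

lemma indicator_Lp:
  assumes "A \<in> sets leb_pos" "A \<subseteq> {l..u}" "0 < l"
  shows "(\<lambda>y. complex_of_real (indicator A y)) \<in> Lp m p"
  by (rule Lp_bounded_supp[of _ l 1 p u]) (use assms p in \<open>auto simp: indicator_def intro!: AE_I2\<close>)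

lemma Int_pos_sets: "A \<in> sets borel \<Longrightarrow> 0 < l \<Longrightarrow> A \<inter> {l<..<u} \<in> sets leb_pos" for l u :: real
  by (auto simp: sets_restrict_space_iff)

text \<open>Dynkin's argument inside a fixed interval (l, u) away from 0, where complements stay in
  L^p_m.\<close>

lemma strongly_cont_borel:
  assumes l: "0 < l" "l < u" and "A \<in> sets borel"
  shows "strongly_cont (\<lambda>y. of_real (indicator (A \<inter> {l<..<u}) y))"
proof -
  have sc0: "strongly_cont (\<lambda>y. 0)" using strongly_cont_cmult[OF strongly_cont_interval[OF l], of 0] by simp
  have gp: "range (\<lambda>(a::real, b). box a b) \<subseteq> Pow UNIV" by simp
  have st: "Int_stable (range (\<lambda>(a::real, b). box a b))"
  proof (rule Int_stableI_image)
    fix i j :: "real \<times> real"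
    show "\<exists>k\<in>UNIV. (case i of (a, b) \<Rightarrow> box a b) \<inter> (case j of (a, b) \<Rightarrow> box a b) = (case k of (a, b) \<Rightarrow> box a b)"
      by (intro bexI[of _ "(max (fst i) (fst j), min (snd i) (snd j))"]) (auto simp: box_real split: prod.splits)
  qed
  have bs: "sets borel = sigma_sets UNIV (range (\<lambda>(a::real, b). box a b))"
    by (subst borel_eq_box) simp
  have "A \<in> sigma_sets UNIV (range (\<lambda>(a::real, b). box a b))" using assms(3) bs by simp
  from st gp this show ?thesis
  proof (induction rule: sigma_sets_induct_disjoint)
    case (basic A)
    then obtain a b where A: "A = {a<..<b}" by (auto simp: box_real)
    have e: "A \<inter> {l<..<u} = {max a l<..<min b u}" by (auto simp: A)
    show ?case
    proof (cases "max a l < min b u")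
      case True
      then show ?thesis unfolding e using l by (intro strongly_cont_interval) auto
    next
      case False
      then have "A \<inter> {l<..<u} = {}" unfolding e by auto
      then show ?thesis using sc0 by simp
    qed
  next
    case empty
    show ?case using sc0 by simp
  next
    case (compl A)
    have "strongly_cont (\<lambda>y. of_real (indicator {l<..<u} y) + (- 1) * of_real (indicator (A \<inter> {l<..<u}) y))"
      by (intro strongly_cont_add strongly_cont_cmult strongly_cont_interval l compl)
    moreover have "(\<lambda>y. complex_of_real (indicator {l<..<u} y) + (- 1) * of_real (indicator (A \<inter> {l<..<u}) y)) = (\<lambda>y. of_real (indicator ((UNIV - A) \<inter> {l<..<u}) y))"
      by (auto simp: fun_eq_iff indicator_def)
    ultimately show ?case by simp
  next
    case (union A)
    then have A: "A i \<in> sets borel" for i using bs by auto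
    have U: "(\<Union>i. A i) \<in> sets borel" using A by auto
    define F where "F n y = (\<Sum>i<n. complex_of_real (indicator (A i \<inter> {l<..<u}) y))" for n y
    have sums: "(\<lambda>i. indicator (A i) y :: real) sums indicator (\<Union>i. A i) y" for y
      by (rule indicator_sums) (use union(1) in \<open>auto simp: disjoint_family_on_def\<close>)
    have F: "F n y = of_real ((\<Sum>i<n. indicator (A i) y) * indicator {l<..<u} y)" for n y
      unfolding F_def of_real_mult of_real_sum sum_distrib_right by (intro sum.cong) (auto simp: indicator_def)
    have le: "(\<Sum>i<n. indicator (A i) y) \<le> (1::real)" "(\<Sum>i<n. indicator (A i) y) \<ge> (0::real)" for n y
    proof -
      have "(\<Sum>i<n. indicator (A i) y) \<le> (\<Sum>i. indicator (A i) y :: real)"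
        by (rule sum_le_suminf[OF sums_summable[OF sums]]) auto
      also have "\<dots> = indicator (\<Union>i. A i) y" by (rule sums_unique[OF sums, symmetric])
      also have "\<dots> \<le> 1" by (rule indicator_le_1)
      finally show "(\<Sum>i<n. indicator (A i) y) \<le> (1::real)" .
      show "(\<Sum>i<n. indicator (A i) y) \<ge> (0::real)" by (rule sum_nonneg) simp
    qed
    show ?case
    proof (rule strongly_cont_dominated[where F = F])
      show "strongly_cont (F n)" for n unfolding F_def by (intro strongly_cont_sum union)
      have "(\<Union>i. A i) \<inter> {l<..<u} \<in> sets leb_pos" by (rule Int_pos_sets[OF U l(1)])
      then show "(\<lambda>y. complex_of_real (indicator ((\<Union>i. A i) \<inter> {l<..<u}) y)) \<in> borel_measurable leb_pos" by measurable
      show "(\<lambda>y. complex_of_real (indicator {l<..<u} y)) \<in> Lp m p"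
        using Int_pos_sets[of UNIV l u] l by (intro indicator_Lp[of _ l u]) auto
      show "AE y in leb_pos. norm (F n y) \<le> norm (complex_of_real (indicator {l<..<u} y))" for n
      proof (intro AE_I2)
        fix y
        have "\<bar>s * i\<bar> \<le> \<bar>i\<bar>" if "0 \<le> s" "s \<le> 1" for s i :: real
          using that by (simp add: abs_mult mult_left_le_one_le)
        from this[OF le(2) le(1)] show "norm (F n y) \<le> norm (complex_of_real (indicator {l<..<u} y))"
          unfolding F norm_of_real .
      qed
      show "AE y in leb_pos. norm (complex_of_real (indicator ((\<Union>i. A i) \<inter> {l<..<u}) y)) \<le> norm (complex_of_real (indicator {l<..<u} y))"
        by (auto simp: indicator_def)
      show "AE y in leb_pos. (\<lambda>n. F n y) \<longlonglongrightarrow> of_real (indicator ((\<Union>i. A i) \<inter> {l<..<u}) y)"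
      proof (intro AE_I2)
        fix y
        have "(\<lambda>n. F n y) \<longlonglongrightarrow> of_real (indicator (\<Union>i. A i) y * indicator {l<..<u} y)"
          unfolding F by (intro tendsto_intros sums[unfolded sums_def])
        then show "(\<lambda>n. F n y) \<longlonglongrightarrow> of_real (indicator ((\<Union>i. A i) \<inter> {l<..<u}) y)"
          by (simp add: indicator_inter_arith)
      qed
    qed
  qed
qed

lemma strongly_cont_set:
  assumes A: "A \<in> sets leb_pos" and L: "(\<lambda>y. complex_of_real (indicator A y)) \<in> Lp m p"
  shows "strongly_cont (\<lambda>y. of_real (indicator A y))"
proof -
  have "A \<in> sets lebesgue" "A \<subseteq> {0<..}" using A by (auto simp: sets_restrict_space_iff)
  then obtain S N N' where S: "A = S \<union> N" "N \<subseteq> N'" "N' \<in> null_sets lborel" "S \<in> sets lborel"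
    by (auto elim: sets_completionE)
  have "AE y in lborel. y \<notin> N'" by (rule AE_not_in[OF S(3)])
  then have "AE y in lebesgue. y \<notin> N'" by (rule AE_completion)
  then have ae: "AE y in leb_pos. y \<notin> N'" by (subst AE_restrict_space_iff) auto
  have SA: "S \<in> sets leb_pos" using S \<open>A \<subseteq> {0<..}\<close> by (auto simp: sets_restrict_space_iff)
  have "strongly_cont (\<lambda>y. of_real (indicator S y))"
  \<comment> \<open>Exhaustion by (1/(n+2), n+2), a nonempty interval already for n = 0.\<close>
  proof (rule strongly_cont_dominated[where F = "\<lambda>n y. of_real (indicator (S \<inter> {1 / real (n + 2)<..<real (n + 2)}) y)"])
    show "strongly_cont (\<lambda>y. complex_of_real (indicator (S \<inter> {1 / real (n + 2)<..<real (n + 2)}) y))" for n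
    proof (rule strongly_cont_borel)
      show "1 / real (n + 2) < real (n + 2)" by (rule less_trans[of _ 1]) auto
    qed (use S in auto)
    show "(\<lambda>y. complex_of_real (indicator S y)) \<in> borel_measurable leb_pos" using SA by measurable
    show "AE y in leb_pos. (\<lambda>n. complex_of_real (indicator (S \<inter> {1 / real (n + 2)<..<real (n + 2)}) y)) \<longlonglongrightarrow> of_real (indicator S y)"
      using AE_leb_pos_gt
    proof eventually_elim
      case (elim y)
      obtain n1 where n1: "1 / y < real n1" using reals_Archimedean2 by blast
      obtain n2 where n2: "y < real n2" using reals_Archimedean2 by blast
      have "complex_of_real (indicator (S \<inter> {1 / real (n + 2)<..<real (n + 2)}) y) = of_real (indicator S y)" if "n \<ge> max n1 n2" for n
      proof -
        have "1 / y < real (n + 2)" "y < real (n + 2)" using n1 n2 that by auto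
        then have "y \<in> {1 / real (n + 2)<..<real (n + 2)}" using elim by (auto simp: field_simps)
        then show ?thesis by (simp add: indicator_def)
      qed
      then show ?case by (intro tendsto_eventually) (auto simp: eventually_sequentially intro!: exI[of _ "max n1 n2"])
    qed
  qed (use S in \<open>auto intro!: L simp: indicator_def\<close>)
  then show ?thesis
    by (rule strongly_cont_cong_AE) (use ae in eventually_elim, use S in \<open>auto simp: indicator_def\<close>)
qed

lemma strongly_cont_simple:
  assumes s: "simple_function leb_pos s" and L: "s \<in> Lp m p"
  shows "strongly_cont (s :: real \<Rightarrow> complex)"
proof -
  define R where "R = s ` space leb_pos"
  have fin: "finite R" using s by (simp add: R_def simple_function_def)
  define A where "A z = s -` {z} \<inter> space leb_pos" for z
  have A: "A z \<in> sets leb_pos" for z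
    unfolding A_def by (rule simple_functionD[OF s])
  have t: "strongly_cont (\<lambda>y. z * of_real (indicator (A z) y))" for z
  \<comment> \<open>The level set of 0 may have infinite measure, but its summand vanishes; for z
    \<noteq> 0 the indicator of the level set is dominated by s / z.\<close>
  proof (cases "z = 0")
    case True
    then show ?thesis using strongly_cont_cmult[OF strongly_cont_interval[of 1 2], of 0] by simp
  next
    case False
    have [measurable]: "A z \<in> sets leb_pos" by (rule A)
    have "(\<lambda>y. complex_of_real (indicator (A z) y)) \<in> Lp m p"
    proof (rule Lp_dom[OF Lp_cmult[OF L, of "1 / z"]])
      show "AE y in leb_pos. norm (complex_of_real (indicator (A z) y)) \<le> norm (1 / z * s y)"
        using False by (auto simp: indicator_def A_def)
    qed (use p in auto)
    then show ?thesis by (intro strongly_cont_cmult strongly_cont_set A)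
  qed
  have "strongly_cont (\<lambda>y. \<Sum>z\<in>R. z * of_real (indicator (A z) y))" by (intro strongly_cont_sum t)
  moreover have "AE y in leb_pos. (\<Sum>z\<in>R. z * of_real (indicator (A z) y)) = s y"
  proof (intro AE_I2)
    fix y assume y: "y \<in> space leb_pos"
    have "(\<Sum>z\<in>R. z * of_real (indicator (A z) y)) = (\<Sum>z\<in>R. if z = s y then s y else 0)"
      using y by (intro sum.cong) (auto simp: A_def indicator_def)
    also have "\<dots> = s y" using fin y by (simp add: R_def)
    finally show "(\<Sum>z\<in>R. z * of_real (indicator (A z) y)) = s y" .
  qed
  ultimately show ?thesis by (rule strongly_cont_cong_AE)
qed

theorem strong_continuity:
  assumes f: "f \<in> Lp m p"
  shows "((\<lambda>\<tau>. Np m p (\<lambda>y. TT c \<tau> f y - f y)) \<longlongrightarrow> 0) (at_right 0)"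
proof -
  \<comment> \<open>The approximating simple functions come with the bound 2 |f|, which provides the
    majorant in L^p_m.\<close>
  obtain F where F: "\<And>i. simple_function leb_pos (F i)" "\<And>x. x \<in> space leb_pos \<Longrightarrow> (\<lambda>i. F i x) \<longlonglongrightarrow> f x"
    "\<And>i x. x \<in> space leb_pos \<Longrightarrow> dist (F i x) 0 \<le> 2 * dist (f x) 0"
    using borel_measurable_implies_sequence_metric[OF LpD(1)[OF f]] by blast
  have dom: "AE y in leb_pos. norm (F i y) \<le> norm (2 * f y)" for i
    using F(3) by (intro AE_I2) (simp add: norm_mult)
  have "strongly_cont f"
  proof (rule strongly_cont_dominated[OF strongly_cont_simple[OF F(1)] LpD(1)[OF f] Lp_cmult[OF f, of 2] dom])
    show "F n \<in> Lp m p" for n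
      by (rule Lp_dom[OF Lp_cmult[OF f, of 2] borel_measurable_simple_function[OF F(1)] dom]) (use p in simp)
    show "AE y in leb_pos. norm (f y) \<le> norm (2 * f y)" by (auto simp: norm_mult)
    show "AE y in leb_pos. (\<lambda>n. F n y) \<longlonglongrightarrow> f y" using F(2) by (intro AE_I2)
  qed
  then show ?thesis by (simp add: strongly_cont_def)
qed

end

section \<open>Strong solutions and the heat equation\<close>

lemma nn_integral_inverse_infinite:
  assumes "d > 0"
  shows "(\<integral>\<^sup>+x. ennreal (indicator {0<..d} x / x) \<partial>leb_pos) = \<infinity>"
    and "(\<integral>\<^sup>+x. ennreal (indicator {d..} x / x) \<partial>leb_pos) = \<infinity>"
proof -
  have top: "I = \<infinity>" if "\<And>\<eta>. \<eta> > 0 \<Longrightarrow> ennreal (1 / \<eta>) \<le> I" for I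
  proof (rule ccontr)
    assume "I \<noteq> \<infinity>"
    then obtain r where r: "I = ennreal r" "r \<ge> 0" by (cases I) auto
    then show False using that[of "1 / (r + 1)"] by (simp add: ennreal_le_iff)
  qed
  show "(\<integral>\<^sup>+x. ennreal (indicator {0<..d} x / x) \<partial>leb_pos) = \<infinity>"
  proof (rule top)
    fix \<eta> :: real assume \<eta>: "\<eta> > 0"
    \<comment> \<open>On (0, d] the function d^(-\<eta>) x^(\<eta> - 1) lies below 1/x, and its
      integral is 1/\<eta>, which is arbitrarily large.\<close>
    have "ennreal (1 / \<eta>) = ennreal (d powr - \<eta>) * (\<integral>\<^sup>+x. ennreal (indicator {0<..d} x * x powr (\<eta> - 1)) \<partial>leb_pos)"
      using \<eta> assms by (subst nn_integral_powr_below) (auto simp: ennreal_mult'[symmetric] powr_minus field_simps)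
    also have "\<dots> = (\<integral>\<^sup>+x. ennreal (d powr - \<eta>) * ennreal (indicator {0<..d} x * x powr (\<eta> - 1)) \<partial>leb_pos)"
      by (rule nn_integral_cmult[symmetric]) measurable
    also have "\<dots> \<le> (\<integral>\<^sup>+x. ennreal (indicator {0<..d} x / x) \<partial>leb_pos)"
    proof (rule nn_integral_mono)
      fix x assume "x \<in> space leb_pos"
      then have x: "x > 0" by simp
      have "d powr - \<eta> * (indicator {0<..d} x * x powr (\<eta> - 1)) \<le> indicator {0<..d} x / x"
      proof (cases "x \<le> d")
        case True
        have "d powr - \<eta> * x powr (\<eta> - 1) \<le> x powr - \<eta> * x powr (\<eta> - 1)"
          using x True \<eta> by (intro mult_right_mono powr_mono2') auto
        also have "\<dots> = x powr (- \<eta> + (\<eta> - 1))" by (rule powr_add[symmetric])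
        also have "\<dots> = 1 / x" using x by (simp add: powr_minus_divide)
        finally show ?thesis using True x by (simp add: indicator_def)
      qed simp
      then show "ennreal (d powr - \<eta>) * ennreal (indicator {0<..d} x * x powr (\<eta> - 1)) \<le> ennreal (indicator {0<..d} x / x)"
        by (simp add: ennreal_mult'[symmetric] ennreal_leI)
    qed
    finally show "ennreal (1 / \<eta>) \<le> (\<integral>\<^sup>+x. ennreal (indicator {0<..d} x / x) \<partial>leb_pos)" .
  qed
  show "(\<integral>\<^sup>+x. ennreal (indicator {d..} x / x) \<partial>leb_pos) = \<infinity>"
  proof (rule top)
    fix \<eta> :: real assume \<eta>: "\<eta> > 0"
    have "ennreal (1 / \<eta>) = ennreal (d powr \<eta>) * (\<integral>\<^sup>+x. ennreal (indicator {d..} x * x powr (- \<eta> - 1)) \<partial>leb_pos)"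
      using \<eta> assms by (subst nn_integral_powr_above) (auto simp: ennreal_mult'[symmetric] powr_minus field_simps)
    also have "\<dots> = (\<integral>\<^sup>+x. ennreal (d powr \<eta>) * ennreal (indicator {d..} x * x powr (- \<eta> - 1)) \<partial>leb_pos)"
      by (rule nn_integral_cmult[symmetric]) measurable
    also have "\<dots> \<le> (\<integral>\<^sup>+x. ennreal (indicator {d..} x / x) \<partial>leb_pos)"
    proof (rule nn_integral_mono)
      fix x assume "x \<in> space leb_pos"
      then have x: "x > 0" by simp
      have "d powr \<eta> * (indicator {d..} x * x powr (- \<eta> - 1)) \<le> indicator {d..} x / x"
      proof (cases "d \<le> x")
        case True
        have "d powr \<eta> * x powr (- \<eta> - 1) \<le> x powr \<eta> * x powr (- \<eta> - 1)"
          using x True \<eta> assms by (intro mult_right_mono powr_mono2) auto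
        also have "\<dots> = 1 / x" using x by (simp add: powr_add[symmetric] powr_minus_divide)
        finally show ?thesis using True x by (simp add: indicator_def)
      qed simp
      then show "ennreal (d powr \<eta>) * ennreal (indicator {d..} x * x powr (- \<eta> - 1)) \<le> ennreal (indicator {d..} x / x)"
        by (simp add: ennreal_mult'[symmetric] ennreal_leI)
    qed
    finally show "ennreal (1 / \<eta>) \<le> (\<integral>\<^sup>+x. ennreal (indicator {d..} x / x) \<partial>leb_pos)" .
  qed
qed

lemma integrable_small_points:
  fixes h :: "real \<Rightarrow> real"
  assumes h: "integrable leb_pos h" "\<And>x. h x \<ge> 0" and "e > 0" "d > 0"
  shows "\<exists>x. 0 < x \<and> x \<le> d \<and> x * h x < e" "\<exists>x\<ge>d. x * h x < e"
proof -
  have fin: "(\<integral>\<^sup>+x. ennreal (h x) \<partial>leb_pos) < \<infinity>" using h by (simp add: integrable_iff_bounded)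
  note [measurable] = borel_measurable_integrable[OF h(1)]
  have contr: False if S: "(\<integral>\<^sup>+x. ennreal (indicator S x / x) \<partial>leb_pos) = \<infinity>" "S \<in> sets leb_pos" "\<And>x. x \<in> S \<Longrightarrow> x * h x \<ge> e" for S
  proof -
    note [measurable] = S(2)
    have "(\<integral>\<^sup>+x. ennreal e * ennreal (indicator S x / x) \<partial>leb_pos) \<le> (\<integral>\<^sup>+x. ennreal (h x) \<partial>leb_pos)"
    proof (rule nn_integral_mono)
      fix x assume "x \<in> space leb_pos"
      then have "e * (indicator S x / x) \<le> h x" using S(3)[of x] h(2)[of x] by (cases "x \<in> S") (auto simp: field_simps)
      then show "ennreal e * ennreal (indicator S x / x) \<le> ennreal (h x)"
        using \<open>e > 0\<close> by (simp add: ennreal_mult'[symmetric] ennreal_leI)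
    qed
    moreover have "(\<integral>\<^sup>+x. ennreal e * ennreal (indicator S x / x) \<partial>leb_pos) = ennreal e * \<infinity>"
      unfolding S(1)[symmetric] by (rule nn_integral_cmult) measurable
    ultimately show False using fin \<open>e > 0\<close> by (simp add: ennreal_mult_top)
  qed
  from contr[OF nn_integral_inverse_infinite(1)[OF \<open>d > 0\<close>]] show "\<exists>x. 0 < x \<and> x \<le> d \<and> x * h x < e"
    by (force simp: sets_restrict_space_iff not_less)
  from contr[OF nn_integral_inverse_infinite(2)[OF \<open>d > 0\<close>]] show "\<exists>x\<ge>d. x * h x < e"
    using \<open>d > 0\<close> by (force simp: sets_restrict_space_iff not_less)
qed

text \<open>The flux y^c u' of a solution of Bu = g whose flux vanishes at the origin.\<close>

definition Gc :: "real \<Rightarrow> (real \<Rightarrow> complex) \<Rightarrow> real \<Rightarrow> complex" where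
  "Gc c g s = (LINT r|leb_pos. indicator {0<..s} r *\<^sub>R (r powr c *\<^sub>R g r))"

lemma continuous_on_FF: "a > 0 \<Longrightarrow> continuous_on S f \<Longrightarrow> continuous_on S (\<lambda>x. FF a (f x))"
  by (rule continuous_on_compose2[where g = "FF a" and t = UNIV])
     (auto intro!: continuous_at_imp_continuous_on DERIV_isCont[OF FF_deriv])

lemma heat_continuous_r:
  assumes "a > 0" "\<tau> > 0"
  shows "continuous_on S (\<lambda>\<rho>. heat_r a \<tau> y \<rho>)" "continuous_on S (\<lambda>\<rho>. heat_t a \<tau> y \<rho>)"
  unfolding heat_r_def heat_t_def using assms by (auto intro!: continuous_intros continuous_on_FF)

lemma heat_continuous_t:
  assumes "a > 0"
  shows "continuous_on {0<..} (\<lambda>\<tau>. heat_t a \<tau> y \<rho>)"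
  unfolding heat_t_def using assms by (auto intro!: continuous_intros continuous_on_FF)

lemma tendsto_iint_exhaust:
  fixes f :: "real \<Rightarrow> complex"
  assumes f: "integrable leb_pos f" and \<alpha>: "\<And>n. 0 < \<alpha> n" "\<And>n. \<alpha> n \<le> 1 / real (Suc n)" and \<beta>: "\<And>n. \<beta> n \<ge> real (Suc n)"
  shows "(\<lambda>n. iint (\<alpha> n) (\<beta> n) f) \<longlonglongrightarrow> integral\<^sup>L leb_pos f"
proof (rule integral_dominated_convergence[where w = "\<lambda>y. norm (f y)"])
  show "AE x in leb_pos. (\<lambda>n. indicator {\<alpha> n..\<beta> n} x *\<^sub>R f x) \<longlonglongrightarrow> f x"
    using AE_leb_pos_gt
  proof eventually_elim
    case (elim y)
    obtain n1 where n1: "1 / y < real n1" using reals_Archimedean2 by blast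
    obtain n2 where n2: "y < real n2" using reals_Archimedean2 by blast
    have "indicator {\<alpha> n..\<beta> n} y *\<^sub>R f y = f y" if "n \<ge> max n1 n2" for n
    proof -
      have "1 / y < real (Suc n)" "y < real (Suc n)" using n1 n2 that by auto
      then have "1 / real (Suc n) < y" using elim by (auto simp: field_simps)
      then have "y \<in> {\<alpha> n..\<beta> n}" using \<alpha>(2)[of n] \<beta>[of n] \<open>y < real (Suc n)\<close> by simp
      then show ?thesis by simp
    qed
    then show ?case by (intro tendsto_eventually) (auto simp: eventually_sequentially intro!: exI[of _ "max n1 n2"])
  qed
  show "AE x in leb_pos. norm (indicator {\<alpha> n..\<beta> n} x *\<^sub>R f x) \<le> norm (f x)" for n
    by (auto simp: indicator_def)
qed (use f in auto)

context bessel_weight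
begin

text \<open>On (0, x] the Gaussian exp(-r^2) is at least exp(-x^2), so
  \<open>gauss_integrable\<close> applies.\<close>

lemma powr_c_integrable:
  assumes g: "g \<in> Lp m p"
  shows "integrable leb_pos (\<lambda>r. indicator {0<..x} r *\<^sub>R (r powr c *\<^sub>R g r))"
proof -
  note [measurable] = LpD(1)[OF g]
  show ?thesis
  proof (rule Bochner_Integration.integrable_bound[OF integrable_scaleR_right[OF gauss_integrable[OF g zero_less_one], of "exp (x\<^sup>2)"]])
    show "AE r in leb_pos. norm (indicator {0<..x} r *\<^sub>R (r powr c *\<^sub>R g r)) \<le> norm (exp (x\<^sup>2) *\<^sub>R ((r powr c * exp (- 1 * r\<^sup>2)) *\<^sub>R g r))"
    proof (intro AE_I2)
      fix r assume "r \<in> space leb_pos"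
      then have r: "r > 0" by simp
      show "norm (indicator {0<..x} r *\<^sub>R (r powr c *\<^sub>R g r)) \<le> norm (exp (x\<^sup>2) *\<^sub>R ((r powr c * exp (- 1 * r\<^sup>2)) *\<^sub>R g r))"
      proof (cases "r \<le> x")
        case True
        have "r\<^sup>2 \<le> x\<^sup>2" using r True by (intro power_mono) auto
        then have "1 \<le> exp (x\<^sup>2) * exp (- r\<^sup>2)" by (simp add: exp_add[symmetric])
        then have "1 * (r powr c * norm (g r)) \<le> (exp (x\<^sup>2) * exp (- r\<^sup>2)) * (r powr c * norm (g r))"
          by (intro mult_right_mono) auto
        then show ?thesis using True r by (simp add: mult_ac)
      qed simp
    qed
  qed measurable
qed

lemma Gc_ac:
  assumes g: "g \<in> Lp m p"
  shows "ac (Gc c g) (\<lambda>r. r powr c *\<^sub>R g r)"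
  unfolding ac_def
proof (intro conjI allI impI)
  note [measurable] = LpD(1)[OF g]
  have i: "integrable leb_pos (\<lambda>r. indicator {a..b} r *\<^sub>R (r powr c *\<^sub>R g r))" if "0 < a" for a b
  proof (rule Bochner_Integration.integrable_bound[OF powr_c_integrable[OF g, of b]])
    show "AE x in leb_pos. norm (indicator {a..b} x *\<^sub>R (x powr c *\<^sub>R g x)) \<le> norm (indicator {0<..b} x *\<^sub>R (x powr c *\<^sub>R g x))"
      using that by (auto simp: indicator_def)
  qed measurable
  then show "loc_int (\<lambda>r. r powr c *\<^sub>R g r)" unfolding loc_int_def by simp
  fix a b :: real assume ab: "0 < a" "a \<le> b"
  have "Gc c g b - Gc c g a = (LINT r|leb_pos. indicator {0<..b} r *\<^sub>R (r powr c *\<^sub>R g r) - indicator {0<..a} r *\<^sub>R (r powr c *\<^sub>R g r))"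
    unfolding Gc_def by (rule Bochner_Integration.integral_diff[symmetric]) (rule powr_c_integrable[OF g])+
  also have "\<dots> = iint a b (\<lambda>r. r powr c *\<^sub>R g r)"
  proof (rule integral_cong_AE)
    show "AE r in leb_pos. indicator {0<..b} r *\<^sub>R (r powr c *\<^sub>R g r) - indicator {0<..a} r *\<^sub>R (r powr c *\<^sub>R g r) = indicator {a..b} r *\<^sub>R (r powr c *\<^sub>R g r)"
      using AE_leb_pos_neq[of a] AE_leb_pos_gt by eventually_elim (use ab in \<open>auto simp: indicator_def\<close>)
  qed measurable
  finally show "Gc c g b - Gc c g a = iint a b (\<lambda>r. r powr c *\<^sub>R g r)" .
qed

lemma Gc_tendsto_0:
  assumes g: "g \<in> Lp m p"
  shows "(Gc c g \<longlongrightarrow> 0) (at_right 0)"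
proof (rule tendsto_at_right_sequentially[of 0 1])
  note [measurable] = LpD(1)[OF g]
  fix S :: "nat \<Rightarrow> real" assume S: "\<And>n. 0 < S n" "\<And>n. S n < 1" "S \<longlonglongrightarrow> 0"
  have "(\<lambda>n. LINT r|leb_pos. indicator {0<..S n} r *\<^sub>R (r powr c *\<^sub>R g r)) \<longlonglongrightarrow> (LINT r|leb_pos. 0)"
  proof (rule integral_dominated_convergence[OF _ _ integrable_norm[OF powr_c_integrable[OF g, of 1]]])
    show "AE r in leb_pos. norm (indicator {0<..S n} r *\<^sub>R (r powr c *\<^sub>R g r)) \<le> norm (indicator {0<..1} r *\<^sub>R (r powr c *\<^sub>R g r))" for n
      using S(2)[of n] by (auto simp: indicator_def)
    show "AE r in leb_pos. (\<lambda>n. indicator {0<..S n} r *\<^sub>R (r powr c *\<^sub>R g r)) \<longlonglongrightarrow> 0"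
      using AE_leb_pos_gt
    proof eventually_elim
      case (elim r)
      have "\<forall>\<^sub>F n in sequentially. S n < r" using S(3) elim by (rule order_tendstoD)
      then have "\<forall>\<^sub>F n in sequentially. indicator {0<..S n} r *\<^sub>R (r powr c *\<^sub>R g r) = 0"
        by eventually_elim simp
      then show ?case by (rule tendsto_eventually)
    qed
  qed measurable
  then show "(\<lambda>n. Gc c g (S n)) \<longlonglongrightarrow> 0" by (simp add: Gc_def)
qed simp

text \<open>Growth at most Gaussian, at any rate d > 0, since exp(d s^2 - d r^2) \<ge> 1 for r \<le>
  s. In \<open>heat_weak\<close> d is half the rate of decay of the kernel.\<close>

lemma Gc_bound:
  assumes g: "g \<in> Lp m p" and d: "d > 0"
  shows "norm (Gc c g s) \<le> exp (d * s\<^sup>2) * (LINT r|leb_pos. norm ((r powr c * exp (- d * r\<^sup>2)) *\<^sub>R g r))"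
proof -
  note [measurable] = LpD(1)[OF g]
  have i: "integrable leb_pos (\<lambda>r. exp (d * s\<^sup>2) * norm ((r powr c * exp (- d * r\<^sup>2)) *\<^sub>R g r))"
    by (intro integrable_mult_right integrable_norm gauss_integrable[OF g d])
  have "norm (Gc c g s) \<le> (LINT r|leb_pos. norm (indicator {0<..s} r *\<^sub>R (r powr c *\<^sub>R g r)))"
    unfolding Gc_def by (rule integral_norm_bound)
  also have "\<dots> \<le> (LINT r|leb_pos. exp (d * s\<^sup>2) * norm ((r powr c * exp (- d * r\<^sup>2)) *\<^sub>R g r))"
  proof (rule integral_mono[OF integrable_norm[OF powr_c_integrable[OF g]] i])
    fix r assume "r \<in> space leb_pos"
    then have r: "r > 0" by simp
    show "norm (indicator {0<..s} r *\<^sub>R (r powr c *\<^sub>R g r)) \<le> exp (d * s\<^sup>2) * norm ((r powr c * exp (- d * r\<^sup>2)) *\<^sub>R g r)"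
    proof (cases "r \<le> s")
      case True
      have "d * r\<^sup>2 \<le> d * s\<^sup>2" using r True d by (intro mult_left_mono power_mono) auto
      then have "1 \<le> exp (d * s\<^sup>2) * exp (- d * r\<^sup>2)" by (simp add: exp_add[symmetric])
      then have "1 * (r powr c * norm (g r)) \<le> (exp (d * s\<^sup>2) * exp (- d * r\<^sup>2)) * (r powr c * norm (g r))"
        by (intro mult_right_mono) auto
      then show ?thesis using True r by (simp add: mult_ac)
    qed simp
  qed
  finally show ?thesis by simp
qed

end

text \<open>Absorbs the polynomial factor 1 + \<rho>^2 of the time derivative into part of the
  Gaussian.\<close>

lemma one_plus_le_exp:
  fixes x K :: real
  assumes "x \<ge> 0" "K > 0"
  shows "1 + x \<le> (1 + K) * exp (x / K)"
proof -
  have "1 + x \<le> (1 + K) * (1 + x / K)" using assms by (simp add: field_simps)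
  also have "\<dots> \<le> (1 + K) * exp (x / K)" using assms by (intro mult_left_mono exp_ge_add_one_self) auto
  finally show ?thesis .
qed

context bessel_weight
begin

text \<open>\<open>y\<^sup>c u' = \<integral>\<^sub>0\<^sup>y s\<^sup>c g ds\<close>: besides \<open>Bu = g\<close>, this excludes the singular
  solution \<open>u' = y\<^sup>-\<^sup>c\<close> of the homogeneous equation.\<close>

definition strong_sol :: "(real \<Rightarrow> complex) \<Rightarrow> (real \<Rightarrow> complex) \<Rightarrow> bool" where
  "strong_sol u g \<longleftrightarrow> u \<in> Lp m p \<and> g \<in> Lp m p \<and> ac u (\<lambda>s. s powr - c *\<^sub>R Gc c g s)"

abbreviation aa :: real where "aa \<equiv> (c + 1) / 2"

lemma aa: "aa > 0" "c = 2 * aa - 1" using c by (auto simp: field_simps)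

text \<open>Green's formula on [\<alpha>, \<beta>]. The first integration by parts moves a
  derivative from the kernel to u, the second from the kernel to \<open>Gc c g\<close>, whose
  density is \<rho>^c g.\<close>

lemma heat_flux:
  assumes sol: "strong_sol u g" and s: "s > 0" and ab: "0 < \<alpha>" "\<alpha> \<le> \<beta>"
  shows "iint \<alpha> \<beta> (\<lambda>\<rho>. (4 * \<rho> powr c * heat_t aa s y \<rho>) *\<^sub>R u \<rho>) - iint \<alpha> \<beta> (\<lambda>\<rho>. (\<rho> powr c * heat aa s y \<rho>) *\<^sub>R g \<rho>)
     = ((\<beta> powr c * heat_r aa s y \<beta>) *\<^sub>R u \<beta> - heat aa s y \<beta> *\<^sub>R Gc c g \<beta>) - ((\<alpha> powr c * heat_r aa s y \<alpha>) *\<^sub>R u \<alpha> - heat aa s y \<alpha> *\<^sub>R Gc c g \<alpha>)"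
proof -
  have u: "ac u (\<lambda>s. s powr - c *\<^sub>R Gc c g s)" and g: "g \<in> Lp m p" using sol by (auto simp: strong_sol_def)
  have 1: "iint \<alpha> \<beta> (\<lambda>\<rho>. (4 * \<rho> powr c * heat_t aa s y \<rho>) *\<^sub>R u \<rho>) =
     (\<beta> powr c * heat_r aa s y \<beta>) *\<^sub>R u \<beta> - (\<alpha> powr c * heat_r aa s y \<alpha>) *\<^sub>R u \<alpha> - iint \<alpha> \<beta> (\<lambda>\<rho>. (\<rho> powr c * heat_r aa s y \<rho>) *\<^sub>R (\<rho> powr - c *\<^sub>R Gc c g \<rho>))"
  proof (rule ac_by_parts[OF u ab])
    show "((\<lambda>\<rho>. \<rho> powr c * heat_r aa s y \<rho>) has_real_derivative 4 * x powr c * heat_t aa s y x) (at x)" if "x \<in> {\<alpha>..\<beta>}" for x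
      by (rule heat_equation[OF s aa]) (use that ab in auto)
    show "continuous_on {\<alpha>..\<beta>} (\<lambda>\<rho>. 4 * \<rho> powr c * heat_t aa s y \<rho>)"
      using ab by (intro continuous_intros heat_continuous_r aa s) auto
  qed
  have 2: "iint \<alpha> \<beta> (\<lambda>\<rho>. (\<rho> powr c * heat_r aa s y \<rho>) *\<^sub>R (\<rho> powr - c *\<^sub>R Gc c g \<rho>)) = iint \<alpha> \<beta> (\<lambda>\<rho>. heat_r aa s y \<rho> *\<^sub>R Gc c g \<rho>)"
    by (rule Bochner_Integration.integral_cong) (auto simp: powr_minus)
  have 3: "iint \<alpha> \<beta> (\<lambda>\<rho>. heat_r aa s y \<rho> *\<^sub>R Gc c g \<rho>) = heat aa s y \<beta> *\<^sub>R Gc c g \<beta> - heat aa s y \<alpha> *\<^sub>R Gc c g \<alpha> - iint \<alpha> \<beta> (\<lambda>\<rho>. heat aa s y \<rho> *\<^sub>R (\<rho> powr c *\<^sub>R g \<rho>))"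
    by (rule ac_by_parts[OF Gc_ac[OF g] ab heat_deriv_r[OF s aa(1)] heat_continuous_r(1)[OF aa(1) s]])
  have 4: "iint \<alpha> \<beta> (\<lambda>\<rho>. heat aa s y \<rho> *\<^sub>R (\<rho> powr c *\<^sub>R g \<rho>)) = iint \<alpha> \<beta> (\<lambda>\<rho>. (\<rho> powr c * heat aa s y \<rho>) *\<^sub>R g \<rho>)"
    by (simp add: mult_ac)
  have alg: "X - Y = (p - v) - (q - w)" if "X = p - q - Z" "Z = v - w - Y" for X Y Z p q v w :: complex
    using that by simp
  show ?thesis by (rule alg[OF 1[unfolded 2] 3[unfolded 4]])
qed

text \<open>A majorant independent of s, integrable by \<open>gauss_integrable\<close>; half of the
  decay rate 1/(2 \<tau>2) is spent on the factor 1 + \<rho>^2.\<close>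

lemma heat_integrable:
  assumes f: "f \<in> Lp m p" and \<tau>: "\<tau>1 > 0" "\<tau>1 \<le> \<tau>2"
  obtains C where "C > 0" "\<And>s \<rho>. \<tau>1 \<le> s \<Longrightarrow> s \<le> \<tau>2 \<Longrightarrow> \<rho> > 0 \<Longrightarrow> norm ((4 * \<rho> powr c * heat_t aa s y \<rho>) *\<^sub>R f \<rho>) \<le> C * norm ((\<rho> powr c * exp (- (1 / (4 * \<tau>2)) * \<rho>\<^sup>2)) *\<^sub>R f \<rho>)"
    "\<And>s \<rho>. \<tau>1 \<le> s \<Longrightarrow> s \<le> \<tau>2 \<Longrightarrow> \<rho> > 0 \<Longrightarrow> norm ((\<rho> powr c * heat aa s y \<rho>) *\<^sub>R f \<rho>) \<le> C * norm ((\<rho> powr c * exp (- (1 / (4 * \<tau>2)) * \<rho>\<^sup>2)) *\<^sub>R f \<rho>)"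
proof -
  obtain C where C: "C > 0" and Cb: "\<And>s \<rho>. \<tau>1 \<le> s \<Longrightarrow> s \<le> \<tau>2 \<Longrightarrow> \<rho> \<ge> 0 \<Longrightarrow>
    heat aa s y \<rho> \<le> C * exp (- \<rho>\<^sup>2 / (2 * \<tau>2)) \<and> \<bar>heat_t aa s y \<rho>\<bar> \<le> C * (1 + \<rho>\<^sup>2) * exp (- \<rho>\<^sup>2 / (2 * \<tau>2))"
    using heat_bounds[OF aa(1) \<tau>, of y] by blast
  have t2: "\<tau>2 > 0" using \<tau> by linarith
  define L where "L = C * (1 + 4 * \<tau>2)"
  have L: "L > 0" "C \<le> L" unfolding L_def using C t2 by (auto intro!: mult_pos_pos add_pos_pos)
  define K where "K = 4 * L"
  show thesis
  proof (rule that)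
    show "K > 0" using L by (simp add: K_def)
    fix s \<rho> :: real assume s: "\<tau>1 \<le> s" "s \<le> \<tau>2" "\<rho> > 0"
    define E where "E = exp (- (1 / (4 * \<tau>2)) * \<rho>\<^sup>2)"
    have e: "exp (\<rho>\<^sup>2 / (4 * \<tau>2)) * exp (- \<rho>\<^sup>2 / (2 * \<tau>2)) = E"
      unfolding E_def exp_add[symmetric] using t2 by (simp add: field_simps)
    have e1: "exp (- \<rho>\<^sup>2 / (2 * \<tau>2)) \<le> E" unfolding E_def using t2 by (simp add: field_simps)
    have "\<bar>heat_t aa s y \<rho>\<bar> \<le> C * (1 + \<rho>\<^sup>2) * exp (- \<rho>\<^sup>2 / (2 * \<tau>2))" using Cb[of s \<rho>] s by auto
    also have "\<dots> \<le> C * ((1 + 4 * \<tau>2) * exp (\<rho>\<^sup>2 / (4 * \<tau>2))) * exp (- \<rho>\<^sup>2 / (2 * \<tau>2))"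
      using C t2 by (intro mult_right_mono mult_left_mono one_plus_le_exp) auto
    also have "\<dots> = L * E" unfolding e[symmetric] L_def by simp
    finally have "4 * \<rho> powr c * \<bar>heat_t aa s y \<rho>\<bar> * norm (f \<rho>) \<le> 4 * \<rho> powr c * (L * E) * norm (f \<rho>)"
      by (intro mult_right_mono mult_left_mono) auto
    then show "norm ((4 * \<rho> powr c * heat_t aa s y \<rho>) *\<^sub>R f \<rho>) \<le> K * norm ((\<rho> powr c * exp (- (1 / (4 * \<tau>2)) * \<rho>\<^sup>2)) *\<^sub>R f \<rho>)"
      unfolding E_def[symmetric] by (simp add: abs_mult K_def E_def mult_ac)
    have "heat aa s y \<rho> \<le> C * exp (- \<rho>\<^sup>2 / (2 * \<tau>2))" using Cb[of s \<rho>] s by auto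
    also have "\<dots> \<le> C * E" using C e1 by (intro mult_left_mono) auto
    also have "C * E \<le> K * E" unfolding K_def using L by (intro mult_right_mono) (auto simp: E_def)
    finally have "\<rho> powr c * heat aa s y \<rho> * norm (f \<rho>) \<le> \<rho> powr c * (K * E) * norm (f \<rho>)"
      by (intro mult_right_mono mult_left_mono) auto
    then show "norm ((\<rho> powr c * heat aa s y \<rho>) *\<^sub>R f \<rho>) \<le> K * norm ((\<rho> powr c * exp (- (1 / (4 * \<tau>2)) * \<rho>\<^sup>2)) *\<^sub>R f \<rho>)"
      unfolding E_def[symmetric] using heat_nonneg[OF aa(1), of s y \<rho>] by (simp add: abs_mult E_def mult_ac)
  qed
qed

lemma heat_measurable [measurable (raw)]:
  assumes [measurable]: "f \<in> borel_measurable M" "g \<in> borel_measurable M" "h \<in> borel_measurable M"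
  shows "(\<lambda>x. heat aa (f x) (g x) (h x)) \<in> borel_measurable M" "(\<lambda>x. heat_t aa (f x) (g x) (h x)) \<in> borel_measurable M"
proof -
  have [measurable]: "FF aa \<in> borel_measurable borel" "FF (aa + 1) \<in> borel_measurable borel" using aa(1) by (intro FF_measurable; linarith)+
  show "(\<lambda>x. heat aa (f x) (g x) (h x)) \<in> borel_measurable M" "(\<lambda>x. heat_t aa (f x) (g x) (h x)) \<in> borel_measurable M"
    unfolding heat_def heat_t_def by measurable
qed

text \<open>The boundary terms vanish along suitable sequences tending to 0 and to infinity.\<close>

lemma heat_weak:
  assumes sol: "strong_sol u g" and s: "s > 0"
  shows "(LINT \<rho>|leb_pos. (4 * \<rho> powr c * heat_t aa s y \<rho>) *\<^sub>R u \<rho>) = (LINT \<rho>|leb_pos. (\<rho> powr c * heat aa s y \<rho>) *\<^sub>R g \<rho>)"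
proof -
  have u: "u \<in> Lp m p" and g: "g \<in> Lp m p" using sol by (auto simp: strong_sol_def)
  note [measurable] = LpD(1)[OF u] LpD(1)[OF g]
  define d where "d = 1 / (4 * s)"
  have d: "d > 0" using s by (simp add: d_def)
  have i1: "integrable leb_pos (\<lambda>\<rho>. (4 * \<rho> powr c * heat_t aa s y \<rho>) *\<^sub>R u \<rho>)"
  proof -
    obtain C where C: "C > 0" "\<And>\<rho>. \<rho> > 0 \<Longrightarrow> norm ((4 * \<rho> powr c * heat_t aa s y \<rho>) *\<^sub>R u \<rho>) \<le> C * norm ((\<rho> powr c * exp (- d * \<rho>\<^sup>2)) *\<^sub>R u \<rho>)"
      using heat_integrable[OF u s order_refl, of y] unfolding d_def by (metis order_refl)
    show ?thesis
      by (rule Bochner_Integration.integrable_bound[OF integrable_mult_right[OF integrable_norm[OF gauss_integrable[OF u d]], of C]])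
         (measurable, use C in \<open>auto simp: abs_mult intro!: AE_I2\<close>)
  qed
  have i2: "integrable leb_pos (\<lambda>\<rho>. (\<rho> powr c * heat aa s y \<rho>) *\<^sub>R g \<rho>)"
  proof -
    obtain C where C: "C > 0" "\<And>\<rho>. \<rho> > 0 \<Longrightarrow> norm ((\<rho> powr c * heat aa s y \<rho>) *\<^sub>R g \<rho>) \<le> C * norm ((\<rho> powr c * exp (- d * \<rho>\<^sup>2)) *\<^sub>R g \<rho>)"
      using heat_integrable[OF g s order_refl, of y] unfolding d_def by (metis order_refl)
    show ?thesis
      by (rule Bochner_Integration.integrable_bound[OF integrable_mult_right[OF integrable_norm[OF gauss_integrable[OF g d]], of C]])
         (measurable, use C in \<open>auto simp: abs_mult intro!: AE_I2\<close>)
  qed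
  obtain C where C: "C > 0" and Cb: "\<And>\<rho>. \<rho> \<ge> 0 \<Longrightarrow> heat aa s y \<rho> \<le> C * exp (- \<rho>\<^sup>2 / (2 * s))" "\<And>\<rho>. \<rho> \<ge> 0 \<Longrightarrow> \<bar>heat_r aa s y \<rho>\<bar> \<le> C * \<rho> * exp (- \<rho>\<^sup>2 / (2 * s))"
    using heat_bounds[OF aa(1) s order_refl, of y] by (meson order_refl)
  define W where "W \<rho> = (\<rho> powr c * heat_r aa s y \<rho>) *\<^sub>R u \<rho> - heat aa s y \<rho> *\<^sub>R Gc c g \<rho>" for \<rho>
  \<comment> \<open>The factor \<rho> in the bound for \<open>heat_r\<close> makes the part of the
    boundary term that contains u at most C \<rho> h(\<rho>) with h integrable, the form handled by
    \<open>integrable_small_points\<close>.\<close>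
  define h where "h \<rho> = norm ((\<rho> powr c * exp (- (2 * d) * \<rho>\<^sup>2)) *\<^sub>R u \<rho>)" for \<rho>
  have h: "integrable leb_pos h" unfolding h_def by (intro integrable_norm gauss_integrable[OF u]) (use d in simp)
  have Wb: "norm (W \<rho>) \<le> C * (\<rho> * h \<rho>) + C * exp (- \<rho>\<^sup>2 / (2 * s)) * norm (Gc c g \<rho>)" if \<rho>: "\<rho> > 0" for \<rho>
  proof -
    have "norm (W \<rho>) \<le> \<rho> powr c * \<bar>heat_r aa s y \<rho>\<bar> * norm (u \<rho>) + heat aa s y \<rho> * norm (Gc c g \<rho>)"
      unfolding W_def using norm_triangle_ineq4 heat_nonneg[OF aa(1), of s y \<rho>] by (metis (no_types, lifting) abs_mult abs_of_nonneg norm_scaleR powr_ge_zero)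
    also have "\<dots> \<le> \<rho> powr c * (C * \<rho> * exp (- \<rho>\<^sup>2 / (2 * s))) * norm (u \<rho>) + C * exp (- \<rho>\<^sup>2 / (2 * s)) * norm (Gc c g \<rho>)"
      using Cb[of \<rho>] \<rho> by (intro add_mono mult_right_mono mult_left_mono) auto
    also have "\<rho> powr c * (C * \<rho> * exp (- \<rho>\<^sup>2 / (2 * s))) * norm (u \<rho>) = C * (\<rho> * h \<rho>)"
      by (simp add: h_def abs_mult d_def)
    finally show ?thesis .
  qed
  \<comment> \<open>Near 0 the second part of the boundary term is small because
    \<open>Gc c g\<close> tends to 0 there.\<close>
  have "\<exists>\<alpha>>0. \<alpha> \<le> 1 / real (Suc n) \<and> norm (W \<alpha>) \<le> 2 * C * (1 / real (Suc n))" for n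
  proof -
    define e where "e = 1 / real (Suc n)"
    have e: "e > 0" by (simp add: e_def)
    have "\<forall>\<^sub>F x in at_right 0. dist (Gc c g x) 0 < e" using Gc_tendsto_0[OF g] e by (rule tendstoD)
    then obtain b where b: "b > 0" "\<And>x. 0 < x \<Longrightarrow> x < b \<Longrightarrow> norm (Gc c g x) < e" by (auto simp: eventually_at_right_field)
    obtain \<alpha> where \<alpha>: "0 < \<alpha>" "\<alpha> \<le> min e (b / 2)" "\<alpha> * h \<alpha> < e"
      using integrable_small_points(1)[OF h _ e, of "min e (b / 2)"] e b(1) by (auto simp: h_def)
    have "norm (W \<alpha>) \<le> C * (\<alpha> * h \<alpha>) + C * exp (- \<alpha>\<^sup>2 / (2 * s)) * norm (Gc c g \<alpha>)" by (rule Wb[OF \<alpha>(1)])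
    also have "\<dots> \<le> C * e + C * 1 * e"
      using C \<alpha> b s by (intro add_mono mult_mono mult_left_mono) (auto intro!: less_imp_le[OF b(2)] divide_nonneg_nonneg)
    finally show ?thesis using \<alpha> unfolding e_def[symmetric] by (intro exI[of _ \<alpha>]) auto
  qed
  then obtain \<alpha> where \<alpha>: "\<And>n. \<alpha> n > 0" "\<And>n. \<alpha> n \<le> 1 / real (Suc n)" "\<And>n. norm (W (\<alpha> n)) \<le> 2 * C * (1 / real (Suc n))" by metis
  define B where "B = (LINT r|leb_pos. norm ((r powr c * exp (- d * r\<^sup>2)) *\<^sub>R g r))"
  have B: "B \<ge> 0" unfolding B_def by (intro integral_nonneg_AE) auto
  \<comment> \<open>Near infinity the kernel decays like exp(-2 d \<beta>^2) against the growth
    exp(d \<beta>^2) of \<open>Gc c g\<close>, and exp(-d \<beta>^2) \<le> 1/(d \<beta>).\<close>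
  have "\<exists>\<beta>\<ge>real (Suc n). norm (W \<beta>) \<le> (C + C * (B / d)) * (1 / real (Suc n))" for n
  proof -
    define e where "e = 1 / real (Suc n)"
    have e: "e > 0" by (simp add: e_def)
    obtain \<beta> where \<beta>: "\<beta> \<ge> real (Suc n)" "\<beta> * h \<beta> < e"
      using integrable_small_points(2)[OF h _ e, of "real (Suc n)"] by (auto simp: h_def)
    have \<beta>1: "\<beta> \<ge> 1" using \<beta>(1) by simp
    have "exp (- \<beta>\<^sup>2 / (2 * s)) * norm (Gc c g \<beta>) \<le> exp (- \<beta>\<^sup>2 / (2 * s)) * (exp (d * \<beta>\<^sup>2) * B)"
      unfolding B_def by (intro mult_left_mono Gc_bound g d) simp
    also have "\<dots> = exp (- d * \<beta>\<^sup>2) * B"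
      unfolding mult.assoc[symmetric] exp_add[symmetric] d_def using s by (simp add: field_simps)
    also have "exp (- d * \<beta>\<^sup>2) \<le> 1 / d * e"
    proof -
      have "d * \<beta> \<le> d * \<beta>\<^sup>2" using d \<beta>1 by (intro mult_left_mono) (auto simp: power2_eq_square)
      also have "\<dots> \<le> exp (d * \<beta>\<^sup>2)" using exp_ge_add_one_self[of "d * \<beta>\<^sup>2"] by linarith
      finally have "d * \<beta> \<le> exp (d * \<beta>\<^sup>2)" .
      then have "exp (- d * \<beta>\<^sup>2) \<le> 1 / (d * \<beta>)" using d \<beta>1 by (simp add: exp_minus field_simps)
      also have "\<dots> \<le> 1 / (d * real (Suc n))" using d \<beta> by (intro divide_left_mono mult_left_mono mult_pos_pos) auto
      finally show ?thesis by (simp add: e_def)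
    qed
    finally have "exp (- \<beta>\<^sup>2 / (2 * s)) * norm (Gc c g \<beta>) \<le> 1 / d * e * B" using B by (simp add: mult_right_mono)
    then have "C * (exp (- \<beta>\<^sup>2 / (2 * s)) * norm (Gc c g \<beta>)) \<le> C * (1 / d * e * B)" using C by (intro mult_left_mono) auto
    moreover have "C * (\<beta> * h \<beta>) \<le> C * e" using C \<beta> by (intro mult_left_mono) auto
    ultimately have "norm (W \<beta>) \<le> C * e + C * (1 / d * e * B)" using Wb[of \<beta>] \<beta>1 by (simp add: mult.assoc)
    also have "\<dots> = (C + C * (B / d)) * e" by (simp add: distrib_right)
    finally show ?thesis using \<beta> unfolding e_def[symmetric] by (intro exI[of _ \<beta>]) auto
  qed
  then obtain \<beta> where \<beta>: "\<And>n. \<beta> n \<ge> real (Suc n)" "\<And>n. norm (W (\<beta> n)) \<le> (C + C * (B / d)) * (1 / real (Suc n))" by metis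
  have lim0: "(\<lambda>n. K * (1 / real (Suc n))) \<longlonglongrightarrow> 0" for K
    using tendsto_mult[OF tendsto_const[of K] LIMSEQ_inverse_real_of_nat] by (simp add: inverse_eq_divide)
  have W\<alpha>: "(\<lambda>n. W (\<alpha> n)) \<longlonglongrightarrow> 0" by (rule Lim_null_comparison[OF always_eventually[OF allI[OF \<alpha>(3)]] lim0])
  have W\<beta>: "(\<lambda>n. W (\<beta> n)) \<longlonglongrightarrow> 0" by (rule Lim_null_comparison[OF always_eventually[OF allI[OF \<beta>(2)]] lim0])
  have ab: "\<alpha> n \<le> \<beta> n" for n
  proof -
    have "\<alpha> n \<le> 1 / real (Suc n)" by (rule \<alpha>)
    also have "\<dots> \<le> 1" by simp
    also have "\<dots> \<le> real (Suc n)" by simp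
    also have "\<dots> \<le> \<beta> n" by (rule \<beta>)
    finally show ?thesis .
  qed
  have "(\<lambda>n. iint (\<alpha> n) (\<beta> n) (\<lambda>\<rho>. (4 * \<rho> powr c * heat_t aa s y \<rho>) *\<^sub>R u \<rho>) - iint (\<alpha> n) (\<beta> n) (\<lambda>\<rho>. (\<rho> powr c * heat aa s y \<rho>) *\<^sub>R g \<rho>)) \<longlonglongrightarrow>
    (LINT \<rho>|leb_pos. (4 * \<rho> powr c * heat_t aa s y \<rho>) *\<^sub>R u \<rho>) - (LINT \<rho>|leb_pos. (\<rho> powr c * heat aa s y \<rho>) *\<^sub>R g \<rho>)"
    by (intro tendsto_diff tendsto_iint_exhaust i1 i2 \<alpha> \<beta>)
  moreover have "(\<lambda>n. W (\<beta> n) - W (\<alpha> n)) \<longlonglongrightarrow> 0 - 0" by (intro tendsto_diff W\<alpha> W\<beta>)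
  moreover have "iint (\<alpha> n) (\<beta> n) (\<lambda>\<rho>. (4 * \<rho> powr c * heat_t aa s y \<rho>) *\<^sub>R u \<rho>) - iint (\<alpha> n) (\<beta> n) (\<lambda>\<rho>. (\<rho> powr c * heat aa s y \<rho>) *\<^sub>R g \<rho>) = W (\<beta> n) - W (\<alpha> n)" for n
    unfolding W_def by (rule heat_flux[OF sol s \<alpha>(1) ab])
  ultimately have "(LINT \<rho>|leb_pos. (4 * \<rho> powr c * heat_t aa s y \<rho>) *\<^sub>R u \<rho>) - (LINT \<rho>|leb_pos. (\<rho> powr c * heat aa s y \<rho>) *\<^sub>R g \<rho>) = 0 - 0"
    by (simp only:) (rule LIMSEQ_unique)
  then show ?thesis by simp
qed

text \<open>The factor 1/4 comes from the time scale \<open>\<tau> = 4t\<close>.\<close>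

lemma TT_increment:
  assumes sol: "strong_sol u g" and \<tau>: "0 < \<tau>1" "\<tau>1 \<le> \<tau>2"
  shows "TT c \<tau>2 u y - TT c \<tau>1 u y = (1 / 4) *\<^sub>R (LINT s|leb_pos. indicator {\<tau>1..\<tau>2} s *\<^sub>R TT c s g y)"
proof -
  have u: "u \<in> Lp m p" and g: "g \<in> Lp m p" using sol by (auto simp: strong_sol_def)
  note [measurable] = LpD(1)[OF u] LpD(1)[OF g]
  have t2: "\<tau>2 > 0" using \<tau> by linarith
  define d where "d = 1 / (4 * \<tau>2)"
  have d: "d > 0" using t2 by (simp add: d_def)
  obtain C where C: "C > 0" "\<And>s \<rho>. \<tau>1 \<le> s \<Longrightarrow> s \<le> \<tau>2 \<Longrightarrow> \<rho> > 0 \<Longrightarrow> norm ((4 * \<rho> powr c * heat_t aa s y \<rho>) *\<^sub>R u \<rho>) \<le> C * norm ((\<rho> powr c * exp (- d * \<rho>\<^sup>2)) *\<^sub>R u \<rho>)"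
    using heat_integrable[OF u \<tau>, of y] unfolding d_def by metis
  \<comment> \<open>The derivative of the kernel in \<tau>, times u. Integrated first in s it gives
    the increment of the kernel, integrated first in \<rho> it gives a quarter of
    \<open>TT c s g y\<close> by \<open>heat_weak\<close>.\<close>
  define k where "k s \<rho> = indicator {\<tau>1..\<tau>2} s *\<^sub>R ((2 * \<rho> powr c * heat_t aa s y \<rho>) *\<^sub>R u \<rho>)" for s \<rho>
  have km: "case_prod k \<in> borel_measurable (leb_pos \<Otimes>\<^sub>M leb_pos)" unfolding k_def by measurable
  have ii: "integrable leb_pos (\<lambda>s. C * indicator {\<tau>1..\<tau>2} s)"
    using integrable_leb_pos_cont[OF \<tau>(1), of \<tau>2 "\<lambda>_. C"] by (simp add: mult.commute)
  have k: "integrable (leb_pos \<Otimes>\<^sub>M leb_pos) (case_prod k)"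
  proof (rule Bochner_Integration.integrable_bound[OF integrable_pair_prod[OF ii gauss_integrable[OF u d]] km])
    show "AE x in leb_pos \<Otimes>\<^sub>M leb_pos. norm (case_prod k x) \<le> norm (case x of (s, \<rho>) \<Rightarrow> (C * indicator {\<tau>1..\<tau>2} s) *\<^sub>R ((\<rho> powr c * exp (- d * \<rho>\<^sup>2)) *\<^sub>R u \<rho>))"
    proof (intro AE_I2)
      fix x assume "x \<in> space (leb_pos \<Otimes>\<^sub>M leb_pos)"
      then obtain s \<rho> where x: "x = (s, \<rho>)" "s > 0" "\<rho> > 0" by (auto simp: space_pair_measure)
      show "norm (case_prod k x) \<le> norm (case x of (s, \<rho>) \<Rightarrow> (C * indicator {\<tau>1..\<tau>2} s) *\<^sub>R ((\<rho> powr c * exp (- d * \<rho>\<^sup>2)) *\<^sub>R u \<rho>))"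
      proof (cases "s \<in> {\<tau>1..\<tau>2}")
        case True
        have "norm (k s \<rho>) \<le> norm ((4 * \<rho> powr c * heat_t aa s y \<rho>) *\<^sub>R u \<rho>)"
          using True by (simp add: k_def abs_mult mult_right_mono)
        also have "\<dots> \<le> C * norm ((\<rho> powr c * exp (- d * \<rho>\<^sup>2)) *\<^sub>R u \<rho>)" using True x by (intro C) auto
        finally show ?thesis using True C(1) by (simp add: x abs_mult)
      qed (simp add: x k_def)
    qed
  qed
  have k1: "(LINT \<rho>|leb_pos. k s \<rho>) = (1 / 4) *\<^sub>R (indicator {\<tau>1..\<tau>2} s *\<^sub>R TT c s g y)" for s
  proof (cases "s \<in> {\<tau>1..\<tau>2}")
    case True
    then have s: "s > 0" using \<tau> by auto
    have "(LINT \<rho>|leb_pos. k s \<rho>) = (LINT \<rho>|leb_pos. (1 / 2) *\<^sub>R ((4 * \<rho> powr c * heat_t aa s y \<rho>) *\<^sub>R u \<rho>))"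
      by (rule Bochner_Integration.integral_cong) (use True in \<open>auto simp: k_def\<close>)
    also have "\<dots> = (1 / 2) *\<^sub>R (LINT \<rho>|leb_pos. (\<rho> powr c * heat aa s y \<rho>) *\<^sub>R g \<rho>)"
      unfolding heat_weak[OF sol s, symmetric] by (rule integral_scaleR_right)
    also have "\<dots> = (1 / 4) *\<^sub>R (2 *\<^sub>R (LINT \<rho>|leb_pos. (\<rho> powr c * heat aa s y \<rho>) *\<^sub>R g \<rho>))" by simp
    also have "2 *\<^sub>R (LINT \<rho>|leb_pos. (\<rho> powr c * heat aa s y \<rho>) *\<^sub>R g \<rho>) = TT c s g y"
      unfolding TT_def kern_def integral_scaleR_right[symmetric] by (simp add: mult.assoc)
    finally show ?thesis using True by simp
  next
    case False
    then have "k s = (\<lambda>\<rho>. 0)" by (auto simp: k_def)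
    then show ?thesis using False by simp
  qed
  have k2: "(LINT s|leb_pos. k s \<rho>) = (kern c \<tau>2 y \<rho> - kern c \<tau>1 y \<rho>) *\<^sub>R u \<rho>" for \<rho>
  proof -
    have ct: "continuous_on {\<tau>1..\<tau>2} (\<lambda>s. heat_t aa s y \<rho>)"
      by (rule continuous_on_subset[OF heat_continuous_t[OF aa(1)]]) (use \<tau> in auto)
    have "(LINT s|leb_pos. k s \<rho>) = (LINT s|leb_pos. (indicator {\<tau>1..\<tau>2} s *\<^sub>R heat_t aa s y \<rho>) *\<^sub>R ((2 * \<rho> powr c) *\<^sub>R u \<rho>))"
      unfolding k_def by (simp add: mult_ac)
    also have "\<dots> = iint \<tau>1 \<tau>2 (\<lambda>s. heat_t aa s y \<rho>) *\<^sub>R ((2 * \<rho> powr c) *\<^sub>R u \<rho>)"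
      by (rule integral_scaleR_left[OF integrable_leb_pos_cont[OF \<tau>(1) ct]])
    also have "iint \<tau>1 \<tau>2 (\<lambda>s. heat_t aa s y \<rho>) = heat aa \<tau>2 y \<rho> - heat aa \<tau>1 y \<rho>"
      by (rule iint_FTC[OF \<tau> heat_deriv_t ct]) (use \<tau> aa in auto)
    finally show ?thesis by (simp add: kern_def algebra_simps)
  qed
  have "TT c \<tau>2 u y - TT c \<tau>1 u y = (LINT \<rho>|leb_pos. (kern c \<tau>2 y \<rho> - kern c \<tau>1 y \<rho>) *\<^sub>R u \<rho>)"
    unfolding TT_def scaleR_diff_left
    by (rule Bochner_Integration.integral_diff[symmetric]) (rule kern_integrable[OF u]; use \<tau> t2 in simp)+
  also have "\<dots> = (LINT s|leb_pos. (1 / 4) *\<^sub>R (indicator {\<tau>1..\<tau>2} s *\<^sub>R TT c s g y))"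
    using leb_pos2.Fubini_integral[OF k] unfolding k1 k2 by simp
  also have "\<dots> = (1 / 4) *\<^sub>R (LINT s|leb_pos. indicator {\<tau>1..\<tau>2} s *\<^sub>R TT c s g y)"
    by (rule integral_scaleR_right)
  finally show ?thesis .
qed

end

text \<open>Jensen's inequality, proved as Hoelder against the constant 1. The average is normalised
  by \<tau> although the interval has length \<tau> - \<epsilon>; replacing the length by \<tau>
  only enlarges the bound.\<close>

lemma jensen_interval:
  fixes h :: "real \<Rightarrow> complex"
  assumes pq: "p > 1" "q > 1" "1 / p + 1 / q = 1" and [measurable]: "h \<in> borel_measurable leb_pos" and \<tau>: "0 < \<epsilon>" "\<epsilon> \<le> \<tau>"
  shows "ennreal (norm ((1 / \<tau>) *\<^sub>R iint \<epsilon> \<tau> h) powr p) \<le> ennreal (1 / \<tau>) * (\<integral>\<^sup>+s. ennreal (indicator {\<epsilon>..\<tau>} s * norm (h s) powr p) \<partial>leb_pos)"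
proof (cases "(\<integral>\<^sup>+s. ennreal (indicator {\<epsilon>..\<tau>} s * norm (h s) powr p) \<partial>leb_pos)")
  case (real J)
  have t: "\<tau> > 0" using \<tau> by linarith
  have H1: "(\<integral>\<^sup>+s. ennreal ((indicator {\<epsilon>..\<tau>} s * norm (h s)) * indicator {\<epsilon>..\<tau>} s) \<partial>leb_pos) \<le> ennreal (J powr (1 / p) * \<tau> powr (1 / q))"
  proof (rule nn_integral_Holder[OF pq])
    have "(\<integral>\<^sup>+s. ennreal ((indicator {\<epsilon>..\<tau>} s * norm (h s)) powr p) \<partial>leb_pos) = (\<integral>\<^sup>+s. ennreal (indicator {\<epsilon>..\<tau>} s * norm (h s) powr p) \<partial>leb_pos)"
      using pq by (intro nn_integral_cong) (auto simp: indicator_def)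
    then show "(\<integral>\<^sup>+s. ennreal ((indicator {\<epsilon>..\<tau>} s * norm (h s)) powr p) \<partial>leb_pos) \<le> ennreal J" using real by simp
    have "(\<integral>\<^sup>+s. ennreal (indicator {\<epsilon>..\<tau>} s powr q) \<partial>leb_pos) \<le> (\<integral>\<^sup>+s. ennreal (indicator {0<..\<tau>} s * s powr 0) \<partial>leb_pos)"
      using \<tau> pq by (intro nn_integral_mono) (auto simp: indicator_def)
    also have "\<dots> = ennreal \<tau>" using t by (subst nn_integral_powr_below) auto
    finally show "(\<integral>\<^sup>+s. ennreal (indicator {\<epsilon>..\<tau>} s powr q) \<partial>leb_pos) \<le> ennreal \<tau>" .
  qed (use real t in auto)
  have H2: "(\<integral>\<^sup>+s. ennreal ((indicator {\<epsilon>..\<tau>} s * norm (h s)) * indicator {\<epsilon>..\<tau>} s) \<partial>leb_pos) = (\<integral>\<^sup>+s. ennreal (norm (indicator {\<epsilon>..\<tau>} s *\<^sub>R h s)) \<partial>leb_pos)"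
    by (intro nn_integral_cong) (auto simp: indicator_def)
  have H3: "ennreal (norm (iint \<epsilon> \<tau> h)) \<le> (\<integral>\<^sup>+s. ennreal (norm (indicator {\<epsilon>..\<tau>} s *\<^sub>R h s)) \<partial>leb_pos)"
    by (rule norm_integral_le_enn2real)
  have "ennreal (norm (iint \<epsilon> \<tau> h)) \<le> ennreal (J powr (1 / p) * \<tau> powr (1 / q))"
    by (rule order_trans[OF H3 H1[unfolded H2]])
  then have "norm (iint \<epsilon> \<tau> h) \<le> J powr (1 / p) * \<tau> powr (1 / q)" by (subst (asm) ennreal_le_iff) auto
  then have "norm ((1 / \<tau>) *\<^sub>R iint \<epsilon> \<tau> h) \<le> (1 / \<tau>) * (J powr (1 / p) * \<tau> powr (1 / q))"
    using t by (simp add: divide_right_mono)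
  then have "norm ((1 / \<tau>) *\<^sub>R iint \<epsilon> \<tau> h) powr p \<le> ((1 / \<tau>) * (J powr (1 / p) * \<tau> powr (1 / q))) powr p"
    using pq by (intro powr_mono2) auto
  also have "\<dots> = (1 / \<tau>) powr p * (J * \<tau> powr (p / q))"
    using pq t real by (simp add: powr_mult powr_powr powr_divide)
  also have "p / q = p - 1" using pq by (simp add: field_simps)
  also have "(1 / \<tau>) powr p * (J * \<tau> powr (p - 1)) = (1 / \<tau>) * J"
    using t by (simp add: powr_divide powr_diff)
  finally show ?thesis using real t by (simp add: ennreal_mult'[symmetric] ennreal_leI)
next
  case top
  have "\<tau> > 0" using \<tau> by linarith
  then show ?thesis unfolding top by (simp add: ennreal_mult_top)
qed

section \<open>Convergence of the difference quotient\<close>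

context bessel_weight
begin

lemma TT_integrable_time:
  assumes g: "g \<in> Lp m p" and \<tau>: "0 < \<tau>1" "\<tau>1 \<le> \<tau>2"
  shows "integrable leb_pos (\<lambda>s. indicator {\<tau>1..\<tau>2} s *\<^sub>R TT c s g y)"
proof -
  note [measurable] = LpD(1)[OF g]
  have [measurable]: "(\<lambda>s. TT c s g y) \<in> borel_measurable leb_pos" by (rule TT_measurable[OF c]) auto
  define d where "d = 1 / (4 * \<tau>2)"
  have t2: "\<tau>2 > 0" using \<tau> by linarith
  have d: "d > 0" using t2 by (simp add: d_def)
  obtain C where C: "C > 0" "\<And>s \<rho>. \<tau>1 \<le> s \<Longrightarrow> s \<le> \<tau>2 \<Longrightarrow> \<rho> > 0 \<Longrightarrow> norm ((\<rho> powr c * heat aa s y \<rho>) *\<^sub>R g \<rho>) \<le> C * norm ((\<rho> powr c * exp (- d * \<rho>\<^sup>2)) *\<^sub>R g \<rho>)"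
    using heat_integrable[OF g \<tau>, of y] unfolding d_def by metis
  define B where "B = (LINT \<rho>|leb_pos. 2 * (C * norm ((\<rho> powr c * exp (- d * \<rho>\<^sup>2)) *\<^sub>R g \<rho>)))"
  have b: "norm (TT c s g y) \<le> B" if s: "s \<in> {\<tau>1..\<tau>2}" for s
  proof -
    have s0: "s > 0" using s \<tau> by auto
    have "norm (TT c s g y) \<le> (LINT \<rho>|leb_pos. norm (kern c s y \<rho> *\<^sub>R g \<rho>))" unfolding TT_def by (rule integral_norm_bound)
    also have "\<dots> \<le> B" unfolding B_def
    proof (rule integral_mono[OF integrable_norm[OF kern_integrable[OF g s0]]])
      show "integrable leb_pos (\<lambda>\<rho>. 2 * (C * norm ((\<rho> powr c * exp (- d * \<rho>\<^sup>2)) *\<^sub>R g \<rho>)))"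
        by (intro integrable_mult_right integrable_norm gauss_integrable[OF g d])
      fix \<rho> assume "\<rho> \<in> space leb_pos"
      then have \<rho>: "\<rho> > 0" by simp
      have "norm (kern c s y \<rho> *\<^sub>R g \<rho>) = 2 * norm ((\<rho> powr c * heat aa s y \<rho>) *\<^sub>R g \<rho>)"
        by (simp add: kern_def abs_mult)
      also have "\<dots> \<le> 2 * (C * norm ((\<rho> powr c * exp (- d * \<rho>\<^sup>2)) *\<^sub>R g \<rho>))"
        using C(2)[of s \<rho>] s \<rho> by (intro mult_left_mono) auto
      finally show "norm (kern c s y \<rho> *\<^sub>R g \<rho>) \<le> 2 * (C * norm ((\<rho> powr c * exp (- d * \<rho>\<^sup>2)) *\<^sub>R g \<rho>))" .
    qed
    finally show ?thesis .
  qed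
  show ?thesis
  proof (rule Bochner_Integration.integrable_bound[OF integrable_leb_pos_cont[OF \<tau>(1), of \<tau>2 "\<lambda>_. B"]])
    show "AE s in leb_pos. norm (indicator {\<tau>1..\<tau>2} s *\<^sub>R TT c s g y) \<le> norm (indicator {\<tau>1..\<tau>2} s *\<^sub>R B)"
      using b by (intro AE_I2) (auto simp: indicator_def intro: order_trans[OF _ abs_ge_self])
  qed (auto, measurable)
qed

text \<open>Jensen's inequality in s for each y, then Tonelli: averaging over time does not increase
  the bound on \<open>Np\<close>.\<close>

lemma average_bound:
  assumes g: "g \<in> Lp m p" and \<tau>: "0 < \<epsilon>" "\<epsilon> \<le> \<tau>" and e: "\<And>s. 0 < s \<Longrightarrow> s \<le> \<tau> \<Longrightarrow> Np m p (\<lambda>y. TT c s g y - g y) \<le> ennreal e" and e0: "e \<ge> 0"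
  shows "Np m p (\<lambda>y. (1 / \<tau>) *\<^sub>R iint \<epsilon> \<tau> (\<lambda>s. TT c s g y - g y)) \<le> ennreal e"
proof -
  note [measurable] = LpD(1)[OF g]
  have t: "\<tau> > 0" using \<tau> by linarith
  have TTm: "(\<lambda>(s, y). TT c s g y) \<in> borel_measurable (leb_pos \<Otimes>\<^sub>M leb_pos)"
    unfolding case_prod_beta by (rule TT_measurable[OF c]) measurable
  note [measurable] = TTm
  have m1: "(\<lambda>s. TT c s g y - g y) \<in> borel_measurable leb_pos" for y
    by (intro borel_measurable_diff TT_measurable[OF c]) auto
  have "Np m p (\<lambda>y. (1 / \<tau>) *\<^sub>R iint \<epsilon> \<tau> (\<lambda>s. TT c s g y - g y)) \<le>
     (\<integral>\<^sup>+y. (\<integral>\<^sup>+s. ennreal (1 / \<tau>) * ennreal (indicator {\<epsilon>..\<tau>} s * (norm (TT c s g y - g y) powr p * y powr m)) \<partial>leb_pos) \<partial>leb_pos)"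
    unfolding Np_def
  proof (rule nn_integral_mono)
    fix y
    have "ennreal (norm ((1 / \<tau>) *\<^sub>R iint \<epsilon> \<tau> (\<lambda>s. TT c s g y - g y)) powr p) * ennreal (y powr m)
       \<le> (ennreal (1 / \<tau>) * (\<integral>\<^sup>+s. ennreal (indicator {\<epsilon>..\<tau>} s * norm (TT c s g y - g y) powr p) \<partial>leb_pos)) * ennreal (y powr m)"
      by (intro mult_right_mono jensen_interval[OF p q(1,2) m1 \<tau>]) simp
    also have "\<dots> = (\<integral>\<^sup>+s. ennreal (1 / \<tau>) * ennreal (indicator {\<epsilon>..\<tau>} s * norm (TT c s g y - g y) powr p) * ennreal (y powr m) \<partial>leb_pos)"
      using m1[of y] by (subst nn_integral_cmult[symmetric], measurable, subst nn_integral_multc[symmetric], measurable)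
    also have "\<dots> = (\<integral>\<^sup>+s. ennreal (1 / \<tau>) * ennreal (indicator {\<epsilon>..\<tau>} s * (norm (TT c s g y - g y) powr p * y powr m)) \<partial>leb_pos)"
      by (intro nn_integral_cong) (simp add: ennreal_mult mult.assoc)
    finally show "ennreal (norm ((1 / \<tau>) *\<^sub>R iint \<epsilon> \<tau> (\<lambda>s. TT c s g y - g y)) powr p * y powr m) \<le> (\<integral>\<^sup>+s. ennreal (1 / \<tau>) * ennreal (indicator {\<epsilon>..\<tau>} s * (norm (TT c s g y - g y) powr p * y powr m)) \<partial>leb_pos)"
      by (simp add: ennreal_mult)
  qed
  also have "\<dots> = (\<integral>\<^sup>+s. (\<integral>\<^sup>+y. ennreal (1 / \<tau>) * ennreal (indicator {\<epsilon>..\<tau>} s * (norm (TT c s g y - g y) powr p * y powr m)) \<partial>leb_pos) \<partial>leb_pos)"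
    by (rule leb_pos2.Fubini') measurable
  also have "\<dots> \<le> (\<integral>\<^sup>+s. ennreal (1 / \<tau>) * ennreal (indicator {0<..\<tau>} s * s powr 0) * ennreal e \<partial>leb_pos)"
  proof (rule nn_integral_mono)
    fix s assume "s \<in> space leb_pos"
    then have s: "s > 0" by simp
    note [measurable] = TT_meas[OF LpD(1)[OF g], of s]
    have "(\<integral>\<^sup>+y. ennreal (1 / \<tau>) * ennreal (indicator {\<epsilon>..\<tau>} s * (norm (TT c s g y - g y) powr p * y powr m)) \<partial>leb_pos)
      = ennreal (1 / \<tau>) * (ennreal (indicator {\<epsilon>..\<tau>} s) * Np m p (\<lambda>y. TT c s g y - g y))"
      unfolding Np_def by (subst nn_integral_cmult[symmetric], measurable)+ (simp add: ennreal_mult)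
    also have "\<dots> \<le> ennreal (1 / \<tau>) * (ennreal (indicator {0<..\<tau>} s * s powr 0) * ennreal e)"
      using \<tau> s e[of s] by (intro mult_left_mono) (auto simp: indicator_def)
    finally show "(\<integral>\<^sup>+y. ennreal (1 / \<tau>) * ennreal (indicator {\<epsilon>..\<tau>} s * (norm (TT c s g y - g y) powr p * y powr m)) \<partial>leb_pos) \<le> ennreal (1 / \<tau>) * ennreal (indicator {0<..\<tau>} s * s powr 0) * ennreal e"
      by (simp add: mult.assoc)
  qed
  also have "\<dots> = ennreal (1 / \<tau>) * (\<integral>\<^sup>+s. ennreal (indicator {0<..\<tau>} s * s powr 0) \<partial>leb_pos) * ennreal e"
    by (subst nn_integral_multc, measurable, subst nn_integral_cmult, measurable)
  also have "(\<integral>\<^sup>+s. ennreal (indicator {0<..\<tau>} s * s powr 0) \<partial>leb_pos) = ennreal \<tau>"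
    using t by (subst nn_integral_powr_below) auto
  also have "ennreal (1 / \<tau>) * ennreal \<tau> = 1" using t by (simp add: ennreal_mult'[symmetric])
  finally show ?thesis by simp
qed

text \<open>\<open>TT_increment\<close> requires a positive lower time, so the average is taken over
  [\<epsilon>, \<tau>]. For fixed \<tau>, \<epsilon> is chosen so small that the two errors it
  causes stay below a given bound, the first by strong continuity for u. The factor 4/\<tau> is
  1/t.\<close>

lemma difference_quotient_tendsto:
  assumes sol: "strong_sol u g"
  shows "((\<lambda>\<tau>. Np m p (\<lambda>y. (4 / \<tau>) *\<^sub>R (TT c \<tau> u y - u y) - g y)) \<longlongrightarrow> 0) (at_right 0)"
  unfolding ennreal_tendsto_0_iff
proof (intro allI impI)
  have u: "u \<in> Lp m p" and g: "g \<in> Lp m p" using sol by (auto simp: strong_sol_def)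
  fix e :: real assume e: "e > 0"
  define P where "P = 2 powr p"
  have P: "P > 0" by (simp add: P_def)
  define X where "X = P * (1 + 2 * P)"
  define d where "d = e / (2 * X)"
  have d: "d > 0" "P * (d + P * (d + d)) < e"
  proof -
    have den: "X > 0" unfolding X_def using P by (intro mult_pos_pos) auto
    show "d > 0" using e den by (simp add: d_def)
    have "P * (d + P * (d + d)) = X * d" by (simp add: X_def algebra_simps)
    also have "\<dots> = e / 2" using den by (simp add: d_def)
    finally show "P * (d + P * (d + d)) < e" using e by simp
  qed
  have "\<forall>\<^sub>F s in at_right 0. Np m p (\<lambda>y. TT c s g y - g y) < ennreal d"
    using strong_continuity[OF g] d(1) unfolding ennreal_tendsto_0_iff by blast
  then obtain b where b: "b > 0" "\<And>s. 0 < s \<Longrightarrow> s < b \<Longrightarrow> Np m p (\<lambda>y. TT c s g y - g y) < ennreal d"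
    by (auto simp: eventually_at_right_field)
  show "\<forall>\<^sub>F \<tau> in at_right 0. Np m p (\<lambda>y. (4 / \<tau>) *\<^sub>R (TT c \<tau> u y - u y) - g y) < ennreal e"
  proof (rule eventually_at_rightI[of 0 b])
    fix \<tau> assume "\<tau> \<in> {0<..<b}"
    then have \<tau>: "\<tau> > 0" "\<tau> < b" by auto
    have "((\<lambda>\<epsilon>. ennreal (norm (complex_of_real (4 / \<tau>)) powr p) * Np m p (\<lambda>y. TT c \<epsilon> u y - u y)) \<longlongrightarrow> ennreal (norm (complex_of_real (4 / \<tau>)) powr p) * 0) (at_right 0)"
      by (intro ennreal_tendsto_cmult strong_continuity[OF u]) simp
    then have "((\<lambda>\<epsilon>. ennreal (norm (complex_of_real (4 / \<tau>)) powr p) * Np m p (\<lambda>y. TT c \<epsilon> u y - u y)) \<longlongrightarrow> 0) (at_right 0)" by simp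
    then have 1: "\<forall>\<^sub>F \<epsilon> in at_right 0. ennreal (norm (complex_of_real (4 / \<tau>)) powr p) * Np m p (\<lambda>y. TT c \<epsilon> u y - u y) < ennreal d"
      using d(1) unfolding ennreal_tendsto_0_iff by blast
    have "((\<lambda>\<epsilon>. (\<epsilon> / \<tau>) powr p) \<longlongrightarrow> (0 / \<tau>) powr p) (at_right 0)"
      using p \<tau> by (intro tendsto_powr' tendsto_divide tendsto_ident_at tendsto_const) (auto simp: eventually_at_filter)
    then have "((\<lambda>\<epsilon>. (\<epsilon> / \<tau>) powr p) \<longlongrightarrow> 0) (at_right 0)" by simp
    then have "((\<lambda>\<epsilon>. ennreal ((\<epsilon> / \<tau>) powr p * enn2real (Np m p g))) \<longlongrightarrow> ennreal (0 * enn2real (Np m p g))) (at_right 0)"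
      by (intro tendsto_ennrealI tendsto_mult tendsto_const)
    then have "((\<lambda>\<epsilon>. ennreal ((\<epsilon> / \<tau>) powr p * enn2real (Np m p g))) \<longlongrightarrow> 0) (at_right 0)" by simp
    then have 2: "\<forall>\<^sub>F \<epsilon> in at_right 0. ennreal ((\<epsilon> / \<tau>) powr p * enn2real (Np m p g)) < ennreal d"
      using d(1) unfolding ennreal_tendsto_0_iff by blast
    have "\<forall>\<^sub>F \<epsilon> in at_right 0. 0 < \<epsilon> \<and> \<epsilon> < \<tau>" using \<tau> by (auto intro: eventually_at_rightI[of 0 \<tau>])
    with 1 2 have "\<forall>\<^sub>F \<epsilon> in at_right (0::real). (0 < \<epsilon> \<and> \<epsilon> < \<tau>) \<and> ennreal (norm (complex_of_real (4 / \<tau>)) powr p) * Np m p (\<lambda>y. TT c \<epsilon> u y - u y) < ennreal d \<and> ennreal ((\<epsilon> / \<tau>) powr p * enn2real (Np m p g)) < ennreal d"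
      by eventually_elim auto
    then obtain \<epsilon> where \<epsilon>: "0 < \<epsilon>" "\<epsilon> < \<tau>" and \<epsilon>1: "ennreal (norm (complex_of_real (4 / \<tau>)) powr p) * Np m p (\<lambda>y. TT c \<epsilon> u y - u y) < ennreal d"
      and \<epsilon>2: "ennreal ((\<epsilon> / \<tau>) powr p * enn2real (Np m p g)) < ennreal d"
      using eventually_happens'[OF trivial_limit_at_right_real] by blast
    have \<epsilon>3: "ennreal (norm (complex_of_real (\<epsilon> / \<tau>)) powr p) * Np m p g < ennreal d"
    proof -
      have "Np m p g = ennreal (enn2real (Np m p g))" using LpD(2)[OF g] by simp
      then have "ennreal (norm (complex_of_real (\<epsilon> / \<tau>)) powr p) * Np m p g = ennreal ((\<epsilon> / \<tau>) powr p * enn2real (Np m p g))"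
        unfolding norm_of_real using \<epsilon> \<tau> by (metis abs_of_pos divide_pos_pos ennreal_mult' powr_ge_zero)
      then show ?thesis using \<epsilon>2 by simp
    qed
    have "\<epsilon> \<le> \<tau>" using \<epsilon> by simp
    define I where "I y = (1 / \<tau>) *\<^sub>R iint \<epsilon> \<tau> (\<lambda>s. TT c s g y - g y)" for y
    note [measurable] = LpD(1)[OF u] LpD(1)[OF g] TT_meas[OF LpD(1)[OF u], of \<tau>] TT_meas[OF LpD(1)[OF u], of \<epsilon>]
    \<comment> \<open>The average of T(s)g - g over [\<epsilon>, \<tau>] plus the two errors due to
      \<epsilon>: the increment of u up to time \<epsilon>, and the part of g missing from the
      average.\<close>
    have dec: "(4 / \<tau>) *\<^sub>R (TT c \<tau> u y - u y) - g y = I y + (of_real (4 / \<tau>) * (TT c \<epsilon> u y - u y) - of_real (\<epsilon> / \<tau>) * g y)" for y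
    proof -
      have len: "iint \<epsilon> \<tau> (\<lambda>_. 1::real) = \<tau> - \<epsilon>"
        using iint_FTC[of \<epsilon> \<tau> "\<lambda>x. x" "\<lambda>_. 1"] \<epsilon> by auto
      have i1: "integrable leb_pos (\<lambda>s. indicator {\<epsilon>..\<tau>} s *\<^sub>R (1::real))"
        by (rule integrable_leb_pos_cont[OF \<epsilon>(1)]) auto
      have "iint \<epsilon> \<tau> (\<lambda>s. TT c s g y - g y) = (LINT s|leb_pos. indicator {\<epsilon>..\<tau>} s *\<^sub>R TT c s g y - (indicator {\<epsilon>..\<tau>} s *\<^sub>R (1::real)) *\<^sub>R g y)"
        by (simp add: scaleR_diff_right)
      also have "\<dots> = iint \<epsilon> \<tau> (\<lambda>s. TT c s g y) - (\<tau> - \<epsilon>) *\<^sub>R g y"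
        unfolding len[symmetric] integral_scaleR_left[OF i1, symmetric]
        by (rule Bochner_Integration.integral_diff[OF TT_integrable_time[OF g \<epsilon>(1) \<open>\<epsilon> \<le> \<tau>\<close>] integrable_scaleR_left[OF i1]])
      also have "iint \<epsilon> \<tau> (\<lambda>s. TT c s g y) = 4 *\<^sub>R (TT c \<tau> u y - TT c \<epsilon> u y)"
        unfolding TT_increment[OF sol \<epsilon>(1) \<open>\<epsilon> \<le> \<tau>\<close>] by simp
      finally have Iy: "I y = (1 / \<tau>) *\<^sub>R (4 *\<^sub>R (TT c \<tau> u y - TT c \<epsilon> u y) - (\<tau> - \<epsilon>) *\<^sub>R g y)" by (simp only: I_def)
      have alg: "(4 / \<tau>) *\<^sub>R (X - U) - G = (1 / \<tau>) *\<^sub>R (4 *\<^sub>R (X - Y) - (\<tau> - \<epsilon>) *\<^sub>R G) + (of_real (4 / \<tau>) * (Y - U) - of_real (\<epsilon> / \<tau>) * G)" for X Y U G :: complex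
        using \<tau> by (simp add: scaleR_conv_of_real field_simps)
      show ?thesis unfolding Iy by (rule alg)
    qed
    have mI: "I \<in> borel_measurable leb_pos"
    proof -
      have "I = (\<lambda>y. ((4 / \<tau>) *\<^sub>R (TT c \<tau> u y - u y) - g y) - (of_real (4 / \<tau>) * (TT c \<epsilon> u y - u y) - of_real (\<epsilon> / \<tau>) * g y))"
        by (auto simp: fun_eq_iff dec)
      also have "\<dots> \<in> borel_measurable leb_pos" by measurable
      finally show ?thesis .
    qed
    note [measurable] = mI
    have "Np m p (\<lambda>y. (4 / \<tau>) *\<^sub>R (TT c \<tau> u y - u y) - g y) \<le> ennreal P * (Np m p I + Np m p (\<lambda>y. of_real (4 / \<tau>) * (TT c \<epsilon> u y - u y) - of_real (\<epsilon> / \<tau>) * g y))"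
      unfolding dec P_def by (rule Np_add_le) (use p in auto)
    also have "\<dots> \<le> ennreal P * (ennreal d + ennreal P * (ennreal d + ennreal d))"
    proof (intro mult_left_mono add_mono)
      show "Np m p I \<le> ennreal d" unfolding I_def[abs_def]
        by (rule average_bound[OF g \<epsilon>(1) \<open>\<epsilon> \<le> \<tau>\<close>]) (use b \<tau> d in \<open>auto intro: less_imp_le\<close>)
      have "Np m p (\<lambda>y. of_real (4 / \<tau>) * (TT c \<epsilon> u y - u y) - of_real (\<epsilon> / \<tau>) * g y) \<le> ennreal P * (Np m p (\<lambda>y. of_real (4 / \<tau>) * (TT c \<epsilon> u y - u y)) + Np m p (\<lambda>y. of_real (\<epsilon> / \<tau>) * g y))"
        unfolding P_def by (rule Np_diff_le) (use p in auto)
      also have "\<dots> \<le> ennreal P * (ennreal d + ennreal d)"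
      proof (intro mult_left_mono add_mono)
        show "Np m p (\<lambda>y. of_real (4 / \<tau>) * (TT c \<epsilon> u y - u y)) \<le> ennreal d"
          by (subst Np_cmult) (measurable, use \<epsilon>1 in \<open>simp only: less_imp_le\<close>)
        show "Np m p (\<lambda>y. of_real (\<epsilon> / \<tau>) * g y) \<le> ennreal d"
          by (subst Np_cmult) (measurable, use \<epsilon>3 in \<open>simp only: less_imp_le\<close>)
      qed simp
      finally show "Np m p (\<lambda>y. of_real (4 / \<tau>) * (TT c \<epsilon> u y - u y) - of_real (\<epsilon> / \<tau>) * g y) \<le> ennreal P * (ennreal d + ennreal d)" .
    qed simp
    also have "\<dots> = ennreal (P * (d + P * (d + d)))"
      using P d(1) by (simp add: ennreal_mult'[symmetric] ennreal_plus[symmetric] del: ennreal_plus)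
    also have "\<dots> < ennreal e" using d(2) e by (simp add: ennreal_lessI)
    finally show "Np m p (\<lambda>y. (4 / \<tau>) *\<^sub>R (TT c \<tau> u y - u y) - g y) < ennreal e" .
  qed (use b in auto)
qed

text \<open>Translation of \<open>difference_quotient_tendsto\<close>: time t = \<tau>/4, the norm
  in place of its p-th power, and agreement of \<open>semigroup_Bn\<close> with \<open>TT\<close>
  for y > 0.\<close>

lemma strong_sol_generator:
  assumes sol: "strong_sol u g"
  shows "is_generator_value m p (semigroup_Bn c) u g"
proof -
  have u: "u \<in> Lp m p" and g: "g \<in> Lp m p" using sol by (auto simp: strong_sol_def)
  define R where "R t y = (semigroup_Bn c (of_real t) u y - u y) / of_real t - g y" for t y
  have R: "AE y in leb_pos. (4 / (4 * t)) *\<^sub>R (TT c (4 * t) u y - u y) - g y = R t y" if t: "t > 0" for t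
    using AE_leb_pos_gt
  proof eventually_elim
    case (elim y)
    have "(4 / (4 * t)) *\<^sub>R z = z / of_real t" for z :: complex
      using t by (simp add: scaleR_conv_of_real)
    then show ?case by (simp only: R_def semigroup_Bn_eq[OF c t elim])
  qed
  have RL: "R t \<in> Lp m p" if t: "t > 0" for t
  proof (rule Lp_cong_AE[OF _ R[OF t]])
    have p0: "p \<ge> 0" using p by simp
    have "(\<lambda>y. of_real (4 / (4 * t)) * (TT c (4 * t) u y - u y) - g y) \<in> Lp m p"
      by (intro Lp_diff Lp_cmult TT_Lp u g p0) (use t in simp)
    then show "(\<lambda>y. (4 / (4 * t)) *\<^sub>R (TT c (4 * t) u y - u y) - g y) \<in> Lp m p" by (simp add: scaleR_conv_of_real)
  qed
  have f4: "filterlim (\<lambda>t::real. 4 * t) (at_right 0) (at_right 0)"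
    unfolding filterlim_at
  proof
    have "((\<lambda>t::real. 4 * t) \<longlongrightarrow> 4 * 0) (at_right 0)" by (intro tendsto_intros)
    then show "((\<lambda>t::real. 4 * t) \<longlongrightarrow> 0) (at_right 0)" by simp
    show "\<forall>\<^sub>F x in at_right (0::real). 4 * x \<in> {0<..} \<and> 4 * x \<noteq> 0"
      using eventually_at_right_less[of 0] by eventually_elim auto
  qed
  have "((\<lambda>t. Np m p (\<lambda>y. (4 / (4 * t)) *\<^sub>R (TT c (4 * t) u y - u y) - g y)) \<longlongrightarrow> 0) (at_right 0)"
    by (rule filterlim_compose[OF difference_quotient_tendsto[OF sol] f4])
  then have "((\<lambda>t. Np m p (R t)) \<longlongrightarrow> 0) (at_right 0)"
  proof (rule Lim_transform_eventually)
    show "\<forall>\<^sub>F t in at_right 0. Np m p (\<lambda>y. (4 / (4 * t)) *\<^sub>R (TT c (4 * t) u y - u y) - g y) = Np m p (R t)"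
      using eventually_at_right_less[of 0] by eventually_elim (rule Np_cong_AE[OF R])
  qed
  then have "((\<lambda>t. enn2real (Np m p (R t))) \<longlongrightarrow> enn2real 0) (at_right 0)" by (intro tendsto_enn2real) auto
  then have "((\<lambda>t. enn2real (Np m p (R t)) powr (1 / p)) \<longlongrightarrow> enn2real 0 powr (1 / p)) (at_right 0)"
    using p by (intro tendsto_powr' tendsto_const) auto
  then have "((\<lambda>t. enn2real (Np m p (R t)) powr (1 / p)) \<longlongrightarrow> 0) (at_right 0)" by simp
  then have "((\<lambda>t. Lp_norm m p (R t)) \<longlongrightarrow> 0) (at_right 0)"
  proof (rule Lim_transform_eventually)
    show "\<forall>\<^sub>F t in at_right 0. enn2real (Np m p (R t)) powr (1 / p) = Lp_norm m p (R t)"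
      using eventually_at_right_less[of 0] by eventually_elim (rule Lp_norm_eq[symmetric], rule LpD(1)[OF RL])
  qed
  moreover have "\<forall>\<^sub>F t in at_right 0. R t \<in> Lp m p"
    using eventually_at_right_less[of 0] by eventually_elim (rule RL)
  ultimately show ?thesis unfolding is_generator_value_def Let_def R_def[abs_def] using u g by simp
qed

end

section \<open>Duality\<close>

text \<open>The weight is bounded above and below on compact subintervals, and |f| \<le> 1 +
  |f|^p.\<close>

lemma Lp_imp_loc:
  assumes f: "f \<in> Lp m p" and p: "p \<ge> 1"
  shows "f \<in> Lp_loc p" "loc_int f"
proof -
  note [measurable] = LpD(1)[OF f]
  have "integrable leb_pos (\<lambda>y. norm (f y) powr p * y powr m)"
    using LpD(2)[OF f] by (intro integrableI_nonneg) (auto simp: Np_def)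
  then have "loc_int (\<lambda>y. norm (f y) powr p * y powr m)"
    unfolding loc_int_def by (intro conjI allI impI integrable_mult_indicator) (auto simp: sets_restrict_space_iff)
  then have "loc_int (\<lambda>y. y powr - m *\<^sub>R (norm (f y) powr p * y powr m))"
    by (rule loc_int_cont_mult) (auto intro!: continuous_intros)
  then have l: "loc_int (\<lambda>y. norm (f y) powr p)"
    by (rule loc_int_AE) (use AE_leb_pos_gt in \<open>eventually_elim\<close>, simp add: powr_minus)
  then show "f \<in> Lp_loc p" by (simp add: Lp_loc_iff)
  show "loc_int f" unfolding loc_int_def
  proof (intro conjI allI impI)
    fix a b :: real assume a: "0 < a"
    have i: "integrable leb_pos (\<lambda>y. indicator {a..b} y *\<^sub>R (1 + norm (f y) powr p))"
      unfolding scaleR_add_right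
      by (intro Bochner_Integration.integrable_add loc_intD(2)[OF l a] integrable_leb_pos_cont a) auto
    show "integrable leb_pos (\<lambda>y. indicator {a..b} y *\<^sub>R f y)"
    proof (rule Bochner_Integration.integrable_bound[OF i])
      have "t \<le> 1 + t powr p" if "t \<ge> 0" for t :: real
      proof (cases "t \<le> 1")
        case False
        then have "t powr 1 \<le> t powr p" using p by (intro powr_mono) auto
        then show ?thesis using False by simp
      qed (use that in \<open>auto intro: add_increasing2\<close>)
      then show "AE y in leb_pos. norm (indicator {a..b} y *\<^sub>R f y) \<le> norm (indicator {a..b} y *\<^sub>R (1 + norm (f y) powr p))"
        by (intro AE_I2) (auto simp: indicator_def)
    qed measurable
  qed measurable
qed

lemma antiderivative_pos:
  fixes k :: "real \<Rightarrow> real"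
  assumes "continuous_on {0<..} k"
  obtains F where "\<And>x. x > 0 \<Longrightarrow> (F has_field_derivative k x) (at x)"
proof -
  have "\<exists>F. \<forall>x :: real. (0::ereal) < x \<longrightarrow> x < (\<infinity>::ereal) \<longrightarrow> (F has_vector_derivative k x) (at x)"
    by (rule einterval_antiderivative) (use assms in \<open>auto simp: continuous_on_eq_continuous_at\<close>)
  then obtain F where "\<forall>x>0. (F has_vector_derivative k x) (at x)" by auto
  then show thesis by (intro that[of F]) (simp add: has_real_derivative_iff_has_vector_derivative)
qed

lemma iint_of_real: "iint a b (\<lambda>x. complex_of_real (f x)) = of_real (iint a b f)"
proof -
  have "iint a b (\<lambda>x. complex_of_real (f x)) = (LINT x|leb_pos. complex_of_real (indicator {a..b} x *\<^sub>R f x))"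
    by (rule Bochner_Integration.integral_cong) (auto simp: indicator_def)
  also have "\<dots> = of_real (iint a b f)" by (rule integral_complex_of_real)
  finally show ?thesis .
qed

lemma loc_int_of_real: "loc_int f \<Longrightarrow> loc_int (\<lambda>x. complex_of_real (f x))"
proof -
  assume f: "loc_int f"
  note [measurable] = loc_intD(1)[OF f]
  show "loc_int (\<lambda>x. complex_of_real (f x))" unfolding loc_int_def
  proof (intro conjI allI impI)
    fix a b :: real assume "0 < a"
    have "integrable leb_pos (\<lambda>y. complex_of_real (indicator {a..b} y *\<^sub>R f y))"
      using loc_intD(2)[OF f \<open>0 < a\<close>] by (rule integrable_of_real)
    then show "integrable leb_pos (\<lambda>y. indicator {a..b} y *\<^sub>R complex_of_real (f y))"
      by (rule back_subst[of "integrable leb_pos"]) (auto simp: indicator_def)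
  qed measurable
qed

context bessel_weight
begin

text \<open>Unlike in \<open>Lp_bounded_supp\<close> the support may touch 0, where m > -1 gives
  integrability of the weight. The functions used for testing in the duality argument are constant
  near 0.\<close>

lemma Lp_bounded_supp0:
  assumes [measurable]: "f \<in> borel_measurable leb_pos" and B: "B \<ge> 0" "b > 0"
    and f: "AE y in leb_pos. norm (f y) \<le> B * indicator {0<..b} y"
  shows "f \<in> Lp m p"
proof -
  have "Np m p f \<le> (\<integral>\<^sup>+y. ennreal (B powr p) * ennreal (indicator {0<..b} y * y powr m) \<partial>leb_pos)"
    unfolding Np_def
  proof (rule nn_integral_mono_AE, use f in eventually_elim)
    case (elim y)
    have "norm (f y) powr p \<le> (B * indicator {0<..b} y) powr p" using elim p by (intro powr_mono2) auto
    also have "\<dots> = B powr p * indicator {0<..b} y" using p by (auto simp: indicator_def)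
    finally have "norm (f y) powr p * y powr m \<le> B powr p * indicator {0<..b} y * y powr m" by (intro mult_right_mono) auto
    then show ?case by (simp add: ennreal_mult'[symmetric] ennreal_leI mult.assoc)
  qed
  also have "\<dots> = ennreal (B powr p) * ennreal (b powr (m + 1) / (m + 1))"
    unfolding nn_integral_powr_below[OF m_gt B(2), symmetric] by (rule nn_integral_cmult) measurable
  also have "\<dots> < \<infinity>" by (simp add: ennreal_mult_less_top)
  finally show ?thesis by (simp add: Lp_iff)
qed

text \<open>The dual semigroup is the same semigroup on the dual space.\<close>

lemma TT_symmetric:
  assumes f: "f \<in> Lp m p" and g: "g \<in> Lp md q" and \<tau>: "\<tau> > 0"
  shows "(LINT y|leb_pos. y powr c *\<^sub>R (TT c \<tau> f y * g y)) = (LINT y|leb_pos. y powr c *\<^sub>R (f y * TT c \<tau> g y))"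
proof -
  note [measurable] = LpD(1)[OF f] LpD(1)[OF g]
  define k where "k y \<rho> = (y powr c * kern c \<tau> y \<rho>) *\<^sub>R (f \<rho> * g y)" for y \<rho>
  have [measurable]: "(\<lambda>(y, \<rho>). kern c \<tau> y \<rho>) \<in> borel_measurable (leb_pos \<Otimes>\<^sub>M leb_pos)" by (rule kern_pair_measurable)
  have km: "case_prod k \<in> borel_measurable (leb_pos \<Otimes>\<^sub>M leb_pos)" unfolding k_def by measurable
  have nf: "(\<lambda>\<rho>. complex_of_real (norm (f \<rho>))) \<in> Lp m p"
    by (rule Lp_dom[OF f]) (use p in auto)
  have ng: "(\<lambda>\<rho>. complex_of_real (norm (g \<rho>))) \<in> Lp md q"
    by (rule Lp_dom[OF g]) (use q in auto)
  \<comment> \<open>Absolute integrability is the pairing of T|f| with |g|, finite by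
    Hoelder.\<close>
  have k: "integrable (leb_pos \<Otimes>\<^sub>M leb_pos) (case_prod k)"
  proof (rule leb_pos2.Fubini_integrable[OF km])
    have i: "integrable leb_pos (\<lambda>y. y powr c *\<^sub>R (TT c \<tau> (\<lambda>\<rho>. complex_of_real (norm (f \<rho>))) y * complex_of_real (norm (g y))))"
      by (rule pairing_integrable[OF TT_Lp[OF nf \<tau>] ng])
    have "norm (y powr c *\<^sub>R (TT c \<tau> (\<lambda>\<rho>. complex_of_real (norm (f \<rho>))) y * complex_of_real (norm (g y)))) = (LINT \<rho>|leb_pos. norm (case_prod k (y, \<rho>)))" for y
    proof -
      have "TT c \<tau> (\<lambda>\<rho>. complex_of_real (norm (f \<rho>))) y = of_real (LINT \<rho>|leb_pos. kern c \<tau> y \<rho> * norm (f \<rho>))"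
        unfolding TT_def integral_complex_of_real[symmetric] by (simp add: scaleR_conv_of_real)
      moreover have "(LINT \<rho>|leb_pos. kern c \<tau> y \<rho> * norm (f \<rho>)) \<ge> 0" by (intro integral_nonneg_AE AE_I2 mult_nonneg_nonneg kern_nonneg c) simp
      moreover have "(LINT \<rho>|leb_pos. norm (case_prod k (y, \<rho>))) = (LINT \<rho>|leb_pos. (y powr c * norm (g y)) * (kern c \<tau> y \<rho> * norm (f \<rho>)))"
        using kern_nonneg[OF c, of \<tau> y] by (intro Bochner_Integration.integral_cong) (auto simp: k_def norm_mult abs_mult)
      ultimately show ?thesis by (simp add: norm_mult abs_mult)
    qed
    then show "integrable leb_pos (\<lambda>y. LINT \<rho>|leb_pos. norm (case_prod k (y, \<rho>)))"
      using integrable_norm[OF i] by simp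
    show "AE y in leb_pos. integrable leb_pos (\<lambda>\<rho>. case_prod k (y, \<rho>))"
    proof (intro AE_I2)
      fix y
      have "integrable leb_pos (\<lambda>\<rho>. (y powr c *\<^sub>R g y) * (kern c \<tau> y \<rho> *\<^sub>R f \<rho>))"
        by (intro integrable_mult_right kern_integrable[OF f \<tau>])
      then show "integrable leb_pos (\<lambda>\<rho>. case_prod k (y, \<rho>))"
        by (rule back_subst[of "integrable leb_pos"]) (simp add: k_def fun_eq_iff mult_ac)
    qed
  qed
  have "(LINT y|leb_pos. y powr c *\<^sub>R (TT c \<tau> f y * g y)) = (LINT y|leb_pos. (LINT \<rho>|leb_pos. k y \<rho>))"
  proof (rule Bochner_Integration.integral_cong[OF refl])
    fix y
    have "(LINT \<rho>|leb_pos. k y \<rho>) = (LINT \<rho>|leb_pos. (y powr c *\<^sub>R g y) * (kern c \<tau> y \<rho> *\<^sub>R f \<rho>))"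
      by (rule Bochner_Integration.integral_cong) (simp_all add: k_def mult_ac)
    also have "\<dots> = (y powr c *\<^sub>R g y) * TT c \<tau> f y"
      unfolding TT_def by (rule integral_mult_right_zero)
    finally show "y powr c *\<^sub>R (TT c \<tau> f y * g y) = (LINT \<rho>|leb_pos. k y \<rho>)" by (simp add: mult_ac)
  qed
  also have "\<dots> = (LINT \<rho>|leb_pos. (LINT y|leb_pos. k y \<rho>))"
    by (rule leb_pos2.Fubini_integral[OF k, symmetric])
  also have "\<dots> = (LINT y|leb_pos. y powr c *\<^sub>R (f y * TT c \<tau> g y))"
  proof (rule Bochner_Integration.integral_cong[OF refl])
    fix \<rho>
    have "(LINT y|leb_pos. k y \<rho>) = (LINT y|leb_pos. (\<rho> powr c *\<^sub>R f \<rho>) * (kern c \<tau> \<rho> y *\<^sub>R g y))"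
    proof (rule Bochner_Integration.integral_cong[OF refl])
      fix y
      have "y powr c * kern c \<tau> y \<rho> = \<rho> powr c * kern c \<tau> \<rho> y" using kern_symm[of c \<tau> y \<rho>] by (simp add: mult.commute)
      then show "k y \<rho> = (\<rho> powr c *\<^sub>R f \<rho>) * (kern c \<tau> \<rho> y *\<^sub>R g y)" by (simp add: k_def)
    qed
    also have "\<dots> = (\<rho> powr c *\<^sub>R f \<rho>) * TT c \<tau> g \<rho>"
      unfolding TT_def by (rule integral_mult_right_zero)
    finally show "(LINT y|leb_pos. k y \<rho>) = \<rho> powr c *\<^sub>R (f \<rho> * TT c \<tau> g \<rho>)" by simp
  qed
  finally show ?thesis .
qed

text \<open>Testing the difference quotient against a smooth element of the domain of the dual
  generator moves the generator onto the test function.\<close>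

lemma generator_weak:
  assumes gen: "is_generator_value m p (semigroup_Bn c) u g" and \<psi>: "bessel_weight.strong_sol q c md \<psi> h"
  shows "(LINT y|leb_pos. y powr c *\<^sub>R (u y * h y)) = (LINT y|leb_pos. y powr c *\<^sub>R (g y * \<psi> y))"
proof -
  define R where "R t y = (semigroup_Bn c (of_real t) u y - u y) / of_real t - g y" for t y
  define S where "S t y = (semigroup_Bn c (of_real t) \<psi> y - \<psi> y) / of_real t - h y" for t y
  have u: "u \<in> Lp m p" and g: "g \<in> Lp m p" and RL: "\<forall>\<^sub>F t in at_right 0. R t \<in> Lp m p"
    and R0: "((\<lambda>t. Lp_norm m p (R t)) \<longlongrightarrow> 0) (at_right 0)"
    using gen unfolding is_generator_value_def Let_def R_def[abs_def] by auto
  have \<psi>L: "\<psi> \<in> Lp md q" and h: "h \<in> Lp md q" and SL: "\<forall>\<^sub>F t in at_right 0. S t \<in> Lp md q"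
    and S0: "((\<lambda>t. Lp_norm md q (S t)) \<longlongrightarrow> 0) (at_right 0)"
    using bessel_weight.strong_sol_generator[OF dual \<psi>] unfolding is_generator_value_def Let_def S_def[abs_def] by auto
  define a where "a t = (LINT y|leb_pos. y powr c *\<^sub>R (R t y * \<psi> y))" for t
  define b where "b t = (LINT y|leb_pos. y powr c *\<^sub>R (u y * S t y))" for t
  define D where "D = (LINT y|leb_pos. y powr c *\<^sub>R (u y * h y)) - (LINT y|leb_pos. y powr c *\<^sub>R (g y * \<psi> y))"
  have a0: "(a \<longlongrightarrow> 0) (at_right 0)"
  proof (rule Lim_null_comparison)
    show "\<forall>\<^sub>F t in at_right 0. norm (a t) \<le> Lp_norm m p (R t) * enn2real (Np md q \<psi>) powr (1/q)"
      using RL by eventually_elim (use pairing_bound[OF _ \<psi>L] in \<open>simp add: a_def Lp_norm_eq LpD(1)\<close>)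
    show "((\<lambda>t. Lp_norm m p (R t) * enn2real (Np md q \<psi>) powr (1/q)) \<longlongrightarrow> 0) (at_right 0)"
      using tendsto_mult[OF R0 tendsto_const] by simp
  qed
  have b0: "(b \<longlongrightarrow> 0) (at_right 0)"
  proof (rule Lim_null_comparison)
    show "\<forall>\<^sub>F t in at_right 0. norm (b t) \<le> enn2real (Np m p u) powr (1/p) * Lp_norm md q (S t)"
      using SL by eventually_elim (use pairing_bound[OF u] in \<open>simp add: b_def Lp_norm_eq LpD(1)\<close>)
    show "((\<lambda>t. enn2real (Np m p u) powr (1/p) * Lp_norm md q (S t)) \<longlongrightarrow> 0) (at_right 0)"
      using tendsto_mult[OF tendsto_const S0] by simp
  qed
  \<comment> \<open>By symmetry the terms with 1/t cancel, so the difference of the two pairings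
    does not depend on t, while both tend to 0.\<close>
  have ab: "a t - b t = D" if t: "t > 0" for t
  proof -
    have t4: "4 * t > 0" using t by simp
    define z where "z = 1 / complex_of_real t"
    note P = pairing_integrable
    have i: "integrable leb_pos (\<lambda>y. y powr c *\<^sub>R (TT c (4 * t) u y * \<psi> y))" "integrable leb_pos (\<lambda>y. y powr c *\<^sub>R (u y * \<psi> y))"
      "integrable leb_pos (\<lambda>y. y powr c *\<^sub>R (g y * \<psi> y))" "integrable leb_pos (\<lambda>y. y powr c *\<^sub>R (u y * h y))"
      "integrable leb_pos (\<lambda>y. y powr c *\<^sub>R (u y * TT c (4 * t) \<psi> y))"
      by (intro P TT_Lp[OF u t4] u g h \<psi>L bessel_weight.TT_Lp[OF dual \<psi>L t4])+
    have "a t = (LINT y|leb_pos. z * (y powr c *\<^sub>R (TT c (4 * t) u y * \<psi> y)) - z * (y powr c *\<^sub>R (u y * \<psi> y)) - y powr c *\<^sub>R (g y * \<psi> y))"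
      unfolding a_def by (rule Bochner_Integration.integral_cong) (auto simp: R_def semigroup_Bn_eq[OF c t] z_def scaleR_conv_of_real algebra_simps diff_divide_distrib)
    also have "\<dots> = z * (LINT y|leb_pos. y powr c *\<^sub>R (TT c (4 * t) u y * \<psi> y)) - z * (LINT y|leb_pos. y powr c *\<^sub>R (u y * \<psi> y)) - (LINT y|leb_pos. y powr c *\<^sub>R (g y * \<psi> y))"
      using i by (simp only: Bochner_Integration.integral_diff Bochner_Integration.integrable_diff integrable_mult_right integral_mult_right_zero)
    finally have A: "a t = \<dots>" .
    have "b t = (LINT y|leb_pos. z * (y powr c *\<^sub>R (u y * TT c (4 * t) \<psi> y)) - z * (y powr c *\<^sub>R (u y * \<psi> y)) - y powr c *\<^sub>R (u y * h y))"
      unfolding b_def by (rule Bochner_Integration.integral_cong) (auto simp: S_def semigroup_Bn_eq[OF c t] z_def scaleR_conv_of_real algebra_simps diff_divide_distrib)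
    also have "\<dots> = z * (LINT y|leb_pos. y powr c *\<^sub>R (u y * TT c (4 * t) \<psi> y)) - z * (LINT y|leb_pos. y powr c *\<^sub>R (u y * \<psi> y)) - (LINT y|leb_pos. y powr c *\<^sub>R (u y * h y))"
      using i by (simp only: Bochner_Integration.integral_diff Bochner_Integration.integrable_diff integrable_mult_right integral_mult_right_zero)
    finally have B: "b t = \<dots>" .
    show ?thesis unfolding A B D_def TT_symmetric[OF u \<psi>L t4] by simp
  qed
  have "((\<lambda>t. a t - b t) \<longlongrightarrow> 0 - 0) (at_right 0)" by (intro tendsto_diff a0 b0)
  moreover have "\<forall>\<^sub>F t in at_right 0. a t - b t = D" using eventually_at_right_less[of 0] by eventually_elim (rule ab)
  ultimately have "((\<lambda>t. D) \<longlongrightarrow> 0) (at_right (0::real))" by (simp add: Lim_transform_eventually)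
  then have "D = 0" by (simp add: tendsto_const_iff)
  then show ?thesis by (simp add: D_def)
qed

text \<open>For a test function \<open>\<phi>\<close>, the primitive \<open>\<psi>\<close> of \<open>y\<^sup>-\<^sup>c \<phi>\<close> that vanishes at infinity satisfies
  \<open>y\<^sup>c B\<psi> = \<phi>'\<close>, so testing with \<open>\<psi>\<close> yields the weak derivative.\<close>

lemma generator_has_weak_deriv:
  assumes gen: "is_generator_value m p (semigroup_Bn c) u g"
  shows "has_weak_deriv u (\<lambda>s. s powr - c *\<^sub>R Gc c g s)"
  unfolding has_weak_deriv_def Lp_loc_1_iff
proof (intro conjI allI impI)
  have u: "u \<in> Lp m p" and g: "g \<in> Lp m p" using gen by (auto simp: is_generator_value_def Let_def)
  have cG: "continuous_on {0<..} (Gc c g)" by (rule ac_continuous_on[OF Gc_ac[OF g]])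
  show "loc_int u" by (rule Lp_imp_loc(2)[OF u]) (use p in simp)
  show "loc_int (\<lambda>s. s powr - c *\<^sub>R Gc c g s)"
    by (rule loc_int_cont) (intro continuous_intros cG, auto)
  fix \<phi> assume \<phi>: "test_function \<phi>"
  obtain a b where ab: "0 < a" "a < b" and s0: "\<And>x. x \<notin> {a..b} \<Longrightarrow> \<phi> x = 0" and s1: "\<And>x. x \<notin> {a..b} \<Longrightarrow> deriv \<phi> x = 0"
    using test_functionD(4)[OF \<phi>] by blast
  have c\<phi>: "continuous_on S \<phi>" "continuous_on S (deriv \<phi>)" for S
    using test_functionD(2,3)[OF \<phi>] by (auto intro: continuous_at_imp_continuous_on)
  define k where "k r = r powr - c * \<phi> r" for r
  have ck: "continuous_on {0<..} k" unfolding k_def by (intro continuous_intros c\<phi>) auto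
  obtain F where F: "\<And>x. x > 0 \<Longrightarrow> (F has_field_derivative k x) (at x)" using antiderivative_pos[OF ck] by blast
  \<comment> \<open>Normalised to vanish from b on. Below a it is constant, so \<psi> is bounded
    with support in (0, b]; it satisfies the Neumann condition at 0 but may be nonzero
    there.\<close>
  define \<psi> where "\<psi> y = F y - F b" for y
  have D\<psi>: "(\<psi> has_field_derivative k x) (at x)" if "x > 0" for x
    unfolding \<psi>_def using F[OF that] by (auto intro!: derivative_eq_intros)
  have FTC: "\<psi> y - \<psi> x = iint x y k" if "0 < x" "x \<le> y" for x y
    by (rule iint_FTC[symmetric, OF that D\<psi> continuous_on_subset[OF ck]]) (use that in auto)
  have \<psi>b: "\<psi> y = 0" if "y \<ge> b" for y
  proof -
    have "iint b y k = 0"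
    proof (rule integral_eq_zero_AE)
      show "AE x in leb_pos. indicator {b..y} x *\<^sub>R k x = 0"
        using AE_leb_pos_neq[of b] by eventually_elim (auto simp: indicator_def k_def s0)
    qed
    then show ?thesis using FTC[of b y] that ab by (simp add: \<psi>_def)
  qed
  have \<psi>a: "\<psi> y = \<psi> a" if "0 < y" "y \<le> a" for y
  proof -
    have "iint y a k = 0"
    proof (rule integral_eq_zero_AE)
      show "AE x in leb_pos. indicator {y..a} x *\<^sub>R k x = 0"
        using AE_leb_pos_neq[of a] by eventually_elim (auto simp: indicator_def k_def s0)
    qed
    then show ?thesis using FTC[of y a] that by simp
  qed
  have c\<psi>: "continuous_on {0<..} \<psi>" using D\<psi> by (intro continuous_at_imp_continuous_on ballI) (auto intro: DERIV_isCont)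
  note [measurable] = leb_pos_measurable_continuous[OF c\<psi>]
  have sub: "{a..b} \<subseteq> {0<..}" using ab by auto
  obtain B where B: "B \<ge> 0" "\<And>x. x \<in> {a..b} \<Longrightarrow> norm (\<psi> x) \<le> B"
    using cont_Icc_bounded[OF continuous_on_subset[OF c\<psi> sub]] by blast
  have \<psi>bd: "norm (\<psi> x) \<le> B * indicator {0<..b} x" if "x > 0" for x
  proof -
    consider "x \<le> a" | "a \<le> x" "x \<le> b" | "b < x" by linarith
    then show ?thesis
    proof cases
      case 1
      have "norm (\<psi> x) = norm (\<psi> a)" by (simp only: \<psi>a[OF that 1])
      also have "\<dots> \<le> B" using ab by (intro B(2)) simp
      finally show ?thesis using 1 that ab by simp
    next
      case 2
      then have "norm (\<psi> x) \<le> B" by (intro B(2)) simp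
      then show ?thesis using 2 that by simp
    next
      case 3
      then show ?thesis using \<psi>b[of x] by simp
    qed
  qed
  define h where "h r = complex_of_real (r powr - c * deriv \<phi> r)" for r
  have ch: "continuous_on {0<..} h" unfolding h_def by (intro continuous_intros c\<phi>) auto
  note [measurable] = leb_pos_measurable_continuous[OF ch]
  have Gh: "Gc c h s = of_real (\<phi> s)" if s: "s > 0" for s
  proof -
    \<comment> \<open>The lower limit stays below a, where \<phi> vanishes, even when s itself lies
      below a.\<close>
    define l where "l = min (a / 2) s"
    have l: "0 < l" "l \<le> s" "l < a" using ab s by (auto simp: l_def)
    have "Gc c h s = iint l s (\<lambda>x. complex_of_real (deriv \<phi> x))"
      unfolding Gc_def
    proof (rule Bochner_Integration.integral_cong[OF refl])
      fix r assume "r \<in> space leb_pos"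
      then have r: "r > 0" by simp
      have "r powr c *\<^sub>R h r = of_real (deriv \<phi> r)" using r by (simp add: h_def scaleR_conv_of_real powr_minus)
      then show "indicator {0<..s} r *\<^sub>R (r powr c *\<^sub>R h r) = indicator {l..s} r *\<^sub>R complex_of_real (deriv \<phi> r)"
        using r l s1[of r] by (auto simp: indicator_def)
    qed
    also have "\<dots> = of_real (\<phi> s - \<phi> l)"
      unfolding iint_of_real by (subst iint_FTC[OF l(1,2) test_functionD(1)[OF \<phi>] c\<phi>(2)]) simp
    also have "\<phi> l = 0" using l by (intro s0) auto
    finally show ?thesis by simp
  qed
  have sol: "bessel_weight.strong_sol q c md (\<lambda>y. of_real (\<psi> y)) h"
    unfolding bessel_weight.strong_sol_def[OF dual]
  proof (intro conjI)
    show "(\<lambda>y. complex_of_real (\<psi> y)) \<in> Lp md q"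
      by (rule bessel_weight.Lp_bounded_supp0[OF dual _ B(1), of _ b]) (use ab \<psi>bd in \<open>auto intro!: AE_I2\<close>)
    obtain B' where B': "B' \<ge> 0" "\<And>x. x \<in> {a..b} \<Longrightarrow> norm (h x) \<le> B'"
      using cont_Icc_bounded[OF continuous_on_subset[OF ch sub]] by blast
    show "h \<in> Lp md q"
    proof (rule Lp_bounded_supp[OF _ ab(1) B'(1)])
      show "AE y in leb_pos. norm (h y) \<le> B' * indicator {a..b} y"
        using B' s1 by (intro AE_I2) (auto simp: indicator_def h_def)
    qed (use q in auto)
    have "ac (\<lambda>y. of_real (\<psi> y)) (\<lambda>x. complex_of_real (k x))"
      unfolding ac_def
    proof (intro conjI allI impI loc_int_of_real loc_int_cont ck)
      fix x y :: real assume "0 < x" "x \<le> y"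
      then have "\<psi> y - \<psi> x = iint x y k" by (rule FTC)
      then show "complex_of_real (\<psi> y) - of_real (\<psi> x) = iint x y (\<lambda>x. complex_of_real (k x))"
        unfolding iint_of_real of_real_diff[symmetric] by (simp only:)
    qed
    then show "ac (\<lambda>y. of_real (\<psi> y)) (\<lambda>s. s powr - c *\<^sub>R Gc c h s)"
      by (rule ac_cong_AE) (use AE_leb_pos_gt in \<open>eventually_elim\<close>, simp add: k_def Gh scaleR_conv_of_real)
  qed
  have \<psi>L: "(\<lambda>y. complex_of_real (\<psi> y)) \<in> Lp md q" using sol unfolding bessel_weight.strong_sol_def[OF dual] by blast
  have W: "(LINT y|leb_pos. y powr c *\<^sub>R (u y * h y)) = (LINT y|leb_pos. y powr c *\<^sub>R (g y * of_real (\<psi> y)))"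
    by (rule generator_weak[OF gen sol])
  have L: "(LINT y|leb_pos. y powr c *\<^sub>R (u y * h y)) = (LINT y|leb_pos. deriv \<phi> y *\<^sub>R u y)"
    by (rule Bochner_Integration.integral_cong) (auto simp: h_def scaleR_conv_of_real powr_minus field_simps)
  have i1: "integrable leb_pos (\<lambda>x. k x *\<^sub>R Gc c g x)"
  proof -
    have "integrable leb_pos (\<lambda>x. indicator {a..b} x *\<^sub>R (k x *\<^sub>R Gc c g x))"
      by (intro integrable_leb_pos_cont ab continuous_intros continuous_on_subset[OF ck] continuous_on_subset[OF cG]) (use ab in auto)
    moreover have "indicator {a..b} x *\<^sub>R (k x *\<^sub>R Gc c g x) = k x *\<^sub>R Gc c g x" for x
      using s0[of x] by (cases "x \<in> {a..b}") (simp_all add: k_def)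
    ultimately show ?thesis by (simp only:)
  qed
  have i2: "integrable leb_pos (\<lambda>x. \<psi> x *\<^sub>R (x powr c *\<^sub>R g x))"
  proof -
    have "integrable leb_pos (\<lambda>y. y powr c *\<^sub>R (g y * of_real (\<psi> y)))" by (rule pairing_integrable[OF g \<psi>L])
    then show ?thesis by (rule back_subst[of "integrable leb_pos"]) (auto simp: scaleR_conv_of_real fun_eq_iff mult_ac)
  qed
  \<comment> \<open>\<beta> n lies beyond b, so the boundary term at the upper end vanishes.\<close>
  define \<alpha> \<beta> where "\<alpha> n = 1 / real (Suc n)" and "\<beta> n = b + real (Suc n)" for n
  have \<alpha>\<beta>: "0 < \<alpha> n" "\<alpha> n \<le> 1 / real (Suc n)" "\<beta> n \<ge> real (Suc n)" "\<alpha> n \<le> \<beta> n" "b \<le> \<beta> n" for n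
  proof -
    have "\<alpha> n \<le> 1" by (simp add: \<alpha>_def)
    also have "1 \<le> \<beta> n" using ab by (simp add: \<beta>_def)
    finally show "\<alpha> n \<le> \<beta> n" .
  qed (use ab in \<open>auto simp: \<alpha>_def \<beta>_def\<close>)
  have eq: "iint (\<alpha> n) (\<beta> n) (\<lambda>x. k x *\<^sub>R Gc c g x) = - (\<psi> (\<alpha> n) *\<^sub>R Gc c g (\<alpha> n)) - iint (\<alpha> n) (\<beta> n) (\<lambda>x. \<psi> x *\<^sub>R (x powr c *\<^sub>R g x))" for n
  proof -
    have "iint (\<alpha> n) (\<beta> n) (\<lambda>x. k x *\<^sub>R Gc c g x) = \<psi> (\<beta> n) *\<^sub>R Gc c g (\<beta> n) - \<psi> (\<alpha> n) *\<^sub>R Gc c g (\<alpha> n) - iint (\<alpha> n) (\<beta> n) (\<lambda>x. \<psi> x *\<^sub>R (x powr c *\<^sub>R g x))"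
    proof (rule ac_by_parts[OF Gc_ac[OF g] \<alpha>\<beta>(1,4)])
      show "(\<psi> has_real_derivative k x) (at x)" if "x \<in> {\<alpha> n..\<beta> n}" for x
        using that \<alpha>\<beta>(1)[of n] by (intro D\<psi>) auto
      show "continuous_on {\<alpha> n..\<beta> n} k"
        by (rule continuous_on_subset[OF ck]) (use \<alpha>\<beta>(1)[of n] in auto)
    qed
    then show ?thesis using \<psi>b[OF \<alpha>\<beta>(5)] by simp
  qed
  have \<alpha>0: "filterlim \<alpha> (at_right 0) sequentially"
    unfolding filterlim_at
  proof
    show "\<alpha> \<longlonglongrightarrow> 0" unfolding \<alpha>_def using LIMSEQ_inverse_real_of_nat by (simp add: inverse_eq_divide)
    show "\<forall>\<^sub>F n in sequentially. \<alpha> n \<in> {0<..} \<and> \<alpha> n \<noteq> 0" using \<alpha>\<beta>(1) by (auto intro!: always_eventually simp: less_imp_neq[THEN not_sym])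
  qed
  have G0: "(\<lambda>n. Gc c g (\<alpha> n)) \<longlonglongrightarrow> 0" by (rule filterlim_compose[OF Gc_tendsto_0[OF g] \<alpha>0])
  have bd0: "(\<lambda>n. \<psi> (\<alpha> n) *\<^sub>R Gc c g (\<alpha> n)) \<longlonglongrightarrow> 0"
  proof (rule Lim_null_comparison)
    show "\<forall>\<^sub>F n in sequentially. norm (\<psi> (\<alpha> n) *\<^sub>R Gc c g (\<alpha> n)) \<le> B * norm (Gc c g (\<alpha> n))"
    proof (intro always_eventually allI)
      fix n
      have "norm (\<psi> (\<alpha> n)) \<le> B * indicator {0<..b} (\<alpha> n)" by (rule \<psi>bd[OF \<alpha>\<beta>(1)])
      also have "\<dots> \<le> B * 1" using B(1) by (intro mult_left_mono indicator_le_1)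
      finally have "norm (\<psi> (\<alpha> n)) \<le> B" by simp
      then show "norm (\<psi> (\<alpha> n) *\<^sub>R Gc c g (\<alpha> n)) \<le> B * norm (Gc c g (\<alpha> n))" by (simp add: mult_right_mono)
    qed
    show "(\<lambda>n. B * norm (Gc c g (\<alpha> n))) \<longlonglongrightarrow> 0" using tendsto_mult[OF tendsto_const tendsto_norm[OF G0]] by simp
  qed
  have "(\<lambda>n. iint (\<alpha> n) (\<beta> n) (\<lambda>x. k x *\<^sub>R Gc c g x)) \<longlonglongrightarrow> (LINT x|leb_pos. k x *\<^sub>R Gc c g x)"
    by (rule tendsto_iint_exhaust[OF i1 \<alpha>\<beta>(1,2,3)])
  moreover have "(\<lambda>n. iint (\<alpha> n) (\<beta> n) (\<lambda>x. k x *\<^sub>R Gc c g x)) \<longlonglongrightarrow> - 0 - (LINT x|leb_pos. \<psi> x *\<^sub>R (x powr c *\<^sub>R g x))"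
    unfolding eq by (intro tendsto_diff tendsto_minus bd0 tendsto_iint_exhaust[OF i2 \<alpha>\<beta>(1,2,3)])
  ultimately have "(LINT x|leb_pos. k x *\<^sub>R Gc c g x) = - 0 - (LINT x|leb_pos. \<psi> x *\<^sub>R (x powr c *\<^sub>R g x))"
    by (rule LIMSEQ_unique)
  moreover have "(LINT x|leb_pos. \<psi> x *\<^sub>R (x powr c *\<^sub>R g x)) = (LINT y|leb_pos. y powr c *\<^sub>R (g y * of_real (\<psi> y)))"
    by (rule Bochner_Integration.integral_cong) (auto simp: scaleR_conv_of_real)
  moreover have "(LINT x|leb_pos. k x *\<^sub>R Gc c g x) = (LINT y|leb_pos. \<phi> y *\<^sub>R (y powr - c *\<^sub>R Gc c g y))"
    by (rule Bochner_Integration.integral_cong) (auto simp: k_def mult.commute)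
  ultimately show "(LINT y|leb_pos. deriv \<phi> y *\<^sub>R u y) = - (LINT y|leb_pos. \<phi> y *\<^sub>R (y powr - c *\<^sub>R Gc c g y))"
    using W L by simp
qed

end

section \<open>Hardy inequalities and interpolation\<close>

lemma neg_divide: "- x / d = x / - d" for x d :: real
  using minus_divide_divide[of "- x" d] by simp

text \<open>Suited to Hardy operators: their values are Bochner integrals, whose norms are only
  dominated by the integral operator applied to |f|.\<close>

lemma Lp_schur:
  fixes k :: "real \<Rightarrow> real \<Rightarrow> real" and f h :: "real \<Rightarrow> complex"
  assumes pq: "p > 1" "q > 1" "1/p + 1/q = 1"
    and k: "(\<lambda>(y, \<rho>). k y \<rho>) \<in> borel_measurable (leb_pos \<Otimes>\<^sub>M leb_pos)"
    and k0: "\<And>y \<rho>. y > 0 \<Longrightarrow> \<rho> > 0 \<Longrightarrow> k y \<rho> \<ge> 0"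
    and C: "C1 \<ge> 0" "C2 \<ge> 0"
    and k1: "\<And>y. y > 0 \<Longrightarrow> (\<integral>\<^sup>+\<rho>. ennreal (k y \<rho> * \<rho> powr (- a * q)) \<partial>leb_pos) \<le> ennreal (C1 * y powr (- a * q))"
    and k2: "\<And>\<rho>. \<rho> > 0 \<Longrightarrow> (\<integral>\<^sup>+y. ennreal (k y \<rho> * y powr (m - a * p)) \<partial>leb_pos) \<le> ennreal (C2 * \<rho> powr (m - a * p))"
    and f: "f \<in> Lp m p"
    and h: "h \<in> borel_measurable leb_pos" "AE y in leb_pos. norm (h y) \<le> enn2real (\<integral>\<^sup>+\<rho>. ennreal (k y \<rho> * norm (f \<rho>)) \<partial>leb_pos)"
  shows "AE y in leb_pos. (\<integral>\<^sup>+\<rho>. ennreal (k y \<rho> * norm (f \<rho>)) \<partial>leb_pos) < \<infinity>" and "h \<in> Lp m p"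
proof -
  note [measurable] = LpD(1)[OF f]
  have fin: "(\<integral>\<^sup>+\<rho>. ennreal (norm (f \<rho>) powr p * \<rho> powr m) \<partial>leb_pos) < \<infinity>" using LpD(2)[OF f] by (simp add: Np_def)
  have nm: "(\<lambda>\<rho>. norm (f \<rho>)) \<in> borel_measurable leb_pos" by measurable
  note S = schur_test[OF pq k k0 C k1 k2 nm norm_ge_zero fin]
  show "AE y in leb_pos. (\<integral>\<^sup>+\<rho>. ennreal (k y \<rho> * norm (f \<rho>)) \<partial>leb_pos) < \<infinity>" by (rule S(1))
  have "Np m p h \<le> (\<integral>\<^sup>+y. ennreal (enn2real (\<integral>\<^sup>+\<rho>. ennreal (k y \<rho> * norm (f \<rho>)) \<partial>leb_pos) powr p * y powr m) \<partial>leb_pos)"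
    unfolding Np_def
    by (rule nn_integral_mono_AE, use h(2) in eventually_elim) (use pq in \<open>auto intro!: ennreal_leI mult_right_mono powr_mono2\<close>)
  also note S(2)
  also have "ennreal (C1 powr (p - 1) * C2) * (\<integral>\<^sup>+\<rho>. ennreal (norm (f \<rho>) powr p * \<rho> powr m) \<partial>leb_pos) < \<infinity>"
    using fin by (simp add: ennreal_mult_less_top)
  finally show "h \<in> Lp m p" using h(1) by (simp add: Lp_iff)
qed

text \<open>\<open>integrable_small_points\<close> for the integrable function |f|^p y^m.\<close>

lemma Lp_small_points:
  assumes f: "f \<in> Lp m p" and "e > 0" "d > 0"
  shows "\<exists>x. 0 < x \<and> x \<le> d \<and> x powr (m + 1) * norm (f x) powr p < e" "\<exists>x\<ge>d. x powr (m + 1) * norm (f x) powr p < e"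
proof -
  note [measurable] = LpD(1)[OF f]
  have "integrable leb_pos (\<lambda>y. norm (f y) powr p * y powr m)"
    using LpD(2)[OF f] by (intro integrableI_nonneg) (auto simp: Np_def)
  from integrable_small_points[OF this _ assms(2,3)]
  have 1: "\<exists>x. 0 < x \<and> x \<le> d \<and> x * (norm (f x) powr p * x powr m) < e" and 2: "\<exists>x\<ge>d. x * (norm (f x) powr p * x powr m) < e"
    by auto
  have *: "x * (norm (f x) powr p * x powr m) = x powr (m + 1) * norm (f x) powr p" if "x > 0" for x
    using that by (simp add: powr_add)
  from 1 show "\<exists>x. 0 < x \<and> x \<le> d \<and> x powr (m + 1) * norm (f x) powr p < e" by (auto simp: *)
  from 2 obtain x where "x \<ge> d" "x * (norm (f x) powr p * x powr m) < e" by blast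
  then show "\<exists>x\<ge>d. x powr (m + 1) * norm (f x) powr p < e" using \<open>d > 0\<close> *[of x] by (intro exI[of _ x]) auto
qed

text \<open>The set where f and g differ is open and a null set, hence empty.\<close>

lemma continuous_AE_eq:
  fixes f g :: "real \<Rightarrow> 'a::real_normed_vector"
  assumes "continuous_on {0<..} f" "continuous_on {0<..} g" "AE y in leb_pos. f y = g y" "x > 0"
  shows "f x = g x"
proof (rule ccontr)
  assume ne: "f x \<noteq> g x"
  define U where "U = (\<lambda>y. f y - g y) -` (- {0}) \<inter> {0<..}"
  have "continuous_on {0<..} (\<lambda>y. f y - g y)" by (intro continuous_intros assms)
  then have "open U"
    unfolding U_def by (subst (asm) continuous_on_open_vimage) (auto simp: open_Compl)
  moreover have "x \<in> U" using ne assms(4) by (simp add: U_def)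
  ultimately have "\<not> negligible U" by (intro open_not_negligible) auto
  moreover have "negligible U"
  proof -
    have "AE y in lebesgue. y \<in> {0<..} \<longrightarrow> f y = g y"
      using assms(3) by (subst (asm) AE_restrict_space_iff) auto
    then have "AE y in lebesgue. y \<notin> U" by eventually_elim (auto simp: U_def)
    then have "U \<in> null_sets lebesgue" using \<open>open U\<close> by (subst AE_iff_null_sets) auto
    then show ?thesis by (simp add: negligible_iff_null_sets)
  qed
  ultimately show False by simp
qed

context bessel_weight
begin

text \<open>Hardy's inequality: the kernel s^(-c-1) r^c on r \<le> s is homogeneous of degree -1,
  and Schur's test succeeds with an exponent a satisfying the same constraints as for the semigroup.
  The two constants are the factors in the power integrals.\<close>

lemma hardy_Gc:
  assumes g: "g \<in> Lp m p"
  shows "(\<lambda>s. (s powr - c *\<^sub>R Gc c g s) / of_real s) \<in> Lp m p"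
proof -
  note [measurable] = LpD(1)[OF g] leb_pos_measurable_continuous[OF ac_continuous_on[OF Gc_ac[OF g]]]
  obtain a where a: "a \<ge> 0" "a * q < c + 1" "a * p < m + 1" "m - c < a * p" using schur_exponent by blast
  define k where "k s r = indicator {0<..s} r * r powr c * s powr (- c - 1)" for s r :: real
  have km: "(\<lambda>(s, r). k s r) \<in> borel_measurable (leb_pos \<Otimes>\<^sub>M leb_pos)"
  proof -
    have "(\<lambda>(s, r). k s r) = (\<lambda>(s, r). (if 0 < r \<and> r \<le> s then 1 else 0) * r powr c * s powr (- c - 1))"
      by (auto simp: k_def indicator_def fun_eq_iff)
    also have "\<dots> \<in> borel_measurable (leb_pos \<Otimes>\<^sub>M leb_pos)" by measurable
    finally show ?thesis .
  qed
  show ?thesis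
  proof (rule Lp_schur(2)[OF p q(1,2) km, of "1 / (c + 1 - a * q)" "1 / (c + a * p - m)" a])
    fix s :: real assume s: "s > 0"
    have "(\<integral>\<^sup>+r. ennreal (k s r * r powr (- a * q)) \<partial>leb_pos) = (\<integral>\<^sup>+r. ennreal (s powr (- c - 1)) * ennreal (indicator {0<..s} r * r powr (c - a * q)) \<partial>leb_pos)"
    proof (intro nn_integral_cong)
      fix r assume "r \<in> space leb_pos"
      have "r powr c * r powr (- a * q) = r powr (c - a * q)" by (simp add: powr_add[symmetric])
      then show "ennreal (k s r * r powr (- a * q)) = ennreal (s powr (- c - 1)) * ennreal (indicator {0<..s} r * r powr (c - a * q))"
        by (simp add: k_def ennreal_mult'[symmetric] mult_ac)
    qed
    also have "\<dots> = ennreal (s powr (- c - 1)) * ennreal (s powr (c - a * q + 1) / (c - a * q + 1))"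
      using a s by (subst nn_integral_powr_below[symmetric]) (auto intro!: nn_integral_cmult)
    also have "\<dots> = ennreal ((s powr (- c - 1) * s powr (c - a * q + 1)) / (c - a * q + 1))"
      using a by (simp add: ennreal_mult'[symmetric])
    also have "s powr (- c - 1) * s powr (c - a * q + 1) = s powr (- a * q)"
      by (simp add: powr_add[symmetric])
    finally show "(\<integral>\<^sup>+r. ennreal (k s r * r powr (- a * q)) \<partial>leb_pos) \<le> ennreal (1 / (c + 1 - a * q) * s powr (- a * q))"
      by (simp add: algebra_simps)
  next
    fix r :: real assume r: "r > 0"
    have "(\<integral>\<^sup>+s. ennreal (k s r * s powr (m - a * p)) \<partial>leb_pos) = (\<integral>\<^sup>+s. ennreal (r powr c) * ennreal (indicator {r..} s * s powr (m - a * p - c - 1)) \<partial>leb_pos)"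
    proof (intro nn_integral_cong)
      fix s assume "s \<in> space leb_pos"
      have "s powr (- c - 1) * s powr (m - a * p) = s powr (m - a * p - c - 1)" by (simp add: powr_add[symmetric] algebra_simps)
      moreover have "indicator {0<..s} r = (indicator {r..} s :: real)" using r by (auto simp: indicator_def)
      ultimately show "ennreal (k s r * s powr (m - a * p)) = ennreal (r powr c) * ennreal (indicator {r..} s * s powr (m - a * p - c - 1))"
        by (simp add: k_def ennreal_mult'[symmetric] mult_ac)
    qed
    also have "\<dots> = ennreal (r powr c) * ennreal (- (r powr (m - a * p - c - 1 + 1)) / (m - a * p - c - 1 + 1))"
      using a r by (subst nn_integral_powr_above[symmetric]) (auto intro!: nn_integral_cmult)
    also have "\<dots> = ennreal ((r powr c * r powr (m - a * p - c)) / (c + a * p - m))"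
    proof -
      have "- (r powr (m - a * p - c - 1 + 1)) / (m - a * p - c - 1 + 1) = r powr (m - a * p - c) / (c + a * p - m)"
      proof -
        have "- (r powr (m - a * p - c - 1 + 1)) / (m - a * p - c - 1 + 1) = r powr (m - a * p - c - 1 + 1) / - (m - a * p - c - 1 + 1)" by (rule neg_divide)
        also have "- (m - a * p - c - 1 + 1) = c + a * p - m" by simp
        finally show ?thesis by simp
      qed
      then show ?thesis by (simp add: ennreal_mult'[symmetric])
    qed
    also have "r powr c * r powr (m - a * p - c) = r powr (m - a * p)" by (simp add: powr_add[symmetric])
    finally show "(\<integral>\<^sup>+s. ennreal (k s r * s powr (m - a * p)) \<partial>leb_pos) \<le> ennreal (1 / (c + a * p - m) * r powr (m - a * p))" by simp
  next
    show "(\<lambda>s. (s powr - c *\<^sub>R Gc c g s) / of_real s) \<in> borel_measurable leb_pos" by measurable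
    show "AE y in leb_pos. norm ((y powr - c *\<^sub>R Gc c g y) / complex_of_real y) \<le> enn2real (\<integral>\<^sup>+\<rho>. ennreal (k y \<rho> * norm (g \<rho>)) \<partial>leb_pos)"
      using AE_leb_pos_gt
    proof eventually_elim
      case (elim s)
      have i: "integrable leb_pos (\<lambda>r. (s powr (- c - 1)) *\<^sub>R (indicator {0<..s} r *\<^sub>R (r powr c *\<^sub>R g r)))"
        by (intro integrable_scaleR_right powr_c_integrable[OF g])
      have eq: "norm ((s powr (- c - 1)) *\<^sub>R (indicator {0<..s} r *\<^sub>R (r powr c *\<^sub>R g r))) = k s r * norm (g r)" for r
        by (simp add: k_def abs_mult mult_ac)
      have "s powr (- c - 1) = s powr - c / s" using elim by (simp add: powr_diff)
      then have "(s powr - c *\<^sub>R Gc c g s) / of_real s = (LINT r|leb_pos. (s powr (- c - 1)) *\<^sub>R (indicator {0<..s} r *\<^sub>R (r powr c *\<^sub>R g r)))"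
        unfolding integral_scaleR_right Gc_def by (simp add: scaleR_conv_of_real)
      moreover have "norm \<dots> \<le> enn2real (\<integral>\<^sup>+r. ennreal (norm ((s powr (- c - 1)) *\<^sub>R (indicator {0<..s} r *\<^sub>R (r powr c *\<^sub>R g r)))) \<partial>leb_pos)"
        by (rule norm_integral_le_enn2real(2)) (use i in \<open>simp only: integrable_iff_bounded\<close>)
      ultimately show ?case unfolding eq by simp
    qed
  qed (use a g in \<open>auto simp: k_def\<close>)
qed

text \<open>The constant of integration vanishes because \<open>y\<^sup>-\<^sup>c\<^sup>-\<^sup>1\<close> is not in \<open>L\<^sup>p\<^sub>m\<close> near 0.\<close>

lemma ac_eq_Gc:
  assumes W: "ac W (\<lambda>r. r powr c *\<^sub>R g r)" and g: "g \<in> Lp m p" and L: "(\<lambda>s. (s powr - c *\<^sub>R W s) / of_real s) \<in> Lp m p" and s: "s > 0"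
  shows "W s = Gc c g s"
proof -
  define K where "K = W 1 - Gc c g 1"
  have K: "W x - Gc c g x = K" if "x > 0" for x
    unfolding K_def by (rule ac_unique[OF W Gc_ac[OF g] that]) simp
  have D: "(\<lambda>s. (s powr - c *\<^sub>R W s) / of_real s - (s powr - c *\<^sub>R Gc c g s) / of_real s) \<in> Lp m p"
    using p by (intro Lp_diff L hardy_Gc g) auto
  have "K = 0"
  proof (rule ccontr)
    assume "K \<noteq> 0"
    then have e: "norm K powr p > 0" by simp
    obtain x where x: "0 < x" "x \<le> 1" "x powr (m + 1) * norm ((x powr - c *\<^sub>R W x) / of_real x - (x powr - c *\<^sub>R Gc c g x) / of_real x) powr p < norm K powr p"
      using Lp_small_points(1)[OF D e zero_less_one] by blast
    have "(x powr - c *\<^sub>R W x) / of_real x - (x powr - c *\<^sub>R Gc c g x) / of_real x = (x powr - c *\<^sub>R K) / of_real x"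
      unfolding K[OF x(1), symmetric] by (simp add: scaleR_diff_right diff_divide_distrib)
    then have n: "norm ((x powr - c *\<^sub>R W x) / of_real x - (x powr - c *\<^sub>R Gc c g x) / of_real x) = x powr (- c - 1) * norm K"
      using x(1) by (simp add: norm_divide powr_diff)
    have "x powr (m + 1) * (x powr (- c - 1) * norm K) powr p = x powr (m + 1) * x powr ((- c - 1) * p) * norm K powr p"
      by (simp add: powr_mult powr_powr)
    also have "x powr (m + 1) * x powr ((- c - 1) * p) = x powr (m + 1 + (- c - 1) * p)" by (rule powr_add[symmetric])
    also have "x powr (m + 1 + (- c - 1) * p) * norm K powr p \<ge> 1 * norm K powr p"
    proof (rule mult_right_mono)
      \<comment> \<open>The exponent is nonpositive because (m+1)/p < c+1; since x \<le> 1, the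
        power of x is at least 1.\<close>
      have "m + 1 < (c + 1) * p" using m1 p by (simp add: field_simps)
      then have "m + 1 + (- c - 1) * p \<le> 0" by (simp add: algebra_simps)
      then show "1 \<le> x powr (m + 1 + (- c - 1) * p)"
        using powr_mono'[of "m + 1 + (- c - 1) * p" 0 x] x by simp
    qed simp
    finally show False using x(3) unfolding n by simp
  qed
  then show ?thesis using K[OF s] by simp
qed

end

text \<open>Since \<open>v\<close> tends to 0 along a sequence at infinity, \<open>\<bar>v(y)\<bar> \<le> \<integral>\<^sub>y\<^sup>\<infinity> \<bar>w\<bar>\<close>.\<close>

lemma hardy_infinity:
  assumes p: "1 < p" and m: "1 < (m + 1) / p" and v: "ac v w" "v \<in> Lp m p" "w \<in> Lp m p"
  shows "(\<lambda>y. v y / of_real y) \<in> Lp m p"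
proof -
  define q where "q = p / (p - 1)"
  have q: "q > 1" "1 / p + 1 / q = 1" using p by (auto simp: q_def field_simps)
  note [measurable] = LpD(1)[OF v(2)] LpD(1)[OF v(3)]
  have q1: "1 / q = 1 - 1 / p" using q by simp
  have "1 / q < m / p" unfolding q1 using m by (simp add: add_divide_distrib)
  \<comment> \<open>The lower bound makes the moments converge at infinity, the upper one those at
    0; the interval is nonempty because (m+1)/p > 1 means 1/q < m/p.\<close>
  then obtain a where a: "1 / q < a" "a < m / p" using dense by blast
  have aq: "a * q > 1" "a * p < m" using a p q(1) by (auto simp: field_simps)
  define k where "k y \<rho> = indicator {y..} \<rho> / y" for y \<rho> :: real
  have km: "(\<lambda>(y, \<rho>). k y \<rho>) \<in> borel_measurable (leb_pos \<Otimes>\<^sub>M leb_pos)"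
  proof -
    have "(\<lambda>(y, \<rho>). k y \<rho>) = (\<lambda>(y, \<rho>). (if y \<le> \<rho> then 1 else 0) / y)"
      by (auto simp: k_def indicator_def fun_eq_iff)
    also have "\<dots> \<in> borel_measurable (leb_pos \<Otimes>\<^sub>M leb_pos)" by measurable
    finally show ?thesis .
  qed
  have k1: "(\<integral>\<^sup>+\<rho>. ennreal (k y \<rho> * \<rho> powr (- a * q)) \<partial>leb_pos) \<le> ennreal (1 / (a * q - 1) * y powr (- a * q))" if y: "y > 0" for y
  proof -
    have "(\<integral>\<^sup>+\<rho>. ennreal (k y \<rho> * \<rho> powr (- a * q)) \<partial>leb_pos) = (\<integral>\<^sup>+\<rho>. ennreal (1 / y) * ennreal (indicator {y..} \<rho> * \<rho> powr (- a * q)) \<partial>leb_pos)"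
      using y by (intro nn_integral_cong) (simp add: k_def ennreal_mult'[symmetric])
    also have "\<dots> = ennreal (1 / y) * ennreal (- (y powr (- a * q + 1)) / (- a * q + 1))"
      using aq y by (subst nn_integral_powr_above[symmetric]) (auto intro!: nn_integral_cmult)
    also have "\<dots> = ennreal ((1 / y) * (y powr (- a * q + 1) / (a * q - 1)))"
    proof -
      have "- (y powr (- a * q + 1)) / (- a * q + 1) = y powr (- a * q + 1) / (a * q - 1)"
      proof -
        have "- (y powr (- a * q + 1)) / (- a * q + 1) = y powr (- a * q + 1) / - (- a * q + 1)" by (rule neg_divide)
        also have "- (- a * q + 1) = a * q - 1" by simp
        finally show ?thesis .
      qed
      then show ?thesis using y by (simp add: ennreal_mult'[symmetric])
    qed
    also have "(1 / y) * (y powr (- a * q + 1) / (a * q - 1)) = 1 / (a * q - 1) * y powr (- a * q)"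
      using y powr_add[of y "- a * q" 1] by simp
    finally show ?thesis by simp
  qed
  have k2: "(\<integral>\<^sup>+y. ennreal (k y \<rho> * y powr (m - a * p)) \<partial>leb_pos) \<le> ennreal (1 / (m - a * p) * \<rho> powr (m - a * p))" if \<rho>: "\<rho> > 0" for \<rho>
  proof -
    have "(\<integral>\<^sup>+y. ennreal (k y \<rho> * y powr (m - a * p)) \<partial>leb_pos) = (\<integral>\<^sup>+y. ennreal (indicator {0<..\<rho>} y * y powr (m - a * p - 1)) \<partial>leb_pos)"
    proof (intro nn_integral_cong arg_cong[where f = ennreal])
      fix y assume "y \<in> space leb_pos"
      then have y: "y > 0" by simp
      then show "k y \<rho> * y powr (m - a * p) = indicator {0<..\<rho>} y * y powr (m - a * p - 1)"
        by (auto simp: k_def powr_diff indicator_def)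
    qed
    also have "\<dots> = ennreal (\<rho> powr (m - a * p - 1 + 1) / (m - a * p - 1 + 1))"
      by (rule nn_integral_powr_below) (use aq \<rho> in auto)
    finally show ?thesis by simp
  qed
  have C: "0 \<le> 1 / (a * q - 1)" "0 \<le> 1 / (m - a * p)" using aq by auto
  have k0: "k y \<rho> \<ge> 0" if "y > 0" "\<rho> > 0" for y \<rho> using that by (simp add: k_def)
  note S = Lp_schur[OF p q km k0 C k1 k2 v(3)]
  have "AE y in leb_pos. (\<integral>\<^sup>+\<rho>. ennreal (k y \<rho> * norm (w \<rho>)) \<partial>leb_pos) < \<infinity>"
    \<comment> \<open>Only the finiteness is wanted here, so the function to be dominated is taken
      to be 0.\<close>
    by (rule S(1)[of "\<lambda>_. 0"]) auto
  then have ae: "AE y in leb_pos. integrable leb_pos (\<lambda>\<rho>. indicator {y..} \<rho> *\<^sub>R w \<rho>)"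
    using AE_leb_pos_gt
  proof eventually_elim
    case (elim y)
    have "(\<integral>\<^sup>+\<rho>. ennreal (norm (indicator {y..} \<rho> *\<^sub>R w \<rho>)) \<partial>leb_pos) = (\<integral>\<^sup>+\<rho>. ennreal y * ennreal (k y \<rho> * norm (w \<rho>)) \<partial>leb_pos)"
      using elim by (intro nn_integral_cong) (simp add: k_def ennreal_mult'[symmetric])
    also have "\<dots> = ennreal y * (\<integral>\<^sup>+\<rho>. ennreal (k y \<rho> * norm (w \<rho>)) \<partial>leb_pos)"
    proof (rule nn_integral_cmult)
      have [measurable]: "k y \<in> borel_measurable leb_pos" unfolding k_def by measurable
      show "(\<lambda>\<rho>. ennreal (k y \<rho> * norm (w \<rho>))) \<in> borel_measurable leb_pos" by measurable
    qed
    also have "\<dots> < \<infinity>" using elim by (simp add: ennreal_mult_less_top)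
    finally show ?case by (intro integrableI_bounded) measurable
  qed
  have "v y = - (LINT \<rho>|leb_pos. indicator {y..} \<rho> *\<^sub>R w \<rho>)" if y: "y > 0" and i: "integrable leb_pos (\<lambda>\<rho>. indicator {y..} \<rho> *\<^sub>R w \<rho>)" for y
  proof -
    define I where "I = (LINT \<rho>|leb_pos. indicator {y..} \<rho> *\<^sub>R w \<rho>)"
    \<comment> \<open>By the increment formula v x - (v y + I) is minus the integral of w over [x,
      \<infinity>), which is small for large x.\<close>
    have cauchy: "norm (v x - (v y + I)) \<le> (LINT \<rho>|leb_pos. norm (indicator {x..} \<rho> *\<^sub>R w \<rho>))" if "x \<ge> y" for x
    proof -
      have ix: "integrable leb_pos (\<lambda>\<rho>. indicator {x..} \<rho> *\<^sub>R w \<rho>)"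
        by (rule Bochner_Integration.integrable_bound[OF i]) (measurable, use that in \<open>auto simp: indicator_def\<close>)
      have "I = (LINT \<rho>|leb_pos. indicator {y..x} \<rho> *\<^sub>R w \<rho> + indicator {x..} \<rho> *\<^sub>R w \<rho>)"
        unfolding I_def
      proof (rule integral_cong_AE)
        show "AE s in leb_pos. indicator {y..} s *\<^sub>R w s = indicator {y..x} s *\<^sub>R w s + indicator {x..} s *\<^sub>R w s"
          using AE_leb_pos_neq[of x] by eventually_elim (use that in \<open>auto simp: indicator_def\<close>)
      qed measurable
      also have "\<dots> = iint y x w + (LINT \<rho>|leb_pos. indicator {x..} \<rho> *\<^sub>R w \<rho>)"
        by (rule Bochner_Integration.integral_add[OF loc_intD(2)[OF acD(1)[OF v(1)] y] ix])
      also have "iint y x w = v x - v y" using acD(2)[OF v(1) y that] by simp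
      finally have "v x - (v y + I) = - (LINT \<rho>|leb_pos. indicator {x..} \<rho> *\<^sub>R w \<rho>)" by simp
      then show ?thesis using integral_norm_bound[of leb_pos "\<lambda>\<rho>. indicator {x..} \<rho> *\<^sub>R w \<rho>"] by simp
    qed
    have tail: "(\<lambda>n. LINT \<rho>|leb_pos. norm (indicator {y + real n..} \<rho> *\<^sub>R w \<rho>)) \<longlonglongrightarrow> (LINT \<rho>|leb_pos. 0)"
    proof (rule integral_dominated_convergence[OF _ _ integrable_norm[OF i]])
      show "AE x in leb_pos. (\<lambda>n. norm (indicator {y + real n..} x *\<^sub>R w x)) \<longlonglongrightarrow> 0"
      proof (intro AE_I2)
        fix x
        obtain N where N: "x - y < real N" using reals_Archimedean2 by blast
        have "norm (indicator {y + real n..} x *\<^sub>R w x) = 0" if "n \<ge> N" for n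
          using N that by (auto simp: indicator_def)
        then show "(\<lambda>n. norm (indicator {y + real n..} x *\<^sub>R w x)) \<longlonglongrightarrow> 0"
          by (intro tendsto_eventually) (auto simp: eventually_sequentially)
      qed
      show "AE x in leb_pos. norm (norm (indicator {y + real n..} x *\<^sub>R w x)) \<le> norm (indicator {y..} x *\<^sub>R w x)" for n
        by (auto simp: indicator_def)
    qed measurable
    \<comment> \<open>Otherwise |v| would stay above a positive constant far out, against
      \<open>Lp_small_points\<close>.\<close>
    have "v y + I = 0"
    proof (rule ccontr)
      assume ne: "v y + I \<noteq> 0"
      define e where "e = norm (v y + I) / 2"
      have e: "e > 0" using ne by (simp add: e_def)
      obtain n where n: "(LINT \<rho>|leb_pos. norm (indicator {y + real n..} \<rho> *\<^sub>R w \<rho>)) < e"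
        using order_tendstoD(2)[OF tail, of e] e by (auto simp: eventually_sequentially)
      define d where "d = max (y + real n) 1"
      have d: "d > 0" "d \<ge> 1" "d \<ge> y + real n" by (auto simp: d_def)
      have "e powr p > 0" using e by simp
      then obtain x where x: "x \<ge> d" "x powr (m + 1) * norm (v x) powr p < e powr p"
        using Lp_small_points(2)[OF v(2) _ d(1)] by blast
      have "norm (v x - (v y + I)) \<le> (LINT \<rho>|leb_pos. norm (indicator {x..} \<rho> *\<^sub>R w \<rho>))" using x(1) d by (intro cauchy) auto
      also have "\<dots> \<le> (LINT \<rho>|leb_pos. norm (indicator {y + real n..} \<rho> *\<^sub>R w \<rho>))"
      proof (rule integral_mono)
        have *: "integrable leb_pos (\<lambda>\<rho>. indicator {z..} \<rho> *\<^sub>R w \<rho>)" if "z \<ge> y" for z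
          by (rule Bochner_Integration.integrable_bound[OF i]) (measurable, use that in \<open>auto simp: indicator_def\<close>)
        show "integrable leb_pos (\<lambda>\<rho>. norm (indicator {x..} \<rho> *\<^sub>R w \<rho>))" "integrable leb_pos (\<lambda>\<rho>. norm (indicator {y + real n..} \<rho> *\<^sub>R w \<rho>))"
          using x(1) d by (auto intro!: integrable_norm * simp del: norm_scaleR)
      qed (use x(1) d in \<open>auto simp: indicator_def\<close>)
      also have "\<dots> < e" by (rule n)
      finally have "norm (v x) > e" using norm_triangle_ineq2[of "v y + I" "v x"] unfolding e_def by (simp add: norm_minus_commute)
      then have "e powr p \<le> norm (v x) powr p" using e p by (intro powr_mono2) auto
      also have "\<dots> \<le> x powr (m + 1) * norm (v x) powr p"
      proof -
        have "m + 1 > 0" using m p by (simp add: field_simps)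
        then have "1 \<le> x powr (m + 1)" using x(1) d by (intro ge_one_powr_ge_zero) auto
        then have "1 * norm (v x) powr p \<le> x powr (m + 1) * norm (v x) powr p" by (rule mult_right_mono) simp
        then show ?thesis by simp
      qed
      finally show False using x(2) by simp
    qed
    then show ?thesis by (simp add: I_def eq_neg_iff_add_eq_0)
  qed
  note vI = this
  show ?thesis
  proof (rule S(2))
    show "(\<lambda>y. v y / complex_of_real y) \<in> borel_measurable leb_pos" by measurable
    show "AE y in leb_pos. norm (v y / complex_of_real y) \<le> enn2real (\<integral>\<^sup>+\<rho>. ennreal (k y \<rho> * norm (w \<rho>)) \<partial>leb_pos)"
      using ae AE_leb_pos_gt
    proof eventually_elim
      case (elim y)
      have i: "integrable leb_pos (\<lambda>\<rho>. (1 / y) *\<^sub>R (indicator {y..} \<rho> *\<^sub>R w \<rho>))" by (intro integrable_scaleR_right elim)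
      have eq: "norm ((1 / y) *\<^sub>R (indicator {y..} \<rho> *\<^sub>R w \<rho>)) = k y \<rho> * norm (w \<rho>)" for \<rho>
        using elim(2) by (simp add: k_def)
      have "norm (v y / complex_of_real y) = norm (LINT \<rho>|leb_pos. (1 / y) *\<^sub>R (indicator {y..} \<rho> *\<^sub>R w \<rho>))"
        unfolding integral_scaleR_right vI[OF elim(2,1)] using elim(2) by (simp add: norm_divide)
      also have "\<dots> \<le> enn2real (\<integral>\<^sup>+\<rho>. ennreal (norm ((1 / y) *\<^sub>R (indicator {y..} \<rho> *\<^sub>R w \<rho>))) \<partial>leb_pos)"
        by (rule norm_integral_le_enn2real(2)) (use i in \<open>simp only: integrable_iff_bounded\<close>)
      finally show ?case unfolding eq .
    qed
  qed
qed

text \<open>Average \<open>v\<close> over \<open>[y, y + 1]\<close> against a weight of integral 1 that vanishes at the end points,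
  and move the derivative onto the weight.\<close>

lemma interpolation_pointwise:
  assumes u: "ac u v" and v: "ac v w" and y: "y > 0"
  shows "norm (v y) \<le> 6 * (LINT s|leb_pos. norm (indicator {y..y + 1} s *\<^sub>R u s)) + (LINT s|leb_pos. norm (indicator {y..y + 1} s *\<^sub>R w s))"
proof -
  \<comment> \<open>The parabola vanishing at y and y + 1, scaled to integral 1; its derivative is
    at most 6 in modulus on the interval, whence the constant 6.\<close>
  define \<kappa> where "\<kappa> s = 6 * (s - y) * (y + 1 - s)" for s
  define \<kappa>' where "\<kappa>' s = 6 * (2 * y + 1 - 2 * s)" for s
  define W where "W = (LINT s|leb_pos. norm (indicator {y..y + 1} s *\<^sub>R w s))"
  have D: "(\<kappa> has_real_derivative \<kappa>' s) (at s)" for s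
    unfolding \<kappa>_def \<kappa>'_def by (auto intro!: derivative_eq_intros simp: algebra_simps)
  have c: "continuous_on S \<kappa>" "continuous_on S \<kappa>'" for S
    unfolding \<kappa>_def \<kappa>'_def by (auto intro!: continuous_intros)
  have \<kappa>0: "\<kappa> s \<ge> 0" if "s \<in> {y..y + 1}" for s using that by (simp add: \<kappa>_def)
  have iw: "integrable leb_pos (\<lambda>s. indicator {a..b} s *\<^sub>R w s)" if "0 < a" for a b using acD(1)[OF v] that by (rule loc_intD)
  have iv: "integrable leb_pos (\<lambda>s. indicator {y..y + 1} s *\<^sub>R v s)" using ac_loc_int[OF v] y by (rule loc_intD)
  have iu: "integrable leb_pos (\<lambda>s. indicator {y..y + 1} s *\<^sub>R u s)" using ac_loc_int[OF u] y by (rule loc_intD)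
  have osc: "norm (v s - v y) \<le> W" if s: "s \<in> {y..y + 1}" for s
  proof -
    have "norm (v s - v y) \<le> (LINT r|leb_pos. norm (indicator {y..s} r *\<^sub>R w r))"
      using acD(2)[OF v y, of s] s integral_norm_bound[of leb_pos "\<lambda>r. indicator {y..s} r *\<^sub>R w r"] by simp
    also have "\<dots> \<le> W" unfolding W_def
      by (rule integral_mono[OF integrable_norm[OF iw[OF y]] integrable_norm[OF iw[OF y]]]) (use s in \<open>auto simp: indicator_def\<close>)
    finally show ?thesis .
  qed
  have i\<kappa>: "integrable leb_pos (\<lambda>s. indicator {y..y + 1} s *\<^sub>R \<kappa> s)" by (rule integrable_leb_pos_cont[OF y c(1)])
  have int\<kappa>: "iint y (y + 1) \<kappa> = 1"
  proof -
    define G where "G s = 3 * (s - y)\<^sup>2 - 2 * (s - y) ^ 3" for s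
    have "iint y (y + 1) \<kappa> = G (y + 1) - G y"
      by (rule iint_FTC[OF y _ _ c(1)]) (auto simp: G_def \<kappa>_def intro!: derivative_eq_intros, simp add: algebra_simps power2_eq_square)
    then show ?thesis by (simp add: G_def)
  qed
  have parts: "iint y (y + 1) (\<lambda>s. \<kappa>' s *\<^sub>R u s) = - iint y (y + 1) (\<lambda>s. \<kappa> s *\<^sub>R v s)"
    using ac_by_parts[OF u y, of "y + 1" \<kappa> \<kappa>'] D c by (simp add: \<kappa>_def)
  have i\<kappa>v: "integrable leb_pos (\<lambda>s. indicator {y..y + 1} s *\<^sub>R \<kappa> s *\<^sub>R v s)" by (rule integrable_cont_mult[OF y iv c(1)])
  have i\<kappa>'u: "integrable leb_pos (\<lambda>s. indicator {y..y + 1} s *\<^sub>R \<kappa>' s *\<^sub>R u s)" by (rule integrable_cont_mult[OF y iu c(2)])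
  have "v y = (LINT s|leb_pos. (indicator {y..y + 1} s *\<^sub>R \<kappa> s) *\<^sub>R v y)"
    unfolding integral_scaleR_left[OF i\<kappa>] int\<kappa> by simp
  also have "\<dots> = iint y (y + 1) (\<lambda>s. \<kappa> s *\<^sub>R v s) - (LINT s|leb_pos. indicator {y..y + 1} s *\<^sub>R \<kappa> s *\<^sub>R v s - (indicator {y..y + 1} s *\<^sub>R \<kappa> s) *\<^sub>R v y)"
    unfolding Bochner_Integration.integral_diff[OF i\<kappa>v integrable_scaleR_left[OF i\<kappa>]] by simp
  finally have vy: "v y = - iint y (y + 1) (\<lambda>s. \<kappa>' s *\<^sub>R u s) - (LINT s|leb_pos. indicator {y..y + 1} s *\<^sub>R \<kappa> s *\<^sub>R v s - (indicator {y..y + 1} s *\<^sub>R \<kappa> s) *\<^sub>R v y)"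
    unfolding parts by simp
  have "norm (iint y (y + 1) (\<lambda>s. \<kappa>' s *\<^sub>R u s)) \<le> (LINT s|leb_pos. norm (indicator {y..y + 1} s *\<^sub>R \<kappa>' s *\<^sub>R u s))" by (rule integral_norm_bound)
  also have "\<dots> \<le> (LINT s|leb_pos. 6 * norm (indicator {y..y + 1} s *\<^sub>R u s))"
  proof (rule integral_mono[OF integrable_norm[OF i\<kappa>'u] integrable_mult_right[OF integrable_norm[OF iu]]])
    fix s
    have "\<bar>\<kappa>' s\<bar> \<le> 6" if "s \<in> {y..y + 1}" using that by (auto simp: \<kappa>'_def abs_le_iff)
    then show "norm (indicator {y..y + 1} s *\<^sub>R \<kappa>' s *\<^sub>R u s) \<le> 6 * norm (indicator {y..y + 1} s *\<^sub>R u s)"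
      by (cases "s \<in> {y..y + 1}") (auto intro!: mult_right_mono)
  qed
  also have "\<dots> = 6 * (LINT s|leb_pos. norm (indicator {y..y + 1} s *\<^sub>R u s))" by (rule integral_mult_right_zero)
  finally have A: "norm (iint y (y + 1) (\<lambda>s. \<kappa>' s *\<^sub>R u s)) \<le> \<dots>" .
  have "norm (LINT s|leb_pos. indicator {y..y + 1} s *\<^sub>R \<kappa> s *\<^sub>R v s - (indicator {y..y + 1} s *\<^sub>R \<kappa> s) *\<^sub>R v y)
      \<le> (LINT s|leb_pos. norm (indicator {y..y + 1} s *\<^sub>R \<kappa> s *\<^sub>R v s - (indicator {y..y + 1} s *\<^sub>R \<kappa> s) *\<^sub>R v y))" by (rule integral_norm_bound)
  also have "\<dots> \<le> (LINT s|leb_pos. (indicator {y..y + 1} s *\<^sub>R \<kappa> s) * W)"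
  proof (rule integral_mono[OF integrable_norm[OF Bochner_Integration.integrable_diff[OF i\<kappa>v integrable_scaleR_left[OF i\<kappa>]]] integrable_mult_left[OF i\<kappa>]])
    fix s
    show "norm (indicator {y..y + 1} s *\<^sub>R \<kappa> s *\<^sub>R v s - (indicator {y..y + 1} s *\<^sub>R \<kappa> s) *\<^sub>R v y) \<le> (indicator {y..y + 1} s *\<^sub>R \<kappa> s) * W"
    proof (cases "s \<in> {y..y + 1}")
      case True
      have "norm (\<kappa> s *\<^sub>R (v s - v y)) \<le> \<kappa> s * W" using \<kappa>0[OF True] osc[OF True] by (simp add: mult_left_mono)
      then show ?thesis using True by (simp add: scaleR_diff_right)
    qed simp
  qed
  also have "\<dots> = iint y (y + 1) \<kappa> * W" by (rule integral_mult_left_zero)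
  also have "\<dots> = W" unfolding int\<kappa> by simp
  finally have B: "norm (LINT s|leb_pos. indicator {y..y + 1} s *\<^sub>R \<kappa> s *\<^sub>R v s - (indicator {y..y + 1} s *\<^sub>R \<kappa> s) *\<^sub>R v y) \<le> W" .
  have tri: "norm (- P - Q) \<le> norm P + norm Q" for P Q :: complex using norm_triangle_ineq4[of "- P" Q] by simp
  have "norm (v y) \<le> norm (iint y (y + 1) (\<lambda>s. \<kappa>' s *\<^sub>R u s)) + norm (LINT s|leb_pos. indicator {y..y + 1} s *\<^sub>R \<kappa> s *\<^sub>R v s - (indicator {y..y + 1} s *\<^sub>R \<kappa> s) *\<^sub>R v y)"
    by (subst vy) (rule tri)
  also have "\<dots> \<le> 6 * (LINT s|leb_pos. norm (indicator {y..y + 1} s *\<^sub>R u s)) + W" by (rule add_mono[OF A B])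
  finally show ?thesis unfolding W_def .
qed

text \<open>For y \<ge> 1 the points of [y, y+1] are comparable with y up to the factor 2, so the
  weight changes by at most 2^|m|, and Schur's test works with a = 0. This is the reason for the
  cut-off at 1.\<close>

lemma window_Lp:
  assumes p: "1 < p" and f: "f \<in> Lp m p"
  shows "(\<lambda>y. complex_of_real (indicator {1..} y * (LINT s|leb_pos. norm (indicator {y..y + 1} s *\<^sub>R f s)))) \<in> Lp m p"
proof -
  define q where "q = p / (p - 1)"
  have q: "q > 1" "1 / p + 1 / q = 1" using p by (auto simp: q_def field_simps)
  note [measurable] = LpD(1)[OF f]
  define k :: "real \<Rightarrow> real \<Rightarrow> real" where "k y \<rho> = (if 1 \<le> y \<and> y \<le> \<rho> \<and> \<rho> \<le> y + 1 then 1 else 0)" for y \<rho>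
  have km: "(\<lambda>(y, \<rho>). k y \<rho>) \<in> borel_measurable (leb_pos \<Otimes>\<^sub>M leb_pos)" unfolding k_def by measurable
  have one: "(\<integral>\<^sup>+x. ennreal (indicator {a..a + 1} x) \<partial>leb_pos) \<le> 1" for a :: real
  proof -
    have "(\<integral>\<^sup>+x. ennreal (indicator {a..a + 1} x) \<partial>leb_pos) \<le> (\<integral>\<^sup>+x. ennreal (indicator {a..a + 1} x) \<partial>lborel)"
      by (subst nn_integral_restrict_space) (auto simp: nn_integral_completion indicator_def intro!: nn_integral_mono)
    also have "\<dots> = 1" by (simp add: ennreal_indicator)
    finally show ?thesis .
  qed
  have i: "integrable leb_pos (\<lambda>s. indicator {y..y + 1} s *\<^sub>R f s)" if "y > 0" for y
    using Lp_imp_loc(2)[OF f] p that by (simp add: loc_int_def)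
  show ?thesis
  proof (rule Lp_schur(2)[OF p q km, of 1 "2 powr \<bar>m\<bar>" 0])
    fix y :: real assume y: "y > 0"
    have "(\<integral>\<^sup>+\<rho>. ennreal (k y \<rho> * \<rho> powr (- 0 * q)) \<partial>leb_pos) \<le> (\<integral>\<^sup>+\<rho>. ennreal (indicator {y..y + 1} \<rho>) \<partial>leb_pos)"
      by (intro nn_integral_mono) (auto simp: k_def indicator_def)
    also have "\<dots> \<le> 1" by (rule one)
    finally show "(\<integral>\<^sup>+\<rho>. ennreal (k y \<rho> * \<rho> powr (- 0 * q)) \<partial>leb_pos) \<le> ennreal (1 * y powr (- 0 * q))" using y by simp
  next
    fix \<rho> :: real assume \<rho>: "\<rho> > 0"
    have "(\<integral>\<^sup>+y. ennreal (k y \<rho> * y powr (m - 0 * p)) \<partial>leb_pos) \<le> (\<integral>\<^sup>+y. ennreal (2 powr \<bar>m\<bar> * \<rho> powr m) * ennreal (indicator {\<rho> - 1..\<rho> - 1 + 1} y) \<partial>leb_pos)"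
    proof (intro nn_integral_mono)
      fix y assume "y \<in> space leb_pos"
      then have y: "y > 0" by simp
      show "ennreal (k y \<rho> * y powr (m - 0 * p)) \<le> ennreal (2 powr \<bar>m\<bar> * \<rho> powr m) * ennreal (indicator {\<rho> - 1..\<rho> - 1 + 1} y)"
      proof (cases "1 \<le> y \<and> y \<le> \<rho> \<and> \<rho> \<le> y + 1")
        case True
        have "y powr m \<le> 2 powr \<bar>m\<bar> * \<rho> powr m"
        proof (cases "m \<ge> 0")
          case m: True
          have "y powr m \<le> 1 * \<rho> powr m" using True m y by (simp add: powr_mono2)
          also have "\<dots> \<le> 2 powr \<bar>m\<bar> * \<rho> powr m" by (intro mult_right_mono ge_one_powr_ge_zero) auto
          finally show ?thesis .
        next
          case m: False
          have "y powr m \<le> (\<rho> / 2) powr m" using True m \<rho> by (intro powr_mono2') auto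
          also have "\<dots> = 2 powr \<bar>m\<bar> * \<rho> powr m" using m \<rho> by (simp add: powr_divide powr_minus field_simps)
          finally show ?thesis .
        qed
        moreover have "indicator {\<rho> - 1..\<rho> - 1 + 1} y = (1::real)" using True by (auto simp: indicator_def)
        ultimately show ?thesis using True by (simp add: k_def ennreal_leI)
      next
        case False
        then have "k y \<rho> = 0" unfolding k_def by (rule if_not_P)
        then show ?thesis by simp
      qed
    qed
    also have "\<dots> = ennreal (2 powr \<bar>m\<bar> * \<rho> powr m) * (\<integral>\<^sup>+y. ennreal (indicator {\<rho> - 1..\<rho> - 1 + 1} y) \<partial>leb_pos)"
      by (rule nn_integral_cmult) measurable
    also have "\<dots> \<le> ennreal (2 powr \<bar>m\<bar> * \<rho> powr m) * 1" by (intro mult_left_mono one) simp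
    finally show "(\<integral>\<^sup>+y. ennreal (k y \<rho> * y powr (m - 0 * p)) \<partial>leb_pos) \<le> ennreal (2 powr \<bar>m\<bar> * \<rho> powr (m - 0 * p))" by simp
  next
    have "(\<lambda>(y, s). norm ((if y \<le> s \<and> s \<le> y + 1 then 1 else 0) *\<^sub>R f s)) \<in> borel_measurable (leb_pos \<Otimes>\<^sub>M leb_pos)" by measurable
    from leb_pos.borel_measurable_lebesgue_integral[OF this]
    have [measurable]: "(\<lambda>y. LINT s|leb_pos. norm (indicator {y..y + 1} s *\<^sub>R f s)) \<in> borel_measurable leb_pos"
      by (rule back_subst[of "\<lambda>F. F \<in> borel_measurable leb_pos"]) (auto simp: fun_eq_iff indicator_def intro!: Bochner_Integration.integral_cong)
    show "(\<lambda>y. complex_of_real (indicator {1..} y * (LINT s|leb_pos. norm (indicator {y..y + 1} s *\<^sub>R f s)))) \<in> borel_measurable leb_pos"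
      by measurable
    show "AE y in leb_pos. norm (complex_of_real (indicator {1..} y * (LINT s|leb_pos. norm (indicator {y..y + 1} s *\<^sub>R f s)))) \<le> enn2real (\<integral>\<^sup>+\<rho>. ennreal (k y \<rho> * norm (f \<rho>)) \<partial>leb_pos)"
      using AE_leb_pos_gt
    proof eventually_elim
      case (elim y)
      show ?case
      proof (cases "y \<ge> 1")
        case True
        have "(LINT s|leb_pos. norm (indicator {y..y + 1} s *\<^sub>R f s)) = enn2real (\<integral>\<^sup>+s. ennreal (norm (indicator {y..y + 1} s *\<^sub>R f s)) \<partial>leb_pos)"
          by (rule integral_eq_nn_integral) (use i[OF elim] in auto)
        also have "(\<integral>\<^sup>+s. ennreal (norm (indicator {y..y + 1} s *\<^sub>R f s)) \<partial>leb_pos) = (\<integral>\<^sup>+\<rho>. ennreal (k y \<rho> * norm (f \<rho>)) \<partial>leb_pos)"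
          using True by (intro nn_integral_cong) (auto simp: k_def indicator_def)
        finally show ?thesis using True by (simp add: integral_nonneg_AE)
      qed simp
    qed
  qed (use f in \<open>auto simp: k_def\<close>)
qed

text \<open>For y < 1 one has |v| \<le> |v|/y; for y \<ge> 1 the local averages of |u| and |w| over
  [y, y+1] take over.\<close>

lemma interpolation_Lp:
  assumes p: "1 < p" and u: "ac u v" "u \<in> Lp m p" and v: "ac v w" "w \<in> Lp m p" and vy: "(\<lambda>y. v y / of_real y) \<in> Lp m p"
  shows "v \<in> Lp m p"
proof -
  define F where "F f y = complex_of_real (indicator {1..} y * (LINT s|leb_pos. norm (indicator {y..y + 1} s *\<^sub>R f s)))" for f :: "real \<Rightarrow> complex" and y
  have F: "F u \<in> Lp m p" "F w \<in> Lp m p" unfolding F_def by (intro window_Lp p u v)+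
  have p0: "p \<ge> 0" using p by simp
  have n: "(\<lambda>y. complex_of_real (norm (v y / of_real y))) \<in> Lp m p"
  proof (rule Lp_dom[OF vy])
    note [measurable] = LpD(1)[OF vy]
    show "(\<lambda>y. complex_of_real (norm (v y / of_real y))) \<in> borel_measurable leb_pos" by measurable
  qed (use p0 in auto)
  have G: "(\<lambda>y. complex_of_real (norm (v y / of_real y)) + (6 * F u y + F w y)) \<in> Lp m p"
    by (intro Lp_add Lp_cmult F n p0)
  show ?thesis
  proof (rule Lp_dom[OF G])
    show "v \<in> borel_measurable leb_pos" by (rule leb_pos_measurable_continuous[OF ac_continuous_on[OF v(1)]])
    show "AE y in leb_pos. norm (v y) \<le> norm (complex_of_real (norm (v y / of_real y)) + (6 * F u y + F w y))"
      using AE_leb_pos_gt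
    proof eventually_elim
      case (elim y)
      define U W where "U = (LINT s|leb_pos. norm (indicator {y..y + 1} s *\<^sub>R u s))" and "W = (LINT s|leb_pos. norm (indicator {y..y + 1} s *\<^sub>R w s))"
      have UW: "U \<ge> 0" "W \<ge> 0" unfolding U_def W_def by (intro integral_nonneg_AE; simp)+
      have b: "norm (v y) \<le> 6 * U + W" unfolding U_def W_def by (rule interpolation_pointwise[OF u(1) v(1) elim])
      have eq: "complex_of_real (norm (v y / of_real y)) + (6 * F u y + F w y) = of_real (norm (v y / of_real y) + indicator {1..} y * (6 * U + W))"
        by (simp add: F_def U_def W_def indicator_def)
      have nn: "norm (v y / of_real y) + indicator {1..} y * (6 * U + W) \<ge> 0" using UW by (intro add_nonneg_nonneg mult_nonneg_nonneg) auto
      have "norm (v y) \<le> norm (v y / of_real y) + indicator {1..} y * (6 * U + W)"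
      proof (cases "y \<ge> 1")
        case True
        have "norm (v y) \<le> norm (v y / of_real y) + (6 * U + W)" using b by (rule add_increasing[OF norm_ge_zero])
        then show ?thesis using True by simp
      next
        case False
        have "norm (v y) * y \<le> norm (v y) * 1" using False by (intro mult_left_mono) auto
        then have "norm (v y) \<le> norm (v y) / y" using elim by (simp add: pos_le_divide_eq)
        then show ?thesis using False elim by (simp add: norm_divide)
      qed
      then show ?case unfolding eq norm_of_real using nn by simp
    qed
  qed (rule p0)
qed

section \<open>The domain of the generator\<close>

lemma weakly_differentiable_Dy: "weakly_differentiable u \<Longrightarrow> has_weak_deriv u (Dy u)"
  unfolding weakly_differentiable_def using Dy_eq(1) by blast

text \<open>Passes from the arbitrary representatives \<open>Dy u\<close> and u to continuous ones:
  w is that of \<open>Dy u\<close>, and u' (not a derivative) that of u.\<close>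

lemma weak_derivs_ac:
  assumes "weakly_differentiable u" "weakly_differentiable (Dy u)"
  obtains w u' where "ac w (Dyy u)" "AE y in leb_pos. Dy u y = w y" "ac u' w" "AE y in leb_pos. u y = u' y"
proof -
  obtain w where w: "ac w (Dyy u)" "AE y in leb_pos. Dy u y = w y"
    using weak_deriv_imp_ac[OF weakly_differentiable_Dy[OF assms(2)]] by blast
  obtain u' where u': "ac u' (Dy u)" "AE y in leb_pos. u y = u' y"
    using weak_deriv_imp_ac[OF weakly_differentiable_Dy[OF assms(1)]] by blast
  show thesis by (rule that[OF w ac_cong_AE[OF u'(1) w(2)] u'(2)])
qed

text \<open>The common form to which all descriptions of the domain are reduced.\<close>

definition E_space :: "real \<Rightarrow> real \<Rightarrow> (real \<Rightarrow> complex) set" where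
  "E_space m p = {u \<in> W2p m p. (\<lambda>y. Dy u y / of_real y) \<in> Lp m p}"

text \<open>Membership of \<open>Dy u\<close> is recovered by interpolation: the quotient of
  \<open>Dy u\<close> by y controls it near 0, u and \<open>Dyy u\<close> control it near
  infinity.\<close>

lemma E_spaceI:
  assumes p: "1 < p" and u: "u \<in> Lp m p" "weakly_differentiable u" "weakly_differentiable (Dy u)" "Dyy u \<in> Lp m p"
    "(\<lambda>y. Dy u y / of_real y) \<in> Lp m p"
  shows "u \<in> E_space m p"
proof -
  obtain w u' where w: "ac w (Dyy u)" "AE y in leb_pos. Dy u y = w y" and u': "ac u' w" "AE y in leb_pos. u y = u' y"
    using weak_derivs_ac[OF u(2,3)] by blast
  have "w \<in> Lp m p"
  proof (rule interpolation_Lp[OF p u'(1) _ w(1) u(4)])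
    show "u' \<in> Lp m p" by (rule Lp_cong_AE[OF u(1) u'(2)])
    show "(\<lambda>y. w y / complex_of_real y) \<in> Lp m p"
      by (rule Lp_cong_AE[OF u(5)]) (use w(2) in eventually_elim, simp)
  qed
  then have "Dy u \<in> Lp m p" by (rule Lp_cong_AE) (use w(2) in eventually_elim, simp)
  then show ?thesis using u by (simp add: E_space_def W2p_def)
qed

text \<open>Bu is a linear combination of u'' and u'/y, so it lies in L^p_m as soon as both of them
  do.\<close>

lemma dom_B_max_eq_E_space:
  assumes p: "1 < p"
  shows "{u \<in> dom_B_max c m p. (\<lambda>y. Dy u y / of_real y) \<in> Lp m p \<and> Dyy u \<in> Lp m p} = E_space m p"
proof (intro equalityI subsetI)
  fix u assume "u \<in> {u \<in> dom_B_max c m p. (\<lambda>y. Dy u y / of_real y) \<in> Lp m p \<and> Dyy u \<in> Lp m p}"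
  then show "u \<in> E_space m p" by (intro E_spaceI[OF p]) (auto simp: dom_B_max_def W2p_loc_def)
next
  fix u assume u: "u \<in> E_space m p"
  then have L: "u \<in> Lp m p" "Dy u \<in> Lp m p" "Dyy u \<in> Lp m p" "(\<lambda>y. Dy u y / of_real y) \<in> Lp m p"
    and d: "weakly_differentiable u" "weakly_differentiable (Dy u)"
    by (auto simp: E_space_def W2p_def)
  have "(\<lambda>y. Dyy u y + of_real c * (Dy u y / of_real y)) \<in> Lp m p" by (intro Lp_add Lp_cmult L) (use p in simp)
  then have "B_op c u \<in> Lp m p" by (simp add: B_op_def[abs_def])
  then show "u \<in> {u \<in> dom_B_max c m p. (\<lambda>y. Dy u y / of_real y) \<in> Lp m p \<and> Dyy u \<in> Lp m p}"
    using L d p Lp_imp_loc(1)[OF L(1)] Lp_imp_loc(1)[OF L(2)] Lp_imp_loc(1)[OF L(3)] by (simp add: dom_B_max_def W2p_loc_def)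
qed

context bessel_weight
begin

text \<open>The kernel integrals do not see null sets, so the difference quotients change only on a
  null set.\<close>

lemma generator_value_cong_AE:
  assumes gen: "is_generator_value m p (semigroup_Bn c) u g" and ae: "AE y in leb_pos. u y = u' y"
  shows "is_generator_value m p (semigroup_Bn c) u' g"
proof -
  define R where "R v t y = (semigroup_Bn c (of_real t) v y - v y) / of_real t - g y" for v t y
  have u: "u \<in> Lp m p" "g \<in> Lp m p" "\<forall>\<^sub>F t in at_right 0. R u t \<in> Lp m p" "((\<lambda>t. Lp_norm m p (R u t)) \<longlongrightarrow> 0) (at_right 0)"
    using gen unfolding is_generator_value_def Let_def R_def[abs_def] by auto
  have eq: "AE y in leb_pos. R u t y = R u' t y" if "t > 0" for t
    using ae AE_leb_pos_gt
  proof eventually_elim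
    case (elim y)
    show ?case using elim by (simp add: R_def semigroup_Bn_eq[OF c that elim(2)] TT_cong_AE[OF c LpD(1)[OF u(1)] ae])
  qed
  have "\<forall>\<^sub>F t in at_right 0. R u' t \<in> Lp m p"
    using u(3) eventually_at_right_less[of 0] by eventually_elim (rule Lp_cong_AE[OF _ eq])
  moreover have "((\<lambda>t. Lp_norm m p (R u' t)) \<longlongrightarrow> 0) (at_right 0)"
  proof (rule Lim_transform_eventually[OF u(4)])
    show "\<forall>\<^sub>F t in at_right 0. Lp_norm m p (R u t) = Lp_norm m p (R u' t)"
      using u(3) eventually_at_right_less[of 0]
    proof eventually_elim
      case (elim t)
      have "R u' t \<in> Lp m p" by (rule Lp_cong_AE[OF elim(1) eq[OF elim(2)]])
      then show ?case using Np_cong_AE[OF eq[OF elim(2)], of m p] by (simp add: Lp_norm_eq LpD(1)[OF elim(1)] LpD(1))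
    qed
  qed
  moreover have "u' \<in> Lp m p" by (rule Lp_cong_AE[OF u(1) ae])
  ultimately show ?thesis using u(2) unfolding is_generator_value_def Let_def R_def[abs_def] by simp
qed

lemma powr_c_deriv:
  "x > 0 \<Longrightarrow> ((\<lambda>x. x powr s) has_real_derivative s * x powr (s - 1)) (at x)"
  by (auto intro!: derivative_eq_intros)

text \<open>The flux y^c u' has density y^c g with g = Bu, and \<open>ac_eq_Gc\<close> identifies it
  with \<open>Gc c g\<close> because u'/y lies in L^p_m. Hence u is a strong solution up to a null
  set.\<close>

lemma E_space_subset_dom: "E_space m p \<subseteq> dom_Bn c m p"
proof
  fix u assume "u \<in> E_space m p"
  then have L: "u \<in> Lp m p" "Dyy u \<in> Lp m p" "(\<lambda>y. Dy u y / of_real y) \<in> Lp m p"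
    and d: "weakly_differentiable u" "weakly_differentiable (Dy u)"
    by (auto simp: E_space_def W2p_def)
  obtain w u' where w: "ac w (Dyy u)" "AE y in leb_pos. Dy u y = w y" and u': "ac u' w" "AE y in leb_pos. u y = u' y"
    using weak_derivs_ac[OF d] by blast
  have wy: "(\<lambda>y. w y / complex_of_real y) \<in> Lp m p"
    by (rule Lp_cong_AE[OF L(3)]) (use w(2) in eventually_elim, simp)
  define g where "g y = Dyy u y + of_real c * (w y / of_real y)" for y
  have g: "g \<in> Lp m p" unfolding g_def by (intro Lp_add Lp_cmult L wy) (use p in simp)
  have "ac (\<lambda>y. y powr c *\<^sub>R w y) (\<lambda>y. (c * y powr (c - 1)) *\<^sub>R w y + y powr c *\<^sub>R Dyy u y)"
    by (rule ac_mult[OF w(1) powr_c_deriv]) (auto intro!: continuous_intros)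
  then have W: "ac (\<lambda>y. y powr c *\<^sub>R w y) (\<lambda>y. y powr c *\<^sub>R g y)"
  proof (rule ac_cong_AE)
    show "AE y in leb_pos. (c * y powr (c - 1)) *\<^sub>R w y + y powr c *\<^sub>R Dyy u y = y powr c *\<^sub>R g y"
      using AE_leb_pos_gt
      by eventually_elim (simp add: g_def powr_diff scaleR_conv_of_real algebra_simps)
  qed
  have WG: "y powr c *\<^sub>R w y = Gc c g y" if y: "y > 0" for y
  proof (rule ac_eq_Gc[OF W g _ y])
    show "(\<lambda>s. (s powr - c *\<^sub>R (s powr c *\<^sub>R w s)) / complex_of_real s) \<in> Lp m p"
      by (rule Lp_cong_AE[OF wy]) (use AE_leb_pos_gt in eventually_elim, simp add: powr_minus)
  qed
  have "strong_sol u' g" unfolding strong_sol_def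
  proof (intro conjI g)
    show "u' \<in> Lp m p" by (rule Lp_cong_AE[OF L(1) u'(2)])
    show "ac u' (\<lambda>s. s powr - c *\<^sub>R Gc c g s)"
    proof (rule ac_cong_AE[OF u'(1)])
      show "AE y in leb_pos. w y = y powr - c *\<^sub>R Gc c g y"
        using AE_leb_pos_gt by eventually_elim (simp add: WG[symmetric] powr_minus)
    qed
  qed
  from strong_sol_generator[OF this] have "is_generator_value m p (semigroup_Bn c) u g"
    by (rule generator_value_cong_AE) (use u'(2) in eventually_elim, simp)
  then show "u \<in> dom_Bn c m p" by (auto simp: dom_Bn_def generator_domain_def)
qed

text \<open>Once y^(-c) times \<open>Gc c g\<close> is known to be the weak derivative v, the
  product rule gives v' = g - c v/y, and Hardy's inequality puts v/y into L^p_m.\<close>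

lemma dom_subset_E_space: "dom_Bn c m p \<subseteq> E_space m p"
proof
  fix u assume "u \<in> dom_Bn c m p"
  then obtain g where gen: "is_generator_value m p (semigroup_Bn c) u g" by (auto simp: dom_Bn_def generator_domain_def)
  then have u: "u \<in> Lp m p" and g: "g \<in> Lp m p" by (auto simp: is_generator_value_def Let_def)
  define v where "v s = s powr - c *\<^sub>R Gc c g s" for s
  define v' where "v' s = g s - of_real c * (v s / of_real s)" for s
  have uv: "has_weak_deriv u v" unfolding v_def by (rule generator_has_weak_deriv[OF gen])
  have vs: "(\<lambda>s. v s / of_real s) \<in> Lp m p" unfolding v_def by (rule hardy_Gc[OF g])
  have v'L: "v' \<in> Lp m p" unfolding v'_def by (intro Lp_diff Lp_cmult g vs) (use p in simp)
  have "ac v (\<lambda>s. (- c * s powr (- c - 1)) *\<^sub>R Gc c g s + s powr - c *\<^sub>R (s powr c *\<^sub>R g s))"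
    unfolding v_def by (rule ac_mult[OF Gc_ac[OF g] powr_c_deriv]) (auto intro!: continuous_intros)
  then have "ac v v'"
  proof (rule ac_cong_AE)
    show "AE s in leb_pos. (- c * s powr (- c - 1)) *\<^sub>R Gc c g s + s powr - c *\<^sub>R (s powr c *\<^sub>R g s) = v' s"
      using AE_leb_pos_gt
      by eventually_elim (simp add: v'_def v_def powr_diff powr_minus scaleR_conv_of_real field_simps)
  qed
  then have vv': "has_weak_deriv v v'" by (rule ac_has_weak_deriv)
  have Dv: "AE y in leb_pos. Dy u y = v y" by (rule Dy_eq(2)[OF uv])
  have DD: "has_weak_deriv (Dy u) v'"
    by (rule has_weak_deriv_cong_AE[OF vv']) (use Dv in \<open>eventually_elim, simp\<close>)+
  have Dv': "AE y in leb_pos. Dyy u y = v' y" by (rule Dy_eq(2)[OF DD])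
  show "u \<in> E_space m p"
  proof (rule E_spaceI[OF p u])
    show "weakly_differentiable u" "weakly_differentiable (Dy u)" using uv DD by (auto simp: weakly_differentiable_def)
    show "Dyy u \<in> Lp m p" by (rule Lp_cong_AE[OF v'L]) (use Dv' in eventually_elim, simp)
    show "(\<lambda>y. Dy u y / of_real y) \<in> Lp m p" by (rule Lp_cong_AE[OF vs]) (use Dv in eventually_elim, simp)
  qed
qed

end

text \<open>The locale with c = 0, whose upper condition is (m+1)/p < 1. There
  \<open>Gc 0 (Dyy u)\<close> is the primitive of u'' vanishing at 0, so u' has limit 0 exactly when
  it coincides with this primitive, and that is equivalent to u'/y in L^p_m by
  \<open>ac_eq_Gc\<close> and \<open>hardy_Gc\<close>.\<close>

lemma W2p_bessel_weight_0:
  assumes p: "1 < p" "0 < (m + 1) / p" "(m + 1) / p < 1"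
  shows "E_space m p = {u \<in> W2p m p. has_Dy_at_0 u 0}"
proof -
  interpret Z: bessel_weight p 0 m using p by unfold_locales auto
  have ac0: "ac v (\<lambda>r. r powr 0 *\<^sub>R w r)" if "ac v w" for v w
    by (rule ac_cong_AE[OF that]) (use AE_leb_pos_gt in eventually_elim, simp)
  have "has_Dy_at_0 u 0 \<longleftrightarrow> (\<lambda>y. Dy u y / of_real y) \<in> Lp m p" if u: "u \<in> W2p m p" for u
  proof -
    have L: "u \<in> Lp m p" "Dy u \<in> Lp m p" "Dyy u \<in> Lp m p"
      and d: "weakly_differentiable u" "weakly_differentiable (Dy u)"
      using u by (auto simp: W2p_def)
    obtain w u' where w: "ac w (Dyy u)" "AE y in leb_pos. Dy u y = w y" and u': "ac u' w" "AE y in leb_pos. u y = u' y"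
      using weak_derivs_ac[OF d] by blast
    have uw: "has_weak_deriv u w"
      by (rule has_weak_deriv_cong_AE[OF weakly_differentiable_Dy[OF d(1)] _ w(2)]) simp
    have cw: "continuous_on {0<..} w" by (rule ac_continuous_on[OF w(1)])
    have iff: "(\<lambda>y. Dy u y / of_real y) \<in> Lp m p \<longleftrightarrow> (\<lambda>y. w y / of_real y) \<in> Lp m p"
    proof
      show "(\<lambda>y. w y / complex_of_real y) \<in> Lp m p" if "(\<lambda>y. Dy u y / complex_of_real y) \<in> Lp m p"
        by (rule Lp_cong_AE[OF that]) (use w(2) in eventually_elim, simp)
      show "(\<lambda>y. Dy u y / complex_of_real y) \<in> Lp m p" if "(\<lambda>y. w y / complex_of_real y) \<in> Lp m p"
        by (rule Lp_cong_AE[OF that]) (use w(2) in eventually_elim, simp)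
    qed
    show ?thesis unfolding iff
    proof
      assume wy: "(\<lambda>y. w y / complex_of_real y) \<in> Lp m p"
      have G: "w y = Gc 0 (Dyy u) y" if y: "y > 0" for y
      proof (rule Z.ac_eq_Gc[OF ac0[OF w(1)] L(3) _ y])
        show "(\<lambda>s. (s powr - 0 *\<^sub>R w s) / complex_of_real s) \<in> Lp m p"
          by (rule Lp_cong_AE[OF wy]) (use AE_leb_pos_gt in eventually_elim, simp)
      qed
      have "(w \<longlongrightarrow> 0) (at_right 0)"
      proof (rule Lim_transform_eventually[OF Z.Gc_tendsto_0[OF L(3)]])
        show "\<forall>\<^sub>F y in at_right 0. Gc 0 (Dyy u) y = w y"
          using eventually_at_right_less[of 0] by eventually_elim (simp add: G)
      qed
      then show "has_Dy_at_0 u 0" unfolding has_Dy_at_0_def using cw uw by blast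
    next
      assume "has_Dy_at_0 u 0"
      then obtain v where v: "continuous_on {0<..} v" "has_weak_deriv u v" "(v \<longlongrightarrow> 0) (at_right 0)"
        by (auto simp: has_Dy_at_0_def)
      have vw: "v y = w y" if "y > 0" for y
        by (rule continuous_AE_eq[OF v(1) cw has_weak_deriv_unique[OF v(2) uw] that])
      define K where "K = w 1 - Gc 0 (Dyy u) 1"
      have K: "w x - Gc 0 (Dyy u) x = K" if "x > 0" for x
        unfolding K_def by (rule ac_unique[OF ac0[OF w(1)] Z.Gc_ac[OF L(3)] that]) simp
      have "((\<lambda>x. v x - Gc 0 (Dyy u) x) \<longlongrightarrow> 0 - 0) (at_right 0)" by (intro tendsto_diff v(3) Z.Gc_tendsto_0 L)
      moreover have "\<forall>\<^sub>F x in at_right 0. v x - Gc 0 (Dyy u) x = K"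
        using eventually_at_right_less[of 0] by eventually_elim (simp add: vw K)
      ultimately have "((\<lambda>x. K) \<longlongrightarrow> 0) (at_right (0::real))" by (simp add: Lim_transform_eventually)
      then have "K = 0" by (simp add: tendsto_const_iff)
      then have G: "w y = Gc 0 (Dyy u) y" if "y > 0" for y using K[OF that] by simp
      show "(\<lambda>y. w y / complex_of_real y) \<in> Lp m p"
        by (rule Lp_cong_AE[OF Z.hardy_Gc[OF L(3)]]) (use AE_leb_pos_gt in eventually_elim, simp add: G)
    qed
  qed
  then show ?thesis by (auto simp: E_space_def)
qed

lemma W2p_eq_E_space:
  assumes p: "1 < p" "1 < (m + 1) / p"
  shows "E_space m p = W2p m p"
proof -
  have "(\<lambda>y. Dy u y / of_real y) \<in> Lp m p" if u: "u \<in> W2p m p" for u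
  proof -
    have L: "Dy u \<in> Lp m p" "Dyy u \<in> Lp m p" and d: "weakly_differentiable u" "weakly_differentiable (Dy u)"
      using u by (auto simp: W2p_def)
    obtain w u' where w: "ac w (Dyy u)" "AE y in leb_pos. Dy u y = w y" and "ac u' w"
      using weak_derivs_ac[OF d] by blast
    have "(\<lambda>y. w y / of_real y) \<in> Lp m p"
      by (rule hardy_infinity[OF p w(1) Lp_cong_AE[OF L(1) w(2)] L(2)])
    then show ?thesis by (rule Lp_cong_AE) (use w(2) in eventually_elim, simp)
  qed
  then show ?thesis by (auto simp: E_space_def)
qed

theorem proposition3p3:
  fixes p c m :: real
  assumes "1 < p" and "c > -1" and "0 < (m + 1) / p" and "(m + 1) / p < c + 1"
  shows "dom_Bn c m p =
           {u \<in> dom_B_max c m p. (\<lambda>y. Dy u y / of_real y) \<in> Lp m p \<and> Dyy u \<in> Lp m p} \<and>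
         ((m + 1) / p < 1 \<longrightarrow> dom_Bn c m p = {u \<in> W2p m p. has_Dy_at_0 u 0}) \<and>
         ((m + 1) / p > 1 \<longrightarrow> dom_Bn c m p = W2p m p)"
proof -
  interpret bessel_weight p c m using assms by unfold_locales
  have "dom_Bn c m p = E_space m p" using dom_subset_E_space E_space_subset_dom by (rule equalityI)
  then show ?thesis
    using dom_B_max_eq_E_space[OF assms(1), of c m] W2p_bessel_weight_0[OF assms(1,3)] W2p_eq_E_space[OF assms(1), of m] by simp
qed

end
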